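(* Consider any exponentially concentrated random sofic approximation $(\sigma_n)_{n\ge1}$ to the free group $\Gamma$ such that $\overline{\mathrm h}^{\mathrm{ann}}\equiv\underline{\mathrm h}^{\mathrm{ann}}$. Let $\mathcal{E}\subset\mathrm{Prob}^\Gamma(\mathtt{A}^\Gamma)$ be the set of states which are both annealed-equilibrium and Gibbs for a given nearest-neighbor interaction. Suppose every element $\mu$ of $\mathcal{E}$ satisfies the second-moment criterion, i.e. $\overline{\mathrm h}^{\mathrm{ann}}(\lambda)\le2\underline{\mathrm h}^{\mathrm{ann}}(\mu)$ for every self-joining $\lambda$ of $\mu$. Then, over a typical sofic approximation, any subsequential local-on-average limit of the finitary Gibbs states is a mixture of states in $\mathcal{E}$. If also every element of $\mathcal{E}$ is extreme, then, over a typical sofic approximation, any subsequential local limit $\mathfrak{m}\in\mathrm{Prob}(\mathrm{Prob}(\mathtt{A}^\Gamma))$ of the finitary Gibbs states is supported on the convex hull of $\mathcal{E}$.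
   Context: $\mathtt A$ is a finite alphabet. $\Gamma$ is the free group of rank $r$ with free generators $s_1,\dots,s_r$ and identity $e$, identified with its left Cayley graph (the $2r$-regular tree with edges $(g,s_ig)$); $\sim$ is adjacency, $d(\gamma,e)$ word length. $\Gamma$ acts on $\mathtt{A}^\Gamma$ by $(g\cdot x)(h)=x(hg)$; $\mathrm{Prob}^\Gamma(\mathtt{A}^\Gamma)$ is the set of shift-invariant Borel probability measures. A self-joining of $\mu$ is a shift-invariant coupling of $\mu$ with itself, viewed in $\mathrm{Prob}^\Gamma((\mathtt A\times\mathtt A)^\Gamma)$. For finite $V$, $\sigma\in\mathrm{Hom}(\Gamma,\mathrm{Sym}(V))$, $x\in\mathtt{A}^V$: $(\Pi_v^\sigma x)(h)=x(\sigma^hv)$, $P_x^\sigma=\frac1{|V|}\sum_v\delta_{\Pi_v^\sigma x}$. Metrics: $d(x,y)=\sum_\gamma\mathbf1_{\{x(\gamma)\ne y(\gamma)\}}(5r^2)^{-d(\gamma,e)}$ on $\mathtt{A}^\Gamma$, and $\overline d(\mu,\nu)=\sup\{|\int f\,d\mu-\int f\,d\nu|:f\text{ real-valued 1-Lipschitz}\}$. $\Omega(\sigma,\mu,\varepsilon)=\{x\in\mathtt{A}^V:\overline d(P_x^\sigma,\mu)<\varepsilon\}$. $\sigma$ is $(F,\delta)$-sofic ($F\subset\Gamma$ finite, $\delta>0$) if $\frac1{|V|}|\{v:\sigma(\gamma_1)v\ne\sigma(\gamma_2)v\ \forall\text{ distinct }\gamma_1,\gamma_2\in F\}|>1-\delta$;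 a sequence $\{\tau_n\}$ is a sofic approximation if for each $(F,\delta)$, $\tau_n$ is $(F,\delta)$-sofic for all large $n$. A random sofic approximation is a sequence of random $\sigma_n\in\mathrm{Hom}(\Gamma,\mathrm{Sym}(V_n))$, $V_n$ finite, such that for every $(F,\delta)$, $\limsup_n\frac1{|V_n|}\log\mathbb{P}\{\sigma_n\text{ not }(F,\delta)\text{-sofic}\}=-\infty$. $\sigma_1,\sigma_2$ differ by a switching if for some $i,j\in V$, $k\in\{1,\dots,r\}$, $\sigma_1^{s_k}(i)=\sigma_2^{s_k}(j)$, $\sigma_1^{s_k}(j)=\sigma_2^{s_k}(i)$, and the generator permutations are otherwise identical; $d(\sigma_1,\sigma_2)=m/|V|$ with $m$ the minimal number of switchings from $\sigma_1$ to $\sigma_2$. Exponentially concentrated: for some $C>0$, for all $n$, all 1-Lipschitz $f\colon\mathrm{Hom}(\Gamma,\mathrm{Sym}(V_n))\to\mathbb{R}$, all $t>0$: $\mathbb{P}\{|f(\sigma_n)-\mathbb{E}f(\sigma_n)|>t\}\le2e^{-C|V_n|t^2}$. A statement holds over a typical sofic approximation if there are sets $S_n\subset\mathrm{Hom}(\Gamma,\mathrm{Sym}(V_n))$ with $\mathbb{P}(\sigma_n\in S_n)\to1$ such that whenever $\tau_n\in S_n$ for each $n$, $\Sigma=\{\tau_n\}$ is a sofic approximation for which the statement holds. Annealed entropies: $\overline{\mathrm h}^{\mathrm{ann}}(\mu)=\inf_{\varepsilon>0}\limsup_n\frac1{|V_n|}\log\mathbb{E}|\Omega(\sigma_n,\mu,\varepsilon)|$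 and $\underline{\mathrm h}^{\mathrm{ann}}(\mu)$ the same with $\liminf$. Nearest-neighbor interaction: given by $h\colon\mathtt A\to\mathbb{R}$ and symmetric $J\colon\mathtt{A}^2\to\mathbb{R}$, with energy function $u(x)=h(x(e))+\frac12\sum_{\gamma\sim e}J(x(e),x(\gamma))$; $u(\mu)=\int u\,d\mu$. The finitary Gibbs state on $\sigma\in\mathrm{Hom}(\Gamma,\mathrm{Sym}(V))$ is $\xi\in\mathrm{Prob}(\mathtt{A}^V)$ with $\xi\{x\}\propto\exp(-\sum_{v\in V}u(\Pi_v^\sigma x))$. A measure on $\mathtt{A}^\Gamma$ is Gibbs if for each finite $\Lambda\subset\Gamma$ the conditional law of $x|_\Lambda$ given $x|_{\Gamma\setminus\Lambda}$ is a.s. proportional to $\exp(-\sum_{g\in\Lambda}h(x(g))-\sum_{\{g,g'\}\cap\Lambda\ne\varnothing}J(x(g),x(g')))$, the last sum over tree edges meeting $\Lambda$. A Gibbs measure is extreme if it is an extreme point of the convex set of all (not necessarily shift-invariant) Gibbs measures for the interaction. $\mu\in\mathrm{Prob}^\Gamma(\mathtt{A}^\Gamma)$ is annealed-equilibrium if it maximizes $\overline{\mathrm h}^{\mathrm{ann}}-u=\underline{\mathrm h}^{\mathrm{ann}}-u$ over $\mathrm{Prob}^\Gamma(\mathtt{A}^\Gamma)$. For a sequence $\tau_n$ and $\zeta_n\in\mathrm{Prob}(\mathtt{A}^{V_n})$: let $P_{\zeta_n}^{\tau_n}=\sum_{x}\zeta_n\{x\}P_x^{\tau_n}$. $\zeta_n$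 converges to $\mu$ locally on average if $P_{\zeta_n}^{\tau_n}\to\mu$ weakly. The local limit is $\mathfrak m\in\mathrm{Prob}(\mathrm{Prob}(\mathtt{A}^\Gamma))$ if $\frac1{|V_n|}\sum_{v\in V_n}\delta_{(\Pi_v^{\tau_n})_*\zeta_n}\to\mathfrak m$ weakly. Subsequential limits are limits along subsequences of $n$. *)

theory Defs
  imports "HOL-Probability.Probability" "HOL-Algebra.Bij"
begin

section \<open>The free group\<close>

text \<open>
  The rank is the cardinality of the (finite) type \<open>'k\<close> of generator indices. The letter
  \<open>(k, True)\<close> stands for the generator indexed by \<open>k\<close>, and \<open>(k, False)\<close> for its inverse;
  group elements are the reduced words.
\<close>

definition inv_letter :: "'k \<times> bool \<Rightarrow> 'k \<times> bool" where
  "inv_letter c = (fst c, \<not> snd c)"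

definition reduced :: "('k \<times> bool) list \<Rightarrow> bool" where
  "reduced w \<longleftrightarrow> successively (\<lambda>c d. d \<noteq> inv_letter c) w"

typedef 'k fgroup = "{w :: ('k \<times> bool) list. reduced w}"
  by (rule exI[of _ "[]"]) (simp add: reduced_def)

setup_lifting type_definition_fgroup

definition cons_red :: "'k \<times> bool \<Rightarrow> ('k \<times> bool) list \<Rightarrow> ('k \<times> bool) list" where
  "cons_red c w = (case w of [] \<Rightarrow> [c] | d # w' \<Rightarrow> if d = inv_letter c then w' else c # w)"

lemma inv_letter_inv_letter [simp]: "inv_letter (inv_letter c) = c"
  by (simp add: inv_letter_def)

lemma inv_letter_neq [simp]: "inv_letter c \<noteq> c" "c \<noteq> inv_letter c"
  by (auto simp: inv_letter_def prod_eq_iff)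

lemma reduced_cons_red: "reduced w \<Longrightarrow> reduced (cons_red c w)"
  by (auto simp: reduced_def cons_red_def successively_Cons split: list.splits)

lemma reduced_foldr_cons_red: "reduced v \<Longrightarrow> reduced (foldr cons_red u v)"
  by (induction u) (auto simp: reduced_cons_red)

lift_definition fg_mult :: "'k fgroup \<Rightarrow> 'k fgroup \<Rightarrow> 'k fgroup" is "foldr cons_red"
  by (rule reduced_foldr_cons_red)

lift_definition fg_one :: "'k fgroup" is "[]"
  by (simp add: reduced_def)

lift_definition gen :: "'k \<Rightarrow> 'k fgroup" is "\<lambda>k. [(k, True)]"
  by (simp add: reduced_def)

lift_definition word_length :: "'k fgroup \<Rightarrow> nat" is length .

definition free_group :: "'k fgroup monoid" where
  "free_group = \<lparr>carrier = UNIV, mult = fg_mult, one = fg_one\<rparr>"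

lemma free_group_simps [simp]:
  "carrier free_group = UNIV" "mult free_group = fg_mult" "one free_group = fg_one"
  by (simp_all add: free_group_def)

lemma cons_red_cancel: "reduced w \<Longrightarrow> cons_red c (cons_red (inv_letter c) w) = w"
  by (auto simp: reduced_def cons_red_def successively_Cons split: list.splits)

lemma foldr_cons_red_cons_red:
  assumes "reduced v"
  shows "foldr cons_red (cons_red c u) v = cons_red c (foldr cons_red u v)"
proof (cases u)
  case (Cons d u')
  have "reduced (foldr cons_red u' v)"
    using assms by (rule reduced_foldr_cons_red)
  then show ?thesis
    using Cons by (auto simp: cons_red_def[of c "d # u'"] cons_red_cancel)
qed (simp add: cons_red_def)

lemma foldr_cons_red_assoc:
  assumes "reduced w"
  shows "foldr cons_red (foldr cons_red u v) w = foldr cons_red u (foldr cons_red v w)"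
  using assms by (induction u) (auto simp: foldr_cons_red_cons_red)

lemma foldr_cons_red_Nil: "reduced u \<Longrightarrow> foldr cons_red u [] = u"
proof (induction u)
  case (Cons c u)
  then have "reduced u" by (auto simp: reduced_def successively_Cons)
  then have *: "foldr cons_red u [] = u" by (rule Cons.IH)
  show ?case
    using Cons.prems unfolding foldr.simps comp_def *
    by (auto simp: reduced_def cons_red_def successively_Cons split: list.splits)
qed simp

lemma foldr_cons_red_inverse: "foldr cons_red (rev (map inv_letter u)) u = []"
proof -
  have "foldr cons_red (rev (map inv_letter u)) (u @ v) = v" for v
    by (induction u arbitrary: v) (auto simp: cons_red_def)
  from this[of "[]"] show ?thesis by simp
qed

lemma reduced_inverse: "reduced u \<Longrightarrow> reduced (rev (map inv_letter u))"
  by (auto simp: reduced_def successively_rev successively_map elim: successively_mono)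

lemma group_free_group: "group (free_group :: 'k fgroup monoid)"
proof (rule groupI)
  fix x :: "'k fgroup"
  have "\<exists>y. fg_mult y x = fg_one"
    by transfer (blast intro: reduced_inverse foldr_cons_red_inverse)
  then show "\<exists>y\<in>carrier free_group. y \<otimes>\<^bsub>free_group\<^esub> x = \<one>\<^bsub>free_group\<^esub>" by simp
qed (simp_all, (transfer, simp add: foldr_cons_red_assoc foldr_cons_red_Nil)+)

definition fg_adj :: "'k fgroup \<Rightarrow> 'k fgroup \<Rightarrow> bool" where
  "fg_adj g g' \<longleftrightarrow> (\<exists>k. g' = fg_mult (gen k) g \<or> g = fg_mult (gen k) g')"


section \<open>Borel probability measures and the weak topology\<close>

definition borel_of :: "'x topology \<Rightarrow> 'x measure" where
  "borel_of X = sigma (topspace X) {U. openin X U}"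

definition Prob :: "'x topology \<Rightarrow> 'x measure set" where
  "Prob X = {\<mu>. prob_space \<mu> \<and> sets \<mu> = sets (borel_of X)}"

definition bdd_continuous :: "'x topology \<Rightarrow> ('x \<Rightarrow> real) set" where
  "bdd_continuous X = {f. continuous_map X euclideanreal f \<and> bounded (f ` topspace X)}"

text \<open>
  The coarsest topology on \<open>Prob X\<close> making every integration map
  \<open>\<mu> \<mapsto> \<integral> f d\<mu>\<close> with \<open>f\<close> bounded and continuous continuous; weak convergence is
  \<open>limitin (weak_topology X)\<close>.
\<close>

definition weak_topology :: "'x topology \<Rightarrow> 'x measure topology" where
  "weak_topology X =
     pullback_topology (Prob X) (\<lambda>\<mu>. \<lambda>f\<in>bdd_continuous X. \<integral>x. f x \<partial>\<mu>)
       (product_topology (\<lambda>_. euclideanreal) (bdd_continuous X))"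

text \<open>
  \<open>\<mu>\<close> is the barycentre of a Borel probability measure carried by \<open>E\<close>; finite convex
  combinations are the case of finitely supported \<open>\<theta>\<close>. The set of all mixtures also serves
  as the convex hull of \<open>E\<close>: when \<open>E\<close> is weakly compact it is the closed convex hull, while
  finite combinations alone need not form a closed set if \<open>E\<close> is infinite.
\<close>

definition mixture_of :: "'x topology \<Rightarrow> 'x measure set \<Rightarrow> 'x measure \<Rightarrow> bool" where
  "mixture_of X E \<mu> \<longleftrightarrow> \<mu> \<in> Prob X \<and>
     (\<exists>\<theta>\<in>Prob (weak_topology X). (AE \<nu> in \<theta>. \<nu> \<in> E) \<and>
        (\<forall>B\<in>sets (borel_of X). emeasure \<mu> B = (\<integral>\<^sup>+ \<nu>. emeasure \<nu> B \<partial>\<theta>)))"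

definition extreme_in :: "'x measure set \<Rightarrow> 'x measure \<Rightarrow> bool" where
  "extreme_in K \<mu> \<longleftrightarrow> \<mu> \<in> K \<and>
     (\<forall>\<nu>1\<in>K. \<forall>\<nu>2\<in>K. \<forall>t\<in>{0<..<1::real}.
        (\<forall>B\<in>sets \<mu>. measure \<mu> B = t * measure \<nu>1 B + (1 - t) * measure \<nu>2 B)
          \<longrightarrow> \<nu>1 = \<mu> \<and> \<nu>2 = \<mu>)"

definition Lip1 :: "'x set \<Rightarrow> ('x \<Rightarrow> 'x \<Rightarrow> real) \<Rightarrow> ('x \<Rightarrow> real) set" where
  "Lip1 S d = {f. \<forall>x\<in>S. \<forall>y\<in>S. \<bar>f x - f y\<bar> \<le> d x y}"

definition ln_ext :: "real \<Rightarrow> ereal" where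
  "ln_ext p = (if p \<le> 0 then -\<infinity> else ereal (ln p))"


section \<open>Configurations on the free group\<close>

type_synonym ('k, 'a) config = "'k fgroup \<Rightarrow> 'a"

definition config_top :: "('k, 'a) config topology" where
  "config_top = product_topology (\<lambda>_. discrete_topology UNIV) UNIV"

definition shift :: "'k fgroup \<Rightarrow> ('k, 'a) config \<Rightarrow> ('k, 'a) config" where
  "shift g x = (\<lambda>h. x (fg_mult h g))"

definition Prob_inv :: "('k, 'a) config measure set" where
  "Prob_inv = {\<mu>\<in>Prob config_top. \<forall>g. distr \<mu> (borel_of config_top) (shift g) = \<mu>}"

definition self_joining ::
    "('k, 'a) config measure \<Rightarrow> ('k, 'a \<times> 'a) config measure \<Rightarrow> bool" where
  "self_joining \<mu> \<kappa> \<longleftrightarrow> \<kappa> \<in> Prob_inv \<and>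
     distr \<kappa> (borel_of config_top) (\<lambda>z h. fst (z h)) = \<mu> \<and>
     distr \<kappa> (borel_of config_top) (\<lambda>z h. snd (z h)) = \<mu>"

definition config_dist :: "('k::finite, 'a) config \<Rightarrow> ('k, 'a) config \<Rightarrow> real" where
  "config_dist x y =
     (\<Sum>\<^sub>\<infinity>\<gamma>. if x \<gamma> \<noteq> y \<gamma> then 1 / (5 * real CARD('k) ^ 2) ^ word_length \<gamma> else 0)"

definition dbar :: "('k::finite, 'a) config measure \<Rightarrow> ('k, 'a) config measure \<Rightarrow> real" where
  "dbar \<mu> \<nu> = (SUP f\<in>Lip1 UNIV config_dist. \<bar>(\<integral>x. f x \<partial>\<mu>) - (\<integral>x. f x \<partial>\<nu>)\<bar>)"


section \<open>Homomorphisms to finite symmetric groups\<close>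

definition Hom :: "'v set \<Rightarrow> ('k fgroup \<Rightarrow> 'v \<Rightarrow> 'v) set" where
  "Hom V = hom free_group (BijGroup V)"

definition pullback :: "('k fgroup \<Rightarrow> 'v \<Rightarrow> 'v) \<Rightarrow> 'v \<Rightarrow> ('v \<Rightarrow> 'a) \<Rightarrow> ('k, 'a) config" where
  "pullback \<sigma> v x = (\<lambda>h. x (\<sigma> h v))"

abbreviation labelings :: "'v set \<Rightarrow> ('v \<Rightarrow> 'a) set" where
  "labelings V \<equiv> V \<rightarrow>\<^sub>E UNIV"

definition empirical ::
    "'v set \<Rightarrow> ('k fgroup \<Rightarrow> 'v \<Rightarrow> 'v) \<Rightarrow> ('v \<Rightarrow> 'a) \<Rightarrow> ('k, 'a) config measure" where
  "empirical V \<sigma> x =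
     distr (uniform_count_measure V) (borel_of config_top) (\<lambda>v. pullback \<sigma> v x)"

definition good_models :: "'v set \<Rightarrow> ('k::finite fgroup \<Rightarrow> 'v \<Rightarrow> 'v) \<Rightarrow>
    ('k, 'a) config measure \<Rightarrow> real \<Rightarrow> ('v \<Rightarrow> 'a) set" where
  "good_models V \<sigma> \<mu> \<epsilon> = {x\<in>labelings V. dbar (empirical V \<sigma> x) \<mu> < \<epsilon>}"

definition is_sofic ::
    "'v set \<Rightarrow> 'k fgroup set \<Rightarrow> real \<Rightarrow> ('k fgroup \<Rightarrow> 'v \<Rightarrow> 'v) \<Rightarrow> bool" where
  "is_sofic V F \<delta> \<sigma> \<longleftrightarrow>
     real (card {v\<in>V. \<forall>\<gamma>1\<in>F. \<forall>\<gamma>2\<in>F. \<gamma>1 \<noteq> \<gamma>2 \<longrightarrow> \<sigma> \<gamma>1 v \<noteq> \<sigma> \<gamma>2 v}) / real (card V) > 1 - \<delta>"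

definition sofic_approx :: "(nat \<Rightarrow> 'v set) \<Rightarrow> (nat \<Rightarrow> 'k fgroup \<Rightarrow> 'v \<Rightarrow> 'v) \<Rightarrow> bool" where
  "sofic_approx V \<tau> \<longleftrightarrow> (\<forall>n. \<tau> n \<in> Hom (V n)) \<and>
     (\<forall>F \<delta>. finite F \<and> \<delta> > 0 \<longrightarrow> (\<forall>\<^sub>F n in sequentially. is_sofic (V n) F \<delta> (\<tau> n)))"

definition switching ::
    "'v set \<Rightarrow> (('k fgroup \<Rightarrow> 'v \<Rightarrow> 'v) \<times> ('k fgroup \<Rightarrow> 'v \<Rightarrow> 'v)) set" where
  "switching V = {(\<sigma>1, \<sigma>2). \<sigma>1 \<in> Hom V \<and> \<sigma>2 \<in> Hom V \<and>
     (\<exists>i\<in>V. \<exists>j\<in>V. \<exists>k.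
        \<sigma>1 (gen k) i = \<sigma>2 (gen k) j \<and> \<sigma>1 (gen k) j = \<sigma>2 (gen k) i \<and>
        (\<forall>l. \<forall>v\<in>V. \<not> (l = k \<and> v \<in> {i, j}) \<longrightarrow> \<sigma>1 (gen l) v = \<sigma>2 (gen l) v))}"

definition hom_dist ::
    "'v set \<Rightarrow> ('k fgroup \<Rightarrow> 'v \<Rightarrow> 'v) \<Rightarrow> ('k fgroup \<Rightarrow> 'v \<Rightarrow> 'v) \<Rightarrow> real" where
  "hom_dist V \<sigma>1 \<sigma>2 = real (LEAST m. (\<sigma>1, \<sigma>2) \<in> switching V ^^ m) / real (card V)"


section \<open>Random sofic approximations and annealed entropy\<close>

text \<open>
  A random element of the finite set \<open>Hom (V n)\<close> is given by its law \<open>\<sigma> n\<close>.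
\<close>

definition random_sofic_approx ::
    "(nat \<Rightarrow> 'v set) \<Rightarrow> (nat \<Rightarrow> ('k fgroup \<Rightarrow> 'v \<Rightarrow> 'v) pmf) \<Rightarrow> bool" where
  "random_sofic_approx V \<sigma> \<longleftrightarrow>
     (\<forall>n. finite (V n) \<and> V n \<noteq> {} \<and> set_pmf (\<sigma> n) \<subseteq> Hom (V n)) \<and>
     (\<forall>F \<delta>. finite F \<and> \<delta> > 0 \<longrightarrow>
        limsup (\<lambda>n. ereal (1 / real (card (V n))) *
          ln_ext (measure_pmf.prob (\<sigma> n) {s. \<not> is_sofic (V n) F \<delta> s})) = -\<infinity>)"

definition exp_concentrated ::
    "(nat \<Rightarrow> 'v set) \<Rightarrow> (nat \<Rightarrow> ('k fgroup \<Rightarrow> 'v \<Rightarrow> 'v) pmf) \<Rightarrow> bool" where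
  "exp_concentrated V \<sigma> \<longleftrightarrow>
     (\<exists>C>0. \<forall>n. \<forall>f\<in>Lip1 (Hom (V n)) (hom_dist (V n)). \<forall>t>0.
        measure_pmf.prob (\<sigma> n) {s. \<bar>f s - measure_pmf.expectation (\<sigma> n) f\<bar> > t}
          \<le> 2 * exp (- C * real (card (V n)) * t ^ 2))"

text \<open>
  The sets \<open>S n\<close> are required to be nonempty for every \<open>n\<close>: otherwise a single empty \<open>S n\<close>
  would leave no sequence \<open>\<tau>\<close> to quantify over, and every statement would be typical.
\<close>

definition typically :: "(nat \<Rightarrow> 'v set) \<Rightarrow> (nat \<Rightarrow> ('k fgroup \<Rightarrow> 'v \<Rightarrow> 'v) pmf) \<Rightarrow>
    ((nat \<Rightarrow> 'k fgroup \<Rightarrow> 'v \<Rightarrow> 'v) \<Rightarrow> bool) \<Rightarrow> bool" where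
  "typically V \<sigma> P \<longleftrightarrow>
     (\<exists>S. (\<forall>n. S n \<subseteq> Hom (V n) \<and> S n \<noteq> {}) \<and>
          (\<lambda>n. measure_pmf.prob (\<sigma> n) (S n)) \<longlonglongrightarrow> 1 \<and>
          (\<forall>\<tau>. (\<forall>n. \<tau> n \<in> S n) \<longrightarrow> sofic_approx V \<tau> \<and> P \<tau>))"

definition log_count :: "(nat \<Rightarrow> 'v set) \<Rightarrow> (nat \<Rightarrow> ('k::finite fgroup \<Rightarrow> 'v \<Rightarrow> 'v) pmf) \<Rightarrow>
    ('k, 'a) config measure \<Rightarrow> real \<Rightarrow> nat \<Rightarrow> ereal" where
  "log_count V \<sigma> \<mu> \<epsilon> n = ereal (1 / real (card (V n))) *
     ln_ext (measure_pmf.expectation (\<sigma> n) (\<lambda>s. real (card (good_models (V n) s \<mu> \<epsilon>))))"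

definition h_ann_upper :: "(nat \<Rightarrow> 'v set) \<Rightarrow> (nat \<Rightarrow> ('k::finite fgroup \<Rightarrow> 'v \<Rightarrow> 'v) pmf) \<Rightarrow>
    ('k, 'a) config measure \<Rightarrow> ereal" where
  "h_ann_upper V \<sigma> \<mu> = (INF \<epsilon>\<in>{0<..}. limsup (log_count V \<sigma> \<mu> \<epsilon>))"

definition h_ann_lower :: "(nat \<Rightarrow> 'v set) \<Rightarrow> (nat \<Rightarrow> ('k::finite fgroup \<Rightarrow> 'v \<Rightarrow> 'v) pmf) \<Rightarrow>
    ('k, 'a) config measure \<Rightarrow> ereal" where
  "h_ann_lower V \<sigma> \<mu> = (INF \<epsilon>\<in>{0<..}. liminf (log_count V \<sigma> \<mu> \<epsilon>))"

definition second_moment_criterion :: "(nat \<Rightarrow> 'v set) \<Rightarrow>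
    (nat \<Rightarrow> ('k::finite fgroup \<Rightarrow> 'v \<Rightarrow> 'v) pmf) \<Rightarrow> ('k, 'a) config measure \<Rightarrow> bool" where
  "second_moment_criterion V \<sigma> \<mu> \<longleftrightarrow>
     (\<forall>\<kappa>. self_joining \<mu> \<kappa> \<longrightarrow> h_ann_upper V \<sigma> \<kappa> \<le> 2 * h_ann_lower V \<sigma> \<mu>)"


section \<open>Nearest-neighbor interactions and Gibbs measures\<close>

definition site_energy ::
    "('a \<Rightarrow> real) \<Rightarrow> ('a \<Rightarrow> 'a \<Rightarrow> real) \<Rightarrow> ('k, 'a) config \<Rightarrow> real" where
  "site_energy h J x =
     h (x fg_one) + 1 / 2 * (\<Sum>\<gamma> | fg_adj \<gamma> fg_one. J (x fg_one) (x \<gamma>))"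

definition mean_energy ::
    "('a \<Rightarrow> real) \<Rightarrow> ('a \<Rightarrow> 'a \<Rightarrow> real) \<Rightarrow> ('k, 'a) config measure \<Rightarrow> real" where
  "mean_energy h J \<mu> = (\<integral>x. site_energy h J x \<partial>\<mu>)"

definition annealed_equilibrium ::
    "(nat \<Rightarrow> 'v set) \<Rightarrow> (nat \<Rightarrow> ('k::finite fgroup \<Rightarrow> 'v \<Rightarrow> 'v) pmf) \<Rightarrow>
     ('a \<Rightarrow> real) \<Rightarrow> ('a \<Rightarrow> 'a \<Rightarrow> real) \<Rightarrow> ('k, 'a) config measure \<Rightarrow> bool" where
  "annealed_equilibrium V \<sigma> h J \<mu> \<longleftrightarrow> \<mu> \<in> Prob_inv \<and>
     (\<forall>\<nu>\<in>Prob_inv. h_ann_upper V \<sigma> \<nu> - ereal (mean_energy h J \<nu>)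
                 \<le> h_ann_upper V \<sigma> \<mu> - ereal (mean_energy h J \<mu>))"

definition finite_weight :: "('a \<Rightarrow> real) \<Rightarrow> ('a \<Rightarrow> 'a \<Rightarrow> real) \<Rightarrow> 'v set \<Rightarrow>
    ('k fgroup \<Rightarrow> 'v \<Rightarrow> 'v) \<Rightarrow> ('v \<Rightarrow> 'a) \<Rightarrow> real" where
  "finite_weight h J V \<sigma> x = exp (- (\<Sum>v\<in>V. site_energy h J (pullback \<sigma> v x)))"

definition finite_gibbs :: "('a \<Rightarrow> real) \<Rightarrow> ('a \<Rightarrow> 'a \<Rightarrow> real) \<Rightarrow> 'v set \<Rightarrow>
    ('k fgroup \<Rightarrow> 'v \<Rightarrow> 'v) \<Rightarrow> ('v \<Rightarrow> 'a) measure" where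
  "finite_gibbs h J V \<sigma> = point_measure (labelings V)
     (\<lambda>x. ennreal (finite_weight h J V \<sigma> x / (\<Sum>y\<in>labelings V. finite_weight h J V \<sigma> y)))"

text \<open>
  Every edge of the Cayley graph is \<open>{g, s\<^sub>k g}\<close> for exactly one pair \<open>(g, k)\<close>, so the sum over
  such pairs counts each edge meeting \<open>\<Lambda>\<close> once.
\<close>

definition region_energy :: "('a \<Rightarrow> real) \<Rightarrow> ('a \<Rightarrow> 'a \<Rightarrow> real) \<Rightarrow> 'k fgroup set \<Rightarrow>
    ('k, 'a) config \<Rightarrow> real" where
  "region_energy h J \<Lambda> x = (\<Sum>g\<in>\<Lambda>. h (x g)) +
     (\<Sum>(g, k) | g \<in> \<Lambda> \<or> fg_mult (gen k) g \<in> \<Lambda>. J (x g) (x (fg_mult (gen k) g)))"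

text \<open>The \<open>\<sigma>\<close>-algebra generated by the coordinates outside \<open>\<Lambda>\<close>.\<close>

definition outside_sigma :: "'k fgroup set \<Rightarrow> ('k, 'a) config measure" where
  "outside_sigma \<Lambda> = sigma UNIV {{x. x g \<in> A} | g A. g \<notin> \<Lambda>}"

definition Gibbs ::
    "('a::finite \<Rightarrow> real) \<Rightarrow> ('a \<Rightarrow> 'a \<Rightarrow> real) \<Rightarrow> ('k, 'a) config measure set" where
  "Gibbs h J = {\<mu>\<in>Prob config_top.
     \<forall>\<Lambda>. finite \<Lambda> \<longrightarrow> (\<forall>a\<in>labelings \<Lambda>. AE x in \<mu>.
       real_cond_exp \<mu> (outside_sigma \<Lambda>) (indicator {y. \<forall>g\<in>\<Lambda>. y g = a g}) x =
       exp (- region_energy h J \<Lambda> (override_on x a \<Lambda>)) /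
         (\<Sum>b\<in>labelings \<Lambda>. exp (- region_energy h J \<Lambda> (override_on x b \<Lambda>))))}"

definition equilibrium_Gibbs ::
    "(nat \<Rightarrow> 'v set) \<Rightarrow> (nat \<Rightarrow> ('k::finite fgroup \<Rightarrow> 'v \<Rightarrow> 'v) pmf) \<Rightarrow>
     ('a::finite \<Rightarrow> real) \<Rightarrow> ('a \<Rightarrow> 'a \<Rightarrow> real) \<Rightarrow> ('k, 'a) config measure set" where
  "equilibrium_Gibbs V \<sigma> h J =
     {\<mu>\<in>Prob_inv. annealed_equilibrium V \<sigma> h J \<mu> \<and> \<mu> \<in> Gibbs h J}"


section \<open>Local limits\<close>

definition averaged_law :: "'v set \<Rightarrow> ('k fgroup \<Rightarrow> 'v \<Rightarrow> 'v) \<Rightarrow> ('v \<Rightarrow> 'a) measure \<Rightarrow>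
    ('k, 'a) config measure" where
  "averaged_law V \<tau> \<zeta> = \<zeta> \<bind> empirical V \<tau>"

definition local_law :: "'v set \<Rightarrow> ('k fgroup \<Rightarrow> 'v \<Rightarrow> 'v) \<Rightarrow> ('v \<Rightarrow> 'a) measure \<Rightarrow>
    ('k, 'a) config measure measure" where
  "local_law V \<tau> \<zeta> = distr (uniform_count_measure V) (borel_of (weak_topology config_top))
     (\<lambda>v. distr \<zeta> (borel_of config_top) (pullback \<tau> v))"

definition subseq_limit_on_average :: "(nat \<Rightarrow> 'v set) \<Rightarrow> (nat \<Rightarrow> 'k fgroup \<Rightarrow> 'v \<Rightarrow> 'v) \<Rightarrow>
    (nat \<Rightarrow> ('v \<Rightarrow> 'a) measure) \<Rightarrow> ('k, 'a) config measure \<Rightarrow> bool" where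
  "subseq_limit_on_average V \<tau> \<zeta> \<mu> \<longleftrightarrow> (\<exists>\<phi>. strict_mono \<phi> \<and>
     limitin (weak_topology config_top)
       (\<lambda>n. averaged_law (V (\<phi> n)) (\<tau> (\<phi> n)) (\<zeta> (\<phi> n))) \<mu> sequentially)"

definition subseq_local_limit :: "(nat \<Rightarrow> 'v set) \<Rightarrow> (nat \<Rightarrow> 'k fgroup \<Rightarrow> 'v \<Rightarrow> 'v) \<Rightarrow>
    (nat \<Rightarrow> ('v \<Rightarrow> 'a) measure) \<Rightarrow> ('k, 'a) config measure measure \<Rightarrow> bool" where
  "subseq_local_limit V \<tau> \<zeta> m \<longleftrightarrow> (\<exists>\<phi>. strict_mono \<phi> \<and>
     limitin (weak_topology (weak_topology config_top))
       (\<lambda>n. local_law (V (\<phi> n)) (\<tau> (\<phi> n)) (\<zeta> (\<phi> n))) m sequentially)"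

end

theory Submission imports Defs begin

text \<open>
  Write \<open>p\<close> for the annealed pressure (entropy minus energy), which is upper semicontinuous, and
  \<open>p\<^sub>m\<close> for its maximum. A first moment bound and compactness show that labelings whose empirical
  measure stays away from the equilibrium states have expected total weight at most
  \<open>exp (N (p\<^sub>m - c))\<close>. The second moment criterion at a single equilibrium state and the
  Paley--Zygmund inequality bound the partition function from below by \<open>exp (N (p\<^sub>m - o(1)))\<close> with
  probability at least \<open>exp (- o(N))\<close>; as the free energy per vertex is Lipschitz for the switching
  distance, exponential concentration turns this into a bound with probability tending to 1. Hence
  typically the finitary Gibbs state carries its mass on labelings whose empirical measure is almost
  an equilibrium state, and an approximate DLR equation for empirical measures makes every limit on
  average a mixture of equilibrium states that are Gibbs. (That there is such a state at all follows
  by the same argument under the planted law, where no second moment is needed.)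

  For a local limit \<open>m\<close>, almost every \<open>\<nu>\<close> is Gibbs and the barycentre of \<open>m\<close> is a mixture of
  states in \<open>E\<close>. Let \<open>\<gamma>\<^sub>k\<close> be the Gibbs kernel of the ball of radius \<open>k\<close>. For an extreme \<open>\<rho>\<close> in
  \<open>E\<close>, reverse martingale convergence gives \<open>\<gamma>\<^sub>k x \<rightarrow> \<rho>\<close> in mean, so the distance from \<open>\<gamma>\<^sub>k x\<close> to
  \<open>E\<close> tends to 0 in mean under the barycentre, hence along a subsequence under almost every \<open>\<nu>\<close>.
  A weak limit of the laws of \<open>\<gamma>\<^sub>k\<close> under \<open>\<nu>\<close> is then carried by \<open>E\<close> and has barycentre \<open>\<nu>\<close>.
\<close>

section \<open>Borel measures and weak topologies\<close>

text \<open>The second moment criterion is assumed only on E, so using it needs a member of E; but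
  being Gibbs is obtained only for limits along sequences that already equilibrate. Reweighting by
  the partition function Z breaks this circle: it replaces Z by its mean in the comparison, and
  soficity survives because its failure is rarer than any exponential while the weight is at most
  exponential. The second moment yields a large Z only with a small probability. It suffices that
  this probability exceeds the concentration bound, since then some sample has both a large Z and a
  free energy close to its mean. In a local limit, a law \<nu> seen from a vertex need not be
  shift-invariant, so no variational argument applies to it. What descends from the barycentre to
  \<nu> is a nonnegative quantity that is linear in the measure, the mean distance of the Gibbs
  kernels to E: two decompositions of one barycentre give it the same average. The Gibbs property is
  handled through tests of the DLR equation on cylinders, which are countably many, continuous and
  linear and so pass to weak limits.\<close>

lemma space_borel_of [simp]: "space (borel_of X) = topspace X"
  unfolding borel_of_def by (rule space_measure_of) (auto dest: openin_subset)

lemma sets_borel_of: "sets (borel_of X) = sigma_sets (topspace X) {U. openin X U}"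
  unfolding borel_of_def by (rule sets_measure_of) (auto dest: openin_subset)

lemma openin_borel_of [intro]: "openin X U \<Longrightarrow> U \<in> sets (borel_of X)"
  by (auto simp: sets_borel_of)

lemma measurable_into_borel_of:
  assumes "f \<in> space M \<rightarrow> topspace X"
    and "\<And>U. openin X U \<Longrightarrow> f -` U \<inter> space M \<in> sets M"
  shows "f \<in> M \<rightarrow>\<^sub>M borel_of X"
  unfolding borel_of_def
  by (rule measurable_sigma_sets[OF sets_borel_of[unfolded borel_of_def]])
    (use assms in \<open>auto dest: openin_subset\<close>)

lemma continuous_map_measurable_borel_of:
  assumes "continuous_map X Y f"
  shows "f \<in> borel_of X \<rightarrow>\<^sub>M borel_of Y"
proof (rule measurable_into_borel_of)
  show "f \<in> space (borel_of X) \<rightarrow> topspace Y"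
    using assms by (simp add: continuous_map_def)
  fix U assume "openin Y U"
  then have "openin X {x \<in> topspace X. f x \<in> U}"
    using assms by (simp add: continuous_map_def)
  moreover have "{x \<in> topspace X. f x \<in> U} = f -` U \<inter> space (borel_of X)" by auto
  ultimately show "f -` U \<inter> space (borel_of X) \<in> sets (borel_of X)"
    by (metis openin_borel_of)
qed

lemma sets_borel_of_euclidean: "sets (borel_of euclidean) = sets borel"
  by (simp add: borel_of_def borel_def)

lemma continuous_map_borel_measurable:
  assumes "continuous_map X euclideanreal f"
  shows "f \<in> borel_measurable (borel_of X)"
  using continuous_map_measurable_borel_of[OF assms] measurable_cong_sets[OF refl sets_borel_of_euclidean]
  by blast

lemma Prob_D:
  assumes "\<mu> \<in> Prob X"
  shows "prob_space \<mu>" "sets \<mu> = sets (borel_of X)" "space \<mu> = topspace X"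
  using assms sets_eq_imp_space_eq[of \<mu> "borel_of X"] by (auto simp: Prob_def)

lemma bdd_continuous_measurable:
  assumes "f \<in> bdd_continuous X" "\<mu> \<in> Prob X"
  shows "f \<in> borel_measurable \<mu>"
  using assms continuous_map_borel_measurable[of X f] measurable_cong_sets[OF Prob_D(2)[OF assms(2)] refl]
  by (auto simp: bdd_continuous_def)

lemma bdd_continuous_bound:
  assumes "f \<in> bdd_continuous X"
  obtains B where "B > 0" "\<And>x. x \<in> topspace X \<Longrightarrow> \<bar>f x\<bar> \<le> B"
  using assms by (auto simp: bdd_continuous_def bounded_pos)

lemma bdd_continuous_integrable:
  assumes "f \<in> bdd_continuous X" "\<mu> \<in> Prob X"
  shows "integrable \<mu> f"
proof -
  interpret prob_space \<mu> using assms(2) by (rule Prob_D)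
  obtain B where "\<And>x. x \<in> topspace X \<Longrightarrow> \<bar>f x\<bar> \<le> B"
    using bdd_continuous_bound[OF assms(1)] by metis
  then show ?thesis
    by (intro integrable_const_bound[of _ B] AE_I2)
      (auto simp: Prob_D(3)[OF assms(2)] bdd_continuous_measurable[OF assms])
qed

lemma compact_bdd_continuous:
  assumes "compact_space X" "continuous_map X euclideanreal f"
  shows "f \<in> bdd_continuous X"
  using assms image_compactin[of X "topspace X" euclideanreal f]
  by (auto simp: bdd_continuous_def compact_space_def compactin_euclidean_iff compact_imp_bounded)

section \<open>Convergence and continuity in the weak topology\<close>

lemma topspace_weak_topology [simp]: "topspace (weak_topology X) = Prob X"
  by (auto simp: weak_topology_def topspace_pullback_topology)

text \<open>The open sets are the traces on \<open>A\<close> of preimages of open sets. The preimage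
  of the whole space is already the set \<open>A\<close> itself, which is why eventual membership in
  \<open>A\<close> appears as a separate condition.\<close>

lemma limitin_pullback_topology:
  "limitin (pullback_topology A f T) x l F \<longleftrightarrow>
     l \<in> A \<and> (\<forall>\<^sub>F n in F. x n \<in> A) \<and> limitin T (f \<circ> x) (f l) F"
proof (intro iffI conjI)
  assume L: "limitin (pullback_topology A f T) x l F"
  then have l: "l \<in> A" "f l \<in> topspace T"
    by (auto simp: limitin_def topspace_pullback_topology)
  then show "l \<in> A" by simp
  have "openin (pullback_topology A f T) (f -` topspace T \<inter> A)"
    by (auto simp: openin_pullback_topology)
  then have "\<forall>\<^sub>F n in F. x n \<in> f -` topspace T \<inter> A"
    using L l by (auto simp: limitin_def)
  then show "\<forall>\<^sub>F n in F. x n \<in> A" by eventually_elim auto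
  show "limitin T (f \<circ> x) (f l) F"
    unfolding limitin_def
  proof (intro conjI allI impI)
    fix U assume U: "openin T U \<and> f l \<in> U"
    then have "openin (pullback_topology A f T) (f -` U \<inter> A)"
      by (auto simp: openin_pullback_topology)
    then have "\<forall>\<^sub>F n in F. x n \<in> f -` U \<inter> A"
      using L l U by (auto simp: limitin_def)
    then show "\<forall>\<^sub>F n in F. (f \<circ> x) n \<in> U" by eventually_elim auto
  qed (fact l)
next
  assume R: "l \<in> A \<and> (\<forall>\<^sub>F n in F. x n \<in> A) \<and> limitin T (f \<circ> x) (f l) F"
  show "limitin (pullback_topology A f T) x l F"
    unfolding limitin_def
  proof (intro conjI allI impI)
    show "l \<in> topspace (pullback_topology A f T)"
      using R by (auto simp: topspace_pullback_topology limitin_def)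
    fix U assume "openin (pullback_topology A f T) U \<and> l \<in> U"
    then obtain W where W: "openin T W" "U = f -` W \<inter> A" "l \<in> U"
      by (auto simp: openin_pullback_topology)
    then have "\<forall>\<^sub>F n in F. (f \<circ> x) n \<in> W" using R by (auto simp: limitin_def)
    with R show "\<forall>\<^sub>F n in F. x n \<in> U" using W by (auto elim: eventually_elim2)
  qed
qed

lemma limitin_weak_topology:
  "limitin (weak_topology X) \<mu> \<nu> F \<longleftrightarrow>
     \<nu> \<in> Prob X \<and> (\<forall>\<^sub>F n in F. \<mu> n \<in> Prob X) \<and>
     (\<forall>f\<in>bdd_continuous X. ((\<lambda>n. \<integral>x. f x \<partial>\<mu> n) \<longlongrightarrow> (\<integral>x. f x \<partial>\<nu>)) F)"
  unfolding weak_topology_def limitin_pullback_topology limitin_componentwise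
  by (auto simp: comp_def)

text \<open>Universal property of the initial topology: integration against a fixed test function is
  a coordinate projection of the product into which the measures are mapped.\<close>

lemma continuous_map_into_weak_topology:
  "continuous_map Y (weak_topology X) T \<longleftrightarrow>
     T \<in> topspace Y \<rightarrow> Prob X \<and>
     (\<forall>f\<in>bdd_continuous X. continuous_map Y euclideanreal (\<lambda>y. \<integral>x. f x \<partial>T y))"
  (is "?L \<longleftrightarrow> ?R")
proof
  have ev: "continuous_map (weak_topology X) euclideanreal (\<lambda>\<mu>. \<integral>x. f x \<partial>\<mu>)"
    if "f \<in> bdd_continuous X" for f
  proof -
    have "continuous_map (weak_topology X) (product_topology (\<lambda>_. euclideanreal) (bdd_continuous X))
      (\<lambda>\<mu>. \<lambda>f\<in>bdd_continuous X. \<integral>x. f x \<partial>\<mu>)"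
      unfolding weak_topology_def
      by (rule continuous_map_pullback[OF continuous_map_id, unfolded id_comp])
    from continuous_map_compose[OF this continuous_map_product_projection[OF that]]
    show ?thesis using that by (simp add: comp_def)
  qed
  assume ?L
  then show ?R
    using continuous_map_compose[OF _ ev] continuous_map_funspace by (fastforce simp: comp_def)
next
  assume R: ?R
  show ?L
    unfolding weak_topology_def
    by (rule continuous_map_pullback')
      (use R in \<open>auto simp: comp_def continuous_map_componentwise\<close>)
qed

lemma continuous_map_integral:
  "f \<in> bdd_continuous X \<Longrightarrow> continuous_map (weak_topology X) euclideanreal (\<lambda>\<mu>. \<integral>x. f x \<partial>\<mu>)"
  using continuous_map_into_weak_topology[of "weak_topology X" X "\<lambda>x. x"] continuous_map_id[of "weak_topology X"]
  by (simp add: id_def)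

lemma distr_Prob:
  assumes "prob_space M" "f \<in> M \<rightarrow>\<^sub>M borel_of X"
  shows "distr M (borel_of X) f \<in> Prob X"
  using prob_space.prob_space_distr[OF assms] by (simp add: Prob_def)

section \<open>Compactness of spaces of probability measures\<close>

text \<open>The point of the middle-thirds Cantor set with digits 0 and 2. Omitting the digit 1
  leaves gaps, which make the coding of 0-1 sequences invertible with a quantitative
  modulus.\<close>

definition ternary :: "(nat \<Rightarrow> bool) \<Rightarrow> real" where
  "ternary b = (\<Sum>i. of_bool (b i) * 2 * (1 / 3) ^ Suc i)"

lemma summable_ternary: "summable (\<lambda>i. of_bool (b i) * 2 * (1 / 3 :: real) ^ Suc i)"
proof (rule summable_comparison_test')
  show "summable (\<lambda>i. 2 * (1 / 3 :: real) ^ Suc i)"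
    by (intro summable_mult) (simp add: summable_geometric summable_mult)
  show "norm (of_bool (b n) * 2 * (1 / 3 :: real) ^ Suc n) \<le> 2 * (1 / 3) ^ Suc n" if "n \<ge> 0" for n
    by (auto simp: of_bool_def)
qed

lemma ternary_bounds: "0 \<le> ternary b" "ternary b \<le> 1"
proof -
  show "0 \<le> ternary b"
    unfolding ternary_def by (rule suminf_nonneg[OF summable_ternary]) auto
  have "(\<lambda>i. 2 / 3 * (1 / 3 :: real) ^ i) sums (2 / 3 * (1 / (1 - 1 / 3)))"
    by (intro sums_mult geometric_sums) auto
  then have s: "(\<lambda>i. 2 * (1 / 3 :: real) ^ Suc i) sums 1" by simp
  have "ternary b \<le> (\<Sum>i. 2 * (1 / 3 :: real) ^ Suc i)"
    unfolding ternary_def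
    by (rule suminf_le[OF _ summable_ternary sums_summable[OF s]]) (auto simp: of_bool_def)
  also have "\<dots> = 1" using s by (rule sums_unique[symmetric])
  finally show "ternary b \<le> 1" .
qed

lemma ternary_Suc: "ternary b = of_bool (b 0) * (2 / 3) + ternary (\<lambda>i. b (Suc i)) / 3"
proof -
  have "ternary b = (\<Sum>i. of_bool (b (Suc i)) * 2 * (1 / 3) ^ Suc (Suc i)) + of_bool (b 0) * 2 * (1 / 3) ^ Suc 0"
    unfolding ternary_def using suminf_split_head[OF summable_ternary[of b]] by linarith
  also have "(\<Sum>i. of_bool (b (Suc i)) * 2 * (1 / 3 :: real) ^ Suc (Suc i)) = ternary (\<lambda>i. b (Suc i)) / 3"
    unfolding ternary_def using suminf_divide[OF summable_ternary[of "\<lambda>i. b (Suc i)"], of 3]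
    by (simp add: field_simps)
  finally show ?thesis by simp
qed

text \<open>A difference in the leading digit contributes 2/3 and the two tails can offset at most
  1/3 of it, so a distance below 1/3 forces equal leading digits. Removing that digit multiplies the
  distance by 3, and the induction continues.\<close>

lemma ternary_separates:
  "\<bar>ternary b - ternary c\<bar> < (1 / 3) ^ m \<Longrightarrow> i < m \<Longrightarrow> b i = c i"
proof (induction m arbitrary: b c i)
  case (Suc m)
  note b = ternary_bounds[of "\<lambda>i. b (Suc i)"] and c = ternary_bounds[of "\<lambda>i. c (Suc i)"]
  have "(1 / 3 :: real) ^ Suc m \<le> 1 / 3" using power_le_one[of "1 / 3 :: real" m] by simp
  then have d: "\<bar>ternary b - ternary c\<bar> < 1 / 3" using Suc.prems by linarith
  have 0: "b 0 = c 0"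
    using d b c by (auto simp: ternary_Suc[of b] ternary_Suc[of c] of_bool_def abs_if field_simps split: if_splits)
  then have "\<bar>ternary (\<lambda>i. b (Suc i)) - ternary (\<lambda>i. c (Suc i))\<bar> < (1 / 3) ^ m"
    using Suc.prems(1) by (simp add: ternary_Suc[of b] ternary_Suc[of c] flip: diff_divide_distrib)
  then show ?case using Suc.IH[of "\<lambda>i. b (Suc i)" "\<lambda>i. c (Suc i)" "i - 1"] Suc.prems(2) 0
    by (cases i) auto
qed simp

text \<open>The ternary expansion records to which balls of a sequence of finite nets a point belongs.\<close>

lemma compact_metric_real_code:
  assumes "Metric_space M d" and comp: "compact_space (Metric_space.mtopology M d)" and "M \<noteq> {}"
  shows "\<exists>q :: 'x \<Rightarrow> real. q \<in> borel_measurable (borel_of (Metric_space.mtopology M d)) \<and>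
    (\<forall>x. 0 \<le> q x \<and> q x \<le> 1) \<and>
    (\<forall>\<eta>>0. \<exists>\<delta>>0. \<forall>x\<in>M. \<forall>y\<in>M. \<bar>q x - q y\<bar> < \<delta> \<longrightarrow> d x y < \<eta>)"
proof -
  interpret Metric_space M d by fact
  have "mtotally_bounded M"
    using comp compactin_imp_mtotally_bounded[of M] by (simp add: compact_space_def)
  then have "\<exists>K. finite K \<and> K \<subseteq> M \<and> M \<subseteq> (\<Union>x\<in>K. mball x (1 / real (Suc N)))" for N
    unfolding mtotally_bounded_def by (auto dest: spec[of _ "1 / real (Suc N)"])
  then obtain K where K: "\<And>N. finite (K N)" "\<And>N. K N \<subseteq> M" "\<And>N. M \<subseteq> (\<Union>x\<in>K N. mball x (1 / real (Suc N)))"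
    by metis
  define C where "C = (\<Union>N. (\<lambda>x. mball x (1 / real (Suc N))) ` K N)"
  have "K 0 \<noteq> {}" using K(3)[of 0] \<open>M \<noteq> {}\<close> by auto
  then have "C \<noteq> {}" by (auto simp: C_def)
  have "countable C" unfolding C_def using K(1) by (intro countable_UN) (simp_all add: countable_finite)
  define B where "B = from_nat_into C"
  have rB: "range B = C" unfolding B_def using \<open>C \<noteq> {}\<close> \<open>countable C\<close> by (rule range_from_nat_into)
  define q where "q x = ternary (\<lambda>i. x \<in> B i)" for x
  have sB: "B i \<in> sets (borel_of mtopology)" for i
  proof -
    have "B i \<in> C" using rB by blast
    then show ?thesis by (auto simp: C_def)
  qed
  have "q \<in> borel_measurable (borel_of mtopology)"
    unfolding q_def ternary_def
    using sB by (intro borel_measurable_suminf borel_measurable_times borel_measurable_const) auto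
  moreover have "0 \<le> q x \<and> q x \<le> 1" for x by (simp add: q_def ternary_bounds)
  moreover have "\<exists>\<delta>>0. \<forall>x\<in>M. \<forall>y\<in>M. \<bar>q x - q y\<bar> < \<delta> \<longrightarrow> d x y < \<eta>" if "\<eta> > 0" for \<eta>
  proof -
    \<comment> \<open>Half of \<eta>: two points in a common ball of the net are then less than
      \<eta> apart.\<close>
    obtain N where N: "1 / real (Suc N) < \<eta> / 2" using nat_approx_posE[of "\<eta> / 2"] \<open>\<eta> > 0\<close> by auto
    have "\<forall>x\<in>K N. \<exists>i. B i = mball x (1 / real (Suc N))"
    proof
      fix x assume "x \<in> K N"
      then have "mball x (1 / real (Suc N)) \<in> range B" unfolding rB C_def by blast
      then show "\<exists>i. B i = mball x (1 / real (Suc N))" by (metis rangeE)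
    qed
    then obtain i where i: "\<And>x. x \<in> K N \<Longrightarrow> B (i x) = mball x (1 / real (Suc N))" by metis
    \<comment> \<open>Exceeds the index of every ball of the net \<open>K N\<close>, so codes closer
      than \<open>(1 / 3) ^ m\<close> place both points in the same balls of that net.\<close>
    define m where "m = Suc (Max (insert 0 (i ` K N)))"
    have im: "i x < m" if "x \<in> K N" for x
      unfolding m_def using that K(1)[of N] by (simp add: le_imp_less_Suc)
    have "d x y < \<eta>" if xy: "x \<in> M" "y \<in> M" "\<bar>q x - q y\<bar> < (1 / 3) ^ m" for x y
    proof -
      have "x \<in> (\<Union>z\<in>K N. mball z (1 / real (Suc N)))" using K(3)[of N] xy(1) by (rule subsetD)
      then obtain z where z: "z \<in> K N" "x \<in> mball z (1 / real (Suc N))" by (rule UN_E)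
      then have "y \<in> mball z (1 / real (Suc N))"
        using ternary_separates[OF xy(3)[unfolded q_def] im[OF z(1)]] i[OF z(1)] by metis
      then have "d z x < \<eta> / 2" "d z y < \<eta> / 2" "z \<in> M" using z N by auto
      then show ?thesis using triangle[of x z y] xy commute[of x z] by linarith
    qed
    then show ?thesis by (intro exI[of _ "(1 / 3) ^ m"]) auto
  qed
  ultimately show ?thesis by blast
qed

text \<open>The code \<open>q\<close> moves the problem to the unit interval, where tightness is
  automatic and Helly's selection theorem gives a limit law. That law is pulled back by the inverse
  of \<open>q\<close>, extended continuously to the closure of the range. Since \<open>q\<close> is
  merely Borel, a test function is first rewritten as a continuous function of
  \<open>q\<close>.\<close>

theorem Prob_sequentially_compact:
  assumes "Metric_space M d" and comp: "compact_space (Metric_space.mtopology M d)"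
    and \<theta>: "\<And>n. \<theta> n \<in> Prob (Metric_space.mtopology M d)"
  obtains r \<theta>' where "strict_mono (r :: nat \<Rightarrow> nat)"
    "limitin (weak_topology (Metric_space.mtopology M d)) (\<theta> \<circ> r) \<theta>' sequentially"
proof -
  interpret Metric_space M d by fact
  interpret \<theta>: prob_space "\<theta> n" for n using \<theta> by (rule Prob_D)
  have sp: "space (\<theta> n) = M" for n using Prob_D(3)[OF \<theta>] by simp
  have "M \<noteq> {}" using \<theta>.not_empty[of 0] by (simp add: sp)
  obtain q :: "_ \<Rightarrow> real" where q: "q \<in> borel_measurable (borel_of mtopology)"
    "\<And>x. 0 \<le> q x \<and> q x \<le> 1"
    "\<And>\<eta>. \<eta> > 0 \<Longrightarrow> \<exists>\<delta>>0. \<forall>x\<in>M. \<forall>y\<in>M. \<bar>q x - q y\<bar> < \<delta> \<longrightarrow> d x y < \<eta>"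
    using compact_metric_real_code[OF assms(1,2) \<open>M \<noteq> {}\<close>] by blast
  have qm [measurable]: "q \<in> borel_measurable (\<theta> n)" for n
    using q(1) measurable_cong_sets[OF Prob_D(2)[OF \<theta>] refl] by blast
  have "inj_on q M"
  proof (rule inj_onI, rule ccontr)
    fix x y assume xy: "x \<in> M" "y \<in> M" "q x = q y" "x \<noteq> y"
    then obtain \<delta> where "\<delta> > 0" "\<bar>q x - q y\<bar> < \<delta> \<longrightarrow> d x y < d x y" using q(3)[of "d x y"] mdist_pos_eq by blast
    then show False using xy by auto
  qed
  define K where "K = closure (q ` M)"
  have "K \<noteq> {}" "closed K" using \<open>M \<noteq> {}\<close> by (auto simp: K_def)
  have qK: "q x \<in> K" if "x \<in> M" for x unfolding K_def using that by (intro subsetD[OF closure_subset] imageI)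
  \<comment> \<open>The modulus built into \<open>q\<close> is uniform continuity of its inverse on
    the range; a compact target is complete, so the inverse extends to the closure
    \<open>K\<close>.\<close>
  have "uniformly_continuous_map (submetric euclidean_metric (q ` M)) (metric (M, d)) (inv_into M q)"
    unfolding uniformly_continuous_map_def
  proof (intro conjI allI impI)
    show "inv_into M q \<in> mspace (submetric euclidean_metric (q ` M)) \<rightarrow> mspace (metric (M, d))"
      by (auto simp: inv_into_into)
    fix \<eta> :: real assume "\<eta> > 0"
    then obtain \<delta> where "\<delta> > 0" "\<forall>x\<in>M. \<forall>y\<in>M. \<bar>q x - q y\<bar> < \<delta> \<longrightarrow> d x y < \<eta>" using q(3) by blast
    then show "\<exists>\<delta>>0. \<forall>x\<in>mspace (submetric euclidean_metric (q ` M)).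
      \<forall>y\<in>mspace (submetric euclidean_metric (q ` M)).
        mdist (submetric euclidean_metric (q ` M)) y x < \<delta> \<longrightarrow>
        mdist (metric (M, d)) (inv_into M q y) (inv_into M q x) < \<eta>"
      using \<open>inj_on q M\<close> by (intro exI[of _ \<delta>]) (auto simp: dist_real_def)
  qed
  then have C: "Cauchy_continuous_map (submetric euclidean_metric (q ` M)) (metric (M, d)) (inv_into M q)"
    by (rule uniformly_imp_Cauchy_continuous_map)
  have "mcomplete_of (metric (M, d))" using comp by (simp add: compact_space_imp_mcomplete)
  from Cauchy_continuous_map_extends_to_continuous_closure_of[OF this C]
  obtain \<psi> where \<psi>: "continuous_map (top_of_set K) mtopology \<psi>" "\<And>x. x \<in> q ` M \<Longrightarrow> \<psi> x = inv_into M q x"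
    by (auto simp: K_def)
  have \<psi>q: "\<psi> (q x) = x" if "x \<in> M" for x using \<psi>(2) that \<open>inj_on q M\<close> by auto
  obtain x0 where "x0 \<in> M" using \<open>M \<noteq> {}\<close> by auto
  \<comment> \<open>The value \<open>x0\<close> outside \<open>K\<close> only makes the map total
    and Borel; the limit law turns out to be carried by \<open>K\<close>.\<close>
  define \<psi>' where "\<psi>' y = (if y \<in> K then \<psi> y else x0)" for y
  have \<psi>'m: "\<psi>' \<in> borel \<rightarrow>\<^sub>M borel_of mtopology"
  proof (rule measurable_into_borel_of)
    show "\<psi>' \<in> space borel \<rightarrow> topspace mtopology"
      using \<psi>(1) \<open>x0 \<in> M\<close> by (auto simp: \<psi>'_def continuous_map_def)
    fix U assume "openin mtopology U"
    then have "openin (top_of_set K) {y \<in> K. \<psi> y \<in> U}"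
      using \<psi>(1) by (simp add: continuous_map_def)
    then obtain T where T: "open T" "{y \<in> K. \<psi> y \<in> U} = K \<inter> T" by (auto simp: openin_open)
    have "\<psi>' -` U \<inter> space borel = {y \<in> K. \<psi> y \<in> U} \<union> (if x0 \<in> U then - K else {})"
      by (auto simp: \<psi>'_def split: if_splits)
    also have "\<dots> \<in> sets borel"
      unfolding T(2) using T(1) \<open>closed K\<close> by (intro sets.Un sets.Int) auto
    finally show "\<psi>' -` U \<inter> space borel \<in> sets borel" .
  qed
  define L where "L n = distr (\<theta> n) borel q" for n
  have L: "real_distribution (L n)" for n
    unfolding L_def real_distribution_def real_distribution_axioms_def
    by (simp add: \<theta>.prob_space_distr)
  have q2: "-1 < q x \<and> q x \<le> 2" for x using q(2)[of x] by linarith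
  have "measure (L n) {-1<..2} = 1" for n
  proof -
    have "q -` {-1<..2} \<inter> space (\<theta> n) = space (\<theta> n)" using q2 by auto
    then show ?thesis by (simp add: L_def measure_distr \<theta>.prob_space)
  qed
  then have "tight L"
    unfolding tight_def using L by (intro conjI allI impI exI[of _ "-1"] exI[of _ "2"]) auto
  from tight_imp_convergent_subsubsequence[OF this strict_mono_id]
  obtain r L' where r: "strict_mono (r :: nat \<Rightarrow> nat)" and L': "real_distribution L'" "weak_conv_m (L \<circ> r) L'"
    by (auto simp: comp_def)
  interpret L': real_distribution L' by fact
  have conv: "(\<lambda>n. \<integral>x. g (q x) \<partial>\<theta> (r n)) \<longlonglongrightarrow> (\<integral>y. g y \<partial>L')"
    if "continuous_on UNIV g" "\<And>y. \<bar>g y\<bar> \<le> B" for g :: "real \<Rightarrow> real" and B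
  proof -
    have [measurable]: "g \<in> borel_measurable borel" using that(1) by (rule borel_measurable_continuous_onI)
    have "(\<lambda>n. integral\<^sup>L ((L \<circ> r) n) g) \<longlonglongrightarrow> integral\<^sup>L L' g"
      by (rule weak_conv_imp_integral_bdd_continuous_conv[OF _ L'(1) L'(2), where B = B])
        (use that L in \<open>auto simp: continuous_on_eq_continuous_at\<close>)
    then show ?thesis by (simp add: L_def integral_distr)
  qed
  have AEK: "AE y in L'. y \<in> K"
  proof -
    \<comment> \<open>A bounded continuous function whose zero set is exactly the closed set
      \<open>K\<close>: its integrals along the sequence all vanish, hence so does the limiting
      one.\<close>
    define g where "g y = min 1 (infdist y K)" for y
    have g: "continuous_on UNIV g" "\<bar>g y\<bar> \<le> 1" for y
      unfolding g_def by (auto intro!: continuous_intros simp: infdist_nonneg)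
    have "(\<lambda>n. \<integral>x. g (q x) \<partial>\<theta> (r n)) = (\<lambda>n. 0)"
    proof
      fix n
      have "(\<integral>x. g (q x) \<partial>\<theta> (r n)) = (\<integral>x. 0 \<partial>\<theta> (r n))"
        by (rule Bochner_Integration.integral_cong) (auto simp: g_def sp qK)
      then show "(\<integral>x. g (q x) \<partial>\<theta> (r n)) = 0" by simp
    qed
    then have "(\<integral>y. g y \<partial>L') = 0"
      using conv[OF g(1) g(2)] LIMSEQ_unique[OF _ tendsto_const] by auto
    moreover have gm: "g \<in> borel_measurable borel" using g(1) by (rule borel_measurable_continuous_onI)
    then have "integrable L' g"
      using g(2) by (intro L'.integrable_const_bound[of _ 1]) auto
    ultimately have "AE y in L'. g y = 0"
      by (subst (asm) integral_nonneg_eq_0_iff_AE) (auto simp: g_def infdist_nonneg)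
    then show ?thesis
      by eventually_elim
        (use \<open>K \<noteq> {}\<close> \<open>closed K\<close> in \<open>auto simp: g_def in_closed_iff_infdist_zero min_def split: if_splits\<close>)
  qed
  have \<psi>'m' [measurable]: "\<psi>' \<in> L' \<rightarrow>\<^sub>M borel_of mtopology"
    using \<psi>'m measurable_cong_sets[OF L'.events_eq_borel refl] by blast
  define \<theta>' where "\<theta>' = distr L' (borel_of mtopology) \<psi>'"
  have "limitin (weak_topology mtopology) (\<theta> \<circ> r) \<theta>' sequentially"
    unfolding limitin_weak_topology
  proof (intro conjI ballI)
    show "\<theta>' \<in> Prob mtopology" unfolding \<theta>'_def by (rule distr_Prob) (auto simp: L'.prob_space_axioms)
    show "\<forall>\<^sub>F n in sequentially. (\<theta> \<circ> r) n \<in> Prob mtopology" using \<theta> by simp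
    fix f assume f: "f \<in> bdd_continuous mtopology"
    obtain B where B: "B > 0" "\<And>x. x \<in> M \<Longrightarrow> \<bar>f x\<bar> \<le> B" using bdd_continuous_bound[OF f] by auto
    have \<psi>M: "\<psi> y \<in> M" if "y \<in> K" for y using \<psi>(1) that by (auto simp: continuous_map_def)
    have "continuous_map (top_of_set K) euclideanreal (f \<circ> \<psi>)"
      by (rule continuous_map_compose[OF \<psi>(1)]) (use f in \<open>simp add: bdd_continuous_def\<close>)
    then have "continuous_on K (f \<circ> \<psi>)" by simp
    \<comment> \<open>The extension \<open>g\<close> satisfies \<open>g (q x) = f x\<close> on the
      space itself, so weak convergence on the line tests \<open>f\<close>.\<close>
    from Tietze[OF this, of UNIV B]
    obtain g where g: "continuous_on UNIV g" "\<And>y. y \<in> K \<Longrightarrow> g y = f (\<psi> y)" "\<And>y. \<bar>g y\<bar> \<le> B"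
      using \<open>closed K\<close> B \<psi>M by auto
    have [measurable]: "f \<in> borel_measurable (borel_of mtopology)"
      using f by (auto simp: bdd_continuous_def intro: continuous_map_borel_measurable)
    have [measurable]: "g \<in> borel_measurable borel" using g(1) by (rule borel_measurable_continuous_onI)
    have "(\<integral>x. f x \<partial>\<theta>') = (\<integral>y. f (\<psi>' y) \<partial>L')"
      unfolding \<theta>'_def by (rule integral_distr) measurable
    also have "\<dots> = (\<integral>y. g y \<partial>L')"
    proof (rule integral_cong_AE)
      show "AE y in L'. f (\<psi>' y) = g y" using AEK by eventually_elim (simp add: \<psi>'_def g)
    qed measurable
    finally have 1: "(\<integral>x. f x \<partial>\<theta>') = (\<integral>y. g y \<partial>L')" .
    have 2: "(\<integral>x. f x \<partial>\<theta> (r n)) = (\<integral>x. g (q x) \<partial>\<theta> (r n))" for n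
      by (rule Bochner_Integration.integral_cong) (auto simp: sp g qK \<psi>q)
    show "(\<lambda>n. \<integral>x. f x \<partial>(\<theta> \<circ> r) n) \<longlonglongrightarrow> (\<integral>x. f x \<partial>\<theta>')"
      using conv[OF g(1,3)] by (simp add: 1 2)
  qed
  then show thesis using r that by blast
qed

section \<open>Configurations\<close>

definition wball :: "nat \<Rightarrow> 'k fgroup set" where
  "wball R = {\<gamma>. word_length \<gamma> \<le> R}"

definition wt :: "'k::finite fgroup \<Rightarrow> real" where
  "wt \<gamma> = 1 / (5 * real CARD('k) ^ 2) ^ word_length \<gamma>"

instance fgroup :: (finite) countable
proof
  have "inj (to_nat \<circ> (Rep_fgroup :: 'a fgroup \<Rightarrow> _))"
    by (intro inj_compose) (auto simp: inj_on_def Rep_fgroup_inject)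
  then show "\<exists>f :: 'a fgroup \<Rightarrow> nat. inj f" by blast
qed

lemma inj_Rep_fgroup: "inj_on Rep_fgroup A"
  by (auto simp: inj_on_def Rep_fgroup_inject)

lemma finite_sphere: "finite {\<gamma> :: 'k::finite fgroup. word_length \<gamma> = n}"
  and card_sphere: "card {\<gamma> :: 'k::finite fgroup. word_length \<gamma> = n} \<le> (2 * CARD('k)) ^ n"
proof -
  let ?L = "{w :: ('k \<times> bool) list. set w \<subseteq> UNIV \<and> length w = n}"
  have sub: "Rep_fgroup ` {\<gamma> :: 'k fgroup. word_length \<gamma> = n} \<subseteq> ?L"
    by (auto simp: word_length.rep_eq)
  have fin: "finite ?L" by (rule finite_lists_length_eq) simp
  show "finite {\<gamma> :: 'k::finite fgroup. word_length \<gamma> = n}"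
    using finite_subset[OF sub fin] finite_imageD inj_Rep_fgroup by blast
  have "card {\<gamma> :: 'k fgroup. word_length \<gamma> = n} = card (Rep_fgroup ` {\<gamma> :: 'k fgroup. word_length \<gamma> = n})"
    by (rule card_image[OF inj_Rep_fgroup, symmetric])
  also have "\<dots> \<le> card ?L" by (rule card_mono[OF fin sub])
  also have "\<dots> = (2 * CARD('k)) ^ n"
    by (subst card_lists_length_eq) (simp_all add: card_cartesian_product mult.commute)
  finally show "card {\<gamma> :: 'k fgroup. word_length \<gamma> = n} \<le> (2 * CARD('k)) ^ n" .
qed

lemma wball_eq: "wball R = (\<Union>n\<le>R. {\<gamma>. word_length \<gamma> = n})"
  by (auto simp: wball_def)

lemma finite_wball [simp]: "finite (wball R :: 'k::finite fgroup set)"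
  by (simp add: wball_eq finite_sphere)

lemma wball_mono: "R \<le> R' \<Longrightarrow> wball R \<subseteq> wball R'"
  by (auto simp: wball_def)

lemma finite_subset_wball:
  assumes "finite F"
  obtains R where "F \<subseteq> wball R"
proof
  show "F \<subseteq> wball (Max (insert 0 (word_length ` F)))"
    using assms by (auto simp: wball_def)
qed

lemma wt_pos [simp]: "0 < wt \<gamma>"
  by (simp add: wt_def)

text \<open>With rank r, the sphere of radius n has at most (2r)^n elements of weight (5r^2)^(-n),
  so its mass is at most (2/5)^n; the geometric series sums to 5/3, which is rounded up to
  2.\<close>

lemma sum_wt_le: "finite F \<Longrightarrow> sum wt F \<le> 2" for F :: "'k::finite fgroup set"
proof -
  assume "finite F"
  then obtain R where R: "F \<subseteq> wball R" by (rule finite_subset_wball)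
  let ?c = "real CARD('k)"
  have c: "?c \<ge> 1" using zero_less_card_finite[where 'a = 'k] by linarith
  have "sum wt F \<le> sum wt (wball R :: 'k fgroup set)"
    using R by (intro sum_mono2) (auto simp: less_imp_le)
  also have "\<dots> = (\<Sum>n\<le>R. \<Sum>\<gamma> | word_length (\<gamma> :: 'k fgroup) = n. wt \<gamma>)"
    unfolding wball_eq by (rule sum.UNION_disjoint) (auto simp: finite_sphere)
  also have "\<dots> \<le> (\<Sum>n\<le>R. (2 / 5) ^ n)"
  proof (rule sum_mono)
    fix n
    have "(\<Sum>\<gamma> | word_length (\<gamma> :: 'k fgroup) = n. wt \<gamma>)
        = real (card {\<gamma> :: 'k fgroup. word_length \<gamma> = n}) * (1 / (5 * ?c ^ 2) ^ n)"
      by (simp add: wt_def)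
    also have "\<dots> \<le> real ((2 * CARD('k)) ^ n) * (1 / (5 * ?c ^ 2) ^ n)"
      by (intro mult_right_mono of_nat_mono card_sphere) simp
    also have "\<dots> = (2 * ?c / (5 * ?c ^ 2)) ^ n" by (simp add: power_divide)
    also have "\<dots> \<le> (2 / 5) ^ n"
      using c by (intro power_mono) (auto simp: field_simps power2_eq_square)
    finally show "(\<Sum>\<gamma> | word_length (\<gamma> :: 'k fgroup) = n. wt \<gamma>) \<le> (2 / 5) ^ n" .
  qed
  also have "\<dots> = (\<Sum>n<Suc R. (2 / 5) ^ n)" by (simp only: lessThan_Suc_atMost)
  also have "\<dots> = (1 - (2 / 5) ^ Suc R) / (1 - 2 / 5 :: real)"
    by (subst sum_gp_strict) simp
  also have "\<dots> \<le> 2" by (simp add: field_simps)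
  finally show "sum wt F \<le> 2" .
qed

lemma wt_summable: "(wt :: 'k::finite fgroup \<Rightarrow> real) summable_on A"
  by (rule nonneg_bdd_above_summable_on) (auto intro!: bdd_aboveI[of _ 2] sum_wt_le simp: less_imp_le)

lemma config_dist_alt: "config_dist x y = infsum wt {\<gamma>. x \<gamma> \<noteq> y \<gamma>}"
  unfolding config_dist_def wt_def
  by (rule infsum_cong_neutral) auto

lemma config_dist_nonneg: "0 \<le> config_dist x y"
  unfolding config_dist_alt by (rule infsum_nonneg) (simp add: less_imp_le)

lemma config_dist_le_2: "config_dist x y \<le> 2"
  unfolding config_dist_alt by (rule infsum_le_finite_sums[OF wt_summable]) (rule sum_wt_le)

lemma wt_le_config_dist: "x \<gamma> \<noteq> y \<gamma> \<Longrightarrow> wt \<gamma> \<le> config_dist x y"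
  unfolding config_dist_alt
  using finite_sum_le_infsum[OF wt_summable, of "{\<gamma>}" "{\<gamma>. x \<gamma> \<noteq> y \<gamma>}"] by (simp add: less_imp_le)

lemma config_dist_sym: "config_dist x y = config_dist y x"
  unfolding config_dist_alt by (rule arg_cong[where f = "infsum wt"]) auto

lemma config_dist_triangle: "config_dist x z \<le> config_dist x y + config_dist y z"
proof -
  have "config_dist x z \<le> infsum wt ({\<gamma>. x \<gamma> \<noteq> y \<gamma>} \<union> ({\<gamma>. y \<gamma> \<noteq> z \<gamma>} - {\<gamma>. x \<gamma> \<noteq> y \<gamma>}))"
    unfolding config_dist_alt
    by (rule infsum_mono_neutral) (auto simp: wt_summable less_imp_le)
  also have "\<dots> = infsum wt {\<gamma>. x \<gamma> \<noteq> y \<gamma>} + infsum wt ({\<gamma>. y \<gamma> \<noteq> z \<gamma>} - {\<gamma>. x \<gamma> \<noteq> y \<gamma>})"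
    by (rule infsum_Un_disjoint) (auto simp: wt_summable)
  also have "infsum wt ({\<gamma>. y \<gamma> \<noteq> z \<gamma>} - {\<gamma>. x \<gamma> \<noteq> y \<gamma>}) \<le> config_dist y z"
    unfolding config_dist_alt
    by (rule infsum_mono_neutral) (auto simp: wt_summable less_imp_le)
  finally show ?thesis by (simp add: config_dist_alt)
qed

text \<open>Tail of a summable family: all but \<eta> of the total weight lies in a finite set, and
  a finite set lies in a word ball.\<close>

lemma config_dist_small:
  assumes "\<eta> > 0"
  obtains R where "\<And>x y :: ('k::finite, 'a) config. \<forall>\<gamma>\<in>wball R. x \<gamma> = y \<gamma> \<Longrightarrow> config_dist x y \<le> \<eta>"
proof -
  obtain F :: "'k fgroup set" where F: "finite F" "dist (sum wt F) (infsum wt (UNIV :: 'k fgroup set)) \<le> \<eta>"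
    using infsum_finite_approximation[OF wt_summable[of "UNIV :: 'k fgroup set"] \<open>\<eta> > 0\<close>] by auto
  then obtain R where R: "F \<subseteq> wball R" using finite_subset_wball by blast
  have "infsum wt (UNIV :: 'k fgroup set) = infsum wt (F \<union> - F)" by simp
  also have "\<dots> = sum wt F + infsum wt (- F)"
    using F(1) by (subst infsum_Un_disjoint) (auto simp: wt_summable)
  finally have "infsum wt (- F) \<le> \<eta>" using F(2) by (simp add: dist_real_def)
  moreover have "config_dist x y \<le> infsum wt (- F)" if "\<forall>\<gamma>\<in>wball R. x \<gamma> = y \<gamma>"
    for x y :: "('k, 'a) config"
    unfolding config_dist_alt
    by (rule infsum_mono_neutral) (use that R in \<open>auto simp: wt_summable less_imp_le\<close>)
  ultimately show thesis using that by force
qed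

section \<open>Cylinders, compactness and Borel sets\<close>

definition cyl :: "'i set \<Rightarrow> ('i \<Rightarrow> 'a) \<Rightarrow> ('i \<Rightarrow> 'a) set" where
  "cyl F a = {x. \<forall>i\<in>F. x i = a i}"

lemma topspace_config_top [simp]: "topspace config_top = UNIV"
  by (simp add: config_top_def)

lemma openin_cyl: "finite F \<Longrightarrow> openin config_top (cyl F a)"
proof -
  assume "finite F"
  have "cyl F a = (\<Inter>i\<in>F. {x \<in> topspace config_top. x i \<in> {a i}}) \<inter> topspace config_top"
    by (auto simp: cyl_def)
  moreover have "openin config_top {x \<in> topspace config_top. x i \<in> {a i}}" for i
    by (rule openin_continuous_map_preimage[where Y = "discrete_topology UNIV"])
      (use continuous_map_product_projection[of i UNIV "\<lambda>_. discrete_topology UNIV"] in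
        \<open>auto simp: config_top_def\<close>)
  ultimately show ?thesis
    using \<open>finite F\<close> openin_topspace[of config_top]
    by (cases "F = {}") (auto intro!: openin_Inter openin_INT2 simp: cyl_def)
qed

lemma openin_config_top_iff:
  "openin config_top U \<longleftrightarrow> (\<forall>x\<in>U. \<exists>F. finite F \<and> cyl F x \<subseteq> U)"
proof
  assume U: "openin config_top U"
  show "\<forall>x\<in>U. \<exists>F. finite F \<and> cyl F x \<subseteq> U"
  proof
    fix x assume "x \<in> U"
    then obtain W where W: "finite {i. W i \<noteq> UNIV}" "x \<in> Pi\<^sub>E UNIV W" "Pi\<^sub>E UNIV W \<subseteq> U"
      using U unfolding config_top_def openin_product_topology_alt by auto
    have "cyl {i. W i \<noteq> UNIV} x \<subseteq> Pi\<^sub>E UNIV W"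
    proof
      fix y assume y: "y \<in> cyl {i. W i \<noteq> UNIV} x"
      have "y i \<in> W i" for i
        using y W(2) by (cases "W i = UNIV") (auto simp: cyl_def PiE_iff)
      then show "y \<in> Pi\<^sub>E UNIV W" by (simp add: PiE_iff)
    qed
    then have "finite {i. W i \<noteq> UNIV} \<and> cyl {i. W i \<noteq> UNIV} x \<subseteq> U" using W(1,3) by simp
    then show "\<exists>F. finite F \<and> cyl F x \<subseteq> U" by (rule exI)
  qed
next
  assume R: "\<forall>x\<in>U. \<exists>F. finite F \<and> cyl F x \<subseteq> U"
  show "openin config_top U"
  proof (subst openin_subopen, intro ballI)
    fix x assume "x \<in> U"
    then obtain F where "finite F" "cyl F x \<subseteq> U" using R by blast
    then show "\<exists>T. openin config_top T \<and> x \<in> T \<and> T \<subseteq> U"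
      by (intro exI[of _ "cyl F x"]) (simp_all add: openin_cyl, simp add: cyl_def)
  qed
qed

lemma Metric_space_config_dist: "Metric_space (UNIV :: ('k::finite, 'a) config set) config_dist"
proof
  fix x y z :: "('k, 'a) config"
  show "(config_dist x y = 0) = (x = y)"
  proof
    assume "config_dist x y = 0"
    then show "x = y" using wt_le_config_dist[of x _ y] wt_pos by (metis ext linorder_not_less)
  qed (simp add: config_dist_alt)
qed (auto simp: config_dist_nonneg config_dist_sym config_dist_triangle)

interpretation config: Metric_space "UNIV :: ('k::finite, 'a) config set" config_dist
  by (rule Metric_space_config_dist)

lemma config_dist_lt_agree:
  assumes "finite F"
  obtains \<delta> where "\<delta> > 0" "\<And>x y :: ('k::finite, 'a) config. config_dist x y < \<delta> \<Longrightarrow> \<forall>\<gamma>\<in>F. x \<gamma> = y \<gamma>"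
proof
  show "Min (insert 1 (wt ` F)) > 0" using assms by (subst Min_gr_iff) auto
  fix x y :: "('k, 'a) config" assume "config_dist x y < Min (insert 1 (wt ` F))"
  then have "config_dist x y < wt \<gamma>" if "\<gamma> \<in> F" for \<gamma>
    using assms that by (subst (asm) Min_gr_iff) auto
  then show "\<forall>\<gamma>\<in>F. x \<gamma> = y \<gamma>" using wt_le_config_dist by (metis linorder_not_less)
qed

text \<open>Metric balls and cylinders over finite sets refine each other, by
  \<open>config_dist_small\<close> in one direction and \<open>config_dist_lt_agree\<close> in the
  other.\<close>

lemma mtopology_config_dist: "config.mtopology = (config_top :: ('k::finite, 'a) config topology)"
  unfolding topology_eq
proof (intro allI iffI)
  fix U :: "('k, 'a) config set"
  assume U: "openin config.mtopology U"
  show "openin config_top U"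
    unfolding openin_config_top_iff
  proof
    fix x assume "x \<in> U"
    then obtain r where r: "r > 0" "config.mball x r \<subseteq> U" using U by (auto simp: config.openin_mtopology)
    obtain R where R: "\<And>x y :: ('k, 'a) config. \<forall>\<gamma>\<in>wball R. x \<gamma> = y \<gamma> \<Longrightarrow> config_dist x y \<le> r / 2"
      using config_dist_small[of "r / 2"] r(1) by (metis half_gt_zero)
    have "cyl (wball R) x \<subseteq> config.mball x r"
    proof
      fix y assume "y \<in> cyl (wball R) x"
      then have "config_dist x y \<le> r / 2" by (intro R) (simp add: cyl_def)
      then show "y \<in> config.mball x r" using r(1) by (simp add: config.mball_def)
    qed
    then show "\<exists>F. finite F \<and> cyl F x \<subseteq> U" using r(2) by (intro exI[of _ "wball R"]) auto
  qed
next
  fix U :: "('k, 'a) config set"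
  assume U: "openin config_top U"
  show "openin config.mtopology U"
    unfolding config.openin_mtopology
  proof (intro conjI allI impI)
    fix x assume "x \<in> U"
    then obtain F where F: "finite F" "cyl F x \<subseteq> U" using U by (auto simp: openin_config_top_iff)
    from config_dist_lt_agree[OF F(1)] obtain \<delta> where
      "\<delta> > 0" "\<And>x y :: ('k, 'a) config. config_dist x y < \<delta> \<Longrightarrow> \<forall>\<gamma>\<in>F. x \<gamma> = y \<gamma>" by metis
    then have "config.mball x \<delta> \<subseteq> cyl F x" by (fastforce simp: cyl_def)
    then show "\<exists>r>0. config.mball x r \<subseteq> U" using F(2) \<open>\<delta> > 0\<close> by blast
  qed simp
qed

lemma compact_config_top: "compact_space (config_top :: ('k, 'a::finite) config topology)"
  by (simp add: config_top_def compact_space_product_topology compact_space_discrete_topology)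

text \<open>Finitely many cylinders on which \<open>f\<close> moves by less than \<eta>/2 from its
  value at the centre cover the compact space; the union of their bases decides to which of them a
  configuration belongs.\<close>

lemma continuous_map_config_uniform:
  fixes f :: "('k, 'a::finite) config \<Rightarrow> real"
  assumes f: "continuous_map config_top euclideanreal f" and "\<eta> > 0"
  obtains F where "finite F" "\<And>x y. \<forall>\<gamma>\<in>F. x \<gamma> = y \<gamma> \<Longrightarrow> \<bar>f x - f y\<bar> < \<eta>"
proof -
  have "\<exists>F. finite F \<and> (\<forall>y\<in>cyl F x. \<bar>f y - f x\<bar> < \<eta> / 2)" for x
  proof -
    have "openin config_top {y \<in> topspace config_top. f y \<in> ball (f x) (\<eta> / 2)}"
      by (rule openin_continuous_map_preimage[OF f]) simp
    moreover have "x \<in> {y \<in> topspace config_top. f y \<in> ball (f x) (\<eta> / 2)}" using \<open>\<eta> > 0\<close> by simp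
    ultimately obtain F where "finite F" "cyl F x \<subseteq> {y \<in> topspace config_top. f y \<in> ball (f x) (\<eta> / 2)}"
      unfolding openin_config_top_iff by blast
    then show ?thesis by (intro exI[of _ F]) (auto simp: dist_real_def abs_minus_commute)
  qed
  then obtain F where F: "\<And>x. finite (F x)" "\<And>x y. y \<in> cyl (F x) x \<Longrightarrow> \<bar>f y - f x\<bar> < \<eta> / 2" by metis
  have "\<exists>C. finite C \<and> C \<subseteq> range (\<lambda>x. cyl (F x) x) \<and> topspace config_top \<subseteq> \<Union>C"
    using compact_config_top unfolding compact_space_def
    by (rule compactinD) (auto simp: openin_cyl F(1), auto simp: cyl_def)
  then obtain C where C: "finite C" "C \<subseteq> (\<lambda>x. cyl (F x) x) ` UNIV" "UNIV \<subseteq> \<Union>C" unfolding topspace_config_top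
    by blast
  then obtain T where T: "finite T" "C = (\<lambda>x. cyl (F x) x) ` T"
    using finite_subset_image[OF C(1,2)] by blast
  show thesis
  proof
    show "finite (\<Union>x\<in>T. F x)" using T F by auto
    fix y z :: "('k, 'a) config" assume yz: "\<forall>\<gamma>\<in>(\<Union>x\<in>T. F x). y \<gamma> = z \<gamma>"
    obtain x where x: "x \<in> T" "y \<in> cyl (F x) x" using C(3) T(2) by blast
    then have "z \<in> cyl (F x) x" using yz by (auto simp: cyl_def)
    then show "\<bar>f y - f z\<bar> < \<eta>" using F(2)[of y x] F(2)[of z x] x by linarith
  qed
qed

lemma continuous_map_local:
  assumes "finite F" "\<And>x y. \<forall>\<gamma>\<in>F. x \<gamma> = y \<gamma> \<Longrightarrow> f x = (f y :: 'b)" "\<And>x. f x \<in> topspace Y"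
  shows "continuous_map config_top Y f"
  unfolding continuous_map_def openin_config_top_iff
proof (intro conjI allI impI ballI)
  fix U x assume "x \<in> {x \<in> topspace config_top. f x \<in> U}"
  moreover have "f y = f x" if "y \<in> cyl F x" for y using that assms(2)[of y x] by (auto simp: cyl_def)
  ultimately show "\<exists>F. finite F \<and> cyl F x \<subseteq> {x \<in> topspace config_top. f x \<in> U}"
    using assms(1) by (intro exI[of _ F]) auto
qed (use assms in auto)

lemma bdd_continuous_local:
  fixes f :: "('k, 'a::finite) config \<Rightarrow> real"
  assumes "finite F" "\<And>x y. \<forall>\<gamma>\<in>F. x \<gamma> = y \<gamma> \<Longrightarrow> f x = f y"
  shows "f \<in> bdd_continuous config_top"
  by (rule compact_bdd_continuous[OF compact_config_top continuous_map_local[OF assms]]) auto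

lemma bdd_continuous_cyl:
  "finite F \<Longrightarrow> (indicator (cyl F a) :: ('k, 'a::finite) config \<Rightarrow> real) \<in> bdd_continuous config_top"
  by (rule bdd_continuous_local[of F]) (auto simp: indicator_def cyl_def)

lemma cyl_sets [simp]: "finite F \<Longrightarrow> cyl F a \<in> sets (borel_of config_top)"
  using openin_cyl by blast

text \<open>There are only countably many pairs of a radius and a pattern on the ball of that
  radius, so every open set is a countable union of cylinders over word balls.\<close>

lemma sets_config_top:
  "sets (borel_of (config_top :: ('k::finite, 'a::finite) config topology)) =
    sigma_sets UNIV {cyl F a | F a. finite F}" (is "_ = sigma_sets UNIV ?C")
proof
  show "sigma_sets UNIV ?C \<subseteq> sets (borel_of config_top)"
  proof -
    have "?C \<subseteq> sets (borel_of config_top)" by auto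
    from sets.sigma_sets_subset[OF this] show ?thesis by simp
  qed
  have "U \<in> sigma_sets UNIV ?C" if U: "openin config_top U" for U :: "('k, 'a) config set"
  proof -
    define I where "I = {p \<in> (SIGMA R : (UNIV :: nat set). labelings (wball R :: 'k fgroup set)). cyl (wball (fst p)) (snd p) \<subseteq> U}"
    have "countable (SIGMA R : (UNIV :: nat set). (labelings (wball R) :: ('k fgroup \<Rightarrow> 'a) set))"
      by (rule countable_SIGMA) (simp_all add: countable_finite finite_PiE)
    then have cI: "countable I" unfolding I_def by (rule countable_subset[rotated]) auto
    have "U = (\<Union>p\<in>I. cyl (wball (fst p)) (snd p))"
    proof
      show "U \<subseteq> (\<Union>p\<in>I. cyl (wball (fst p)) (snd p))"
      proof
        fix x assume x: "x \<in> U"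
        then obtain F where F: "finite F" "cyl F x \<subseteq> U" using U by (auto simp: openin_config_top_iff)
        obtain R where R: "F \<subseteq> wball R" using finite_subset_wball[OF F(1)] by blast
        have eq: "cyl (wball R) (restrict x (wball R)) = cyl (wball R) x" by (auto simp: cyl_def)
        also have "\<dots> \<subseteq> cyl F x" using R by (auto simp: cyl_def)
        finally have "(R, restrict x (wball R)) \<in> I" using F by (auto simp: I_def)
        moreover have "x \<in> cyl (wball R) (restrict x (wball R))" by (simp add: cyl_def)
        ultimately show "x \<in> (\<Union>p\<in>I. cyl (wball (fst p)) (snd p))" by force
      qed
    qed (auto simp: I_def)
    also have "\<dots> \<in> sigma_sets UNIV ?C"
      by (rule sigma_sets_UNION) (use cI in \<open>auto intro!: sigma_sets.Basic\<close>)
    finally show ?thesis .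
  qed
  then have "sigma_sets UNIV {U :: ('k, 'a) config set. openin config_top U} \<subseteq> sigma_sets UNIV ?C"
    by (intro sigma_sets_mono) auto
  then show "sets (borel_of (config_top :: ('k, 'a) config topology)) \<subseteq> sigma_sets UNIV ?C"
    by (simp add: sets_borel_of)
qed

lemma cyl_Int: "cyl F a \<inter> cyl G b = (if \<forall>i\<in>F \<inter> G. a i = b i then cyl (F \<union> G) (\<lambda>i. if i \<in> F then a i else b i) else {})"
  by (auto simp: cyl_def)

text \<open>Two cylinders with conflicting prescriptions are disjoint, and no cylinder is empty
  since \<open>a\<close> itself belongs to \<open>cyl F a\<close>. Hence the empty set must be added
  to obtain a pi-system.\<close>

lemma Int_stable_cyl: "Int_stable (insert {} {cyl F (a :: 'i \<Rightarrow> 'a) | F a. finite F})"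
proof (rule Int_stableI)
  fix A B :: "('i \<Rightarrow> 'a) set"
  assume "A \<in> insert {} {cyl F a | F a. finite F}" "B \<in> insert {} {cyl F a | F a. finite F}"
  then consider "A \<inter> B = {}" | F a G b where "A = cyl F a" "finite F" "B = cyl G b" "finite G" by blast
  then show "A \<inter> B \<in> insert {} {cyl F a | F a. finite F}"
  proof cases
    case 2
    then have "finite (F \<union> G)" by simp
    then show ?thesis unfolding 2(1,3) cyl_Int by (auto simp del: finite_Un)
  qed simp
qed

lemma sigma_sets_insert_empty: "sigma_sets \<Omega> (insert {} A) = sigma_sets \<Omega> A"
proof
  show "sigma_sets \<Omega> (insert {} A) \<subseteq> sigma_sets \<Omega> A"
    by (rule sigma_sets_mono) (simp add: sigma_sets.Empty subset_iff sigma_sets.Basic)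
  show "sigma_sets \<Omega> A \<subseteq> sigma_sets \<Omega> (insert {} A)"
    by (rule sigma_sets_mono') auto
qed

lemma measure_eq_cylI:
  fixes \<mu> \<nu> :: "('k::finite, 'a::finite) config measure"
  assumes \<mu>: "finite_measure \<mu>" "sets \<mu> = sets (borel_of config_top)"
    and \<nu>: "finite_measure \<nu>" "sets \<nu> = sets (borel_of config_top)"
    and eq: "\<And>F a. finite F \<Longrightarrow> measure \<mu> (cyl F a) = measure \<nu> (cyl F a)"
  shows "\<mu> = \<nu>"
proof (rule measure_eqI_generator_eq[OF Int_stable_cyl, where \<Omega> = UNIV and A = "\<lambda>_. UNIV"])
  interpret \<mu>: finite_measure \<mu> by fact
  interpret \<nu>: finite_measure \<nu> by fact
  show "sets \<mu> = sigma_sets UNIV (insert {} {cyl F a | F a. finite F})"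
    "sets \<nu> = sigma_sets UNIV (insert {} {cyl F a | F a. finite F})"
    using \<mu> \<nu> by (simp_all add: sigma_sets_insert_empty sets_config_top)
  have "(UNIV :: ('k, 'a) config set) = cyl {} undefined" by (auto simp: cyl_def)
  moreover have "cyl {} undefined \<in> {cyl F a | F (a :: ('k, 'a) config). finite F}"
    by (intro CollectI exI conjI) (rule refl, simp)
  ultimately show "range (\<lambda>_ :: nat. UNIV :: ('k, 'a) config set) \<subseteq> insert {} {cyl F a | F a. finite F}"
    by auto
  show "emeasure \<mu> X = emeasure \<nu> X" if "X \<in> insert {} {cyl F a | F a. finite F}" for X
    using that eq by (auto simp: \<mu>.emeasure_eq_measure \<nu>.emeasure_eq_measure)
qed (auto simp: finite_measure.emeasure_finite[OF \<mu>(1)])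

lemma Prob_config_eqI:
  fixes \<mu> \<nu> :: "('k::finite, 'a::finite) config measure"
  assumes "\<mu> \<in> Prob config_top" "\<nu> \<in> Prob config_top"
    and "\<And>F a. finite F \<Longrightarrow> measure \<mu> (cyl F a) = measure \<nu> (cyl F a)"
  shows "\<mu> = \<nu>"
  by (rule measure_eq_cylI[OF _ _ _ _ assms(3)])
    (simp_all add: prob_space.finite_measure Prob_D[OF assms(1)] Prob_D[OF assms(2)])

section \<open>The metric on invariant measures\<close>

lemma continuous_map_realI:
  assumes "\<And>x e. x \<in> topspace X \<Longrightarrow> e > 0 \<Longrightarrow> \<exists>U. openin X U \<and> x \<in> U \<and> (\<forall>y\<in>U. \<bar>f y - f x\<bar> < e)"
  shows "continuous_map X euclideanreal f"
  unfolding continuous_map_def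
proof (intro conjI allI impI)
  fix W :: "real set" assume W: "openin euclideanreal W"
  show "openin X {x \<in> topspace X. f x \<in> W}"
  proof (subst openin_subopen, intro ballI)
    fix x assume x: "x \<in> {x \<in> topspace X. f x \<in> W}"
    then obtain e where e: "e > 0" "ball (f x) e \<subseteq> W" using W by (auto simp: open_contains_ball)
    obtain U where U: "openin X U" "x \<in> U" "\<forall>y\<in>U. \<bar>f y - f x\<bar> < e" using assms[of x e] x e by auto
    have "U \<subseteq> {x \<in> topspace X. f x \<in> W}"
    proof
      fix y assume "y \<in> U"
      then have "f y \<in> ball (f x) e" "y \<in> topspace X"
        using U openin_subset[OF U(1)] by (auto simp: dist_real_def abs_minus_commute)
      then show "y \<in> {x \<in> topspace X. f x \<in> W}" using e by auto
    qed
    then show "\<exists>T. openin X T \<and> x \<in> T \<and> T \<subseteq> {x \<in> topspace X. f x \<in> W}" using U by blast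
  qed
qed simp

lemma Lip1_bdd_continuous:
  assumes "f \<in> Lip1 UNIV (config_dist :: ('k::finite, 'a::finite) config \<Rightarrow> _)"
  shows "f \<in> bdd_continuous config_top"
proof (rule compact_bdd_continuous[OF compact_config_top continuous_map_realI])
  fix x :: "('k, 'a) config" and e :: real assume "e > 0"
  then obtain R where R: "\<And>x y :: ('k, 'a) config. \<forall>\<gamma>\<in>wball R. x \<gamma> = y \<gamma> \<Longrightarrow> config_dist x y \<le> e / 2"
    using config_dist_small[of "e / 2"] by (metis half_gt_zero)
  have "\<bar>f y - f x\<bar> < e" if "y \<in> cyl (wball R) x" for y
  proof -
    have "\<bar>f y - f x\<bar> \<le> config_dist y x" using assms by (simp add: Lip1_def)
    also have "\<dots> \<le> e / 2" using that by (intro R) (simp add: cyl_def)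
    finally show ?thesis using \<open>e > 0\<close> by simp
  qed
  then show "\<exists>U. openin config_top U \<and> x \<in> U \<and> (\<forall>y\<in>U. \<bar>f y - f x\<bar> < e)"
    by (intro exI[of _ "cyl (wball R) x"]) (simp add: openin_cyl, simp add: cyl_def)
qed

lemma cyl_iff_restrict: "a \<in> labelings F \<Longrightarrow> x \<in> cyl F a \<longleftrightarrow> a = restrict x F"
  by (auto simp: cyl_def PiE_iff extensional_def restrict_def fun_eq_iff)

lemma finite_labelings [simp]: "finite F \<Longrightarrow> finite (labelings F :: ('i \<Rightarrow> 'a::finite) set)"
  by (simp add: finite_PiE)

lemma local_eq_sum_cyl:
  fixes f :: "('i \<Rightarrow> 'a::finite) \<Rightarrow> real"
  assumes "finite F"
  shows "f (restrict x F) = (\<Sum>a\<in>labelings F. f a * indicator (cyl F a) x)"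
proof -
  have "(\<Sum>a\<in>labelings F. f a * indicator (cyl F a) x) = (\<Sum>a\<in>labelings F. if a = restrict x F then f a else 0)"
    by (rule sum.cong) (auto simp: cyl_iff_restrict indicator_def)
  also have "\<dots> = f (restrict x F)" using assms by (subst sum.delta) auto
  finally show ?thesis by simp
qed

lemma Prob_config_D:
  assumes "\<mu> \<in> Prob (config_top :: ('k, 'a) config topology)"
  shows "prob_space \<mu>" "sets \<mu> = sets (borel_of config_top)" "space \<mu> = UNIV"
  using Prob_D[OF assms] by auto

lemma integral_local:
  fixes f :: "('k::finite, 'a::finite) config \<Rightarrow> real"
  assumes "finite F" "\<mu> \<in> Prob config_top"
  shows "(\<integral>x. f (restrict x F) \<partial>\<mu>) = (\<Sum>a\<in>labelings F. f a * measure \<mu> (cyl F a))"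
proof -
  interpret prob_space \<mu> using Prob_config_D[OF assms(2)] by simp
  have m: "cyl F a \<in> events" for a
    using assms(1) by (simp add: Prob_config_D[OF assms(2)])
  have "(\<integral>x. f (restrict x F) \<partial>\<mu>) = (\<integral>x. (\<Sum>a\<in>labelings F. f a * indicator (cyl F a) x) \<partial>\<mu>)"
    by (simp only: local_eq_sum_cyl[OF assms(1)])
  also have "\<dots> = (\<Sum>a\<in>labelings F. (\<integral>x. f a * indicator (cyl F a) x \<partial>\<mu>))"
    by (rule Bochner_Integration.integral_sum)
      (intro integrable_mult_right integrable_real_indicator m, simp add: emeasure_eq_measure)
  also have "\<dots> = (\<Sum>a\<in>labelings F. f a * measure \<mu> (cyl F a))"
    by (simp add: Prob_config_D[OF assms(2)])
  finally show ?thesis .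
qed

lemma sum_measure_cyl:
  assumes "finite F" "\<mu> \<in> Prob (config_top :: ('k::finite, 'a::finite) config topology)"
  shows "(\<Sum>a\<in>labelings F. measure \<mu> (cyl F a)) = 1"
  using integral_local[OF assms, of "\<lambda>_. 1"] prob_space.prob_space[OF Prob_config_D(1)[OF assms(2)]] by simp

text \<open>Twice the total variation distance between the marginals on \<open>F\<close>, when both
  arguments are probability measures.\<close>

definition cdist :: "'k fgroup set \<Rightarrow> ('k, 'a) config measure \<Rightarrow> ('k, 'a) config measure \<Rightarrow> real" where
  "cdist F \<mu> \<nu> = (\<Sum>a\<in>labelings F. \<bar>measure \<mu> (cyl F a) - measure \<nu> (cyl F a)\<bar>)"

lemma integral_diff_bound:
  fixes f :: "'x \<Rightarrow> real"
  assumes "prob_space \<mu>" "integrable \<mu> f" "integrable \<mu> g" "\<And>x. \<bar>f x - g x\<bar> \<le> B"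
  shows "\<bar>(\<integral>x. f x \<partial>\<mu>) - (\<integral>x. g x \<partial>\<mu>)\<bar> \<le> B"
proof -
  interpret prob_space \<mu> by fact
  have "\<bar>(\<integral>x. f x \<partial>\<mu>) - (\<integral>x. g x \<partial>\<mu>)\<bar> = \<bar>\<integral>x. f x - g x \<partial>\<mu>\<bar>" using assms by simp
  also have "\<dots> \<le> (\<integral>x. \<bar>f x - g x\<bar> \<partial>\<mu>)" by (rule integral_abs_bound)
  also have "\<dots> \<le> (\<integral>x. B \<partial>\<mu>)" using assms by (intro integral_mono) auto
  finally show ?thesis by (simp add: prob_space)
qed

text \<open>Replacing \<open>f\<close> by its value at the restricted configuration costs \<eta>
  under each measure. The remaining finite sum may be centred at any \<open>c\<close>, because both
  marginals have total mass 1; so \<open>B\<close> need only bound the deviation of \<open>f\<close>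
  from \<open>c\<close>, not its size.\<close>

lemma integral_diff_cdist:
  fixes f :: "('k::finite, 'a::finite) config \<Rightarrow> real"
  assumes F: "finite F" and \<mu>: "\<mu> \<in> Prob config_top" and \<nu>: "\<nu> \<in> Prob config_top"
    and f: "f \<in> bdd_continuous config_top"
    and loc: "\<And>x y. \<forall>\<gamma>\<in>F. x \<gamma> = y \<gamma> \<Longrightarrow> \<bar>f x - f y\<bar> \<le> \<eta>"
    and B: "\<And>x. \<bar>f x - c\<bar> \<le> B"
  shows "\<bar>(\<integral>x. f x \<partial>\<mu>) - (\<integral>x. f x \<partial>\<nu>)\<bar> \<le> 2 * \<eta> + B * cdist F \<mu> \<nu>"
proof -
  have r: "(\<lambda>x. f (restrict x F)) \<in> bdd_continuous config_top"
  proof (rule bdd_continuous_local[OF F])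
    fix x y :: "('k, 'a) config" assume "\<forall>\<gamma>\<in>F. x \<gamma> = y \<gamma>"
    then have "restrict x F = restrict y F" by auto
    then show "f (restrict x F) = f (restrict y F)" by simp
  qed
  have 1: "\<bar>(\<integral>x. f x \<partial>\<mu>) - (\<integral>x. f (restrict x F) \<partial>\<mu>)\<bar> \<le> \<eta>" if "\<mu> \<in> Prob config_top" for \<mu>
    by (rule integral_diff_bound[OF Prob_config_D(1)[OF that] bdd_continuous_integrable[OF f that]
          bdd_continuous_integrable[OF r that]]) (simp add: loc)
  have "(\<integral>x. f (restrict x F) \<partial>\<mu>) - (\<integral>x. f (restrict x F) \<partial>\<nu>)
      = (\<Sum>a\<in>labelings F. f a * (measure \<mu> (cyl F a) - measure \<nu> (cyl F a)))"
    by (simp add: integral_local F \<mu> \<nu> sum_subtractf right_diff_distrib)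
  also have "\<dots> = (\<Sum>a\<in>labelings F. (f a - c) * (measure \<mu> (cyl F a) - measure \<nu> (cyl F a)))
      + c * ((\<Sum>a\<in>labelings F. measure \<mu> (cyl F a)) - (\<Sum>a\<in>labelings F. measure \<nu> (cyl F a)))"
    by (simp add: sum_distrib_left sum_subtractf[symmetric] sum.distrib[symmetric] algebra_simps)
  also have "\<dots> = (\<Sum>a\<in>labelings F. (f a - c) * (measure \<mu> (cyl F a) - measure \<nu> (cyl F a)))"
    by (simp add: sum_measure_cyl F \<mu> \<nu>)
  also have "\<bar>\<dots>\<bar> \<le> (\<Sum>a\<in>labelings F. B * \<bar>measure \<mu> (cyl F a) - measure \<nu> (cyl F a)\<bar>)"
    using B by (intro order.trans[OF sum_abs] sum_mono) (simp add: abs_mult mult_right_mono)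
  also have "\<dots> = B * cdist F \<mu> \<nu>" by (simp add: cdist_def sum_distrib_left)
  finally show ?thesis using 1[OF \<mu>] 1[OF \<nu>] by linarith
qed

section \<open>Lipschitz tests against cylinder probabilities\<close>

lemma Lip1_near:
  assumes "f \<in> Lip1 UNIV (config_dist :: ('k::finite, 'a) config \<Rightarrow> _)"
  shows "\<bar>f x - f y\<bar> \<le> 2"
proof -
  have "\<bar>f x - f y\<bar> \<le> config_dist x y" using assms by (simp add: Lip1_def)
  then show ?thesis using config_dist_le_2[of x y] by linarith
qed

lemma const_Lip1: "(\<lambda>_. 0) \<in> Lip1 UNIV config_dist"
  by (simp add: Lip1_def config_dist_nonneg)

lemma Lip1_diff_bdd:
  fixes \<mu> \<nu> :: "('k::finite, 'a::finite) config measure"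
  assumes "\<mu> \<in> Prob config_top" "\<nu> \<in> Prob config_top" "f \<in> Lip1 UNIV config_dist"
  shows "\<bar>(\<integral>x. f x \<partial>\<mu>) - (\<integral>x. f x \<partial>\<nu>)\<bar> \<le> 4"
proof -
  have "\<bar>(\<integral>x. f x \<partial>\<rho>) - f undefined\<bar> \<le> 2" if "\<rho> \<in> Prob config_top" for \<rho>
  proof -
    interpret prob_space \<rho> using Prob_config_D[OF that] by simp
    show ?thesis
      using integral_diff_bound[of \<rho> f "\<lambda>_. f undefined" 2] Lip1_near[OF assms(3), of _ undefined]
        bdd_continuous_integrable[OF Lip1_bdd_continuous[OF assms(3)] that]
      by (simp add: prob_space_axioms prob_space)
  qed
  from this[OF assms(1)] this[OF assms(2)] show ?thesis by linarith
qed

lemma Lip1_le_dbar: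
  fixes \<mu> \<nu> :: "('k::finite, 'a::finite) config measure"
  assumes "\<mu> \<in> Prob config_top" "\<nu> \<in> Prob config_top" "f \<in> Lip1 UNIV config_dist"
  shows "\<bar>(\<integral>x. f x \<partial>\<mu>) - (\<integral>x. f x \<partial>\<nu>)\<bar> \<le> dbar \<mu> \<nu>"
  unfolding dbar_def
  by (rule cSUP_upper[OF assms(3)]) (auto intro!: bdd_aboveI[of _ 4] Lip1_diff_bdd assms)

lemma dbar_leI:
  assumes "\<And>f. f \<in> Lip1 UNIV config_dist \<Longrightarrow> \<bar>(\<integral>x. f x \<partial>\<mu>) - (\<integral>x. f x \<partial>\<nu>)\<bar> \<le> B"
  shows "dbar \<mu> \<nu> \<le> B"
  unfolding dbar_def using const_Lip1 assms by (intro cSUP_least) auto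

text \<open>Uniform over the whole test class: each 1-Lipschitz function moves by at most \<eta>
  when only sites outside a large ball change, and it stays within 2, the bound on the diameter, of
  its value at one configuration.\<close>

lemma dbar_le_cdist:
  assumes "\<eta> > 0"
  obtains R where "\<And>\<mu> \<nu> :: ('k::finite, 'a::finite) config measure.
    \<mu> \<in> Prob config_top \<Longrightarrow> \<nu> \<in> Prob config_top \<Longrightarrow> dbar \<mu> \<nu> \<le> 2 * \<eta> + 2 * cdist (wball R) \<mu> \<nu>"
proof -
  obtain R where R: "\<And>x y :: ('k, 'a) config. \<forall>\<gamma>\<in>wball R. x \<gamma> = y \<gamma> \<Longrightarrow> config_dist x y \<le> \<eta>"
    using config_dist_small[OF assms] by metis
  show thesis
  proof (rule that[of R], rule dbar_leI)
    fix \<mu> \<nu> :: "('k, 'a) config measure" and f :: "('k, 'a) config \<Rightarrow> real"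
    assume P: "\<mu> \<in> Prob config_top" "\<nu> \<in> Prob config_top" and f: "f \<in> Lip1 UNIV config_dist"
    show "\<bar>(\<integral>x. f x \<partial>\<mu>) - (\<integral>x. f x \<partial>\<nu>)\<bar> \<le> 2 * \<eta> + 2 * cdist (wball R) \<mu> \<nu>"
    proof (rule integral_diff_cdist[OF _ P Lip1_bdd_continuous[OF f]])
      show "\<bar>f x - f undefined\<bar> \<le> 2" for x using f by (rule Lip1_near)
      show "\<bar>f x - f y\<bar> \<le> \<eta>" if "\<forall>\<gamma>\<in>wball R. x \<gamma> = y \<gamma>" for x y
      proof -
        have "\<bar>f x - f y\<bar> \<le> config_dist x y" using f by (simp add: Lip1_def)
        then show ?thesis using R[OF that] by linarith
      qed
    qed simp
  qed
qed

text \<open>If configurations closer than \<delta> agree on \<open>F\<close>, then \<delta> times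
  the indicator of a cylinder over \<open>F\<close> is 1-Lipschitz.\<close>

lemma cyl_le_dbar:
  assumes "finite F"
  obtains c where "c > 0" "\<And>(\<mu> :: ('k::finite, 'a::finite) config measure) \<nu> a.
    \<mu> \<in> Prob config_top \<Longrightarrow> \<nu> \<in> Prob config_top \<Longrightarrow>
    \<bar>measure \<mu> (cyl F a) - measure \<nu> (cyl F a)\<bar> \<le> c * dbar \<mu> \<nu>"
proof -
  from config_dist_lt_agree[OF assms] obtain \<delta> where \<delta>: "\<delta> > 0"
    "\<And>x y :: ('k, 'a) config. config_dist x y < \<delta> \<Longrightarrow> \<forall>\<gamma>\<in>F. x \<gamma> = y \<gamma>" by metis
  show thesis
  proof (rule that[of "1 / \<delta>"])
    fix \<mu> \<nu> :: "('k, 'a) config measure" and a :: "('k, 'a) config"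
    assume P: "\<mu> \<in> Prob config_top" "\<nu> \<in> Prob config_top"
    have "(\<lambda>x. \<delta> * indicator (cyl F a) x) \<in> Lip1 UNIV config_dist"
      unfolding Lip1_def
    proof (intro CollectI ballI)
      fix x y :: "('k, 'a) config"
      show "\<bar>\<delta> * indicator (cyl F a) x - \<delta> * indicator (cyl F a) y\<bar> \<le> config_dist x y"
      proof (cases "config_dist x y < \<delta>")
        case True
        then have "x \<in> cyl F a \<longleftrightarrow> y \<in> cyl F a" using \<delta>(2)[of x y] by (auto simp: cyl_def)
        then show ?thesis by (simp add: indicator_def config_dist_nonneg)
      qed (use \<delta>(1) in \<open>auto simp: indicator_def config_dist_nonneg\<close>)
    qed
    from Lip1_le_dbar[OF P this]
    have "\<delta> * \<bar>measure \<mu> (cyl F a) - measure \<nu> (cyl F a)\<bar> \<le> dbar \<mu> \<nu>"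
      using \<delta>(1) by (simp add: Prob_config_D[OF P(1)] Prob_config_D[OF P(2)] abs_mult flip: right_diff_distrib)
    then show "\<bar>measure \<mu> (cyl F a) - measure \<nu> (cyl F a)\<bar> \<le> 1 / \<delta> * dbar \<mu> \<nu>"
      using \<delta>(1) by (simp add: field_simps)
  qed (use \<delta> in simp)
qed

text \<open>
  Outside the probability measures the supremum defining \<open>dbar\<close> may be over an unbounded set;
  truncating at 0 yields a total nonnegative function.
\<close>

definition dprob :: "('k::finite, 'a) config measure \<Rightarrow> ('k, 'a) config measure \<Rightarrow> real" where
  "dprob \<mu> \<nu> = max 0 (dbar \<mu> \<nu>)"

lemma dbar_nonneg:
  fixes \<mu> \<nu> :: "('k::finite, 'a::finite) config measure"
  assumes "\<mu> \<in> Prob config_top" "\<nu> \<in> Prob config_top"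
  shows "0 \<le> dbar \<mu> \<nu>"
  using Lip1_le_dbar[OF assms const_Lip1] by simp

lemma dprob_eq:
  fixes \<mu> \<nu> :: "('k::finite, 'a::finite) config measure"
  assumes "\<mu> \<in> Prob config_top" "\<nu> \<in> Prob config_top"
  shows "dprob \<mu> \<nu> = dbar \<mu> \<nu>"
  using dbar_nonneg[OF assms] by (simp add: dprob_def)

lemma dprob_le_4:
  fixes \<mu> \<nu> :: "('k::finite, 'a::finite) config measure"
  assumes "\<mu> \<in> Prob config_top" "\<nu> \<in> Prob config_top"
  shows "dprob \<mu> \<nu> \<le> 4"
  unfolding dprob_eq[OF assms] by (rule dbar_leI) (rule Lip1_diff_bdd[OF assms])

lemma Metric_space_dprob:
  "Metric_space (Prob (config_top :: ('k::finite, 'a::finite) config topology)) dprob"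
proof
  fix \<mu> \<nu> \<rho> :: "('k, 'a) config measure"
  show "0 \<le> dprob \<mu> \<nu>" by (simp add: dprob_def)
  show "dprob \<mu> \<nu> = dprob \<nu> \<mu>" by (simp add: dprob_def dbar_def abs_minus_commute)
  assume \<mu>: "\<mu> \<in> Prob config_top" and \<nu>: "\<nu> \<in> Prob config_top"
  show "(dprob \<mu> \<nu> = 0) = (\<mu> = \<nu>)"
  proof
    assume 0: "dprob \<mu> \<nu> = 0"
    show "\<mu> = \<nu>"
    proof (rule Prob_config_eqI[OF \<mu> \<nu>])
      fix F :: "'k fgroup set" and a :: "('k, 'a) config" assume F: "finite F"
      obtain c where "c > 0" "\<bar>measure \<mu> (cyl F a) - measure \<nu> (cyl F a)\<bar> \<le> c * dbar \<mu> \<nu>"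
        using cyl_le_dbar[OF F] \<mu> \<nu> by metis
      then show "measure \<mu> (cyl F a) = measure \<nu> (cyl F a)"
        using 0 by (simp add: dprob_eq[OF \<mu> \<nu>])
    qed
  next
    assume "\<mu> = \<nu>"
    then show "dprob \<mu> \<nu> = 0" using dbar_leI[of \<mu> \<mu> 0] by (simp add: dprob_def)
  qed
  assume \<rho>: "\<rho> \<in> Prob config_top"
  show "dprob \<mu> \<rho> \<le> dprob \<mu> \<nu> + dprob \<nu> \<rho>"
    unfolding dprob_eq[OF \<mu> \<nu>] dprob_eq[OF \<nu> \<rho>] dprob_eq[OF \<mu> \<rho>]
  proof (rule dbar_leI)
    fix f :: "('k, 'a) config \<Rightarrow> real" assume f: "f \<in> Lip1 UNIV config_dist"
    show "\<bar>(\<integral>x. f x \<partial>\<mu>) - (\<integral>x. f x \<partial>\<rho>)\<bar> \<le> dbar \<mu> \<nu> + dbar \<nu> \<rho>"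
      using Lip1_le_dbar[OF \<mu> \<nu> f] Lip1_le_dbar[OF \<nu> \<rho> f] by linarith
  qed
qed

interpretation dprob: Metric_space "Prob (config_top :: ('k::finite, 'a::finite) config topology)" dprob
  by (rule Metric_space_dprob)

lemma continuous_map_measure_cyl:
  assumes "finite F"
  shows "continuous_map (weak_topology (config_top :: ('k::finite, 'a::finite) config topology)) euclideanreal
    (\<lambda>\<mu>. measure \<mu> (cyl F a))"
proof -
  have "continuous_map (weak_topology (config_top :: ('k, 'a) config topology)) euclideanreal
    (\<lambda>\<mu>. \<integral>x. indicator (cyl F a) x \<partial>\<mu>)"
    by (rule continuous_map_integral[OF bdd_continuous_cyl[OF assms]])
  then show ?thesis
    by (rule continuous_map_eq) (simp add: Prob_config_D)
qed

lemma continuous_map_cdist: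
  "finite F \<Longrightarrow> continuous_map (weak_topology (config_top :: ('k::finite, 'a::finite) config topology)) euclideanreal
    (cdist F \<mu>)"
  unfolding cdist_def
  by (intro continuous_map_sum continuous_map_real_abs continuous_map_diff continuous_map_measure_cyl) auto

text \<open>A continuous test function need not be Lipschitz, so it is compared with cylinder
  probabilities on a window where it is determined up to a small error; this is the origin of the
  additive \<eta>.\<close>

lemma integral_le_dprob:
  fixes f :: "('k::finite, 'a::finite) config \<Rightarrow> real"
  assumes f: "f \<in> bdd_continuous config_top" and "\<eta> > 0"
  obtains c where "c > 0" "\<And>\<mu> \<nu>. \<mu> \<in> Prob config_top \<Longrightarrow> \<nu> \<in> Prob config_top \<Longrightarrow>
    \<bar>(\<integral>x. f x \<partial>\<mu>) - (\<integral>x. f x \<partial>\<nu>)\<bar> \<le> \<eta> + c * dprob \<mu> \<nu>"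
proof -
  obtain B where B: "B > 0" "\<And>x. \<bar>f x\<bar> \<le> B" using bdd_continuous_bound[OF f] by auto
  have "continuous_map config_top euclideanreal f" using f by (simp add: bdd_continuous_def)
  then obtain F where F: "finite F" "\<And>x y. \<forall>\<gamma>\<in>F. x \<gamma> = y \<gamma> \<Longrightarrow> \<bar>f x - f y\<bar> < \<eta> / 2"
    by (rule continuous_map_config_uniform[where \<eta> = "\<eta> / 2"]) (use \<open>\<eta> > 0\<close> in auto)
  obtain c where c: "c > 0" "\<And>(\<mu> :: ('k, 'a) config measure) \<nu> a. \<mu> \<in> Prob config_top \<Longrightarrow> \<nu> \<in> Prob config_top \<Longrightarrow>
    \<bar>measure \<mu> (cyl F a) - measure \<nu> (cyl F a)\<bar> \<le> c * dbar \<mu> \<nu>"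
    using cyl_le_dbar[OF F(1)] by metis
  define n where "n = real (card (labelings F :: ('k, 'a) config set))"
  show thesis
  proof (rule that[of "B * ((n + 1) * c)"])
    show "0 < B * ((n + 1) * c)" using B c by (simp add: n_def)
    fix \<mu> \<nu> :: "('k, 'a) config measure" assume P: "\<mu> \<in> Prob config_top" "\<nu> \<in> Prob config_top"
    have "cdist F \<mu> \<nu> \<le> (\<Sum>a\<in>(labelings F :: ('k, 'a) config set). c * dbar \<mu> \<nu>)"
      unfolding cdist_def by (intro sum_mono c P)
    also have "\<dots> = n * c * dbar \<mu> \<nu>" by (simp add: n_def)
    also have "\<dots> \<le> (n + 1) * c * dbar \<mu> \<nu>"
      using c dbar_nonneg[OF P] by (intro mult_right_mono) auto
    finally have cd: "cdist F \<mu> \<nu> \<le> (n + 1) * c * dprob \<mu> \<nu>" by (simp add: dprob_eq[OF P])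
    have "\<bar>(\<integral>x. f x \<partial>\<mu>) - (\<integral>x. f x \<partial>\<nu>)\<bar> \<le> 2 * (\<eta> / 2) + B * cdist F \<mu> \<nu>"
      by (rule integral_diff_cdist[OF F(1) P f, where c = 0]) (use F(2) B in \<open>auto intro: less_imp_le\<close>)
    also have "\<dots> \<le> \<eta> + B * ((n + 1) * c * dprob \<mu> \<nu>)"
      using mult_left_mono[OF cd, of B] B by simp
    finally show "\<bar>(\<integral>x. f x \<partial>\<mu>) - (\<integral>x. f x \<partial>\<nu>)\<bar> \<le> \<eta> + B * ((n + 1) * c) * dprob \<mu> \<nu>"
      by (simp add: mult.assoc)
  qed
qed

text \<open>A small \<open>dbar\<close> is implied by finitely many cylinder probabilities being
  close, which is a weakly open condition, and it conversely controls all integrals of continuous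
  functions. The weak topology thus becomes metric, and compactness can be argued with
  sequences.\<close>

lemma mtopology_dprob:
  "dprob.mtopology = weak_topology (config_top :: ('k::finite, 'a::finite) config topology)"
  unfolding topology_eq
proof (intro allI iffI)
  fix U :: "('k, 'a) config measure set"
  assume U: "openin dprob.mtopology U"
  show "openin (weak_topology config_top) U"
  proof (subst openin_subopen, intro ballI)
    fix \<mu> assume "\<mu> \<in> U"
    then obtain r where r: "r > 0" "dprob.mball \<mu> r \<subseteq> U" and \<mu>: "\<mu> \<in> Prob config_top"
      using U unfolding dprob.openin_mtopology by blast
    obtain R where R: "\<And>\<mu> \<nu> :: ('k, 'a) config measure. \<mu> \<in> Prob config_top \<Longrightarrow> \<nu> \<in> Prob config_top \<Longrightarrow>
      dbar \<mu> \<nu> \<le> 2 * (r / 8) + 2 * cdist (wball R) \<mu> \<nu>"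
      using dbar_le_cdist[of "r / 8"] r(1) by (metis zero_less_divide_iff zero_less_numeral)
    define T where "T = {\<nu> \<in> topspace (weak_topology config_top). cdist (wball R) \<mu> \<nu> \<in> {..<r / 8}}"
    have "openin (weak_topology config_top) T"
      unfolding T_def by (rule openin_continuous_map_preimage[OF continuous_map_cdist]) auto
    moreover have "\<mu> \<in> T" using \<mu> r(1) by (simp add: T_def cdist_def)
    moreover have "T \<subseteq> U"
    proof
      fix \<nu> assume "\<nu> \<in> T"
      then have \<nu>: "\<nu> \<in> Prob config_top" "cdist (wball R) \<mu> \<nu> < r / 8" by (auto simp: T_def)
      then have "dprob \<mu> \<nu> < r" using R[OF \<mu> \<nu>(1)] r(1) by (simp add: dprob_eq[OF \<mu> \<nu>(1)])
      then show "\<nu> \<in> U" using r(2) \<mu> \<nu>(1) by auto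
    qed
    ultimately show "\<exists>T. openin (weak_topology config_top) T \<and> \<mu> \<in> T \<and> T \<subseteq> U" by blast
  qed
next
  fix U :: "('k, 'a) config measure set"
  assume U: "openin (weak_topology config_top) U"
  have "continuous_map dprob.mtopology (weak_topology (config_top :: ('k, 'a) config topology)) (\<lambda>\<mu>. \<mu>)"
    unfolding continuous_map_into_weak_topology
  proof (intro conjI ballI)
    fix f :: "('k, 'a) config \<Rightarrow> real" assume f: "f \<in> bdd_continuous config_top"
    show "continuous_map dprob.mtopology euclideanreal (\<lambda>\<mu>. \<integral>x. f x \<partial>\<mu>)"
    proof (rule continuous_map_realI)
      fix \<mu> :: "('k, 'a) config measure" and e :: real assume "\<mu> \<in> topspace dprob.mtopology" and e: "e > 0"
      then have \<mu>: "\<mu> \<in> Prob config_top" by simp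
      obtain c where c: "c > 0" "\<And>\<mu> \<nu>. \<mu> \<in> Prob config_top \<Longrightarrow> \<nu> \<in> Prob config_top \<Longrightarrow>
        \<bar>(\<integral>x. f x \<partial>\<mu>) - (\<integral>x. f x \<partial>\<nu>)\<bar> \<le> e / 2 + c * dprob \<mu> \<nu>"
        using integral_le_dprob[OF f, of "e / 2"] e by auto
      have "\<bar>(\<integral>x. f x \<partial>\<nu>) - (\<integral>x. f x \<partial>\<mu>)\<bar> < e" if "\<nu> \<in> dprob.mball \<mu> (e / (2 * c))" for \<nu>
      proof -
        have "\<nu> \<in> Prob config_top" "c * dprob \<mu> \<nu> < e / 2" using that c(1) by (auto simp: field_simps)
        then show ?thesis using c(2)[OF \<mu>, of \<nu>] by linarith
      qed
      then show "\<exists>U. openin dprob.mtopology U \<and> \<mu> \<in> U \<and>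
          (\<forall>\<nu>\<in>U. \<bar>(\<integral>x. f x \<partial>\<nu>) - (\<integral>x. f x \<partial>\<mu>)\<bar> < e)"
        using \<mu> e c(1) by (intro exI[of _ "dprob.mball \<mu> (e / (2 * c))"]) auto
    qed
  qed simp
  then have "openin dprob.mtopology {\<mu> \<in> topspace dprob.mtopology. \<mu> \<in> U}"
    using U by (rule openin_continuous_map_preimage)
  moreover have "{\<mu> \<in> topspace dprob.mtopology. \<mu> \<in> U} = U"
    using openin_subset[OF U] by auto
  ultimately show "openin dprob.mtopology U" by simp
qed


section \<open>Compactness of the space of laws\<close>

abbreviation Pcomp :: "('k, 'a) config measure topology" where
  "Pcomp \<equiv> weak_topology config_top"

lemma limitin_Pcomp:
  fixes \<nu> :: "('k::finite, 'a::finite) config measure"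
  shows "limitin Pcomp \<mu> \<nu> F \<longleftrightarrow> \<nu> \<in> Prob config_top \<and> (\<forall>\<^sub>F n in F. \<mu> n \<in> Prob config_top) \<and>
    ((\<lambda>n. dprob (\<mu> n) \<nu>) \<longlongrightarrow> 0) F"
  by (simp add: dprob.limitin_metric_dist_null flip: mtopology_dprob)

lemma compact_Pcomp: "compact_space (Pcomp :: ('k::finite, 'a::finite) config measure topology)"
  unfolding mtopology_dprob[symmetric] dprob.compact_space_sequentially
proof (intro allI impI)
  fix \<theta> :: "nat \<Rightarrow> ('k, 'a) config measure"
  assume "range \<theta> \<subseteq> Prob config_top"
  then have "\<theta> n \<in> Prob config.mtopology" for n by (auto simp: mtopology_config_dist)
  moreover have "compact_space (config.mtopology :: ('k, 'a) config topology)"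
    by (simp add: mtopology_config_dist compact_config_top)
  ultimately obtain r \<theta>' where "strict_mono (r :: nat \<Rightarrow> nat)"
    "limitin (weak_topology (config.mtopology :: ('k, 'a) config topology)) (\<theta> \<circ> r) \<theta>' sequentially"
    using Prob_sequentially_compact[OF Metric_space_config_dist] by metis
  then show "\<exists>l r. l \<in> Prob config_top \<and> strict_mono r \<and> limitin dprob.mtopology (\<theta> \<circ> r) l sequentially"
    unfolding mtopology_dprob mtopology_config_dist by (auto simp: limitin_weak_topology)
qed

text \<open>The same selection theorem one level up, with the compact metric space of laws in place
  of the space of configurations.\<close>

lemma Prob_Pcomp_sequentially_compact:
  fixes \<theta> :: "nat \<Rightarrow> ('k::finite, 'a::finite) config measure measure"
  assumes "\<And>n. \<theta> n \<in> Prob Pcomp"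
  obtains r \<theta>' where "strict_mono (r :: nat \<Rightarrow> nat)" "limitin (weak_topology Pcomp) (\<theta> \<circ> r) \<theta>' sequentially"
proof -
  have "compact_space (dprob.mtopology :: ('k, 'a) config measure topology)"
    by (simp add: mtopology_dprob compact_Pcomp)
  moreover have "\<theta> n \<in> Prob dprob.mtopology" for n using assms by (simp add: mtopology_dprob)
  ultimately show thesis
    using Prob_sequentially_compact[OF Metric_space_dprob] that unfolding mtopology_dprob by metis
qed

lemma compactin_Pcomp_sequence:
  fixes K :: "('k::finite, 'a::finite) config measure set"
  assumes "closedin Pcomp K" "\<And>n. \<mu> n \<in> K"
  obtains r \<nu> where "strict_mono (r :: nat \<Rightarrow> nat)" "\<nu> \<in> K" "limitin Pcomp (\<mu> \<circ> r) \<nu> sequentially"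
proof -
  have "compactin dprob.mtopology K"
    using closedin_compact_space[OF compact_Pcomp assms(1)] by (simp add: mtopology_dprob)
  moreover have "range \<mu> \<subseteq> K" using assms(2) by auto
  ultimately have "\<exists>l r. l \<in> K \<and> strict_mono r \<and> limitin dprob.mtopology (\<mu> \<circ> r) l sequentially"
    unfolding dprob.compactin_sequentially by blast
  then show thesis using that unfolding mtopology_dprob by blast
qed

lemma continuous_map_Pcomp_realI:
  fixes f :: "('k::finite, 'a::finite) config measure \<Rightarrow> real"
  assumes "\<And>\<mu> \<nu>. \<mu> \<in> Prob config_top \<Longrightarrow> \<nu> \<in> Prob config_top \<Longrightarrow> \<bar>f \<mu> - f \<nu>\<bar> \<le> dprob \<mu> \<nu>"
  shows "continuous_map Pcomp euclideanreal f"
  unfolding mtopology_dprob[symmetric]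
proof (rule continuous_map_realI)
  fix \<mu> :: "('k, 'a) config measure" and e :: real
  assume "\<mu> \<in> topspace dprob.mtopology" "e > 0"
  then have \<mu>: "\<mu> \<in> Prob config_top" "e > 0" by auto
  have "\<bar>f \<nu> - f \<mu>\<bar> < e" if "\<nu> \<in> dprob.mball \<mu> e" for \<nu>
    using that assms[of \<mu> \<nu>] by (auto simp: abs_minus_commute)
  then show "\<exists>U. openin dprob.mtopology U \<and> \<mu> \<in> U \<and> (\<forall>\<nu>\<in>U. \<bar>f \<nu> - f \<mu>\<bar> < e)"
    using \<mu> by (intro exI[of _ "dprob.mball \<mu> e"]) auto
qed

section \<open>Distance to a set of laws\<close>

definition set_dprob :: "('k::finite, 'a) config measure set \<Rightarrow> ('k, 'a) config measure \<Rightarrow> real" where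
  "set_dprob S \<mu> = (INF \<rho>\<in>S. dprob \<mu> \<rho>)"

context
  fixes S :: "('k::finite, 'a::finite) config measure set"
  assumes S: "S \<noteq> {}" "S \<subseteq> Prob config_top"
begin

lemma set_dprob_le: "\<rho> \<in> S \<Longrightarrow> set_dprob S \<mu> \<le> dprob \<mu> \<rho>"
  unfolding set_dprob_def by (rule cINF_lower) (auto intro!: bdd_belowI[of _ 0])

lemma set_dprob_nonneg: "0 \<le> set_dprob S \<mu>"
  unfolding set_dprob_def by (rule cINF_greatest) (use S in auto)

lemma set_dprob_zero: "\<rho> \<in> S \<Longrightarrow> set_dprob S \<rho> = 0"
  using set_dprob_le[of \<rho> \<rho>] set_dprob_nonneg[of \<rho>] S dprob.mdist_zero[of \<rho>] by fastforce

lemma set_dprob_le_4: "\<mu> \<in> Prob config_top \<Longrightarrow> set_dprob S \<mu> \<le> 4"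
proof -
  assume \<mu>: "\<mu> \<in> Prob config_top"
  obtain \<rho> where \<rho>: "\<rho> \<in> S" using S by auto
  show ?thesis using set_dprob_le[OF \<rho>, of \<mu>] dprob_le_4[OF \<mu>, of \<rho>] \<rho> S by auto
qed

lemma set_dprob_triangle:
  assumes "\<mu> \<in> Prob config_top" "\<nu> \<in> Prob config_top"
  shows "set_dprob S \<mu> \<le> dprob \<mu> \<nu> + set_dprob S \<nu>"
proof -
  have "set_dprob S \<mu> - dprob \<mu> \<nu> \<le> set_dprob S \<nu>"
    unfolding set_dprob_def[of S \<nu>]
  proof (rule cINF_greatest)
    fix \<rho> assume \<rho>: "\<rho> \<in> S"
    then have "dprob \<mu> \<rho> \<le> dprob \<mu> \<nu> + dprob \<nu> \<rho>" using assms S by (intro dprob.triangle) auto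
    then show "set_dprob S \<mu> - dprob \<mu> \<nu> \<le> dprob \<nu> \<rho>" using set_dprob_le[OF \<rho>, of \<mu>] by linarith
  qed (use S in simp)
  then show ?thesis by linarith
qed

lemma continuous_map_set_dprob: "continuous_map Pcomp euclideanreal (set_dprob S)"
proof (rule continuous_map_Pcomp_realI)
  fix \<mu> \<nu> :: "('k, 'a) config measure" assume P: "\<mu> \<in> Prob config_top" "\<nu> \<in> Prob config_top"
  show "\<bar>set_dprob S \<mu> - set_dprob S \<nu>\<bar> \<le> dprob \<mu> \<nu>"
    using set_dprob_triangle[OF P] set_dprob_triangle[OF P(2,1)] dprob.commute[of \<mu> \<nu>] by linarith
qed

lemma set_dprob_eq_0_closed:
  assumes "closedin Pcomp S" "\<mu> \<in> Prob config_top" "set_dprob S \<mu> = 0"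
  shows "\<mu> \<in> S"
proof (rule ccontr)
  assume "\<mu> \<notin> S"
  then have "\<mu> \<in> Prob config_top - S" "openin dprob.mtopology (Prob config_top - S)"
    using assms by (auto simp: closedin_def mtopology_dprob)
  then obtain r where r: "r > 0" "dprob.mball \<mu> r \<subseteq> Prob config_top - S"
    unfolding dprob.openin_mtopology by blast
  have "r \<le> set_dprob S \<mu>"
    unfolding set_dprob_def
  proof (rule cINF_greatest)
    fix \<rho> assume "\<rho> \<in> S"
    then show "r \<le> dprob \<mu> \<rho>" using r(2) S assms(2) by (force simp: not_le[symmetric])
  qed (use S in simp)
  then show False using assms r by simp
qed

end

section \<open>Barycentres\<close>

lemma measurable_measure_cyl:
  "finite F \<Longrightarrow> (\<lambda>\<nu> :: ('k::finite, 'a::finite) config measure. measure \<nu> (cyl F a)) \<in> borel_measurable (borel_of Pcomp)"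
  by (rule continuous_map_borel_measurable[OF continuous_map_measure_cyl])

text \<open>Evaluation at a cylinder is continuous, and cylinders form a generating pi-system, so
  evaluation at every Borel set is measurable. Viewing a law as a kernel at itself makes the
  barycentre an instance of the monadic bind.\<close>

lemma kernel_id:
  "(\<lambda>\<nu>. \<nu>) \<in> borel_of Pcomp \<rightarrow>\<^sub>M subprob_algebra (borel_of (config_top :: ('k::finite, 'a::finite) config topology))"
proof (rule measurable_subprob_algebra_generated[OF _ Int_stable_cyl])
  show "sets (borel_of (config_top :: ('k, 'a) config topology)) = sigma_sets UNIV (insert {} {cyl F a | F a. finite F})"
    by (simp add: sets_config_top sigma_sets_insert_empty)
  have em: "(\<lambda>\<nu> :: ('k, 'a) config measure. emeasure \<nu> A) \<in> borel_measurable (borel_of Pcomp)"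
    if "(\<lambda>\<nu> :: ('k, 'a) config measure. measure \<nu> A) \<in> borel_measurable (borel_of Pcomp)" for A
  proof -
    have "(\<lambda>\<nu> :: ('k, 'a) config measure. ennreal (measure \<nu> A)) \<in> borel_measurable (borel_of Pcomp)"
      using that by simp
    then show ?thesis
      by (rule measurable_cong[THEN iffD1, rotated])
        (simp add: finite_measure.emeasure_eq_measure[OF prob_space.finite_measure[OF Prob_config_D(1)], symmetric])
  qed
  show "(\<lambda>\<nu> :: ('k, 'a) config measure. emeasure \<nu> A) \<in> borel_measurable (borel_of Pcomp)"
    if "A \<in> insert {} {cyl F a | F a. finite F}" for A
    using that measurable_measure_cyl by (intro em) auto
  have "(UNIV :: ('k, 'a) config set) = cyl {} undefined" by (auto simp: cyl_def)
  then show "(\<lambda>\<nu> :: ('k, 'a) config measure. emeasure \<nu> UNIV) \<in> borel_measurable (borel_of Pcomp)"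
    using em[OF measurable_measure_cyl[of "{}" undefined]] by simp
qed (auto simp: Prob_config_D prob_space_imp_subprob_space)

definition bary :: "('k, 'a) config measure measure \<Rightarrow> ('k, 'a) config measure" where
  "bary \<theta> = \<theta> \<bind> (\<lambda>\<nu>. \<nu>)"

context
  fixes \<theta> :: "('k::finite, 'a::finite) config measure measure"
  assumes \<theta>: "\<theta> \<in> Prob Pcomp"
begin

interpretation prob_space \<theta> using Prob_D(1)[OF \<theta>] .

lemma kernel_id': "(\<lambda>\<nu>. \<nu>) \<in> \<theta> \<rightarrow>\<^sub>M subprob_algebra (borel_of config_top)"
  using kernel_id measurable_cong_sets[OF Prob_D(2)[OF \<theta>] refl] by blast

lemma space_Prob_Pcomp: "space \<theta> = Prob config_top"
  using Prob_D(3)[OF \<theta>] by simp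

lemma sets_bary: "sets (bary \<theta>) = sets (borel_of config_top)"
  unfolding bary_def by (rule sets_bind[OF sets_kernel[OF kernel_id'] not_empty])

lemma emeasure_bary:
  "B \<in> sets (borel_of config_top) \<Longrightarrow> emeasure (bary \<theta>) B = (\<integral>\<^sup>+ \<nu>. emeasure \<nu> B \<partial>\<theta>)"
  unfolding bary_def by (rule emeasure_bind[OF not_empty kernel_id'])

lemma bary_Prob: "bary \<theta> \<in> Prob config_top"
proof -
  have "prob_space (bary \<theta>)"
    unfolding bary_def by (rule prob_space_bind[OF _ kernel_id'])
      (auto intro!: AE_I2 simp: space_Prob_Pcomp Prob_config_D)
  then show ?thesis by (simp add: Prob_def sets_bary)
qed

text \<open>The integration rule for bind is available for nonnegative functions; adding the bound
  \<open>B\<close> reduces the real case to it.\<close>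

lemma integral_bary:
  fixes f :: "('k, 'a) config \<Rightarrow> real"
  assumes f [measurable]: "f \<in> borel_measurable (borel_of config_top)" and B: "\<And>x. \<bar>f x\<bar> \<le> B"
  shows "(\<integral>x. f x \<partial>bary \<theta>) = (\<integral>\<nu>. (\<integral>x. f x \<partial>\<nu>) \<partial>\<theta>)" "(\<lambda>\<nu>. \<integral>x. f x \<partial>\<nu>) \<in> borel_measurable \<theta>"
proof -
  have int: "integrable \<nu> f" if "\<nu> \<in> Prob config_top" for \<nu>
  proof -
    interpret \<nu>: prob_space \<nu> using Prob_config_D[OF that] by simp
    show ?thesis using B
      by (intro \<nu>.integrable_const_bound[of _ B]) (simp_all add: measurable_cong_sets[OF Prob_config_D(2)[OF that] refl])
  qed
  have nn: "(\<integral>\<^sup>+x. ennreal (f x + B) \<partial>\<nu>) = ennreal ((\<integral>x. f x \<partial>\<nu>) + B)" "0 \<le> (\<integral>x. f x \<partial>\<nu>) + B"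
    if "\<nu> \<in> Prob config_top" for \<nu>
  proof -
    interpret \<nu>: prob_space \<nu> using Prob_config_D[OF that] by simp
    have "\<bar>f x\<bar> \<le> B" for x by (rule B)
    then have pos: "0 \<le> f x + B" for x by (smt (verit, best))
    have "(\<integral>\<^sup>+x. ennreal (f x + B) \<partial>\<nu>) = ennreal (\<integral>x. f x + B \<partial>\<nu>)"
      using int[OF that] pos by (intro nn_integral_eq_integral) auto
    then show "(\<integral>\<^sup>+x. ennreal (f x + B) \<partial>\<nu>) = ennreal ((\<integral>x. f x \<partial>\<nu>) + B)"
      using int[OF that] by (simp add: \<nu>.prob_space)
    have "0 \<le> (\<integral>x. f x + B \<partial>\<nu>)" using pos by (intro integral_nonneg_AE) auto
    then show "0 \<le> (\<integral>x. f x \<partial>\<nu>) + B" using int[OF that] by (simp add: \<nu>.prob_space)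
  qed
  have m: "(\<lambda>\<nu>. \<integral>\<^sup>+x. ennreal (f x + B) \<partial>\<nu>) \<in> borel_measurable \<theta>"
    by (rule nn_integral_measurable_subprob_algebra2[OF _ kernel_id']) measurable
  have "(\<lambda>\<nu>. enn2real (\<integral>\<^sup>+x. ennreal (f x + B) \<partial>\<nu>) - B) \<in> borel_measurable \<theta>"
    using m by measurable
  then show meas: "(\<lambda>\<nu>. \<integral>x. f x \<partial>\<nu>) \<in> borel_measurable \<theta>"
    by (rule measurable_cong[THEN iffD1, rotated]) (simp add: space_Prob_Pcomp nn)
  have ib: "integrable \<theta> (\<lambda>\<nu>. \<integral>x. f x \<partial>\<nu>)"
  proof (rule integrable_const_bound[of _ B, OF AE_I2 meas])
    fix \<nu> assume "\<nu> \<in> space \<theta>"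
    then have \<nu>: "\<nu> \<in> Prob config_top" by (simp add: space_Prob_Pcomp)
    then interpret \<nu>: prob_space \<nu> by (rule Prob_config_D)
    have "\<bar>(\<integral>x. f x \<partial>\<nu>) - (\<integral>x. 0 \<partial>\<nu>)\<bar> \<le> B"
      by (rule integral_diff_bound) (use int[OF \<nu>] B \<nu>.prob_space_axioms in auto)
    then show "norm (\<integral>x. f x \<partial>\<nu>) \<le> B" by simp
  qed
  have "ennreal ((\<integral>x. f x \<partial>bary \<theta>) + B) = (\<integral>\<^sup>+x. ennreal (f x + B) \<partial>bary \<theta>)"
    by (rule nn(1)[OF bary_Prob, symmetric])
  also have "\<dots> = (\<integral>\<^sup>+\<nu>. \<integral>\<^sup>+x. ennreal (f x + B) \<partial>\<nu> \<partial>\<theta>)"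
    unfolding bary_def by (rule nn_integral_bind[OF _ kernel_id']) measurable
  also have "\<dots> = (\<integral>\<^sup>+\<nu>. ennreal ((\<integral>x. f x \<partial>\<nu>) + B) \<partial>\<theta>)"
    by (rule nn_integral_cong) (simp add: space_Prob_Pcomp nn)
  also have "\<dots> = ennreal (\<integral>\<nu>. (\<integral>x. f x \<partial>\<nu>) + B \<partial>\<theta>)"
    using ib nn(2) by (intro nn_integral_eq_integral) (auto simp: space_Prob_Pcomp)
  also have "(\<integral>\<nu>. (\<integral>x. f x \<partial>\<nu>) + B \<partial>\<theta>) = (\<integral>\<nu>. (\<integral>x. f x \<partial>\<nu>) \<partial>\<theta>) + B"
    using ib by (simp add: prob_space)
  finally have "(\<integral>x. f x \<partial>bary \<theta>) + B = (\<integral>\<nu>. (\<integral>x. f x \<partial>\<nu>) \<partial>\<theta>) + B"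
  proof (subst (asm) ennreal_inj)
    show "0 \<le> (\<integral>x. f x \<partial>bary \<theta>) + B" by (rule nn(2)[OF bary_Prob])
    have "0 \<le> (\<integral>\<nu>. (\<integral>x. f x \<partial>\<nu>) + B \<partial>\<theta>)"
      using nn(2) by (intro integral_nonneg_AE AE_I2) (simp add: space_Prob_Pcomp)
    then show "0 \<le> (\<integral>\<nu>. (\<integral>x. f x \<partial>\<nu>) \<partial>\<theta>) + B"
      using ib by (simp add: prob_space)
  qed
  then show "(\<integral>x. f x \<partial>bary \<theta>) = (\<integral>\<nu>. (\<integral>x. f x \<partial>\<nu>) \<partial>\<theta>)" by simp
qed

lemma measure_bary_cyl:
  assumes "finite F"
  shows "measure (bary \<theta>) (cyl F a) = (\<integral>\<nu>. measure \<nu> (cyl F a) \<partial>\<theta>)"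
proof -
  have "(\<integral>x. (indicator (cyl F a) x :: real) \<partial>bary \<theta>) = (\<integral>\<nu>. (\<integral>x. indicator (cyl F a) x \<partial>\<nu>) \<partial>\<theta>)"
    by (rule integral_bary(1)[where f = "indicator (cyl F a)" and B = 1])
      (use assms in \<open>auto intro!: borel_measurable_indicator\<close>)
  also have "\<dots> = (\<integral>\<nu>. measure \<nu> (cyl F a) \<partial>\<theta>)"
    by (rule Bochner_Integration.integral_cong) (auto simp: space_Prob_Pcomp Prob_config_D)
  finally show ?thesis by (simp add: Prob_config_D[OF bary_Prob])
qed

lemma mixture_ofI:
  assumes "AE \<nu> in \<theta>. \<nu> \<in> S" "\<mu> \<in> Prob config_top"
    and "\<And>F a. finite F \<Longrightarrow> measure \<mu> (cyl F a) = (\<integral>\<nu>. measure \<nu> (cyl F a) \<partial>\<theta>)"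
  shows "mixture_of config_top S \<mu>"
proof -
  have "\<mu> = bary \<theta>"
    by (rule Prob_config_eqI[OF assms(2) bary_Prob]) (simp add: assms(3) measure_bary_cyl)
  then show ?thesis
    unfolding mixture_of_def using assms \<theta> emeasure_bary by blast
qed

end

lemma mixture_ofD:
  fixes \<mu> :: "('k::finite, 'a::finite) config measure"
  assumes "mixture_of config_top S \<mu>"
  obtains \<theta> where "\<theta> \<in> Prob Pcomp" "AE \<nu> in \<theta>. \<nu> \<in> S" "\<mu> = bary \<theta>"
proof -
  obtain \<theta> where \<theta>: "\<theta> \<in> Prob Pcomp" "AE \<nu> in \<theta>. \<nu> \<in> S"
    "\<forall>B\<in>sets (borel_of config_top). emeasure \<mu> B = (\<integral>\<^sup>+ \<nu>. emeasure \<nu> B \<partial>\<theta>)" and \<mu>: "\<mu> \<in> Prob config_top"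
    using assms by (auto simp: mixture_of_def)
  have "\<mu> = bary \<theta>"
    by (rule measure_eqI) (simp_all add: sets_bary[OF \<theta>(1)] Prob_config_D[OF \<mu>] emeasure_bary[OF \<theta>(1)] \<theta>(3))
  then show thesis using \<theta> that by blast
qed

section \<open>Continuous maps of configurations\<close>

lemma continuous_map_config_into:
  fixes T :: "('k, 'a) config \<Rightarrow> ('l, 'b) config"
  assumes "\<And>i. \<exists>F. finite F \<and> (\<forall>x y. (\<forall>\<gamma>\<in>F. x \<gamma> = y \<gamma>) \<longrightarrow> T x i = T y i)"
  shows "continuous_map config_top config_top T"
proof -
  have "continuous_map config_top (product_topology (\<lambda>_. discrete_topology UNIV) UNIV) T"
    unfolding continuous_map_componentwise_UNIV
  proof
    fix i
    obtain F where "finite F" "\<forall>x y. (\<forall>\<gamma>\<in>F. x \<gamma> = y \<gamma>) \<longrightarrow> T x i = T y i" using assms by blast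
    then show "continuous_map config_top (discrete_topology UNIV) (\<lambda>x. T x i)"
      by (intro continuous_map_local) auto
  qed
  then show ?thesis unfolding config_top_def[symmetric] .
qed

lemma continuous_map_shift: "continuous_map config_top config_top (shift g)"
proof (rule continuous_map_config_into)
  show "\<exists>F. finite F \<and> (\<forall>x y. (\<forall>\<gamma>\<in>F. x \<gamma> = y \<gamma>) \<longrightarrow> shift g x i = shift g y i)" for i
    by (intro exI[of _ "{fg_mult i g}"]) (auto simp: shift_def)
qed

lemma continuous_map_config_apply: "continuous_map config_top config_top (\<lambda>x i. f (x i))"
proof (rule continuous_map_config_into)
  show "\<exists>F. finite F \<and> (\<forall>x y. (\<forall>\<gamma>\<in>F. x \<gamma> = y \<gamma>) \<longrightarrow> f (x i) = f (y i))" for i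
    by (intro exI[of _ "{i}"]) auto
qed

lemma Prob_measurable_distr:
  assumes "continuous_map X Y T" "\<mu> \<in> Prob X"
  shows "T \<in> \<mu> \<rightarrow>\<^sub>M borel_of Y"
  using continuous_map_measurable_borel_of[OF assms(1)] measurable_cong_sets[OF Prob_D(2)[OF assms(2)] refl]
  by blast

lemma distr_in_Prob:
  assumes "continuous_map X Y T" "\<mu> \<in> Prob X"
  shows "distr \<mu> (borel_of Y) T \<in> Prob Y"
  by (rule distr_Prob[OF Prob_D(1)[OF assms(2)] Prob_measurable_distr[OF assms]])

lemma continuous_map_distr:
  assumes "continuous_map X Y T"
  shows "continuous_map (weak_topology X) (weak_topology Y) (\<lambda>\<mu>. distr \<mu> (borel_of Y) T)"
  unfolding continuous_map_into_weak_topology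
proof (intro conjI ballI)
  show "(\<lambda>\<mu>. distr \<mu> (borel_of Y) T) \<in> topspace (weak_topology X) \<rightarrow> Prob Y"
    using distr_in_Prob[OF assms] by simp
  fix f :: "'b \<Rightarrow> real" assume f: "f \<in> bdd_continuous Y"
  have "T ` topspace X \<subseteq> topspace Y" using assms by (auto simp: continuous_map_def)
  then have "(f \<circ> T) ` topspace X \<subseteq> f ` topspace Y" by auto
  then have "f \<circ> T \<in> bdd_continuous X"
    using f continuous_map_compose[OF assms] bounded_subset unfolding bdd_continuous_def by blast
  then have "continuous_map (weak_topology X) euclideanreal (\<lambda>\<mu>. \<integral>x. (f \<circ> T) x \<partial>\<mu>)"
    by (rule continuous_map_integral)
  then show "continuous_map (weak_topology X) euclideanreal (\<lambda>\<mu>. \<integral>x. f x \<partial>distr \<mu> (borel_of Y) T)"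
    by (rule continuous_map_eq)
      (use f in \<open>auto simp: integral_distr[OF Prob_measurable_distr[OF assms]] bdd_continuous_def continuous_map_borel_measurable\<close>)
qed

text \<open>An intersection of closed conditions, one for each group element and cylinder, because
  cylinder probabilities determine a law and shifts act continuously on laws.\<close>

lemma closedin_Prob_inv: "closedin Pcomp (Prob_inv :: ('k::finite, 'a::finite) config measure set)"
proof -
  define I where "I = (UNIV :: 'k fgroup set) \<times> {p :: 'k fgroup set \<times> ('k, 'a) config. finite (fst p)}"
  define K where "K p = {\<mu> \<in> topspace Pcomp. measure (distr \<mu> (borel_of config_top) (shift (fst p))) (cyl (fst (snd p)) (snd (snd p)))
      - measure \<mu> (cyl (fst (snd p)) (snd (snd p))) \<in> {0}}" for p :: "'k fgroup \<times> 'k fgroup set \<times> ('k, 'a) config"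
  have cl: "closedin Pcomp (K p)" if "p \<in> I" for p
    unfolding K_def
  proof (rule closedin_continuous_map_preimage)
    have fin: "finite (fst (snd p))" using that by (auto simp: I_def)
    have "continuous_map Pcomp euclideanreal ((\<lambda>\<mu>. measure \<mu> (cyl (fst (snd p)) (snd (snd p)))) \<circ>
        (\<lambda>\<mu>. distr \<mu> (borel_of config_top) (shift (fst p))))"
      by (rule continuous_map_compose[OF continuous_map_distr[OF continuous_map_shift] continuous_map_measure_cyl[OF fin]])
    then show "continuous_map Pcomp euclideanreal (\<lambda>\<mu>. measure (distr \<mu> (borel_of config_top) (shift (fst p))) (cyl (fst (snd p)) (snd (snd p)))
      - measure \<mu> (cyl (fst (snd p)) (snd (snd p))))"
      unfolding comp_def by (rule continuous_map_diff) (rule continuous_map_measure_cyl[OF fin])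
  qed simp
  have "Prob_inv = (\<Inter>p\<in>I. K p)"
  proof (intro equalityI subsetI)
    fix \<mu> :: "('k, 'a) config measure" assume "\<mu> \<in> Prob_inv"
    then show "\<mu> \<in> (\<Inter>p\<in>I. K p)" by (auto simp: Prob_inv_def K_def)
  next
    fix \<mu> :: "('k, 'a) config measure" assume \<mu>: "\<mu> \<in> (\<Inter>p\<in>I. K p)"
    have *: "\<mu> \<in> Prob config_top \<and> measure (distr \<mu> (borel_of config_top) (shift g)) (cyl F a) = measure \<mu> (cyl F a)"
      if "finite F" for g F a
    proof -
      have "(g, F, a) \<in> I" using that by (simp add: I_def)
      then have "\<mu> \<in> K (g, F, a)" using \<mu> by blast
      then show ?thesis by (simp add: K_def)
    qed
    then have P: "\<mu> \<in> Prob config_top" using finite.emptyI by blast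
    have "distr \<mu> (borel_of config_top) (shift g) = \<mu>" for g
      by (rule Prob_config_eqI[OF distr_in_Prob[OF continuous_map_shift P] P]) (simp add: *)
    then show "\<mu> \<in> Prob_inv" using P by (simp add: Prob_inv_def)
  qed
  moreover have "I \<noteq> {}" by (auto simp: I_def)
  then have "closedin Pcomp (\<Inter>p\<in>I. K p)" using cl by (rule closedin_INT)
  ultimately show ?thesis by simp
qed

lemma Prob_inv_Prob: "\<mu> \<in> Prob_inv \<Longrightarrow> \<mu> \<in> Prob config_top"
  by (simp add: Prob_inv_def)

section \<open>Actions of the free group\<close>

lemma fg_mult_assoc: "fg_mult (fg_mult x y) z = fg_mult x (fg_mult y z)"
  using group.is_monoid[OF group_free_group] monoid.m_assoc[of free_group x y z] by simp

lemma fg_mult_one [simp]: "fg_mult fg_one x = x" "fg_mult x fg_one = x"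
  using group.is_monoid[OF group_free_group] monoid.l_one[of free_group x] monoid.r_one[of free_group x]
    by simp_all

definition fg_inv :: "'k fgroup \<Rightarrow> 'k fgroup" where
  "fg_inv x = inv\<^bsub>free_group\<^esub> x"

lemma fg_inv [simp]: "fg_mult (fg_inv x) x = fg_one" "fg_mult x (fg_inv x) = fg_one"
  using group.l_inv[OF group_free_group, of x] group.r_inv[OF group_free_group, of x]
  by (simp_all add: fg_inv_def)

lemma fg_inv_cancel [simp]: "fg_mult (fg_inv x) (fg_mult x y) = y" "fg_mult x (fg_mult (fg_inv x) y) = y"
  by (simp_all flip: fg_mult_assoc)

lemma fg_mult_left_cancel [simp]: "fg_mult x y = fg_mult x z \<longleftrightarrow> y = z"
  using fg_inv_cancel(1) by metis

lemma fg_mult_eq_one_iff: "fg_mult x y = fg_one \<longleftrightarrow> y = fg_inv x"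
  using fg_inv(2)[of x] fg_mult_left_cancel[of x y "fg_inv x"] by simp

lemma Rep_gen: "Rep_fgroup (gen k) = [(k, True)]"
  by (simp add: gen.rep_eq)

lemma gen_inject [simp]: "gen k = gen l \<longleftrightarrow> k = l"
  by (metis Rep_gen list.inject prod.inject)

lemma Rep_fg_inv_gen: "Rep_fgroup (fg_inv (gen k)) = [(k, False)]"
proof -
  have r: "Rep_fgroup (Abs_fgroup [(k, False)]) = [(k, False)]"
    by (rule Abs_fgroup_inverse) (simp add: reduced_def)
  have "fg_mult (gen k) (Abs_fgroup [(k, False)]) = fg_one"
    unfolding Rep_fgroup_inject[symmetric] fg_mult.rep_eq fg_one.rep_eq Rep_gen r
    by (simp add: cons_red_def inv_letter_def)
  then show ?thesis using r by (simp add: fg_mult_eq_one_iff)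
qed

lemma fg_inv_gen_inject [simp]: "fg_inv (gen k) = fg_inv (gen l) \<longleftrightarrow> k = l"
  by (metis Rep_fg_inv_gen list.inject prod.inject)

lemma gen_neq_fg_inv_gen [simp]: "gen k \<noteq> fg_inv (gen l)"
  by (metis Rep_fg_inv_gen Rep_gen list.inject prod.inject)

lemma fg_adj_one: "{\<gamma>. fg_adj \<gamma> fg_one} = range gen \<union> range (\<lambda>k. fg_inv (gen k))"
proof -
  have "fg_adj \<gamma> fg_one \<longleftrightarrow> (\<exists>k. \<gamma> = gen k) \<or> (\<exists>k. \<gamma> = fg_inv (gen k))" for \<gamma>
    unfolding fg_adj_def using fg_mult_eq_one_iff[of "gen _" \<gamma>] by (auto simp: eq_commute[of fg_one])
  then show ?thesis by auto
qed

lemma finite_fg_adj: "finite {\<gamma> :: 'k::finite fgroup. fg_adj \<gamma> fg_one}"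
  by (simp add: fg_adj_one)

lemma Hom_Bij: "\<sigma> \<in> Hom V \<Longrightarrow> \<sigma> g \<in> Bij V"
  by (auto simp: Hom_def hom_def BijGroup_def)

lemma Hom_bij_betw: "\<sigma> \<in> Hom V \<Longrightarrow> bij_betw (\<sigma> g) V V"
  using Hom_Bij[of \<sigma> V g] by (simp add: Bij_def)

lemma Hom_in [simp]: "\<sigma> \<in> Hom V \<Longrightarrow> v \<in> V \<Longrightarrow> \<sigma> g v \<in> V"
  using Hom_bij_betw[of \<sigma> V g] by (auto simp: bij_betw_def)

lemma Hom_mult: "\<sigma> \<in> Hom V \<Longrightarrow> v \<in> V \<Longrightarrow> \<sigma> (fg_mult g h) v = \<sigma> g (\<sigma> h v)"
proof -
  assume \<sigma>: "\<sigma> \<in> Hom V" and v: "v \<in> V"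
  have "\<sigma> (fg_mult g h) = \<sigma> g \<otimes>\<^bsub>BijGroup V\<^esub> \<sigma> h"
    using \<sigma> by (auto simp: Hom_def hom_def)
  also have "\<dots> = compose V (\<sigma> g) (\<sigma> h)" using Hom_Bij[OF \<sigma>] by (simp add: BijGroup_def)
  finally show ?thesis using v by (simp add: compose_def)
qed

lemma Hom_one: "\<sigma> \<in> Hom V \<Longrightarrow> v \<in> V \<Longrightarrow> \<sigma> fg_one v = v"
proof -
  assume \<sigma>: "\<sigma> \<in> Hom V" and v: "v \<in> V"
  have "\<sigma> fg_one (\<sigma> fg_one v) = \<sigma> fg_one v" using Hom_mult[OF \<sigma> v, of fg_one fg_one] by simp
  then show ?thesis
    using Hom_bij_betw[OF \<sigma>, of fg_one] Hom_in[OF \<sigma> v, of fg_one] v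
    unfolding bij_betw_def by (metis inj_onD)
qed

lemma Hom_inv: "\<sigma> \<in> Hom V \<Longrightarrow> v \<in> V \<Longrightarrow> \<sigma> (fg_inv g) (\<sigma> g v) = v" "\<sigma> \<in> Hom V \<Longrightarrow> v \<in> V \<Longrightarrow> \<sigma> g (\<sigma> (fg_inv g) v) = v"
  using Hom_mult[of \<sigma> V v "fg_inv g" g] Hom_mult[of \<sigma> V v g "fg_inv g"] Hom_one[of \<sigma> V v] by simp_all

lemma pullback_shift: "\<sigma> \<in> Hom V \<Longrightarrow> v \<in> V \<Longrightarrow> pullback \<sigma> (\<sigma> g v) x = shift g (pullback \<sigma> v x)"
  by (auto simp: pullback_def shift_def Hom_mult)

section \<open>Empirical measures\<close>

context
  fixes V :: "'v set"
  assumes V: "finite V" "V \<noteq> {}"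
begin

lemma prob_uniform_V: "prob_space (uniform_count_measure V)"
  by (rule prob_space_uniform_count_measure[OF V])

lemma measurable_uniform_V: "f \<in> uniform_count_measure V \<rightarrow>\<^sub>M N \<longleftrightarrow> f \<in> V \<rightarrow> space N"
  by (auto simp: measurable_def sets_uniform_count_measure space_uniform_count_measure)

lemma integral_uniform_V: "(\<integral>v. f v \<partial>uniform_count_measure V) = (\<Sum>v\<in>V. f v) / real (card V)"
  for f :: "'v \<Rightarrow> real"
  unfolding uniform_count_measure_def
  using V by (subst lebesgue_integral_point_measure_finite) (auto simp: sum_divide_distrib)

lemma empirical_Prob: "empirical V \<sigma> x \<in> Prob config_top"
  unfolding empirical_def by (rule distr_Prob[OF prob_uniform_V]) (simp add: measurable_uniform_V)

lemma integral_empirical: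
  fixes f :: "_ \<Rightarrow> real"
  assumes "f \<in> borel_measurable (borel_of config_top)"
  shows "(\<integral>y. f y \<partial>empirical V \<sigma> x) = (\<Sum>v\<in>V. f (pullback \<sigma> v x)) / real (card V)"
  unfolding empirical_def using assms
  by (subst integral_distr) (simp_all add: measurable_uniform_V integral_uniform_V)

lemma measure_empirical_cyl:
  fixes x :: "'v \<Rightarrow> 'a::finite" and \<sigma> :: "'k::finite fgroup \<Rightarrow> 'v \<Rightarrow> 'v"
  assumes "finite F"
  shows "measure (empirical V \<sigma> x) (cyl F a) = (\<Sum>v\<in>V. indicator (cyl F a) (pullback \<sigma> v x)) / real (card V)"
proof -
  have "(\<integral>y. (indicator (cyl F a) y :: real) \<partial>empirical V \<sigma> x) = (\<Sum>v\<in>V. indicator (cyl F a) (pullback \<sigma> v x)) / real (card V)"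
    using assms by (intro integral_empirical borel_measurable_indicator) simp
  then show ?thesis by (simp add: Prob_config_D[OF empirical_Prob])
qed

text \<open>Shifting the view from \<open>v\<close> by \<open>g\<close> gives the view from
  \<open>\<sigma> g v\<close>, and \<sigma> of \<open>g\<close> permutes the vertices, so the
  average over vertices does not change.\<close>

lemma empirical_Prob_inv:
  fixes x :: "'v \<Rightarrow> 'a::finite" and \<sigma> :: "'k::finite fgroup \<Rightarrow> 'v \<Rightarrow> 'v"
  assumes "\<sigma> \<in> Hom V"
  shows "empirical V \<sigma> x \<in> Prob_inv"
proof -
  have "distr (empirical V \<sigma> x) (borel_of config_top) (shift g) = empirical V \<sigma> x" for g
  proof (rule Prob_config_eqI[OF distr_in_Prob[OF continuous_map_shift empirical_Prob] empirical_Prob])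
    fix F :: "'k fgroup set" and a :: "('k, 'a) config" assume F: "finite F"
    let ?f = "\<lambda>y. indicator (cyl F a) y :: real"
    have m: "?f \<in> borel_measurable (borel_of config_top)" using F by (intro borel_measurable_indicator) simp
    have ms: "shift g \<in> borel_of config_top \<rightarrow>\<^sub>M borel_of (config_top :: ('k, 'a) config topology)"
      by (rule continuous_map_measurable_borel_of[OF continuous_map_shift])
    note P = distr_in_Prob[OF continuous_map_shift[of g] empirical_Prob[of \<sigma> x]]
    have "measure (distr (empirical V \<sigma> x) (borel_of config_top) (shift g)) (cyl F a)
        = (\<integral>y. ?f y \<partial>distr (empirical V \<sigma> x) (borel_of config_top) (shift g))"
      by (simp add: Prob_config_D[OF P])
    also have "\<dots> = (\<integral>y. ?f (shift g y) \<partial>empirical V \<sigma> x)"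
      by (rule integral_distr[OF Prob_measurable_distr[OF continuous_map_shift empirical_Prob] m])
    also have "\<dots> = (\<Sum>v\<in>V. ?f (shift g (pullback \<sigma> v x))) / real (card V)"
      by (rule integral_empirical) (rule measurable_compose[OF ms m])
    also have "(\<Sum>v\<in>V. ?f (shift g (pullback \<sigma> v x))) = (\<Sum>v\<in>V. ?f (pullback \<sigma> (\<sigma> g v) x))"
      by (rule sum.cong) (simp_all add: pullback_shift[OF assms])
    also have "\<dots> = (\<Sum>v\<in>V. ?f (pullback \<sigma> v x))"
      by (rule sum.reindex_bij_betw[OF Hom_bij_betw[OF assms]])
    finally show "measure (distr (empirical V \<sigma> x) (borel_of config_top) (shift g)) (cyl F a) = measure (empirical V \<sigma> x) (cyl F a)"
      by (simp add: measure_empirical_cyl[OF F])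
  qed
  then show ?thesis by (simp add: Prob_inv_def empirical_Prob)
qed

end

section \<open>Energies\<close>

lemma site_energy_local: "\<forall>\<gamma>\<in>insert fg_one {\<gamma>. fg_adj \<gamma> fg_one}. x \<gamma> = y \<gamma> \<Longrightarrow> site_energy h J x = site_energy h J y"
  unfolding site_energy_def by (auto intro!: sum.cong)

lemma site_energy_bdd_continuous:
  "(site_energy h J :: ('k::finite, 'a::finite) config \<Rightarrow> real) \<in> bdd_continuous config_top"
  by (rule bdd_continuous_local[of "insert fg_one {\<gamma>. fg_adj \<gamma> fg_one}", OF _ site_energy_local]) (simp_all add: finite_fg_adj)

lemma continuous_map_mean_energy:
  "continuous_map Pcomp euclideanreal (mean_energy h J :: ('k::finite, 'a::finite) config measure \<Rightarrow> real)"
  unfolding mean_energy_def[abs_def] by (rule continuous_map_integral[OF site_energy_bdd_continuous])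

lemma mean_energy_bounded:
  obtains B where "B > 0" "\<And>\<mu> :: ('k::finite, 'a::finite) config measure. \<mu> \<in> Prob config_top \<Longrightarrow> \<bar>mean_energy h J \<mu>\<bar> \<le> B"
proof -
  have "(mean_energy h J :: ('k, 'a) config measure \<Rightarrow> real) \<in> bdd_continuous Pcomp"
    by (rule compact_bdd_continuous[OF compact_Pcomp continuous_map_mean_energy])
  from bdd_continuous_bound[OF this] show thesis using that by auto
qed

text \<open>Each edge is seen from both ends with weight 1/2. The substitution along the bijection
  \<open>\<sigma> (gen k)\<close> together with the symmetry of J turns the inverse-generator half
  into the generator half.\<close>

lemma site_energy_sum:
  fixes x :: "'v \<Rightarrow> 'a" and \<sigma> :: "'k::finite fgroup \<Rightarrow> 'v \<Rightarrow> 'v"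
  assumes \<sigma>: "\<sigma> \<in> Hom V" and J: "\<forall>a b. J a b = J b a"
  shows "(\<Sum>v\<in>V. site_energy h J (pullback \<sigma> v x)) =
    (\<Sum>v\<in>V. h (x v)) + (\<Sum>v\<in>V. \<Sum>k\<in>UNIV. J (x v) (x (\<sigma> (gen k) v)))"
proof -
  have "(\<Sum>v\<in>V. site_energy h J (pullback \<sigma> v x)) = (\<Sum>v\<in>V. h (x v) + 1 / 2 *
    ((\<Sum>k\<in>UNIV. J (x v) (x (\<sigma> (gen k) v))) + (\<Sum>k\<in>UNIV. J (x v) (x (\<sigma> (fg_inv (gen k)) v)))))"
  proof (rule sum.cong)
    fix v assume v: "v \<in> V"
    have "(\<Sum>\<gamma> | fg_adj \<gamma> fg_one. J (x v) (x (\<sigma> \<gamma> v))) =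
      (\<Sum>\<gamma>\<in>range gen. J (x v) (x (\<sigma> \<gamma> v))) + (\<Sum>\<gamma>\<in>range (\<lambda>k. fg_inv (gen k)). J (x v) (x (\<sigma> \<gamma> v)))"
      unfolding fg_adj_one by (rule sum.union_disjoint) auto
    also have "(\<Sum>\<gamma>\<in>range gen. J (x v) (x (\<sigma> \<gamma> v))) = (\<Sum>k\<in>UNIV. J (x v) (x (\<sigma> (gen k) v)))"
      by (subst sum.reindex) (auto simp: inj_on_def)
    also have "(\<Sum>\<gamma>\<in>range (\<lambda>k. fg_inv (gen k)). J (x v) (x (\<sigma> \<gamma> v))) = (\<Sum>k\<in>UNIV. J (x v) (x (\<sigma> (fg_inv (gen k)) v)))"
      by (subst sum.reindex) (auto simp: inj_on_def)
    finally show "site_energy h J (pullback \<sigma> v x) = h (x v) + 1 / 2 *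
      ((\<Sum>k\<in>UNIV. J (x v) (x (\<sigma> (gen k) v))) + (\<Sum>k\<in>UNIV. J (x v) (x (\<sigma> (fg_inv (gen k)) v))))"
      using Hom_one[OF \<sigma> v] by (simp add: site_energy_def pullback_def)
  qed simp
  also have "\<dots> = (\<Sum>v\<in>V. h (x v)) + 1 / 2 * ((\<Sum>v\<in>V. \<Sum>k\<in>UNIV. J (x v) (x (\<sigma> (gen k) v)))
      + (\<Sum>v\<in>V. \<Sum>k\<in>UNIV. J (x v) (x (\<sigma> (fg_inv (gen k)) v))))"
    by (simp add: sum.distrib sum_divide_distrib[symmetric])
  also have "(\<Sum>v\<in>V. \<Sum>k\<in>UNIV. J (x v) (x (\<sigma> (fg_inv (gen k)) v))) = (\<Sum>v\<in>V. \<Sum>k\<in>UNIV. J (x v) (x (\<sigma> (gen k) v)))"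
  proof -
    have "(\<Sum>v\<in>V. J (x v) (x (\<sigma> (fg_inv (gen k)) v))) = (\<Sum>v\<in>V. J (x v) (x (\<sigma> (gen k) v)))" for k
    proof -
      have "(\<Sum>v\<in>V. J (x v) (x (\<sigma> (fg_inv (gen k)) v))) = (\<Sum>v\<in>V. J (x (\<sigma> (gen k) v)) (x (\<sigma> (fg_inv (gen k)) (\<sigma> (gen k) v))))"
        by (rule sum.reindex_bij_betw[OF Hom_bij_betw[OF \<sigma>], symmetric])
      also have "\<dots> = (\<Sum>v\<in>V. J (x v) (x (\<sigma> (gen k) v)))"
        using J by (intro sum.cong) (simp_all add: Hom_inv[OF \<sigma>])
      finally show ?thesis .
    qed
    then show ?thesis by (subst (1 2) sum.swap) simp
  qed
  finally show ?thesis by simp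
qed

text \<open>The weight of a labeling depends on its empirical measure alone. This links finitary
  Gibbs states to annealed entropy: counting labelings by empirical measure also counts their
  weight.\<close>

lemma finite_weight_eq:
  fixes x :: "'v \<Rightarrow> 'a::finite" and \<sigma> :: "'k::finite fgroup \<Rightarrow> 'v \<Rightarrow> 'v"
  assumes "finite V" "V \<noteq> {}"
  shows "finite_weight h J V \<sigma> x = exp (- (real (card V) * mean_energy h J (empirical V \<sigma> x)))"
proof -
  have "site_energy h J \<in> borel_measurable (borel_of (config_top :: ('k, 'a) config topology))"
    using site_energy_bdd_continuous[of h J]
      by (auto simp: bdd_continuous_def intro: continuous_map_borel_measurable)
  then show ?thesis
    using assms by (simp add: finite_weight_def mean_energy_def integral_empirical[OF assms])
qed

section \<open>Switchings\<close>

context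
  fixes V :: "'v set" and p :: "'k \<Rightarrow> 'v \<Rightarrow> 'v"
  assumes p: "\<And>k. p k \<in> Bij V"
begin

interpretation B: group "BijGroup V" by (rule group_BijGroup)

definition act_letter :: "'k \<times> bool \<Rightarrow> 'v \<Rightarrow> 'v" where
  "act_letter c = (if snd c then p (fst c) else inv\<^bsub>BijGroup V\<^esub> p (fst c))"

definition act_word :: "('k \<times> bool) list \<Rightarrow> 'v \<Rightarrow> 'v" where
  "act_word w = foldr (\<lambda>c f. act_letter c \<otimes>\<^bsub>BijGroup V\<^esub> f) w \<one>\<^bsub>BijGroup V\<^esub>"

lemma p_carrier: "p k \<in> carrier (BijGroup V)"
  using p by (simp add: BijGroup_def)

lemma act_letter_carrier: "act_letter c \<in> carrier (BijGroup V)"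
  by (simp add: act_letter_def p_carrier)

lemma act_word_carrier: "act_word w \<in> carrier (BijGroup V)"
  by (induction w) (auto simp: act_word_def act_letter_carrier)

lemma act_letter_inv: "f \<in> carrier (BijGroup V) \<Longrightarrow>
    act_letter c \<otimes>\<^bsub>BijGroup V\<^esub> (act_letter (inv_letter c) \<otimes>\<^bsub>BijGroup V\<^esub> f) = f"
  by (auto simp: act_letter_def inv_letter_def p_carrier B.m_assoc[symmetric])

lemma act_word_cons_red: "act_word (cons_red c w) = act_letter c \<otimes>\<^bsub>BijGroup V\<^esub> act_word w"
  using act_letter_inv[OF act_word_carrier, of c]
  by (auto simp: cons_red_def act_word_def split: list.split)

lemma act_word_mult: "act_word (foldr cons_red u v) = act_word u \<otimes>\<^bsub>BijGroup V\<^esub> act_word v"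
proof (induction u)
  case (Cons c u)
  have "act_word (c # u) = act_letter c \<otimes>\<^bsub>BijGroup V\<^esub> act_word u" by (simp add: act_word_def)
  then show ?case
    using Cons by (simp add: act_word_cons_red B.m_assoc act_letter_carrier act_word_carrier)
next
  case Nil
  have "act_word [] = \<one>\<^bsub>BijGroup V\<^esub>" by (simp add: act_word_def)
  then show ?case by (simp add: act_word_carrier)
qed

text \<open>Universal property of the free group: reduced words act letter by letter, and
  cancellation in \<open>cons_red\<close> matches the cancellation of a permutation with its
  inverse. It allows a homomorphism to be altered at a single generator.\<close>

lemma exists_Hom: "\<exists>\<sigma>\<in>Hom V. \<forall>k. \<sigma> (gen k) = p k"
proof
  show "(\<lambda>g. act_word (Rep_fgroup g)) \<in> Hom V"
    unfolding Hom_def hom_def by (auto simp: act_word_carrier fg_mult.rep_eq act_word_mult)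
  show "\<forall>k. act_word (Rep_fgroup (gen k)) = p k"
    by (simp add: Rep_gen act_word_def act_letter_def p_carrier)
qed

end

lemma bij_betw_comp_transpose:
  assumes "bij_betw f V V" "i \<in> V" "j \<in> V"
  shows "bij_betw (f \<circ> Transposition.transpose i j) V V"
  using assms by (intro bij_betw_trans[OF _ assms(1)]) (auto simp: bij_betw_transpose_iff)

text \<open>Precomposing a generator with the transposition of i and j, where j is the vertex sent
  to the value wanted at i, corrects i and spoils no vertex that was already right, so disagreements
  strictly decrease. Without connectedness the minimum in \<open>hom_dist\<close> would be a junk
  value.\<close>

lemma switching_connected:
  fixes \<sigma>1 \<sigma>2 :: "'k::finite fgroup \<Rightarrow> 'v \<Rightarrow> 'v"
  assumes V: "finite V" "V \<noteq> {}" and "\<sigma>1 \<in> Hom V" and \<sigma>2: "\<sigma>2 \<in> Hom V"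
  shows "\<exists>m. (\<sigma>1, \<sigma>2) \<in> switching V ^^ m"
  using assms(3)
proof (induction "card {(k, v). v \<in> V \<and> \<sigma>1 (gen k) v \<noteq> \<sigma>2 (gen k) v}" arbitrary: \<sigma>1 rule: less_induct)
  case less
  define D where "D \<sigma> = {(k, v). v \<in> V \<and> \<sigma> (gen k) v \<noteq> \<sigma>2 (gen k) v}" for \<sigma>
  have fin: "finite (D \<sigma>)" for \<sigma>
    by (rule finite_subset[of _ "UNIV \<times> V"]) (auto simp: D_def V)
  show ?case
  proof (cases "D \<sigma>1 = {}")
    case True
    then have eq: "\<sigma>1 (gen k) v = \<sigma>2 (gen k) v" if "v \<in> V" for k v using that by (auto simp: D_def)
    \<comment> \<open>A switching with i = j leaves the generators as they are; taking this one step
      spares a proof that agreement on generators implies equality.\<close>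
    obtain i where "i \<in> V" using V by auto
    then have "(\<sigma>1, \<sigma>2) \<in> switching V"
      unfolding switching_def using less.prems \<sigma>2 eq by auto
    then show ?thesis by (intro exI[of _ 1]) simp
  next
    case False
    then obtain k i where i: "i \<in> V" "\<sigma>1 (gen k) i \<noteq> \<sigma>2 (gen k) i" by (auto simp: D_def)
    have "\<sigma>2 (gen k) i \<in> \<sigma>1 (gen k) ` V"
      using Hom_in[OF \<sigma>2 i(1)] Hom_bij_betw[OF less.prems] by (auto simp: bij_betw_def)
    then obtain j where j: "j \<in> V" "\<sigma>1 (gen k) j = \<sigma>2 (gen k) i" by auto
    then have ij: "i \<noteq> j" using i by auto
    define q where "q l = (if l = k then restrict (\<sigma>1 (gen k) \<circ> Transposition.transpose i j) V else \<sigma>1 (gen l))"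
      for l
    have "q l \<in> Bij V" for l
      using bij_betw_comp_transpose[OF Hom_bij_betw[OF less.prems] i(1) j(1)] Hom_Bij[OF less.prems]
      by (auto simp: q_def Bij_def)
    then obtain \<sigma>' where \<sigma>': "\<sigma>' \<in> Hom V" "\<And>l. \<sigma>' (gen l) = q l" using exists_Hom[of q V] by blast
    have sw: "(\<sigma>1, \<sigma>') \<in> switching V"
    proof -
      have "\<sigma>1 (gen k) i = \<sigma>' (gen k) j" "\<sigma>1 (gen k) j = \<sigma>' (gen k) i"
        "\<forall>l. \<forall>v\<in>V. \<not> (l = k \<and> v \<in> {i, j}) \<longrightarrow> \<sigma>1 (gen l) v = \<sigma>' (gen l) v"
        using i(1) j(1) by (auto simp: \<sigma>' q_def Transposition.transpose_def)
      then show ?thesis unfolding switching_def using less.prems \<sigma>'(1) i(1) j(1) by blast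
    qed
    have "D \<sigma>' \<subset> D \<sigma>1"
    proof
      show "D \<sigma>' \<subseteq> D \<sigma>1"
      proof
        fix x assume "x \<in> D \<sigma>'"
        then obtain l v where x: "x = (l, v)" "v \<in> V" "q l v \<noteq> \<sigma>2 (gen l) v" by (auto simp: D_def \<sigma>')
        have "inj_on (\<sigma>2 (gen k)) V" using Hom_bij_betw[OF \<sigma>2] by (auto simp: bij_betw_def)
        \<comment> \<open>Injectivity shows that j was a disagreement too:
          \<open>\<sigma>1 (gen k) j\<close> is the target value at i, hence not the one at j.
          Changing the value at j therefore creates no new disagreement.\<close>
        then have "\<sigma>2 (gen k) i \<noteq> \<sigma>2 (gen k) j" using ij i j by (auto dest: inj_onD)
        then show "x \<in> D \<sigma>1"
          using x i j by (auto simp: D_def q_def Transposition.transpose_def split: if_splits)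
      qed
      have "(k, i) \<in> D \<sigma>1" "(k, i) \<notin> D \<sigma>'"
        using i j by (auto simp: D_def \<sigma>' q_def Transposition.transpose_def)
      then show "D \<sigma>' \<noteq> D \<sigma>1" by blast
    qed
    then have "card (D \<sigma>') < card (D \<sigma>1)" by (rule psubset_card_mono[OF fin])
    then obtain m where "(\<sigma>', \<sigma>2) \<in> switching V ^^ m"
      using less.hyps[of \<sigma>'] \<sigma>'(1) by (auto simp: D_def)
    then show ?thesis using sw relpow_Suc_I2 by metis
  qed
qed

definition partition_function :: "('a::finite \<Rightarrow> real) \<Rightarrow> ('a \<Rightarrow> 'a \<Rightarrow> real) \<Rightarrow> 'v set \<Rightarrow>
    ('k fgroup \<Rightarrow> 'v \<Rightarrow> 'v) \<Rightarrow> real" where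
  "partition_function h J V \<sigma> = (\<Sum>x\<in>labelings V. finite_weight h J V \<sigma> x)"

lemma finite_weight_pos [simp]: "0 < finite_weight h J V \<sigma> x"
  by (simp add: finite_weight_def)

lemma labelings_nonempty [simp]: "(labelings V :: ('v \<Rightarrow> 'a) set) \<noteq> {}"
  by (simp add: PiE_eq_empty_iff)

lemma partition_function_pos: "finite V \<Longrightarrow> 0 < partition_function h J V \<sigma>"
  unfolding partition_function_def by (rule sum_pos) auto

text \<open>Only the edges labelled k out of i and j are affected, each changing the energy by at
  most 2M.\<close>

lemma switching_energy:
  fixes \<sigma>1 \<sigma>2 :: "'k::finite fgroup \<Rightarrow> 'v \<Rightarrow> 'v" and x :: "'v \<Rightarrow> 'a"
  assumes V: "finite V" and sw: "(\<sigma>1, \<sigma>2) \<in> switching V"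
    and J: "\<forall>a b. J a b = J b a" and M: "\<forall>a b. \<bar>J a b\<bar> \<le> M"
  shows "\<bar>(\<Sum>v\<in>V. site_energy h J (pullback \<sigma>1 v x)) - (\<Sum>v\<in>V. site_energy h J (pullback \<sigma>2 v x))\<bar> \<le> 4 * M"
proof -
  have \<sigma>: "\<sigma>1 \<in> Hom V" "\<sigma>2 \<in> Hom V" using sw by (auto simp: switching_def)
  obtain i j k where ij: "i \<in> V" "j \<in> V"
    and same: "\<forall>l. \<forall>v\<in>V. \<not> (l = k \<and> v \<in> {i, j}) \<longrightarrow> \<sigma>1 (gen l) v = \<sigma>2 (gen l) v"
    using sw unfolding switching_def by blast
  define d where "d q = J (x (fst q)) (x (\<sigma>1 (gen (snd q)) (fst q))) - J (x (fst q)) (x (\<sigma>2 (gen (snd q)) (fst q)))"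
    for q :: "'v \<times> 'k"
  have dM: "\<bar>d q\<bar> \<le> 2 * M" for q
    using M[rule_format, of "x (fst q)" "x (\<sigma>1 (gen (snd q)) (fst q))"] M[rule_format, of "x (fst q)" "x (\<sigma>2 (gen (snd q)) (fst q))"]
    unfolding d_def by linarith
  have "0 \<le> M" using M[rule_format, of undefined undefined] by linarith
  have "(\<Sum>v\<in>V. site_energy h J (pullback \<sigma>1 v x)) - (\<Sum>v\<in>V. site_energy h J (pullback \<sigma>2 v x))
      = (\<Sum>q\<in>V \<times> UNIV. d q)"
    unfolding site_energy_sum[OF \<sigma>(1) J] site_energy_sum[OF \<sigma>(2) J] d_def
    by (simp add: sum_subtractf sum.cartesian_product case_prod_unfold)
  also have "\<dots> = (\<Sum>q\<in>{(i, k), (j, k)}. d q)"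
  proof (rule sum.mono_neutral_right)
    show "\<forall>q\<in>V \<times> UNIV - {(i, k), (j, k)}. d q = 0"
    proof
      fix q assume q: "q \<in> V \<times> UNIV - {(i, k), (j, k)}"
      then have "\<sigma>1 (gen (snd q)) (fst q) = \<sigma>2 (gen (snd q)) (fst q)"
        by (intro same[rule_format]) (auto simp: prod_eq_iff)
      then show "d q = 0" by (simp add: d_def)
    qed
  qed (use V ij in auto)
  also have "\<bar>\<dots>\<bar> \<le> (\<Sum>q\<in>{(i, k), (j, k)}. 2 * M)"
    by (intro order.trans[OF sum_abs] sum_mono dM)
  also have "\<dots> \<le> 4 * M"
    using \<open>0 \<le> M\<close> card_insert_le_m1[of 2 "{(j, k)}" "(i, k)"] by (simp add: card_insert_if)
  finally show ?thesis .
qed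

text \<open>Bounded energy change makes the two weights comparable within a factor exp (4M),
  labeling by labeling, and the comparison survives summation.\<close>

lemma switching_ln_partition_function:
  fixes \<sigma>1 \<sigma>2 :: "'k::finite fgroup \<Rightarrow> 'v \<Rightarrow> 'v" and J :: "'a::finite \<Rightarrow> 'a \<Rightarrow> real"
  assumes V: "finite V" and sw: "(\<sigma>1, \<sigma>2) \<in> switching V"
    and J: "\<forall>a b. J a b = J b a" and M: "\<forall>a b. \<bar>J a b\<bar> \<le> M"
  shows "\<bar>ln (partition_function h J V \<sigma>1) - ln (partition_function h J V \<sigma>2)\<bar> \<le> 4 * M"
proof -
  have w: "finite_weight h J V \<sigma>1 x \<le> exp (4 * M) * finite_weight h J V \<sigma>2 x"
    "finite_weight h J V \<sigma>2 x \<le> exp (4 * M) * finite_weight h J V \<sigma>1 x" for x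
    using switching_energy[OF assms, of h x] unfolding finite_weight_def mult_exp_exp by auto
  have "partition_function h J V \<sigma>1 \<le> exp (4 * M) * partition_function h J V \<sigma>2"
    "partition_function h J V \<sigma>2 \<le> exp (4 * M) * partition_function h J V \<sigma>1"
    unfolding partition_function_def sum_distrib_left by (intro sum_mono w)+
  then show ?thesis
    using ln_mono[OF _ partition_function_pos[OF V, of h J \<sigma>1], of "exp (4 * M) * partition_function h J V \<sigma>2"]
      ln_mono[OF _ partition_function_pos[OF V, of h J \<sigma>2], of "exp (4 * M) * partition_function h J V \<sigma>1"]
      partition_function_pos[OF V, of h J \<sigma>1] partition_function_pos[OF V, of h J \<sigma>2]
    by (simp add: ln_mult)
qed

lemma relpow_switching_ln_partition_function:
  fixes \<sigma>1 \<sigma>2 :: "'k::finite fgroup \<Rightarrow> 'v \<Rightarrow> 'v" and J :: "'a::finite \<Rightarrow> 'a \<Rightarrow> real"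
  assumes V: "finite V" and J: "\<forall>a b. J a b = J b a" and M: "\<forall>a b. \<bar>J a b\<bar> \<le> M"
  shows "(\<sigma>1, \<sigma>2) \<in> switching V ^^ m \<Longrightarrow>
    \<bar>ln (partition_function h J V \<sigma>1) - ln (partition_function h J V \<sigma>2)\<bar> \<le> 4 * M * real m"
proof (induction m arbitrary: \<sigma>2)
  case (Suc m)
  then obtain \<sigma>' where "(\<sigma>1, \<sigma>') \<in> switching V ^^ m" and sw: "(\<sigma>', \<sigma>2) \<in> switching V" by auto
  then show ?case
    using Suc.IH[of \<sigma>'] switching_ln_partition_function[OF V sw J M, of h] by (simp add: algebra_simps)
qed simp

text \<open>Division by 4M normalises the free energy per vertex to a 1-Lipschitz function, the form
  in which exponential concentration is assumed.\<close>

lemma ln_partition_function_Lip1: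
  fixes V :: "'v set" and J :: "'a::finite \<Rightarrow> 'a \<Rightarrow> real"
  assumes V: "finite V" "V \<noteq> {}" and J: "\<forall>a b. J a b = J b a" and M: "\<forall>a b. \<bar>J a b\<bar> \<le> M" "0 < M"
  shows "(\<lambda>\<sigma> :: 'k::finite fgroup \<Rightarrow> 'v \<Rightarrow> 'v. ln (partition_function h J V \<sigma>) / real (card V) / (4 * M))
    \<in> Lip1 (Hom V) (hom_dist V)"
  unfolding Lip1_def
proof (intro CollectI ballI)
  fix \<sigma>1 \<sigma>2 :: "'k fgroup \<Rightarrow> 'v \<Rightarrow> 'v" assume \<sigma>: "\<sigma>1 \<in> Hom V" "\<sigma>2 \<in> Hom V"
  define m where "m = (LEAST m. (\<sigma>1, \<sigma>2) \<in> switching V ^^ m)"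
  have "(\<sigma>1, \<sigma>2) \<in> switching V ^^ m"
    unfolding m_def by (rule LeastI_ex[OF switching_connected[OF V \<sigma>]])
  then have "\<bar>ln (partition_function h J V \<sigma>1) - ln (partition_function h J V \<sigma>2)\<bar> \<le> 4 * M * real m"
    by (rule relpow_switching_ln_partition_function[OF V(1) J M(1)])
  then have "\<bar>ln (partition_function h J V \<sigma>1) - ln (partition_function h J V \<sigma>2)\<bar> / (real (card V) * (4 * M)) \<le> real m / real (card V)"
    using M(2) V by (simp add: field_simps card_gt_0_iff)
  moreover have "hom_dist V \<sigma>1 \<sigma>2 = real m / real (card V)" by (simp add: hom_dist_def m_def)
  ultimately show "\<bar>ln (partition_function h J V \<sigma>1) / real (card V) / (4 * M)
      - ln (partition_function h J V \<sigma>2) / real (card V) / (4 * M)\<bar> \<le> hom_dist V \<sigma>1 \<sigma>2"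
    using M(2) V by (simp add: abs_mult diff_divide_distrib[symmetric])
qed

section \<open>Finitary Gibbs states\<close>

context
  fixes V :: "'v set" and h :: "'a::finite \<Rightarrow> real" and J :: "'a \<Rightarrow> 'a \<Rightarrow> real"
    and \<sigma> :: "'k::finite fgroup \<Rightarrow> 'v \<Rightarrow> 'v"
  assumes V: "finite V" "V \<noteq> {}"
begin

lemma space_finite_gibbs [simp]: "space (finite_gibbs h J V \<sigma>) = labelings V"
  by (simp add: finite_gibbs_def space_point_measure)

lemma measurable_finite_gibbs: "f \<in> finite_gibbs h J V \<sigma> \<rightarrow>\<^sub>M N \<longleftrightarrow> f \<in> labelings V \<rightarrow> space N"
  unfolding finite_gibbs_def by simp

lemma integral_finite_gibbs:
  fixes f :: "_ \<Rightarrow> real"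
  shows "(\<integral>x. f x \<partial>finite_gibbs h J V \<sigma>) = (\<Sum>x\<in>labelings V. finite_weight h J V \<sigma> x * f x) / partition_function h J V \<sigma>"
proof -
  have "(\<integral>x. f x \<partial>finite_gibbs h J V \<sigma>) = (\<Sum>x\<in>labelings V. finite_weight h J V \<sigma> x / partition_function h J V \<sigma> * f x)"
    unfolding finite_gibbs_def partition_function_def[symmetric]
    by (subst lebesgue_integral_point_measure_finite)
      (use partition_function_pos[OF V(1), of h J \<sigma>] V in \<open>auto simp: less_imp_le intro!: divide_nonneg_pos\<close>)
  then show ?thesis by (simp add: sum_divide_distrib)
qed

lemma prob_space_finite_gibbs: "prob_space (finite_gibbs h J V \<sigma>)"
  unfolding finite_gibbs_def partition_function_def[symmetric]
proof (rule prob_space_point_measure)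
  show "(\<Sum>x\<in>labelings V. ennreal (finite_weight h J V \<sigma> x / partition_function h J V \<sigma>)) = 1"
    using partition_function_pos[OF V(1), of h J \<sigma>]
    by (subst sum_ennreal) (auto simp: less_imp_le partition_function_def simp flip: sum_divide_distrib)
qed (use V in auto)

lemma integrable_finite_gibbs: "integrable (finite_gibbs h J V \<sigma>) (f :: _ \<Rightarrow> real)"
proof -
  interpret prob_space "finite_gibbs h J V \<sigma>" by (rule prob_space_finite_gibbs)
  show ?thesis
  proof (rule integrable_const_bound[of _ "Max ((\<lambda>x. \<bar>f x\<bar>) ` labelings V)"])
    show "f \<in> borel_measurable (finite_gibbs h J V \<sigma>)" by (simp add: measurable_finite_gibbs)
  qed (use V in auto)
qed

end

section \<open>Annealed entropy\<close>

text \<open>Compactness with a radius chosen separately at each centre, as needed when a bound near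
  each law holds only at a scale depending on that law.\<close>

lemma closedin_Pcomp_ball_cover:
  fixes K :: "('k::finite, 'a::finite) config measure set"
  assumes K: "closedin Pcomp K" and \<epsilon>: "\<forall>\<kappa>\<in>K. \<epsilon> \<kappa> > (0 :: real)"
  shows "\<exists>T. finite T \<and> T \<subseteq> K \<and> (\<forall>\<nu>\<in>K. \<exists>\<kappa>\<in>T. dprob \<kappa> \<nu> < \<epsilon> \<kappa>)"
proof -
  have "compactin dprob.mtopology K"
    using closedin_compact_space[OF compact_Pcomp K] by (simp add: mtopology_dprob)
  moreover have KP: "K \<subseteq> Prob config_top" using closedin_subset[OF K] by simp
  then have "K \<subseteq> \<Union>((\<lambda>\<kappa>. dprob.mball \<kappa> (\<epsilon> \<kappa>)) ` K)" using \<epsilon> by (auto intro!: bexI)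
  ultimately have "\<exists>C. finite C \<and> C \<subseteq> (\<lambda>\<kappa>. dprob.mball \<kappa> (\<epsilon> \<kappa>)) ` K \<and> K \<subseteq> \<Union>C"
    by (intro compactinD) auto
  then obtain C where C: "finite C" "C \<subseteq> (\<lambda>\<kappa>. dprob.mball \<kappa> (\<epsilon> \<kappa>)) ` K" "K \<subseteq> \<Union>C" by blast
  obtain T where T: "T \<subseteq> K" "finite T" "C = (\<lambda>\<kappa>. dprob.mball \<kappa> (\<epsilon> \<kappa>)) ` T"
    using finite_subset_image[OF C(1,2)] by blast
  have "\<exists>\<kappa>\<in>T. dprob \<kappa> \<nu> < \<epsilon> \<kappa>" if \<nu>: "\<nu> \<in> K" for \<nu>
  proof -
    obtain \<kappa> where "\<kappa> \<in> T" "\<nu> \<in> dprob.mball \<kappa> (\<epsilon> \<kappa>)" using C(3) T(3) \<nu> by blast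
    then show ?thesis by auto
  qed
  then show ?thesis using T(1,2) by blast
qed

lemma continuous_map_Pcomp_realD:
  fixes g :: "('k::finite, 'a::finite) config measure \<Rightarrow> real"
  assumes "continuous_map Pcomp euclideanreal g" "\<kappa> \<in> Prob config_top" "\<eta> > 0"
  obtains \<delta> where "\<delta> > 0" "\<And>\<nu>. \<nu> \<in> Prob config_top \<Longrightarrow> dprob \<kappa> \<nu> < \<delta> \<Longrightarrow> \<bar>g \<nu> - g \<kappa>\<bar> < \<eta>"
proof -
  have "openin Pcomp {\<nu> \<in> topspace Pcomp. g \<nu> \<in> ball (g \<kappa>) \<eta>}"
    by (rule openin_continuous_map_preimage[OF assms(1)]) simp
  then have "openin dprob.mtopology {\<nu> \<in> Prob config_top. g \<nu> \<in> ball (g \<kappa>) \<eta>}"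
    by (simp add: mtopology_dprob)
  moreover have "\<kappa> \<in> {\<nu> \<in> Prob config_top. g \<nu> \<in> ball (g \<kappa>) \<eta>}" using assms by simp
  ultimately obtain r where r: "r > 0" "dprob.mball \<kappa> r \<subseteq> {\<nu> \<in> Prob config_top. g \<nu> \<in> ball (g \<kappa>) \<eta>}"
    unfolding dprob.openin_mtopology by blast
  show thesis
  proof (rule that[OF r(1)])
    fix \<nu> :: "('k, 'a) config measure" assume "\<nu> \<in> Prob config_top" "dprob \<kappa> \<nu> < r"
    then have "\<nu> \<in> dprob.mball \<kappa> r" using assms(2) by simp
    then show "\<bar>g \<nu> - g \<kappa>\<bar> < \<eta>" using r(2) by (auto simp: dist_real_def)
  qed
qed

text \<open>Positive powers of one generator already have all word lengths.\<close>

lemma infinite_fgroup: "infinite (UNIV :: 'k fgroup set)"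
proof
  assume fin: "finite (UNIV :: 'k fgroup set)"
  fix k :: 'k
  have "n \<in> range (word_length :: 'k fgroup \<Rightarrow> nat)" for n
  proof -
    have "reduced (replicate n (k, True))"
      unfolding reduced_def by (induction n) (auto simp: successively_Cons inv_letter_def)
    then have "word_length (Abs_fgroup (replicate n (k, True))) = n"
      by (simp add: word_length.rep_eq Abs_fgroup_inverse)
    then show ?thesis by (metis rangeI)
  qed
  then have "range (word_length :: 'k fgroup \<Rightarrow> nat) = UNIV" by auto
  then show False using finite_imageI[OF fin, of word_length] by simp
qed

lemma ln_ext_less_iff: "N > 0 \<Longrightarrow> ereal (1 / N) * ln_ext p < ereal c \<Longrightarrow> p \<le> exp (c * N)"
proof (cases "p \<le> 0")
  case True
  then show ?thesis using order.trans[OF True] by (simp add: less_imp_le)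
next
  case False
  assume "N > 0" "ereal (1 / N) * ln_ext p < ereal c"
  then have "ln p < c * N" using False by (simp add: ln_ext_def field_simps)
  then have "exp (ln p) \<le> exp (c * N)" by simp
  then show ?thesis using False by simp
qed

lemma ln_ext_greater_iff: "N > 0 \<Longrightarrow> ereal c < ereal (1 / N) * ln_ext p \<Longrightarrow> exp (c * N) \<le> p"
proof (cases "p \<le> 0")
  case True
  assume "N > 0" "ereal c < ereal (1 / N) * ln_ext p"
  then show ?thesis using True by (simp add: ln_ext_def)
next
  case False
  assume "N > 0" "ereal c < ereal (1 / N) * ln_ext p"
  then have "c * N < ln p" using False by (simp add: ln_ext_def field_simps)
  then have "exp (c * N) \<le> exp (ln p)" by simp
  then show ?thesis using False by simp
qed

lemma sum_UNION_le_nonneg: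
  fixes f :: "'x \<Rightarrow> real"
  assumes "finite T" "\<And>t. t \<in> T \<Longrightarrow> finite (A t)" "\<And>x. 0 \<le> f x"
  shows "sum f (\<Union>t\<in>T. A t) \<le> (\<Sum>t\<in>T. sum f (A t))"
  using assms(1,2)
proof (induction T)
  case (insert t T)
  have "sum f (\<Union>t\<in>insert t T. A t) \<le> sum f (A t) + sum f (\<Union>t\<in>T. A t)"
    using insert assms(3) sum_nonneg[of "A t \<inter> (\<Union>t\<in>T. A t)" f]
    by (simp add: sum_Un)
  then show ?case using insert by fastforce
qed simp

section \<open>Exponential rates along a random sofic approximation\<close>

locale random_sofic =
  fixes V :: "nat \<Rightarrow> 'v set" and \<sigma> :: "nat \<Rightarrow> ('k::finite fgroup \<Rightarrow> 'v \<Rightarrow> 'v) pmf"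
  assumes random_sofic: "random_sofic_approx V \<sigma>"
begin

definition N :: "nat \<Rightarrow> real" where "N n = real (card (V n))"

lemma V: "finite (V n)" "V n \<noteq> {}" and set_pmf_Hom: "set_pmf (\<sigma> n) \<subseteq> Hom (V n)"
  using random_sofic by (auto simp: random_sofic_approx_def)

lemma N_pos: "N n > 0"
  using V[of n] by (simp add: N_def card_gt_0_iff)

lemma not_sofic_prob:
  assumes "finite F" "\<delta> > 0"
  shows "\<forall>\<^sub>F n in sequentially. measure_pmf.prob (\<sigma> n) {s. \<not> is_sofic (V n) F \<delta> s} \<le> exp (c * N n)"
proof -
  have "limsup (\<lambda>n. ereal (1 / N n) * ln_ext (measure_pmf.prob (\<sigma> n) {s. \<not> is_sofic (V n) F \<delta> s})) < ereal c"
    using random_sofic assms by (simp add: random_sofic_approx_def N_def)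
  from Limsup_lessD[OF this] show ?thesis
    by eventually_elim (rule ln_ext_less_iff[OF N_pos])
qed

text \<open>On at most m vertices no orbit map is injective on a set of m + 1 group elements, so
  every homomorphism fails soficity for that set. This failure would have probability 1, against a
  bound exp (- N) that is below 1.\<close>

lemma N_at_top: "filterlim N at_top sequentially"
  unfolding filterlim_at_top
proof
  fix Z :: real
  obtain m :: nat where m: "Z \<le> real m" using real_arch_simple by blast
  obtain F :: "'k fgroup set" where F: "finite F" "card F = Suc m"
    using infinite_arbitrarily_large[OF infinite_fgroup, of "Suc m"] by auto
  have "\<forall>\<^sub>F n in sequentially. measure_pmf.prob (\<sigma> n) {s. \<not> is_sofic (V n) F (1 / 2) s} \<le> exp (- 1 * N n)"
    using F(1) by (intro not_sofic_prob) auto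
  then show "\<forall>\<^sub>F n in sequentially. Z \<le> N n"
  proof eventually_elim
    case (elim n)
    show ?case
    proof (rule ccontr)
      assume "\<not> Z \<le> N n"
      then have lt: "card (V n) < Suc m" using m by (simp add: N_def)
      have "\<not> is_sofic (V n) F (1 / 2) s" if s: "s \<in> set_pmf (\<sigma> n)" for s
      proof -
        have sH: "s \<in> Hom (V n)" using s set_pmf_Hom by blast
        have "{v \<in> V n. \<forall>\<gamma>1\<in>F. \<forall>\<gamma>2\<in>F. \<gamma>1 \<noteq> \<gamma>2 \<longrightarrow> s \<gamma>1 v \<noteq> s \<gamma>2 v} = {}"
        proof (rule ccontr)
          assume "{v \<in> V n. \<forall>\<gamma>1\<in>F. \<forall>\<gamma>2\<in>F. \<gamma>1 \<noteq> \<gamma>2 \<longrightarrow> s \<gamma>1 v \<noteq> s \<gamma>2 v} \<noteq> {}"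
          then obtain v where "v \<in> {v \<in> V n. \<forall>\<gamma>1\<in>F. \<forall>\<gamma>2\<in>F. \<gamma>1 \<noteq> \<gamma>2 \<longrightarrow> s \<gamma>1 v \<noteq> s \<gamma>2 v}"
            by (meson equals0I)
          then have v: "v \<in> V n" "\<forall>\<gamma>1\<in>F. \<forall>\<gamma>2\<in>F. \<gamma>1 \<noteq> \<gamma>2 \<longrightarrow> s \<gamma>1 v \<noteq> s \<gamma>2 v" by simp_all
          then have "inj_on (\<lambda>\<gamma>. s \<gamma> v) F" by (auto simp: inj_on_def)
          moreover have "(\<lambda>\<gamma>. s \<gamma> v) ` F \<subseteq> V n" using Hom_in[OF sH v(1)] by auto
          ultimately have "card F \<le> card (V n)" using V(1) by (rule card_inj_on_le)
          then show False using F lt by simp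
        qed
        then show ?thesis unfolding is_sofic_def by (simp only: card.empty)
      qed
      then have "measure_pmf.prob (\<sigma> n) {s. \<not> is_sofic (V n) F (1 / 2) s} = 1"
        by (intro measure_pmf.prob_eq_1[THEN iffD2]) (auto simp: AE_measure_pmf_iff)
      moreover have "exp (- 1 * N n) < 1" using N_pos by simp
      ultimately show False using elim by simp
    qed
  qed
qed

lemma exp_N_tendsto: "d < 0 \<Longrightarrow> (\<lambda>n. exp (d * N n)) \<longlonglongrightarrow> 0"
proof -
  assume "d < 0"
  then have "filterlim (\<lambda>n. d * N n) at_bot sequentially"
    using filterlim_tendsto_neg_mult_at_bot[OF tendsto_const _ N_at_top] by blast
  then show ?thesis by (rule filterlim_compose[OF exp_at_bot])
qed

text \<open>A finite number of terms is invisible on the exponential scale once each rate is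
  strictly below \<open>c\<close>.\<close>

lemma sum_exp_le_exp:
  assumes "finite T" "\<And>t. t \<in> T \<Longrightarrow> d t < (c :: real)"
  shows "\<forall>\<^sub>F n in sequentially. (\<Sum>t\<in>T. exp (d t * N n)) \<le> exp (c * N n)"
proof -
  have "(\<lambda>n. \<Sum>t\<in>T. exp ((d t - c) * N n)) \<longlonglongrightarrow> (\<Sum>t\<in>T. 0)"
    by (intro tendsto_sum exp_N_tendsto) (use assms in simp)
  then have "\<forall>\<^sub>F n in sequentially. (\<Sum>t\<in>T. exp ((d t - c) * N n)) < 1"
    by (rule order_tendstoD) simp
  then show ?thesis
  proof eventually_elim
    case (elim n)
    have "(\<Sum>t\<in>T. exp (d t * N n)) = (\<Sum>t\<in>T. exp ((d t - c) * N n)) * exp (c * N n)"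
      unfolding sum_distrib_right mult_exp_exp by (simp add: left_diff_distrib)
    also have "\<dots> \<le> 1 * exp (c * N n)" using elim by (intro mult_right_mono) auto
    finally show ?case by simp
  qed
qed

section \<open>Expected numbers of good models\<close>

definition ecount :: "('k, 'b) config measure \<Rightarrow> real \<Rightarrow> nat \<Rightarrow> real" where
  "ecount \<mu> \<epsilon> n = measure_pmf.expectation (\<sigma> n) (\<lambda>s. real (card (good_models (V n) s \<mu> \<epsilon>)))"

lemma log_count_eq: "log_count V \<sigma> \<mu> \<epsilon> n = ereal (1 / N n) * ln_ext (ecount \<mu> \<epsilon> n)"
  by (simp add: log_count_def N_def ecount_def)

lemma good_models_eq:
  fixes \<mu> :: "('k, 'b::finite) config measure"
  shows "\<mu> \<in> Prob config_top \<Longrightarrow> good_models (V n) s \<mu> \<epsilon> = {x \<in> labelings (V n). dprob \<mu> (empirical (V n) s x) < \<epsilon>}"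
  unfolding good_models_def dprob.commute[of \<mu>] by (subst dprob_eq[OF empirical_Prob[OF V]]) auto

lemma finite_good_models: "finite (good_models (V n) s (\<mu> :: ('k, 'b::finite) config measure) \<epsilon>)"
  unfolding good_models_def using V(1)[of n] by simp

lemma card_good_models: "real (card (good_models (V n) s (\<mu> :: ('k, 'b::finite) config measure) \<epsilon>)) \<le> exp (ln (real CARD('b)) * N n)"
proof -
  have "card (good_models (V n) s \<mu> \<epsilon>) \<le> card (labelings (V n) :: ('v \<Rightarrow> 'b) set)"
    unfolding good_models_def using V(1)[of n] by (intro card_mono) auto
  also have "\<dots> = CARD('b) ^ card (V n)" using V(1)[of n] by (simp add: card_PiE)
  finally have "real (card (good_models (V n) s \<mu> \<epsilon>)) \<le> real (CARD('b) ^ card (V n))" by (rule of_nat_mono)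
  also have "\<dots> = exp (ln (real CARD('b)) * N n)"
    by (simp add: N_def exp_of_nat2_mult)
  finally show ?thesis .
qed

lemma integrable_pmf_bounded:
  assumes "\<And>s. \<bar>f s\<bar> \<le> B"
  shows "integrable (measure_pmf p) (f :: _ \<Rightarrow> real)"
  by (rule measure_pmf.integrable_const_bound[where B = B]) (use assms in auto)

lemma integrable_card_good_models:
  "integrable (measure_pmf (\<sigma> n)) (\<lambda>s. real (card (good_models (V n) s (\<mu> :: ('k, 'b::finite) config measure) \<epsilon>)))"
  by (rule integrable_pmf_bounded[of _ "exp (ln (real CARD('b)) * N n)"]) (simp add: card_good_models)

lemma ecount_le: "ecount (\<mu> :: ('k, 'b::finite) config measure) \<epsilon> n \<le> exp (ln (real CARD('b)) * N n)"
proof -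
  have "ecount \<mu> \<epsilon> n \<le> measure_pmf.expectation (\<sigma> n) (\<lambda>_. exp (ln (real CARD('b)) * N n))"
    unfolding ecount_def by (intro integral_mono integrable_card_good_models) (auto simp: card_good_models)
  then show ?thesis by simp
qed

lemma ecount_mono:
  fixes \<mu> \<nu> :: "('k, 'b::finite) config measure"
  assumes "\<mu> \<in> Prob config_top" "\<nu> \<in> Prob config_top" "dprob \<mu> \<nu> + \<epsilon>' \<le> \<epsilon>"
  shows "ecount \<nu> \<epsilon>' n \<le> ecount \<mu> \<epsilon> n"
  unfolding ecount_def
proof (intro integral_mono integrable_card_good_models of_nat_mono card_mono finite_good_models subsetI)
  fix s x assume "x \<in> good_models (V n) s \<nu> \<epsilon>'"
  then have x: "x \<in> labelings (V n)" "dprob \<nu> (empirical (V n) s x) < \<epsilon>'" using assms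
    by (auto simp: good_models_eq)
  have "dprob \<mu> (empirical (V n) s x) \<le> dprob \<mu> \<nu> + dprob \<nu> (empirical (V n) s x)"
    by (rule dprob.triangle[OF assms(1,2) empirical_Prob[OF V]])
  then show "x \<in> good_models (V n) s \<mu> \<epsilon>" using assms x by (simp add: good_models_eq)
qed

lemma ln_ext_mono: "p \<le> q \<Longrightarrow> ln_ext p \<le> ln_ext q"
  by (auto simp: ln_ext_def)

lemma log_count_mono:
  fixes \<mu> \<nu> :: "('k, 'b::finite) config measure"
  assumes "\<mu> \<in> Prob config_top" "\<nu> \<in> Prob config_top" "dprob \<mu> \<nu> + \<epsilon>' \<le> \<epsilon>"
  shows "log_count V \<sigma> \<nu> \<epsilon>' n \<le> log_count V \<sigma> \<mu> \<epsilon> n"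
  unfolding log_count_eq using N_pos[of n]
  by (intro ereal_mult_left_mono ln_ext_mono ecount_mono assms) auto

lemma h_ann_upper_le: "h_ann_upper V \<sigma> (\<mu> :: ('k, 'b::finite) config measure) \<le> ereal (ln (real CARD('b)))"
proof -
  have "log_count V \<sigma> \<mu> 1 n \<le> ereal (ln (real CARD('b)))" for n
  proof (rule ccontr)
    assume "\<not> log_count V \<sigma> \<mu> 1 n \<le> ereal (ln (real CARD('b)))"
    then obtain c where c: "ereal (ln (real CARD('b))) < ereal c" "ereal c < log_count V \<sigma> \<mu> 1 n"
      using ereal_dense2 by (metis linorder_not_le)
    then have "exp (c * N n) \<le> ecount \<mu> 1 n" unfolding log_count_eq by (intro ln_ext_greater_iff[OF N_pos])
    also have "\<dots> \<le> exp (ln (real CARD('b)) * N n)" by (rule ecount_le)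
    finally show False using c(1) N_pos[of n] by simp
  qed
  then have "limsup (log_count V \<sigma> \<mu> 1) \<le> ereal (ln (real CARD('b)))" by (intro Limsup_bounded) auto
  moreover have "h_ann_upper V \<sigma> \<mu> \<le> limsup (log_count V \<sigma> \<mu> 1)"
    unfolding h_ann_upper_def by (rule INF_lower) simp
  ultimately show ?thesis by (rule order.trans[rotated])
qed

lemma h_ann_upper_lessD:
  assumes "h_ann_upper V \<sigma> \<mu> < ereal c"
  obtains \<epsilon> where "\<epsilon> > 0" "limsup (log_count V \<sigma> \<mu> \<epsilon>) < ereal c"
  using assms that unfolding h_ann_upper_def INF_less_iff by auto

text \<open>The \<epsilon>/2-ball around a law within \<epsilon>/2 of \<mu> lies in the
  \<epsilon>-ball around \<mu>, so a count bound at \<mu> is inherited by all nearby laws.\<close>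

lemma h_ann_upper_usc:
  fixes \<mu> :: "('k, 'b::finite) config measure"
  assumes "\<mu> \<in> Prob config_top" "h_ann_upper V \<sigma> \<mu> < ereal c"
  obtains \<delta> where "\<delta> > 0" "\<And>\<nu>. \<nu> \<in> Prob config_top \<Longrightarrow> dprob \<mu> \<nu> < \<delta> \<Longrightarrow> h_ann_upper V \<sigma> \<nu> < ereal c"
proof -
  obtain \<epsilon> where \<epsilon>: "\<epsilon> > 0" "limsup (log_count V \<sigma> \<mu> \<epsilon>) < ereal c" using h_ann_upper_lessD[OF assms(2)]
    by blast
  show thesis
  proof (rule that[of "\<epsilon> / 2"])
    fix \<nu> :: "('k, 'b) config measure" assume \<nu>: "\<nu> \<in> Prob config_top" "dprob \<mu> \<nu> < \<epsilon> / 2"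
    have "h_ann_upper V \<sigma> \<nu> \<le> limsup (log_count V \<sigma> \<nu> (\<epsilon> / 2))"
      unfolding h_ann_upper_def using \<epsilon> by (intro INF_lower) simp
    also have "\<dots> \<le> limsup (log_count V \<sigma> \<mu> \<epsilon>)"
      using \<nu> by (intro Limsup_mono always_eventually allI log_count_mono[OF assms(1)]) auto
    finally show "h_ann_upper V \<sigma> \<nu> < ereal c" using \<epsilon>(2) by (rule order.strict_trans1)
  qed (use \<epsilon> in simp)
qed

lemma ecount_upper:
  assumes "h_ann_upper V \<sigma> \<mu> < ereal c"
  obtains \<epsilon> where "\<epsilon> > 0" "\<forall>\<^sub>F n in sequentially. ecount \<mu> \<epsilon> n \<le> exp (c * N n)"
proof -
  obtain \<epsilon> where \<epsilon>: "\<epsilon> > 0" "limsup (log_count V \<sigma> \<mu> \<epsilon>) < ereal c" using h_ann_upper_lessD[OF assms] by blast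
  have "\<forall>\<^sub>F n in sequentially. ecount \<mu> \<epsilon> n \<le> exp (c * N n)"
    using Limsup_lessD[OF \<epsilon>(2)] by eventually_elim (simp only: log_count_eq, rule ln_ext_less_iff[OF N_pos])
  then show thesis using that \<epsilon> by blast
qed

lemma ecount_lower:
  assumes "ereal c < h_ann_lower V \<sigma> \<mu>" "\<epsilon> > 0"
  shows "\<forall>\<^sub>F n in sequentially. exp (c * N n) \<le> ecount \<mu> \<epsilon> n"
proof -
  have "h_ann_lower V \<sigma> \<mu> \<le> liminf (log_count V \<sigma> \<mu> \<epsilon>)"
    unfolding h_ann_lower_def using assms(2) by (intro INF_lower) simp
  then have "ereal c < liminf (log_count V \<sigma> \<mu> \<epsilon>)" using assms(1) by (rule order.strict_trans2[rotated])
  from less_LiminfD[OF this] show ?thesis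
    by eventually_elim (simp only: log_count_eq, rule ln_ext_greater_iff[OF N_pos])
qed

text \<open>With \<open>g\<close> the negative mean energy this is a partition function restricted
  to empirical measures in \<open>S\<close>; with \<open>g = 0\<close> it is a plain count, the form
  needed for pairs of labelings.\<close>

definition wsum :: "nat \<Rightarrow> (('k, 'b) config measure \<Rightarrow> real) \<Rightarrow> ('k, 'b) config measure set \<Rightarrow>
    ('k fgroup \<Rightarrow> 'v \<Rightarrow> 'v) \<Rightarrow> real" where
  "wsum n g S s = (\<Sum>x | x \<in> labelings (V n) \<and> empirical (V n) s x \<in> S. exp (N n * g (empirical (V n) s x)))"

lemma wsum_nonneg: "0 \<le> wsum n g S s"
  by (simp add: wsum_def sum_nonneg)

lemma wsum_mono: "S \<subseteq> S' \<Longrightarrow> wsum n g S s \<le> wsum n (g :: ('k, 'b::finite) config measure \<Rightarrow> real) S' s"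
  unfolding wsum_def using V(1)[of n] by (intro sum_mono2) auto

lemma wsum_le:
  fixes g :: "('k, 'b::finite) config measure \<Rightarrow> real"
  assumes "\<mu> \<in> Prob config_top"
    and "\<And>\<nu>. \<nu> \<in> S \<Longrightarrow> \<nu> \<in> Prob config_top \<Longrightarrow> dprob \<mu> \<nu> < \<epsilon> \<and> g \<nu> \<le> c"
  shows "wsum n g S s \<le> exp (c * N n) * real (card (good_models (V n) s \<mu> \<epsilon>))"
proof -
  have fin: "finite {x \<in> labelings (V n). empirical (V n) s x \<in> S}" using V(1)[of n] by simp
  have "wsum n g S s \<le> (\<Sum>x | x \<in> labelings (V n) \<and> empirical (V n) s x \<in> S. exp (c * N n))"
    unfolding wsum_def
  proof (rule sum_mono)
    fix x assume "x \<in> {x \<in> labelings (V n). empirical (V n) s x \<in> S}"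
    then have "g (empirical (V n) s x) \<le> c" using assms(2) empirical_Prob[OF V] by blast
    then show "exp (N n * g (empirical (V n) s x)) \<le> exp (c * N n)"
      using N_pos[of n] by (simp add: mult.commute mult_right_mono)
  qed
  also have "\<dots> = exp (c * N n) * real (card {x \<in> labelings (V n). empirical (V n) s x \<in> S})" by simp
  also have "\<dots> \<le> exp (c * N n) * real (card (good_models (V n) s \<mu> \<epsilon>))"
  proof (intro mult_left_mono of_nat_mono card_mono finite_good_models subsetI)
    fix x assume "x \<in> {x \<in> labelings (V n). empirical (V n) s x \<in> S}"
    then show "x \<in> good_models (V n) s \<mu> \<epsilon>"
      unfolding good_models_eq[OF assms(1)] using assms(2) empirical_Prob[OF V] by blast
  qed simp
  finally show ?thesis .
qed

lemma wsum_bounded: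
  fixes g :: "('k, 'b::finite) config measure \<Rightarrow> real"
  assumes "continuous_map Pcomp euclideanreal g"
  obtains B where "\<And>s S. \<bar>wsum n g S s\<bar> \<le> B"
proof -
  have "g \<in> bdd_continuous Pcomp" by (rule compact_bdd_continuous[OF compact_Pcomp assms])
  then obtain c where c: "\<And>\<nu>. \<nu> \<in> Prob config_top \<Longrightarrow> \<bar>g \<nu>\<bar> \<le> c" by (rule bdd_continuous_bound) auto
  have "\<bar>wsum n g S s\<bar> \<le> (\<Sum>x\<in>(labelings (V n) :: ('v \<Rightarrow> 'b) set). exp (c * N n))" for s S
  proof -
    have "\<bar>wsum n g S s\<bar> = wsum n g S s" using wsum_nonneg[of n g S s] by simp
    also have "\<dots> \<le> wsum n g UNIV s" by (rule wsum_mono) simp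
    also have "\<dots> \<le> (\<Sum>x\<in>(labelings (V n) :: ('v \<Rightarrow> 'b) set). exp (c * N n))"
    proof -
      have "{x \<in> labelings (V n). empirical (V n) s x \<in> (UNIV :: ('k, 'b) config measure set)} = labelings (V n)" by simp
      then have "wsum n g UNIV s = (\<Sum>x\<in>labelings (V n). exp (N n * g (empirical (V n) s x)))"
        by (simp only: wsum_def)
      also have "\<dots> \<le> (\<Sum>x\<in>(labelings (V n) :: ('v \<Rightarrow> 'b) set). exp (c * N n))"
    proof (rule sum_mono)
      fix x :: "'v \<Rightarrow> 'b"
      have "g (empirical (V n) s x) \<le> c" using c[OF empirical_Prob[OF V], of n s x] by linarith
      then show "exp (N n * g (empirical (V n) s x)) \<le> exp (c * N n)"
        using N_pos[of n] by (simp add: mult.commute mult_right_mono)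
    qed
      finally show ?thesis .
    qed
    finally show ?thesis .
  qed
  then show thesis by (rule that)
qed

lemma integrable_wsum:
  fixes g :: "('k, 'b::finite) config measure \<Rightarrow> real"
  assumes "continuous_map Pcomp euclideanreal g"
  shows "integrable (measure_pmf (\<sigma> n)) (wsum n g S)"
proof -
  obtain B where "\<And>s S. \<bar>wsum n g S s\<bar> \<le> B" using wsum_bounded[OF assms] by blast
  then show ?thesis by (rule integrable_pmf_bounded)
qed

definition ewsum :: "nat \<Rightarrow> (('k, 'b) config measure \<Rightarrow> real) \<Rightarrow> ('k, 'b) config measure set \<Rightarrow> real" where
  "ewsum n g S = measure_pmf.expectation (\<sigma> n) (wsum n g S)"

text \<open>The upper bound in Laplace's principle: near each \<kappa> the expected count is
  governed by the entropy and \<open>g\<close> is almost constant; finitely many such neighbourhoods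
  cover the compact set \<open>K\<close>, and a finite sum does not raise the rate.\<close>

lemma ewsum_upper:
  fixes g :: "('k, 'b::finite) config measure \<Rightarrow> real"
  assumes g: "continuous_map Pcomp euclideanreal g" and K: "closedin Pcomp K"
    and c: "\<And>\<kappa>. \<kappa> \<in> K \<Longrightarrow> h_ann_upper V \<sigma> \<kappa> < ereal (c - g \<kappa>)"
  shows "\<forall>\<^sub>F n in sequentially. ewsum n g K \<le> exp (c * N n)"
proof -
  have KP: "\<kappa> \<in> Prob config_top" if "\<kappa> \<in> K" for \<kappa> using closedin_subset[OF K] that by auto
  have "\<exists>\<epsilon> d. \<epsilon> > 0 \<and> d < c \<and> (\<forall>\<^sub>F n in sequentially. ewsum n g {\<nu> \<in> K. dprob \<kappa> \<nu> < \<epsilon>} \<le> exp (d * N n))"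
    if \<kappa>: "\<kappa> \<in> K" for \<kappa>
  proof -
    obtain c' where c': "h_ann_upper V \<sigma> \<kappa> < ereal c'" "c' < c - g \<kappa>"
      using ereal_dense2[OF c[OF \<kappa>]] by auto
    \<comment> \<open>Half of the slack goes to the oscillation of \<open>g\<close>; the local
      exponent is then \<open>c - \<eta>\<close>, still strictly below \<open>c\<close>.\<close>
    define \<eta> where "\<eta> = (c - g \<kappa> - c') / 2"
    have \<eta>: "\<eta> > 0" using c' by (simp add: \<eta>_def)
    obtain \<epsilon>1 where \<epsilon>1: "\<epsilon>1 > 0" "\<forall>\<^sub>F n in sequentially. ecount \<kappa> \<epsilon>1 n \<le> exp (c' * N n)"
      using ecount_upper[OF c'(1)] by blast
    obtain \<epsilon>2 where \<epsilon>2: "\<epsilon>2 > 0" "\<And>\<nu>. \<nu> \<in> Prob config_top \<Longrightarrow> dprob \<kappa> \<nu> < \<epsilon>2 \<Longrightarrow> \<bar>g \<nu> - g \<kappa>\<bar> < \<eta>"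
      using continuous_map_Pcomp_realD[OF g KP[OF \<kappa>] \<eta>] by blast
    define \<epsilon> where "\<epsilon> = min \<epsilon>1 \<epsilon>2"
    have w: "wsum n g {\<nu> \<in> K. dprob \<kappa> \<nu> < \<epsilon>} s \<le> exp ((g \<kappa> + \<eta>) * N n) * real (card (good_models (V n) s \<kappa> \<epsilon>1))"
      for n s
    proof (rule wsum_le[OF KP[OF \<kappa>]])
      fix \<nu> assume "\<nu> \<in> {\<nu> \<in> K. dprob \<kappa> \<nu> < \<epsilon>}" "\<nu> \<in> Prob config_top"
      then show "dprob \<kappa> \<nu> < \<epsilon>1 \<and> g \<nu> \<le> g \<kappa> + \<eta>" using \<epsilon>2(2)[of \<nu>] by (auto simp: \<epsilon>_def)
    qed
    have "\<forall>\<^sub>F n in sequentially. ewsum n g {\<nu> \<in> K. dprob \<kappa> \<nu> < \<epsilon>} \<le> exp ((g \<kappa> + \<eta> + c') * N n)"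
      using \<epsilon>1(2)
    proof eventually_elim
      case (elim n)
      have "ewsum n g {\<nu> \<in> K. dprob \<kappa> \<nu> < \<epsilon>} \<le> measure_pmf.expectation (\<sigma> n)
          (\<lambda>s. exp ((g \<kappa> + \<eta>) * N n) * real (card (good_models (V n) s \<kappa> \<epsilon>1)))"
        unfolding ewsum_def
        by (intro integral_mono integrable_wsum g integrable_mult_right integrable_card_good_models w)
      also have "\<dots> = exp ((g \<kappa> + \<eta>) * N n) * ecount \<kappa> \<epsilon>1 n" by (simp add: ecount_def)
      also have "\<dots> \<le> exp ((g \<kappa> + \<eta>) * N n) * exp (c' * N n)" using elim by (intro mult_left_mono) auto
      also have "\<dots> = exp ((g \<kappa> + \<eta> + c') * N n)" by (simp add: mult_exp_exp algebra_simps)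
      finally show ?case .
    qed
    moreover have "g \<kappa> + \<eta> + c' < c" using c' by (simp add: \<eta>_def field_simps)
    moreover have "\<epsilon> > 0" using \<epsilon>1 \<epsilon>2 by (simp add: \<epsilon>_def)
    ultimately show ?thesis by blast
  qed
  then have "\<forall>\<kappa>\<in>K. \<exists>\<epsilon>. \<exists>d. \<epsilon> > 0 \<and> d < c \<and> (\<forall>\<^sub>F n in sequentially. ewsum n g {\<nu> \<in> K. dprob \<kappa> \<nu> < \<epsilon>} \<le> exp (d * N n))"
    by (rule ballI)
  from bchoice[OF this] obtain \<epsilon> where "\<forall>\<kappa>\<in>K. \<exists>d. \<epsilon> \<kappa> > 0 \<and> d < c \<and>
    (\<forall>\<^sub>F n in sequentially. ewsum n g {\<nu> \<in> K. dprob \<kappa> \<nu> < \<epsilon> \<kappa>} \<le> exp (d * N n))" ..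
  from bchoice[OF this] obtain d where "\<forall>\<kappa>\<in>K. \<epsilon> \<kappa> > 0 \<and> d \<kappa> < c \<and>
    (\<forall>\<^sub>F n in sequentially. ewsum n g {\<nu> \<in> K. dprob \<kappa> \<nu> < \<epsilon> \<kappa>} \<le> exp (d \<kappa> * N n))" ..
  then have \<epsilon>: "\<And>\<kappa>. \<kappa> \<in> K \<Longrightarrow> \<epsilon> \<kappa> > 0" and d: "\<And>\<kappa>. \<kappa> \<in> K \<Longrightarrow> d \<kappa> < c"
    and ev: "\<And>\<kappa>. \<kappa> \<in> K \<Longrightarrow> \<forall>\<^sub>F n in sequentially. ewsum n g {\<nu> \<in> K. dprob \<kappa> \<nu> < \<epsilon> \<kappa>} \<le> exp (d \<kappa> * N n)"
    by blast+
  from closedin_Pcomp_ball_cover[OF K, of \<epsilon>] \<epsilon>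
  obtain T where T: "finite T" "T \<subseteq> K" "\<forall>\<nu>\<in>K. \<exists>\<kappa>\<in>T. dprob \<kappa> \<nu> < \<epsilon> \<kappa>"
    by auto
  have le: "ewsum n g K \<le> (\<Sum>\<kappa>\<in>T. ewsum n g {\<nu> \<in> K. dprob \<kappa> \<nu> < \<epsilon> \<kappa>})" for n
  proof -
    have "wsum n g K s \<le> (\<Sum>\<kappa>\<in>T. wsum n g {\<nu> \<in> K. dprob \<kappa> \<nu> < \<epsilon> \<kappa>} s)" for s
    proof -
      have "{x \<in> labelings (V n). empirical (V n) s x \<in> K}
          = (\<Union>\<kappa>\<in>T. {x \<in> labelings (V n). empirical (V n) s x \<in> {\<nu> \<in> K. dprob \<kappa> \<nu> < \<epsilon> \<kappa>}})"
      proof (intro equalityI subsetI)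
        fix x assume x: "x \<in> {x \<in> labelings (V n). empirical (V n) s x \<in> K}"
        then obtain \<kappa> where "\<kappa> \<in> T" "dprob \<kappa> (empirical (V n) s x) < \<epsilon> \<kappa>" using T(3) by auto
        then show "x \<in> (\<Union>\<kappa>\<in>T. {x \<in> labelings (V n). empirical (V n) s x \<in> {\<nu> \<in> K. dprob \<kappa> \<nu> < \<epsilon> \<kappa>}})"
          using x by auto
      qed auto
      then have "wsum n g K s = (\<Sum>x\<in>(\<Union>\<kappa>\<in>T. {x \<in> labelings (V n). empirical (V n) s x \<in> {\<nu> \<in> K. dprob \<kappa> \<nu> < \<epsilon> \<kappa>}}).
          exp (N n * g (empirical (V n) s x)))"
        by (simp only: wsum_def)
      also have "\<dots> \<le> (\<Sum>\<kappa>\<in>T. wsum n g {\<nu> \<in> K. dprob \<kappa> \<nu> < \<epsilon> \<kappa>} s)"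
        unfolding wsum_def using V(1)[of n] by (intro sum_UNION_le_nonneg T(1)) auto
      finally show ?thesis .
    qed
    then have "ewsum n g K \<le> measure_pmf.expectation (\<sigma> n) (\<lambda>s. \<Sum>\<kappa>\<in>T. wsum n g {\<nu> \<in> K. dprob \<kappa> \<nu> < \<epsilon> \<kappa>} s)"
      unfolding ewsum_def by (intro integral_mono integrable_wsum g Bochner_Integration.integrable_sum) auto
    also have "\<dots> = (\<Sum>\<kappa>\<in>T. ewsum n g {\<nu> \<in> K. dprob \<kappa> \<nu> < \<epsilon> \<kappa>})"
      unfolding ewsum_def by (rule Bochner_Integration.integral_sum) (rule integrable_wsum[OF g])
    finally show ?thesis .
  qed
  have "\<forall>\<^sub>F n in sequentially. \<forall>\<kappa>\<in>T. ewsum n g {\<nu> \<in> K. dprob \<kappa> \<nu> < \<epsilon> \<kappa>} \<le> exp (d \<kappa> * N n)"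
    using T ev by (intro eventually_ball_finite) auto
  moreover have "\<forall>\<^sub>F n in sequentially. (\<Sum>\<kappa>\<in>T. exp (d \<kappa> * N n)) \<le> exp (c * N n)"
    using T d by (intro sum_exp_le_exp) auto
  ultimately show ?thesis
  proof eventually_elim
    case (elim n)
    have "ewsum n g K \<le> (\<Sum>\<kappa>\<in>T. exp (d \<kappa> * N n))"
      using elim by (intro order.trans[OF le] sum_mono) auto
    then show ?case using elim by simp
  qed
qed

text \<open>Each point has a neighbourhood with its own bound below \<open>S\<close>, and the
  maximum over a finite subcover is again below \<open>S\<close>. Upper semicontinuity is only
  required within \<open>K\<close>.\<close>

lemma usc_bound:
  fixes p :: "('k, 'b::finite) config measure \<Rightarrow> ereal"
  assumes K: "closedin Pcomp K" and "K \<noteq> {}"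
    and usc: "\<forall>\<kappa>\<in>K. \<forall>c. p \<kappa> < ereal c \<longrightarrow> (\<exists>\<delta>>0. \<forall>\<nu>\<in>K. dprob \<kappa> \<nu> < \<delta> \<longrightarrow> p \<nu> < ereal c)"
    and S: "\<forall>\<kappa>\<in>K. p \<kappa> < S"
  shows "\<exists>c. ereal c < S \<and> (\<forall>\<kappa>\<in>K. p \<kappa> < ereal c)"
proof -
  have "\<exists>c \<delta>. ereal c < S \<and> \<delta> > 0 \<and> (\<forall>\<nu>\<in>K. dprob \<kappa> \<nu> < \<delta> \<longrightarrow> p \<nu> < ereal c)" if \<kappa>: "\<kappa> \<in> K" for \<kappa>
  proof -
    obtain c where "p \<kappa> < ereal c" "ereal c < S" using ereal_dense2[OF S[rule_format, OF \<kappa>]] by blast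
    then show ?thesis using usc[rule_format, OF \<kappa>] by blast
  qed
  then have "\<forall>\<kappa>\<in>K. \<exists>c. \<exists>\<delta>. ereal c < S \<and> \<delta> > 0 \<and> (\<forall>\<nu>\<in>K. dprob \<kappa> \<nu> < \<delta> \<longrightarrow> p \<nu> < ereal c)" by (rule ballI)
  from bchoice[OF this] obtain c where
    "\<forall>\<kappa>\<in>K. \<exists>\<delta>. ereal (c \<kappa>) < S \<and> \<delta> > 0 \<and> (\<forall>\<nu>\<in>K. dprob \<kappa> \<nu> < \<delta> \<longrightarrow> p \<nu> < ereal (c \<kappa>))" ..
  from bchoice[OF this] obtain \<delta> where
    "\<forall>\<kappa>\<in>K. ereal (c \<kappa>) < S \<and> \<delta> \<kappa> > 0 \<and> (\<forall>\<nu>\<in>K. dprob \<kappa> \<nu> < \<delta> \<kappa> \<longrightarrow> p \<nu> < ereal (c \<kappa>))" ..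
  then have c: "\<And>\<kappa>. \<kappa> \<in> K \<Longrightarrow> ereal (c \<kappa>) < S" "\<And>\<kappa>. \<kappa> \<in> K \<Longrightarrow> \<delta> \<kappa> > 0"
    "\<And>\<kappa> \<nu>. \<kappa> \<in> K \<Longrightarrow> \<nu> \<in> K \<Longrightarrow> dprob \<kappa> \<nu> < \<delta> \<kappa> \<Longrightarrow> p \<nu> < ereal (c \<kappa>)" by auto
  from closedin_Pcomp_ball_cover[OF K, of \<delta>] c(2)
  obtain T where T: "finite T" "T \<subseteq> K" "\<forall>\<nu>\<in>K. \<exists>\<kappa>\<in>T. dprob \<kappa> \<nu> < \<delta> \<kappa>"
    by auto
  have "T \<noteq> {}" using T(3) \<open>K \<noteq> {}\<close> by blast
  then have "Max (c ` T) \<in> c ` T" using T(1) by (intro Max_in) auto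
  then have "ereal (Max (c ` T)) < S" using c(1) T(2) by auto
  moreover have "p \<nu> < ereal (Max (c ` T))" if \<nu>: "\<nu> \<in> K" for \<nu>
  proof -
    obtain \<kappa> where \<kappa>: "\<kappa> \<in> T" "dprob \<kappa> \<nu> < \<delta> \<kappa>" using T(3) \<nu> by blast
    then have "p \<nu> < ereal (c \<kappa>)" using c(3) \<nu> T(2) by blast
    also have "\<dots> \<le> ereal (Max (c ` T))" using T(1) \<kappa> by simp
    finally show ?thesis .
  qed
  ultimately show ?thesis by blast
qed

end

section \<open>Annealed equilibrium states\<close>

locale gibbs_sofic = random_sofic V \<sigma>
  for V :: "nat \<Rightarrow> 'v set" and \<sigma> :: "nat \<Rightarrow> ('k::finite fgroup \<Rightarrow> 'v \<Rightarrow> 'v) pmf" +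
  fixes h :: "'a::finite \<Rightarrow> real" and J :: "'a \<Rightarrow> 'a \<Rightarrow> real"
  assumes J_sym: "\<forall>a b. J a b = J b a"
    and ann: "\<forall>\<mu>\<in>(Prob_inv :: ('k, 'a) config measure set). h_ann_upper V \<sigma> \<mu> = h_ann_lower V \<sigma> \<mu>"
begin

abbreviation u :: "('k, 'a) config measure \<Rightarrow> real" where "u \<equiv> mean_energy h J"
abbreviation Z :: "nat \<Rightarrow> ('k fgroup \<Rightarrow> 'v \<Rightarrow> 'v) \<Rightarrow> real" where "Z n \<equiv> partition_function h J (V n)"

text \<open>Valued in the extended reals because the annealed entropy can be minus infinity; the
  energy is finite, so the difference is always meaningful.\<close>

definition press :: "('k, 'a) config measure \<Rightarrow> ereal" where
  "press \<mu> = h_ann_upper V \<sigma> \<mu> - ereal (u \<mu>)"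

lemma press_less_iff: "press \<mu> < ereal c \<longleftrightarrow> h_ann_upper V \<sigma> \<mu> < ereal (c + u \<mu>)"
  unfolding press_def by (cases "h_ann_upper V \<sigma> \<mu>") auto

lemma press_usc:
  assumes "\<mu> \<in> Prob config_top" "press \<mu> < ereal c"
  shows "\<exists>\<delta>>0. \<forall>\<nu>\<in>Prob config_top. dprob \<mu> \<nu> < \<delta> \<longrightarrow> press \<nu> < ereal c"
proof -
  obtain c' where c': "h_ann_upper V \<sigma> \<mu> < ereal c'" "c' < c + u \<mu>"
    using ereal_dense2[OF assms(2)[unfolded press_less_iff]] by auto
  obtain \<delta>1 where \<delta>1: "\<delta>1 > 0" "\<And>\<nu>. \<nu> \<in> Prob config_top \<Longrightarrow> dprob \<mu> \<nu> < \<delta>1 \<Longrightarrow> h_ann_upper V \<sigma> \<nu> < ereal c'"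
    using h_ann_upper_usc[OF assms(1) c'(1)] by blast
  have "c + u \<mu> - c' > 0" using c'(2) by simp
  then obtain \<delta>2 where \<delta>2: "\<delta>2 > 0" "\<And>\<nu>. \<nu> \<in> Prob config_top \<Longrightarrow> dprob \<mu> \<nu> < \<delta>2 \<Longrightarrow> \<bar>u \<nu> - u \<mu>\<bar> < c + u \<mu> - c'"
    using continuous_map_Pcomp_realD[OF continuous_map_mean_energy assms(1)] by blast
  show ?thesis
  proof (intro exI[of _ "min \<delta>1 \<delta>2"] conjI ballI impI)
    fix \<nu> :: "('k, 'a) config measure" assume \<nu>: "\<nu> \<in> Prob config_top" "dprob \<mu> \<nu> < min \<delta>1 \<delta>2"
    have "h_ann_upper V \<sigma> \<nu> < ereal c'" using \<delta>1(2) \<nu> by simp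
    also have "ereal c' \<le> ereal (c + u \<nu>)" using \<delta>2(2)[of \<nu>] \<nu> by simp
    finally show "press \<nu> < ereal c" by (simp add: press_less_iff)
  qed (use \<delta>1 \<delta>2 in simp)
qed

lemma press_usc_on:
  assumes "K \<subseteq> Prob config_top"
  shows "\<forall>\<kappa>\<in>K. \<forall>c. press \<kappa> < ereal c \<longrightarrow> (\<exists>\<delta>>0. \<forall>\<nu>\<in>K. dprob \<kappa> \<nu> < \<delta> \<longrightarrow> press \<nu> < ereal c)"
proof (intro ballI allI impI)
  fix \<kappa> c assume \<kappa>: "\<kappa> \<in> K" "press \<kappa> < ereal c"
  from press_usc[OF subsetD[OF assms \<kappa>(1)] \<kappa>(2)]
  obtain \<delta> where "\<delta> > 0" "\<forall>\<nu>\<in>Prob config_top. dprob \<kappa> \<nu> < \<delta> \<longrightarrow> press \<nu> < ereal c"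
    by (elim exE conjE)
  then show "\<exists>\<delta>>0. \<forall>\<nu>\<in>K. dprob \<kappa> \<nu> < \<delta> \<longrightarrow> press \<nu> < ereal c"
    using assms by (intro exI[of _ \<delta>]) auto
qed

lemma finite_weight_N: "finite_weight h J (V n) s x = exp (N n * - u (empirical (V n) s x))"
  by (simp add: finite_weight_eq[OF V] N_def)

lemma wsum_weight: "wsum n (\<lambda>\<nu>. - u \<nu>) S s = (\<Sum>x | x \<in> labelings (V n) \<and> empirical (V n) s x \<in> S. finite_weight h J (V n) s x)"
  by (simp add: wsum_def finite_weight_N)

lemma wsum_Prob_inv: "s \<in> Hom (V n) \<Longrightarrow> wsum n (\<lambda>\<nu>. - u \<nu>) Prob_inv s = Z n s"
  unfolding wsum_weight partition_function_def by (simp add: empirical_Prob_inv[OF V])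

lemma Z_eq_wsum_UNIV: "Z n = wsum n (\<lambda>\<nu>. - u \<nu>) UNIV"
  unfolding wsum_weight partition_function_def by simp

lemma cont_minus_u: "continuous_map Pcomp euclideanreal (\<lambda>\<nu>. - u \<nu>)"
  by (intro continuous_map_minus continuous_map_mean_energy)

lemma integrable_Z: "integrable (measure_pmf (\<sigma> n)) (Z n)"
  unfolding Z_eq_wsum_UNIV by (rule integrable_wsum[OF cont_minus_u])

definition EZ :: "nat \<Rightarrow> real" where "EZ n = measure_pmf.expectation (\<sigma> n) (Z n)"

lemma Z_pos: "Z n s > 0"
  by (rule partition_function_pos[OF V(1)])

lemma Prob_inv_nonempty: "(Prob_inv :: ('k, 'a) config measure set) \<noteq> {}"
proof -
  obtain s :: "'k fgroup \<Rightarrow> 'v \<Rightarrow> 'v" where "s \<in> Hom (V 0)" using set_pmf_Hom[of 0] set_pmf_not_empty[of "\<sigma> 0"]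
    by blast
  then show ?thesis using empirical_Prob_inv[OF V] by blast
qed

text \<open>Finite from above because there are only |A|^N labelings and the energy is bounded.
  Finite from below because a single labeling already contributes weight exp (- B N), which the
  first moment bound would otherwise forbid. Attained by upper semicontinuity on the compact set of
  invariant laws.\<close>

lemma exists_press_max:
  "\<exists>P. (\<exists>\<mu>\<in>Prob_inv. press \<mu> = ereal P) \<and> (\<forall>\<mu>\<in>Prob_inv. press \<mu> \<le> ereal P)"
proof -
  define S where "S = (SUP \<mu>\<in>Prob_inv. press \<mu>)"
  have le: "press \<mu> \<le> S" if "\<mu> \<in> Prob_inv" for \<mu> unfolding S_def using that by (rule SUP_upper)
  obtain B where B: "B > 0" "\<And>\<mu> :: ('k, 'a) config measure. \<mu> \<in> Prob config_top \<Longrightarrow> \<bar>u \<mu>\<bar> \<le> B"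
    using mean_energy_bounded[of h J] by blast
  have "S \<le> ereal (ln (real CARD('a)) + B)"
    unfolding S_def
  proof (rule SUP_least)
    fix \<mu> :: "('k, 'a) config measure" assume \<mu>: "\<mu> \<in> Prob_inv"
    show "press \<mu> \<le> ereal (ln (real CARD('a)) + B)"
      using h_ann_upper_le[of \<mu>] B(2)[OF Prob_inv_Prob[OF \<mu>]]
      unfolding press_def by (cases "h_ann_upper V \<sigma> \<mu>") auto
  qed
  moreover have "S \<noteq> -\<infinity>"
  proof
    assume "S = -\<infinity>"
    \<comment> \<open>One unit below the trivial lower bound - B, so that the two bounds on the same
      expectation contradict each other for every N.\<close>
    then have p: "press \<mu> < ereal (- B - 1)" if "\<mu> \<in> Prob_inv" for \<mu> using le[OF that] by auto
    have "\<forall>\<^sub>F n in sequentially. ewsum n (\<lambda>\<nu>. - u \<nu>) Prob_inv \<le> exp ((- B - 1) * N n)"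
      by (rule ewsum_upper[OF cont_minus_u closedin_Prob_inv]) (use p press_less_iff in simp)
    then obtain n where n: "ewsum n (\<lambda>\<nu>. - u \<nu>) Prob_inv \<le> exp ((- B - 1) * N n)"
      using eventually_happens'[OF sequentially_bot] by blast
    have "exp (- B * N n) \<le> wsum n (\<lambda>\<nu>. - u \<nu>) Prob_inv s" if s: "s \<in> set_pmf (\<sigma> n)" for s
    proof -
      have sH: "s \<in> Hom (V n)" using s set_pmf_Hom by blast
      obtain x where x: "x \<in> (labelings (V n) :: ('v \<Rightarrow> 'a) set)"
        using labelings_nonempty[of "V n", where 'a = 'a] by (metis ex_in_conv)
      have "exp (- B * N n) \<le> finite_weight h J (V n) s x"
        unfolding finite_weight_N using B(2)[OF empirical_Prob[OF V], of n s x] N_pos[of n]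
        by (simp add: mult.commute abs_le_iff)
      also have "\<dots> \<le> Z n s"
        unfolding partition_function_def using x V(1)[of n]
        by (intro member_le_sum) (auto simp: less_imp_le)
      finally show ?thesis by (simp add: wsum_Prob_inv[OF sH])
    qed
    then have "measure_pmf.expectation (\<sigma> n) (\<lambda>_. exp (- B * N n)) \<le> ewsum n (\<lambda>\<nu>. - u \<nu>) Prob_inv"
      unfolding ewsum_def
      by (intro integral_mono_AE integrable_wsum cont_minus_u) (auto simp: AE_measure_pmf_iff)
    moreover have "measure_pmf.expectation (\<sigma> n) (\<lambda>_. exp (- B * N n)) = exp (- B * N n)" by simp
    ultimately have "exp (- B * N n) \<le> exp ((- B - 1) * N n)" using n by linarith
    then show False using N_pos[of n] by (simp add: left_diff_distrib)
  qed
  ultimately obtain P where P: "S = ereal P" by (cases S) auto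
  have "\<exists>\<mu>\<in>Prob_inv. press \<mu> = S"
  proof (rule ccontr)
    assume "\<not> (\<exists>\<mu>\<in>Prob_inv. press \<mu> = S)"
    then have lt: "press \<kappa> < S" if "\<kappa> \<in> Prob_inv" for \<kappa> using le[OF that] that by (auto simp: order_less_le)
    have "(Prob_inv :: ('k, 'a) config measure set) \<subseteq> Prob config_top" using Prob_inv_Prob by blast
    then have "\<exists>c. ereal c < S \<and> (\<forall>\<kappa>\<in>Prob_inv. press \<kappa> < ereal c)"
      by (intro usc_bound closedin_Prob_inv Prob_inv_nonempty press_usc_on ballI lt)
    then obtain c where c: "ereal c < S" "\<forall>\<kappa>\<in>Prob_inv. press \<kappa> < ereal c" by (elim exE conjE)
    have "S \<le> ereal c" unfolding S_def using c(2) by (intro SUP_least less_imp_le) simp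
    then show False using c(1) by simp
  qed
  then show ?thesis using le P by (intro exI[of _ P]) auto
qed

definition Pmax :: real where
  "Pmax = (SOME P. (\<exists>\<mu>\<in>Prob_inv. press \<mu> = ereal P) \<and> (\<forall>\<mu>\<in>Prob_inv. press \<mu> \<le> ereal P))"

lemma Pmax: "\<exists>\<mu>\<in>Prob_inv. press \<mu> = ereal Pmax" "\<mu> \<in> Prob_inv \<Longrightarrow> press \<mu> \<le> ereal Pmax"
  using someI_ex[OF exists_press_max] unfolding Pmax_def by auto

section \<open>Equilibrium states and the laws far from them\<close>

definition EQ :: "('k, 'a) config measure set" where
  "EQ = {\<mu> \<in> Prob_inv. annealed_equilibrium V \<sigma> h J \<mu>}"

lemma EQ_eq: "EQ = {\<mu> \<in> Prob_inv. press \<mu> = ereal Pmax}"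
proof -
  have "annealed_equilibrium V \<sigma> h J \<mu> \<longleftrightarrow> press \<mu> = ereal Pmax" if "\<mu> \<in> Prob_inv" for \<mu>
    unfolding annealed_equilibrium_def press_def[symmetric]
    using Pmax(1) Pmax(2) that by (metis order_antisym)
  then show ?thesis by (auto simp: EQ_def)
qed

lemma EQ_nonempty: "EQ \<noteq> {}"
  using Pmax(1) by (auto simp: EQ_eq)

lemma EQ_Prob_inv: "EQ \<subseteq> Prob_inv"
  by (auto simp: EQ_def)

lemma EQ_Prob: "EQ \<subseteq> Prob config_top"
  using EQ_Prob_inv Prob_inv_Prob by blast

text \<open>Within the invariant laws, equilibrium is the complement of the strict sublevel set at
  the maximum, and strict sublevel sets of an upper semicontinuous function are open.\<close>

lemma closedin_EQ: "closedin Pcomp EQ"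
proof -
  have "openin dprob.mtopology {\<nu> \<in> Prob config_top. press \<nu> < ereal Pmax}"
    unfolding dprob.openin_mtopology
  proof (intro conjI allI impI)
    fix \<mu> assume "\<mu> \<in> {\<nu> \<in> Prob config_top. press \<nu> < ereal Pmax}"
    then obtain \<delta> where "\<delta> > 0" "\<forall>\<nu>\<in>Prob config_top. dprob \<mu> \<nu> < \<delta> \<longrightarrow> press \<nu> < ereal Pmax"
      using press_usc by blast
    then show "\<exists>r>0. dprob.mball \<mu> r \<subseteq> {\<nu> \<in> Prob config_top. press \<nu> < ereal Pmax}"
      by (intro exI[of _ \<delta>]) auto
  qed auto
  then have "closedin Pcomp (Prob_inv - {\<nu> \<in> Prob config_top. press \<nu> < ereal Pmax})"
    by (intro closedin_diff closedin_Prob_inv) (simp add: mtopology_dprob)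
  also have "Prob_inv - {\<nu> \<in> Prob config_top. press \<nu> < ereal Pmax} = EQ"
    using Pmax(2) Prob_inv_Prob by (auto simp: EQ_eq not_less intro: order_antisym)
  finally show ?thesis .
qed

text \<open>The distance is to all annealed equilibrium states, Gibbs or not: the counting estimates
  see only entropy and energy, and the Gibbs property is recovered separately in the limit.\<close>

definition phi :: "('k, 'a) config measure \<Rightarrow> real" where "phi = set_dprob EQ"

lemmas phi_nonneg = set_dprob_nonneg[OF EQ_nonempty EQ_Prob, folded phi_def]
  and phi_le_4 = set_dprob_le_4[OF EQ_nonempty EQ_Prob, folded phi_def]
  and continuous_map_phi = continuous_map_set_dprob[OF EQ_nonempty EQ_Prob, folded phi_def]
  and phi_eq_0 = set_dprob_eq_0_closed[OF EQ_nonempty EQ_Prob closedin_EQ, folded phi_def]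
  and phi_EQ = set_dprob_zero[OF EQ_nonempty EQ_Prob, folded phi_def]

definition far :: "real \<Rightarrow> ('k, 'a) config measure set" where
  "far \<eta> = {\<nu> \<in> Prob_inv. \<eta> \<le> phi \<nu>}"

text \<open>Being far is a closed condition that excludes every maximiser, so the pressure is
  bounded away from its maximum on the whole compact set.\<close>

lemma ewsum_far:
  assumes "\<eta> > 0"
  obtains c where "c < Pmax" "\<forall>\<^sub>F n in sequentially. ewsum n (\<lambda>\<nu>. - u \<nu>) (far \<eta>) \<le> exp (c * N n)"
proof -
  have "closedin Pcomp {\<nu> \<in> topspace Pcomp. phi \<nu> \<in> {\<eta>..}}"
    by (rule closedin_continuous_map_preimage[OF continuous_map_phi]) simp
  then have "closedin Pcomp (Prob_inv \<inter> {\<nu> \<in> topspace Pcomp. phi \<nu> \<in> {\<eta>..}})"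
    by (intro closedin_Int closedin_Prob_inv)
  also have "Prob_inv \<inter> {\<nu> \<in> topspace Pcomp. phi \<nu> \<in> {\<eta>..}} = far \<eta>"
    using Prob_inv_Prob by (auto simp: far_def)
  finally have cl: "closedin Pcomp (far \<eta>)" .
  have lt: "press \<kappa> < ereal Pmax" if "\<kappa> \<in> far \<eta>" for \<kappa>
  proof -
    have "\<kappa> \<in> Prob_inv" "\<kappa> \<notin> EQ" using that phi_EQ[of \<kappa>] assms by (auto simp: far_def)
    then show ?thesis using Pmax(2)[of \<kappa>] by (auto simp: EQ_eq order_less_le)
  qed
  have "\<exists>c<Pmax. \<forall>\<kappa>\<in>far \<eta>. press \<kappa> < ereal c"
  proof (cases "far \<eta> = {}")
    case True
    then show ?thesis by (intro exI[of _ "Pmax - 1"]) simp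
  next
    case False
    have "far \<eta> \<subseteq> Prob config_top" using Prob_inv_Prob by (auto simp: far_def)
    then have "\<exists>c. ereal c < ereal Pmax \<and> (\<forall>\<kappa>\<in>far \<eta>. press \<kappa> < ereal c)"
      by (intro usc_bound cl False press_usc_on ballI lt)
    then show ?thesis by simp
  qed
  then obtain c where c: "c < Pmax" "\<forall>\<kappa>\<in>far \<eta>. press \<kappa> < ereal c" by (elim exE conjE)
  have "\<forall>\<^sub>F n in sequentially. ewsum n (\<lambda>\<nu>. - u \<nu>) (far \<eta>) \<le> exp (c * N n)"
    by (rule ewsum_upper[OF cont_minus_u cl]) (use c(2) press_less_iff in simp)
  then show thesis using that c(1) by blast
qed

text \<open>The agreement of upper and lower annealed entropy enters here: it turns the maximality
  of the limsup version into a lower bound on counts for all large n.\<close>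

lemma EQ_entropy:
  assumes "\<mu> \<in> EQ"
  shows "h_ann_upper V \<sigma> \<mu> = ereal (Pmax + u \<mu>)" "h_ann_lower V \<sigma> \<mu> = ereal (Pmax + u \<mu>)"
proof -
  show "h_ann_upper V \<sigma> \<mu> = ereal (Pmax + u \<mu>)"
    using assms by (cases "h_ann_upper V \<sigma> \<mu>") (auto simp: EQ_eq press_def)
  then show "h_ann_lower V \<sigma> \<mu> = ereal (Pmax + u \<mu>)" using ann assms EQ_Prob_inv by auto
qed

lemma Z_ge_card:
  assumes "\<mu> \<in> Prob config_top" "\<And>\<nu>. \<nu> \<in> Prob config_top \<Longrightarrow> dprob \<mu> \<nu> < \<epsilon> \<Longrightarrow> u \<nu> \<le> c"
  shows "exp (- c * N n) * real (card (good_models (V n) s \<mu> \<epsilon>)) \<le> Z n s"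
proof -
  have "exp (- c * N n) * real (card (good_models (V n) s \<mu> \<epsilon>)) = (\<Sum>x\<in>good_models (V n) s \<mu> \<epsilon>. exp (- c * N n))"
    by simp
  also have "\<dots> \<le> (\<Sum>x\<in>good_models (V n) s \<mu> \<epsilon>. finite_weight h J (V n) s x)"
  proof (rule sum_mono)
    fix x assume "x \<in> good_models (V n) s \<mu> \<epsilon>"
    then have "u (empirical (V n) s x) \<le> c"
      using assms(2)[OF empirical_Prob[OF V]] by (simp add: good_models_eq[OF assms(1)])
    then show "exp (- c * N n) \<le> finite_weight h J (V n) s x"
      unfolding finite_weight_N using N_pos[of n] by (simp add: mult.commute)
  qed
  also have "\<dots> \<le> Z n s"
    unfolding partition_function_def using V(1)[of n]
    by (intro sum_mono2) (auto simp: good_models_def less_imp_le)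
  finally show ?thesis .
qed

text \<open>Good models of a single equilibrium state suffice, since their expected number times
  their common weight already has rate almost \<open>Pmax\<close>.\<close>

lemma EZ_lower:
  assumes "\<delta> > 0"
  shows "\<forall>\<^sub>F n in sequentially. exp ((Pmax - \<delta>) * N n) \<le> EZ n"
proof -
  obtain \<mu> where \<mu>: "\<mu> \<in> EQ" using EQ_nonempty by blast
  then have \<mu>P: "\<mu> \<in> Prob config_top" using EQ_Prob by blast
  obtain \<epsilon> where \<epsilon>: "\<epsilon> > 0" "\<And>\<nu>. \<nu> \<in> Prob config_top \<Longrightarrow> dprob \<mu> \<nu> < \<epsilon> \<Longrightarrow> \<bar>u \<nu> - u \<mu>\<bar> < \<delta> / 2"
    using continuous_map_Pcomp_realD[OF continuous_map_mean_energy \<mu>P, of "\<delta> / 2"] assms half_gt_zero by blast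
  have "ereal (Pmax + u \<mu> - \<delta> / 2) < h_ann_lower V \<sigma> \<mu>" using EQ_entropy[OF \<mu>] assms by simp
  from ecount_lower[OF this \<epsilon>(1)] show ?thesis
  proof eventually_elim
    case (elim n)
    have "exp ((Pmax - \<delta>) * N n) = exp (- (u \<mu> + \<delta> / 2) * N n) * exp ((Pmax + u \<mu> - \<delta> / 2) * N n)"
      by (simp add: mult_exp_exp algebra_simps)
    also have "\<dots> \<le> exp (- (u \<mu> + \<delta> / 2) * N n) * ecount \<mu> \<epsilon> n" using elim by (intro mult_left_mono) auto
    also have "\<dots> = measure_pmf.expectation (\<sigma> n) (\<lambda>s. exp (- (u \<mu> + \<delta> / 2) * N n) * real (card (good_models (V n) s \<mu> \<epsilon>)))"
      by (simp add: ecount_def)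
    also have "\<dots> \<le> EZ n"
      unfolding EZ_def
    proof (intro integral_mono integrable_Z integrable_mult_right integrable_card_good_models Z_ge_card[OF \<mu>P])
      fix \<nu> :: "('k, 'a) config measure" assume "\<nu> \<in> Prob config_top" "dprob \<mu> \<nu> < \<epsilon>"
      then show "u \<nu> \<le> u \<mu> + \<delta> / 2" using \<epsilon>(2)[of \<nu>] by linarith
    qed
    finally show ?case .
  qed
qed

section \<open>The second moment method\<close>

text \<open>Approximate self-joinings with tolerance \<epsilon>. A pair of good models has only
  approximately the right marginals, so exact self-joinings cannot be used at finite n.\<close>

definition joinings :: "('k, 'a) config measure \<Rightarrow> real \<Rightarrow> ('k, 'a \<times> 'a) config measure set" where
  "joinings \<mu> \<epsilon> = {\<kappa> \<in> Prob_inv. dprob \<mu> (distr \<kappa> (borel_of config_top) (\<lambda>z i. fst (z i))) \<le> \<epsilon> \<and>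
    dprob \<mu> (distr \<kappa> (borel_of config_top) (\<lambda>z i. snd (z i))) \<le> \<epsilon>}"

lemma continuous_map_dprob:
  fixes \<mu> :: "('k, 'a) config measure"
  assumes "\<mu> \<in> Prob config_top"
  shows "continuous_map Pcomp euclideanreal (dprob \<mu>)"
proof (rule continuous_map_Pcomp_realI)
  fix \<nu> \<nu>' :: "('k, 'a) config measure" assume P: "\<nu> \<in> Prob config_top" "\<nu>' \<in> Prob config_top"
  show "\<bar>dprob \<mu> \<nu> - dprob \<mu> \<nu>'\<bar> \<le> dprob \<nu> \<nu>'"
    using dprob.triangle[OF assms P] dprob.triangle[OF assms P(2,1)] dprob.commute[of \<nu> \<nu>'] by linarith
qed

lemma continuous_map_dprob_distr:
  fixes \<mu> :: "('k, 'a) config measure" and f :: "'a \<times> 'a \<Rightarrow> 'a"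
  assumes "\<mu> \<in> Prob config_top"
  shows "continuous_map Pcomp euclideanreal (\<lambda>\<kappa>. dprob \<mu> (distr \<kappa> (borel_of config_top) (\<lambda>z i. f (z i))))"
  using continuous_map_compose[OF continuous_map_distr[OF continuous_map_config_apply[of f]] continuous_map_dprob[OF assms]]
  by (simp add: comp_def)

lemma closedin_joinings:
  assumes "\<mu> \<in> Prob config_top"
  shows "closedin Pcomp (joinings \<mu> \<epsilon>)"
proof -
  have "closedin Pcomp {\<kappa> \<in> topspace Pcomp. dprob \<mu> (distr \<kappa> (borel_of config_top) (\<lambda>z i. f (z i))) \<in> {..\<epsilon>}}"
    for f :: "'a \<times> 'a \<Rightarrow> 'a"
    by (rule closedin_continuous_map_preimage[OF continuous_map_dprob_distr[OF assms]]) simp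
  then have "closedin Pcomp (Prob_inv \<inter> ({\<kappa> \<in> topspace Pcomp. dprob \<mu> (distr \<kappa> (borel_of config_top) (\<lambda>z i. fst (z i))) \<in> {..\<epsilon>}}
    \<inter> {\<kappa> \<in> topspace Pcomp. dprob \<mu> (distr \<kappa> (borel_of config_top) (\<lambda>z i. snd (z i))) \<in> {..\<epsilon>}}))"
    by (intro closedin_Int closedin_Prob_inv)
  also have "Prob_inv \<inter> ({\<kappa> \<in> topspace Pcomp. dprob \<mu> (distr \<kappa> (borel_of config_top) (\<lambda>z i. fst (z i))) \<in> {..\<epsilon>}}
    \<inter> {\<kappa> \<in> topspace Pcomp. dprob \<mu> (distr \<kappa> (borel_of config_top) (\<lambda>z i. snd (z i))) \<in> {..\<epsilon>}}) = joinings \<mu> \<epsilon>"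
    using Prob_inv_Prob by (auto simp: joinings_def)
  finally show ?thesis .
qed

text \<open>Approximate self-joinings with tolerance tending to 0 and entropy above the bound would
  accumulate at an exact self-joining, where upper semicontinuity contradicts the criterion. The
  price of approximation is the slack \<eta>.\<close>

lemma joinings_entropy:
  assumes \<mu>: "\<mu> \<in> EQ" and sm: "second_moment_criterion V \<sigma> \<mu>" and "\<eta> > 0"
  shows "\<exists>\<epsilon>>0. \<forall>\<kappa>\<in>joinings \<mu> \<epsilon>. h_ann_upper V \<sigma> \<kappa> < ereal (2 * (Pmax + u \<mu>) + \<eta>)"
proof (rule ccontr)
  have \<mu>P: "\<mu> \<in> Prob config_top" using \<mu> EQ_Prob by blast
  assume "\<not> (\<exists>\<epsilon>>0. \<forall>\<kappa>\<in>joinings \<mu> \<epsilon>. h_ann_upper V \<sigma> \<kappa> < ereal (2 * (Pmax + u \<mu>) + \<eta>))"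
  then have "\<forall>m :: nat. \<exists>\<kappa>\<in>joinings \<mu> (1 / real (Suc m)). \<not> h_ann_upper V \<sigma> \<kappa> < ereal (2 * (Pmax + u \<mu>) + \<eta>)"
    by (meson of_nat_0_less_iff zero_less_Suc zero_less_divide_1_iff)
  then obtain \<kappa> where \<kappa>: "\<And>m :: nat. \<kappa> m \<in> joinings \<mu> (1 / real (Suc m))"
    "\<And>m. \<not> h_ann_upper V \<sigma> (\<kappa> m) < ereal (2 * (Pmax + u \<mu>) + \<eta>)" by metis
  have "\<kappa> m \<in> Prob_inv" for m using \<kappa>(1)[of m] by (simp add: joinings_def)
  then obtain r \<rho> where r: "strict_mono (r :: nat \<Rightarrow> nat)" "\<rho> \<in> Prob_inv" "limitin Pcomp (\<kappa> \<circ> r) \<rho> sequentially"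
    using compactin_Pcomp_sequence[OF closedin_Prob_inv] by metis
  have marg: "distr \<rho> (borel_of config_top) (\<lambda>z i. f (z i)) = \<mu>"
    if le: "\<And>m. dprob \<mu> (distr (\<kappa> m) (borel_of config_top) (\<lambda>z i. f (z i))) \<le> 1 / real (Suc m)"
      for f :: "'a \<times> 'a \<Rightarrow> 'a"
  proof -
    let ?d = "\<lambda>\<kappa>. dprob \<mu> (distr \<kappa> (borel_of config_top) (\<lambda>z i. f (z i)))"
    have "limitin euclideanreal (?d \<circ> (\<kappa> \<circ> r)) (?d \<rho>) sequentially"
      by (rule continuous_map_limit[OF continuous_map_dprob_distr[OF \<mu>P] r(3)])
    then have "(\<lambda>m. ?d (\<kappa> (r m))) \<longlonglongrightarrow> ?d \<rho>" by (simp add: comp_def)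
    moreover have "(\<lambda>m. ?d (\<kappa> (r m))) \<longlonglongrightarrow> 0"
    proof (rule tendsto_sandwich[OF always_eventually always_eventually tendsto_const])
      show "\<forall>m. 0 \<le> ?d (\<kappa> (r m))" by simp
      show "\<forall>m. ?d (\<kappa> (r m)) \<le> 1 / real (Suc (r m))" using le by blast
      show "(\<lambda>m. 1 / real (Suc (r m))) \<longlonglongrightarrow> 0"
        using LIMSEQ_subseq_LIMSEQ[OF LIMSEQ_inverse_real_of_nat r(1)]
          by (simp add: comp_def inverse_eq_divide)
    qed
    ultimately have "?d \<rho> = 0" by (rule LIMSEQ_unique)
    then show ?thesis
      using dprob.zero[OF \<mu>P distr_in_Prob[OF continuous_map_config_apply Prob_inv_Prob[OF r(2)], of f]]
        by simp
  qed
  have "self_joining \<mu> \<rho>"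
    unfolding self_joining_def using r(2) marg[of fst] marg[of snd] \<kappa>(1) by (auto simp: joinings_def)
  then have "h_ann_upper V \<sigma> \<rho> \<le> 2 * h_ann_lower V \<sigma> \<mu>"
    using sm by (auto simp: second_moment_criterion_def)
  also have "\<dots> < ereal (2 * (Pmax + u \<mu>) + \<eta>)" using EQ_entropy[OF \<mu>] \<open>\<eta> > 0\<close> by simp
  finally obtain \<delta> where \<delta>: "\<delta> > 0" "\<And>\<nu>. \<nu> \<in> Prob config_top \<Longrightarrow> dprob \<rho> \<nu> < \<delta> \<Longrightarrow> h_ann_upper V \<sigma> \<nu> < ereal (2 * (Pmax + u \<mu>) + \<eta>)"
    using h_ann_upper_usc[OF Prob_inv_Prob[OF r(2)]] by blast
  have "(\<lambda>m. dprob (\<kappa> (r m)) \<rho>) \<longlonglongrightarrow> 0" using r(3) by (simp add: limitin_Pcomp comp_def)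
  then have "\<forall>\<^sub>F m in sequentially. dprob (\<kappa> (r m)) \<rho> < \<delta>" using \<delta>(1) by (rule order_tendstoD)
  then obtain m where "dprob (\<kappa> (r m)) \<rho> < \<delta>" using eventually_happens'[OF sequentially_bot] by blast
  then have "h_ann_upper V \<sigma> (\<kappa> (r m)) < ereal (2 * (Pmax + u \<mu>) + \<eta>)"
    using \<open>\<And>m. \<kappa> m \<in> Prob_inv\<close> by (intro \<delta>(2) Prob_inv_Prob) (simp_all add: dprob.commute)
  then show False using \<kappa>(2) by blast
qed

lemma distr_empirical_apply:
  assumes "s \<in> Hom (V n)" "\<And>v. v \<in> V n \<Longrightarrow> x v = f (z v)"
  shows "distr (empirical (V n) s z) (borel_of config_top) (\<lambda>y i. f (y i)) = empirical (V n) s x"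
  unfolding empirical_def
proof (subst distr_distr)
  show "(\<lambda>y i. f (y i)) \<in> borel_of config_top \<rightarrow>\<^sub>M borel_of config_top"
    by (rule continuous_map_measurable_borel_of[OF continuous_map_config_apply])
  show "(\<lambda>v. pullback s v z) \<in> uniform_count_measure (V n) \<rightarrow>\<^sub>M borel_of config_top"
    by (simp add: measurable_uniform_V[OF V])
  show "distr (uniform_count_measure (V n)) (borel_of config_top) ((\<lambda>y i. f (y i)) \<circ> (\<lambda>v. pullback s v z)) =
      distr (uniform_count_measure (V n)) (borel_of config_top) (\<lambda>v. pullback s v x)"
    by (rule distr_cong) (auto simp: space_uniform_count_measure pullback_def assms(2) Hom_in[OF assms(1)])
qed

text \<open>A pair of good models is one labeling by pairs, and its empirical measure projects to
  the two given ones; distinct pairs give distinct labelings.\<close>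

lemma card_good_models_squared:
  assumes "\<mu> \<in> Prob config_top" "s \<in> Hom (V n)" "\<epsilon> \<le> \<epsilon>'"
  shows "(real (card (good_models (V n) s \<mu> \<epsilon>)))\<^sup>2 \<le> wsum n (\<lambda>_. 0) (joinings \<mu> \<epsilon>') s"
proof -
  let ?G = "good_models (V n) s \<mu> \<epsilon>"
  define pr :: "('v \<Rightarrow> 'a) \<times> ('v \<Rightarrow> 'a) \<Rightarrow> 'v \<Rightarrow> 'a \<times> 'a" where
    "pr p = (\<lambda>v\<in>V n. (fst p v, snd p v))" for p
  have ext: "x = y" if "x \<in> labelings (V n)" "y \<in> labelings (V n)" "\<And>v. v \<in> V n \<Longrightarrow> x v = y v"
    for x y :: "'v \<Rightarrow> 'a"
    using that by (metis PiE_ext)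
  have inj: "inj_on pr (?G \<times> ?G)"
  proof (rule inj_onI)
    fix p q assume pq: "p \<in> ?G \<times> ?G" "q \<in> ?G \<times> ?G" "pr p = pr q"
    have "fst p v = fst q v \<and> snd p v = snd q v" if "v \<in> V n" for v
      using fun_cong[OF pq(3), of v] that by (simp add: pr_def)
    moreover have "fst p \<in> labelings (V n)" "fst q \<in> labelings (V n)" "snd p \<in> labelings (V n)" "snd q \<in> labelings (V n)"
      using pq by (auto simp: good_models_def)
    ultimately have "fst p = fst q" "snd p = snd q" using ext by blast+
    then show "p = q" by (rule prod_eqI)
  qed
  have img: "pr ` (?G \<times> ?G) \<subseteq> {z \<in> labelings (V n). empirical (V n) s z \<in> joinings \<mu> \<epsilon>'}"
  proof
    fix z assume "z \<in> pr ` (?G \<times> ?G)"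
    then obtain x y where xy: "x \<in> ?G" "y \<in> ?G" "z = pr (x, y)" by auto
    have "distr (empirical (V n) s z) (borel_of config_top) (\<lambda>y i. fst (y i)) = empirical (V n) s x"
      "distr (empirical (V n) s z) (borel_of config_top) (\<lambda>y i. snd (y i)) = empirical (V n) s y"
      by (rule distr_empirical_apply[OF assms(2)]; simp add: xy(3) pr_def)+
    moreover have "z \<in> labelings (V n)" using xy(3) by (auto simp: pr_def)
    ultimately show "z \<in> {z \<in> labelings (V n). empirical (V n) s z \<in> joinings \<mu> \<epsilon>'}"
      using xy(1,2) assms(3) empirical_Prob_inv[OF V assms(2)]
      by (auto simp: joinings_def good_models_eq[OF assms(1)])
  qed
  have "(real (card ?G))\<^sup>2 = real (card (?G \<times> ?G))" by (simp add: card_cartesian_product power2_eq_square)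
  also have "\<dots> \<le> real (card {z \<in> labelings (V n). empirical (V n) s z \<in> joinings \<mu> \<epsilon>'})"
    using V(1)[of n] by (intro of_nat_mono card_inj_on_le[OF inj img]) simp
  also have "\<dots> = wsum n (\<lambda>_. 0) (joinings \<mu> \<epsilon>') s" by (simp add: wsum_def)
  finally show ?thesis .
qed

text \<open>The number X of good models is at least half its mean with probability at least exp (- 3
  \<eta> N) / 4, whereas the free energy deviates from its mean with probability at most 2 exp (- R
  N), where R exceeds 3 \<eta>. Some sample therefore has a large Z without deviating, which forces
  the mean free energy to be large; after that, a small Z is itself a deviation.\<close>

lemma Z_typically_large:
  assumes conc: "exp_concentrated V \<sigma>" and \<mu>: "\<mu> \<in> EQ" and sm: "second_moment_criterion V \<sigma> \<mu>" and "\<delta> > 0"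
  shows "(\<lambda>n. measure_pmf.prob (\<sigma> n) {s. Z n s < exp ((Pmax - \<delta>) * N n)}) \<longlonglongrightarrow> 0"
proof -
  have \<mu>P: "\<mu> \<in> Prob config_top" using \<mu> EQ_Prob by blast
  define M where "M = 1 + (\<Sum>p\<in>UNIV. \<bar>J (fst p) (snd p)\<bar>)"
  have M: "M > 0" by (simp add: M_def add_pos_nonneg sum_nonneg)
  have JM: "\<forall>a b. \<bar>J a b\<bar> \<le> M"
  proof (intro allI)
    fix a b
    have "\<bar>J (fst (a, b)) (snd (a, b))\<bar> \<le> (\<Sum>p\<in>UNIV. \<bar>J (fst p) (snd p)\<bar>)"
      by (rule member_le_sum) auto
    then show "\<bar>J a b\<bar> \<le> M" by (simp add: M_def)
  qed
  obtain C where C: "C > 0" "\<forall>n. \<forall>f\<in>Lip1 (Hom (V n)) (hom_dist (V n)). \<forall>t>0.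
        measure_pmf.prob (\<sigma> n) {s. \<bar>f s - measure_pmf.expectation (\<sigma> n) f\<bar> > t}
          \<le> 2 * exp (- C * real (card (V n)) * t ^ 2)"
    using conc unfolding exp_concentrated_def by (elim exE conjE)
  define f where "f n = (\<lambda>s. ln (Z n s) / real (card (V n)) / (4 * M))" for n
  \<comment> \<open>Undoing the normalisation by 4M, a deviation \<open>t\<close> of
    \<open>f\<close> is a deviation \<delta>/4 of the free energy per vertex.\<close>
  define t where "t = \<delta> / (16 * M)"
  have t: "t > 0" using M \<open>\<delta> > 0\<close> by (simp add: t_def)
  define R where "R = C * t ^ 2"
  have R: "R > 0" using C t by (simp add: R_def)
  define dev where "dev n = {s. \<bar>f n s - measure_pmf.expectation (\<sigma> n) (f n)\<bar> > t}" for n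
  have dev: "measure_pmf.prob (\<sigma> n) (dev n) \<le> 2 * exp (- R * N n)" for n
  proof -
    have "f n \<in> Lip1 (Hom (V n)) (hom_dist (V n))"
      unfolding f_def by (rule ln_partition_function_Lip1[OF V J_sym JM M])
    then have "measure_pmf.prob (\<sigma> n) (dev n) \<le> 2 * exp (- C * real (card (V n)) * t ^ 2)"
      using C(2) t unfolding dev_def by blast
    then show ?thesis by (simp add: R_def N_def mult.commute mult.left_commute)
  qed
  \<comment> \<open>The bound R/8 makes the loss 3 \<eta> of the second moment method smaller than
    the concentration rate; \<delta>/8 keeps the loss in the count within the final error
    budget.\<close>
  define \<eta> where "\<eta> = min (R / 8) (\<delta> / 8)"
  have \<eta>: "\<eta> > 0" "\<eta> \<le> R / 8" "\<eta> \<le> \<delta> / 8" using R \<open>\<delta> > 0\<close> by (auto simp: \<eta>_def)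
  define H where "H = Pmax + u \<mu>"
  obtain \<epsilon>0 where \<epsilon>0: "\<epsilon>0 > 0" "\<forall>\<kappa>\<in>joinings \<mu> \<epsilon>0. h_ann_upper V \<sigma> \<kappa> < ereal (2 * H + \<eta>)"
    using joinings_entropy[OF \<mu> sm \<eta>(1)] unfolding H_def by (elim exE conjE)
  have "\<delta> / 8 > 0" using \<open>\<delta> > 0\<close> by simp
  from continuous_map_Pcomp_realD[OF continuous_map_mean_energy \<mu>P this]
  obtain \<epsilon>1 where \<epsilon>1: "\<epsilon>1 > 0" "\<And>\<nu>. \<nu> \<in> Prob config_top \<Longrightarrow> dprob \<mu> \<nu> < \<epsilon>1 \<Longrightarrow> \<bar>u \<nu> - u \<mu>\<bar> < \<delta> / 8"
    by blast
  define \<epsilon> where "\<epsilon> = min \<epsilon>0 \<epsilon>1"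
  have \<epsilon>: "\<epsilon> > 0" "\<epsilon> \<le> \<epsilon>0" "\<epsilon> \<le> \<epsilon>1" using \<epsilon>0 \<epsilon>1 by (auto simp: \<epsilon>_def)
  have "ereal (H - \<eta>) < h_ann_lower V \<sigma> \<mu>" using EQ_entropy[OF \<mu>] \<eta> by (simp add: H_def)
  then have ev1: "\<forall>\<^sub>F n in sequentially. exp ((H - \<eta>) * N n) \<le> ecount \<mu> \<epsilon> n"
    using \<epsilon>(1) by (rule ecount_lower)
  have ev2: "\<forall>\<^sub>F n in sequentially. ewsum n (\<lambda>_. 0) (joinings \<mu> \<epsilon>0) \<le> exp ((2 * H + \<eta>) * N n)"
    by (rule ewsum_upper[OF _ closedin_joinings[OF \<mu>P]]) (use \<epsilon>0(2) in simp_all)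
  have "(\<lambda>n. exp ((3 * \<eta> - R) * N n)) \<longlonglongrightarrow> 0" using \<eta> R by (intro exp_N_tendsto) linarith
  then have ev3: "\<forall>\<^sub>F n in sequentially. exp ((3 * \<eta> - R) * N n) < 1 / 8" by (rule order_tendstoD) simp
  have ev4: "\<forall>\<^sub>F n in sequentially. ln 2 / (\<delta> / 8) \<le> N n"
    using N_at_top by (simp add: filterlim_at_top)
  have "\<forall>\<^sub>F n in sequentially. {s. Z n s < exp ((Pmax - \<delta>) * N n)} \<subseteq> dev n"
    using ev1 ev2 ev3 ev4
  proof eventually_elim
    case (elim n)
    define X where "X s = real (card (good_models (V n) s \<mu> \<epsilon>))" for s
    define m where "m = ecount \<mu> \<epsilon> n"
    define B where "B = exp ((2 * H + \<eta>) * N n)"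
    have m: "m > 0" "exp ((H - \<eta>) * N n) \<le> m" using elim(1) less_le_trans[OF exp_gt_zero]
      by (auto simp: m_def)
    have B: "B > 0" by (simp add: B_def)
    have mX: "m = measure_pmf.expectation (\<sigma> n) X" by (simp add: m_def ecount_def X_def[abs_def])
    have intX: "integrable (measure_pmf (\<sigma> n)) X" unfolding X_def[abs_def]
      by (rule integrable_card_good_models)
    have X0: "X s \<ge> 0" "X s \<le> exp (ln (real CARD('a)) * N n)" for s by (simp_all add: X_def card_good_models)
    have intX2: "integrable (measure_pmf (\<sigma> n)) (\<lambda>s. (X s)\<^sup>2)"
      by (rule integrable_pmf_bounded[of _ "(exp (ln (real CARD('a)) * N n))\<^sup>2"]) (use X0 in \<open>simp add: power_mono\<close>)
    have "measure_pmf.expectation (\<sigma> n) (\<lambda>s. (X s)\<^sup>2) \<le> ewsum n (\<lambda>_. 0) (joinings \<mu> \<epsilon>0)"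
      unfolding ewsum_def
    proof (intro integral_mono_AE intX2 integrable_wsum)
      show "AE s in measure_pmf (\<sigma> n). (X s)\<^sup>2 \<le> wsum n (\<lambda>_. 0) (joinings \<mu> \<epsilon>0) s"
        unfolding AE_measure_pmf_iff X_def
        using card_good_models_squared[OF \<mu>P _ \<epsilon>(2)] set_pmf_Hom by blast
    qed simp
    then have EX2: "measure_pmf.expectation (\<sigma> n) (\<lambda>s. (X s)\<^sup>2) \<le> B" using elim(2) by (simp add: B_def)
    define A where "A = {s. m / 2 \<le> X s}"
    \<comment> \<open>With this \<open>a\<close> the quadratic term in the pointwise bound below has
      expectation at most m/4. That bound is the completed square of \<open>a * X s - 1\<close> on
      \<open>A\<close>, and it replaces Cauchy-Schwarz in the Paley--Zygmund argument.\<close>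
    define a where "a = m / (2 * B)"
    have a: "a > 0" using m B by (simp add: a_def)
    have pw: "X s \<le> m / 2 + (a / 2 * (X s)\<^sup>2 + 1 / (2 * a) * indicator A s)" for s
    proof (cases "s \<in> A")
      case True
      have "0 \<le> (a * X s - 1)\<^sup>2 / (2 * a)" using a by simp
      also have "\<dots> = a / 2 * (X s)\<^sup>2 + 1 / (2 * a) - X s"
        using a by (simp add: power2_eq_square field_simps)
      finally have "X s \<le> a / 2 * (X s)\<^sup>2 + 1 / (2 * a)" by simp
      then show ?thesis using True m(1) by simp
    next
      case False
      then have "X s \<le> m / 2" by (simp add: A_def)
      moreover have "0 \<le> a / 2 * (X s)\<^sup>2" using a by simp
      ultimately show ?thesis using False by simp
    qed
    have "m \<le> measure_pmf.expectation (\<sigma> n) (\<lambda>s. m / 2 + (a / 2 * (X s)\<^sup>2 + 1 / (2 * a) * indicator A s))"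
      unfolding mX by (intro integral_mono intX Bochner_Integration.integrable_add integrable_mult_right intX2 pw[unfolded mX])
        (auto intro!: integrable_pmf_bounded[of _ 1])
    also have "\<dots> = m / 2 + (a / 2 * measure_pmf.expectation (\<sigma> n) (\<lambda>s. (X s)\<^sup>2) + 1 / (2 * a) * measure_pmf.prob (\<sigma> n) A)"
      using intX2 by (simp add: integrable_pmf_bounded[of _ 1])
    also have "\<dots> \<le> m / 2 + (a / 2 * B + 1 / (2 * a) * measure_pmf.prob (\<sigma> n) A)"
      using EX2 a by (simp add: mult_left_mono)
    also have "a / 2 * B = m / 4" using B by (simp add: a_def)
    also have "1 / (2 * a) = B / m" using B m by (simp add: a_def)
    finally have "m \<le> m / 2 + (m / 4 + B / m * measure_pmf.prob (\<sigma> n) A)" .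
    then have "m / 4 \<le> B / m * measure_pmf.prob (\<sigma> n) A" by linarith
    then have "m / 4 * m / B \<le> measure_pmf.prob (\<sigma> n) A" using m B by (simp add: field_simps)
    \<comment> \<open>The exponent is the defect between squared first moment and second moment: 2
      (H - \<eta>) - (2 H + \<eta>) = - 3 \<eta>.\<close>
    moreover have "exp (- 3 * \<eta> * N n) / 4 \<le> m / 4 * m / B"
    proof -
      have "exp (- 3 * \<eta> * N n) = exp ((H - \<eta>) * N n) * exp ((H - \<eta>) * N n) / B"
        by (simp add: B_def mult_exp_exp exp_diff[symmetric] algebra_simps)
      also have "\<dots> \<le> m * m / B" using m B by (intro divide_right_mono mult_mono) auto
      finally show ?thesis by simp
    qed
    moreover have "2 * exp (- R * N n) < exp (- 3 * \<eta> * N n) / 4"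
    proof -
      have "exp (- R * N n) = exp ((3 * \<eta> - R) * N n) * exp (- 3 * \<eta> * N n)"
        by (simp add: mult_exp_exp algebra_simps)
      also have "\<dots> < 1 / 8 * exp (- 3 * \<eta> * N n)" using elim(3) by (intro mult_strict_right_mono) auto
      finally show ?thesis by simp
    qed
    ultimately have lt: "measure_pmf.prob (\<sigma> n) (dev n) < measure_pmf.prob (\<sigma> n) A" using dev[of n]
      by linarith
    \<comment> \<open>\<open>A\<close> is strictly more probable than the deviation event, so it
      cannot be contained in it.\<close>
    have "\<not> A \<inter> set_pmf (\<sigma> n) \<subseteq> dev n"
    proof
      assume "A \<inter> set_pmf (\<sigma> n) \<subseteq> dev n"
      then have "measure_pmf.prob (\<sigma> n) (A \<inter> set_pmf (\<sigma> n)) \<le> measure_pmf.prob (\<sigma> n) (dev n)"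
        by (intro measure_pmf.finite_measure_mono) auto
      then show False using lt by (simp add: measure_Int_set_pmf)
    qed
    then obtain s where "s \<in> A" "s \<notin> dev n" by blast
    then have s: "m / 2 \<le> X s" "\<bar>f n s - measure_pmf.expectation (\<sigma> n) (f n)\<bar> \<le> t"
      by (simp_all add: A_def dev_def not_less)
    have fZ: "f n s' * (4 * M) = ln (Z n s') / N n" for s' using M by (simp add: f_def N_def)
    \<comment> \<open>Three losses of \<delta>/8 each: the variation of the energy over good models,
      the slack \<eta> in the expected count, and the factor 1/2 in X >= m/2, which exp (- \<delta>
      N / 8) absorbs for large n.\<close>
    have "exp ((Pmax - 3 * \<delta> / 8) * N n) \<le> Z n s"
    proof -
      have l2: "ln 2 \<le> \<delta> / 8 * N n" using elim(4) \<open>\<delta> > 0\<close> by (simp add: field_simps)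
      have "exp ((Pmax - 3 * \<delta> / 8) * N n) = exp (- (u \<mu> + \<delta> / 8) * N n) * (exp ((H - \<delta> / 8) * N n) / exp (\<delta> / 8 * N n))"
        by (simp add: H_def mult_exp_exp exp_diff[symmetric] algebra_simps)
      also have "\<dots> \<le> exp (- (u \<mu> + \<delta> / 8) * N n) * (m / 2)"
      proof (intro mult_left_mono frac_le)
        show "exp ((H - \<delta> / 8) * N n) \<le> m"
          using \<eta>(3) N_pos[of n] by (intro order.trans[OF _ m(2)]) (simp add: mult_right_mono)
        show "2 \<le> exp (\<delta> / 8 * N n)" using l2
          by (simp add: ln_le_cancel_iff[of 2 "exp _", symmetric] del: ln_le_cancel_iff)
      qed (use m in auto)
      also have "\<dots> \<le> exp (- (u \<mu> + \<delta> / 8) * N n) * X s" using s(1) by (intro mult_left_mono) auto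
      also have "\<dots> \<le> Z n s"
        unfolding X_def
      proof (rule Z_ge_card[OF \<mu>P])
        fix \<nu> :: "('k, 'a) config measure" assume "\<nu> \<in> Prob config_top" "dprob \<mu> \<nu> < \<epsilon>"
        then show "u \<nu> \<le> u \<mu> + \<delta> / 8" using \<epsilon>1(2)[of \<nu>] \<epsilon>(3) by linarith
      qed
      finally show ?thesis .
    qed
    then have "(Pmax - 3 * \<delta> / 8) * N n \<le> ln (Z n s)" by (simp add: ln_ge_iff[OF Z_pos])
    then have 1: "Pmax - 3 * \<delta> / 8 \<le> f n s * (4 * M)" using N_pos[of n] by (simp add: fZ pos_le_divide_eq)
    have t4: "t * (4 * M) = \<delta> / 4" using M by (simp add: t_def)
    have "f n s * (4 * M) - t * (4 * M) \<le> measure_pmf.expectation (\<sigma> n) (f n) * (4 * M)"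
      using s(2) M by (simp add: left_diff_distrib[symmetric] mult_right_mono)
    \<comment> \<open>3/8 from the sample plus 1/4 from its distance to the mean. A free energy
      below Pmax - \<delta> is then at least 3 \<delta>/8 under the mean, which exceeds the allowed
      \<delta>/4.\<close>
    then have 2: "Pmax - 5 * \<delta> / 8 \<le> measure_pmf.expectation (\<sigma> n) (f n) * (4 * M)" using 1 t4 by simp
    show ?case
    proof
      fix s' assume "s' \<in> {s. Z n s < exp ((Pmax - \<delta>) * N n)}"
      then have "ln (Z n s') < ln (exp ((Pmax - \<delta>) * N n))" using Z_pos[of n s']
        by (simp only: ln_less_cancel_iff mem_Collect_eq exp_gt_zero)
      then have "f n s' * (4 * M) < Pmax - \<delta>" using N_pos[of n] by (simp add: fZ pos_divide_less_eq)
      then have "t * (4 * M) < (measure_pmf.expectation (\<sigma> n) (f n) - f n s') * (4 * M)"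
        using 2 t4 \<open>\<delta> > 0\<close> by (simp add: left_diff_distrib)
      then have "t < measure_pmf.expectation (\<sigma> n) (f n) - f n s'" using M by simp
      then show "s' \<in> dev n" by (simp add: dev_def)
    qed
  qed
  then have ub: "\<forall>\<^sub>F n in sequentially. measure_pmf.prob (\<sigma> n) {s. Z n s < exp ((Pmax - \<delta>) * N n)} \<le> 2 * exp (- R * N n)"
  proof eventually_elim
    case (elim n)
    then have "measure_pmf.prob (\<sigma> n) {s. Z n s < exp ((Pmax - \<delta>) * N n)} \<le> measure_pmf.prob (\<sigma> n) (dev n)"
      by (intro measure_pmf.finite_measure_mono) auto
    then show ?case using dev[of n] by simp
  qed
  have "(\<lambda>n. 2 * exp (- R * N n)) \<longlonglongrightarrow> 2 * 0" using R by (intro tendsto_mult_left exp_N_tendsto) simp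
  then show ?thesis
    by (intro tendsto_sandwich[OF _ ub tendsto_const]) auto
qed

end

section \<open>Typical sequences\<close>

lemma prob_Int_tendsto_1:
  assumes M: "\<And>n. prob_space (M n)" "\<And>n. sets (M n) = UNIV"
    and "(\<lambda>n. measure (M n) (A n)) \<longlonglongrightarrow> 1" "(\<lambda>n. measure (M n) (B n)) \<longlonglongrightarrow> 1"
  shows "(\<lambda>n. measure (M n) (A n \<inter> B n)) \<longlonglongrightarrow> 1"
proof (rule tendsto_sandwich[OF always_eventually always_eventually _ tendsto_const])
  have "(\<lambda>n. measure (M n) (A n) + measure (M n) (B n) - 1) \<longlonglongrightarrow> 1 + 1 - 1"
    by (intro tendsto_intros assms)
  then show "(\<lambda>n. measure (M n) (A n) + measure (M n) (B n) - 1) \<longlonglongrightarrow> 1" by simp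
  show "\<forall>n. measure (M n) (A n) + measure (M n) (B n) - 1 \<le> measure (M n) (A n \<inter> B n)"
  proof
    fix n interpret prob_space "M n" by (rule M)
    have "measure (M n) (A n \<union> B n) = measure (M n) (A n) + measure (M n) (B n) - measure (M n) (A n \<inter> B n)"
      using finite_measure_Union'[of "A n" "B n"] finite_measure_Diff'[of "B n" "A n"]
        by (simp add: M Int_commute)
    then show "measure (M n) (A n) + measure (M n) (B n) - 1 \<le> measure (M n) (A n \<inter> B n)"
      using prob_le_1[of "A n \<union> B n"] by linarith
  qed
  show "\<forall>n. measure (M n) (A n \<inter> B n) \<le> 1" using prob_space.prob_le_1[OF M(1)] by blast
qed

text \<open>At time n take the largest k \<le> n for which the first k + 1 events hold jointly with
  probability above 1 - 1/(k+1); this k tends to infinity. If no k qualifies, \<open>A n\<close> is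
  the default, which keeps every \<open>S n\<close> nonempty. The measures are arbitrary so that the
  random approximation and its reweighting are both covered.\<close>

lemma diagonal_events:
  assumes M: "\<And>n. prob_space (M n)" "\<And>n. sets (M n) = UNIV"
    and A: "\<And>n. measure (M n) (A n) = 1"
    and G: "\<And>j :: nat. (\<lambda>n. measure (M n) (G j n)) \<longlonglongrightarrow> 1"
  shows "\<exists>S. (\<forall>n. S n \<subseteq> A n \<and> S n \<noteq> {}) \<and> (\<lambda>n. measure (M n) (S n)) \<longlonglongrightarrow> 1 \<and>
    (\<forall>j. \<forall>\<^sub>F n in sequentially. S n \<subseteq> G j n)"
proof -
  define H where "H k n = A n \<inter> (\<Inter>j\<le>k. G j n)" for k n
  have H: "(\<lambda>n. measure (M n) (H k n)) \<longlonglongrightarrow> 1" for k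
  proof (induction k)
    case 0
    show ?case unfolding H_def using prob_Int_tendsto_1[OF M _ G[of 0], of A] by (simp add: A)
  next
    case (Suc k)
    have "H (Suc k) n = H k n \<inter> G (Suc k) n" for n by (auto simp: H_def atMost_Suc)
    then show ?case using prob_Int_tendsto_1[OF M Suc G[of "Suc k"]] by simp
  qed
  define Q where "Q k n \<longleftrightarrow> 1 - 1 / real (Suc k) < measure (M n) (H k n)" for k n
  have Q: "\<forall>\<^sub>F n in sequentially. Q k n" for k
    unfolding Q_def by (rule order_tendstoD(1)[OF H]) simp
  define T where "T n = {k. k \<le> n \<and> Q k n}" for n
  define S where "S n = (if T n = {} then A n else H (Max (T n)) n)" for n
  have finT: "finite (T n)" for n by (simp add: T_def)
  have QT: "Q (Max (T n)) n" if "T n \<noteq> {}" for n using Max_in[OF finT that] by (simp add: T_def)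
  have ev: "\<forall>\<^sub>F n in sequentially. T n \<noteq> {} \<and> k \<le> Max (T n)" for k
    using Q[of k] eventually_ge_at_top[of k]
  proof eventually_elim
    case (elim n)
    then have "k \<in> T n" by (simp add: T_def)
    then show ?case using finT by auto
  qed
  have "S n \<noteq> {}" for n
  proof -
    have "0 < measure (M n) (S n)"
    proof (cases "T n = {}")
      case True
      then show ?thesis by (simp add: S_def A)
    next
      case False
      have "0 \<le> 1 - 1 / real (Suc (Max (T n)))" by simp
      also have "\<dots> < measure (M n) (H (Max (T n)) n)" using QT[OF False] by (simp add: Q_def)
      finally show ?thesis using False by (simp add: S_def)
    qed
    then show ?thesis by auto
  qed
  moreover have "S n \<subseteq> A n" for n by (auto simp: S_def H_def)
  moreover have "(\<lambda>n. measure (M n) (S n)) \<longlonglongrightarrow> 1"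
  proof (rule order_tendstoI)
    fix a :: real assume "a < 1"
    then obtain k where k: "1 / real (Suc k) < 1 - a" using nat_approx_posE[of "1 - a"] by auto
    show "\<forall>\<^sub>F n in sequentially. a < measure (M n) (S n)"
      using ev[of k]
    proof eventually_elim
      case (elim n)
      have "a < 1 - 1 / real (Suc k)" using k by simp
      also have "\<dots> \<le> 1 - 1 / real (Suc (Max (T n)))" using elim by (simp add: frac_le)
      also have "\<dots> < measure (M n) (H (Max (T n)) n)" using QT elim by (simp add: Q_def)
      finally show ?case using elim by (simp add: S_def)
    qed
  next
    fix a :: real assume "1 < a"
    then show "\<forall>\<^sub>F n in sequentially. measure (M n) (S n) < a"
      using prob_space.prob_le_1[OF M(1)] by (intro always_eventually allI) (rule le_less_trans)
  qed
  moreover have "\<forall>\<^sub>F n in sequentially. S n \<subseteq> G j n" for j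
    using ev[of j]
  proof eventually_elim
    case (elim n)
    then show ?case by (auto simp: S_def H_def)
  qed
  ultimately show ?thesis by blast
qed

lemma is_sofic_mono:
  assumes "is_sofic V F \<delta> s" "F' \<subseteq> F" "\<delta> \<le> \<delta>'" "finite V"
  shows "is_sofic V F' \<delta>' s"
proof -
  have "card {v \<in> V. \<forall>\<gamma>1\<in>F. \<forall>\<gamma>2\<in>F. \<gamma>1 \<noteq> \<gamma>2 \<longrightarrow> s \<gamma>1 v \<noteq> s \<gamma>2 v}
      \<le> card {v \<in> V. \<forall>\<gamma>1\<in>F'. \<forall>\<gamma>2\<in>F'. \<gamma>1 \<noteq> \<gamma>2 \<longrightarrow> s \<gamma>1 v \<noteq> s \<gamma>2 v}"
    by (rule card_mono) (use assms in auto)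
  then have "real (card {v \<in> V. \<forall>\<gamma>1\<in>F. \<forall>\<gamma>2\<in>F. \<gamma>1 \<noteq> \<gamma>2 \<longrightarrow> s \<gamma>1 v \<noteq> s \<gamma>2 v}) / real (card V)
      \<le> real (card {v \<in> V. \<forall>\<gamma>1\<in>F'. \<forall>\<gamma>2\<in>F'. \<gamma>1 \<noteq> \<gamma>2 \<longrightarrow> s \<gamma>1 v \<noteq> s \<gamma>2 v}) / real (card V)"
    by (intro divide_right_mono) auto
  then show ?thesis using assms(1,3) by (simp add: is_sofic_def)
qed

section \<open>Sequences whose Gibbs states concentrate near equilibrium\<close>

context gibbs_sofic
begin

text \<open>The deterministic property of a single sequence on which both limit theorems rest; once
  it is secured, randomness no longer enters.\<close>

definition equilibrating :: "(nat \<Rightarrow> 'k fgroup \<Rightarrow> 'v \<Rightarrow> 'v) \<Rightarrow> bool" where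
  "equilibrating \<tau> \<longleftrightarrow> sofic_approx V \<tau> \<and>
    (\<lambda>n. \<integral>x. phi (empirical (V n) (\<tau> n) x) \<partial>finite_gibbs h J (V n) (\<tau> n)) \<longlonglongrightarrow> 0"

text \<open>One index controls the ball, the soficity defect, the distance from equilibrium and the
  admissible mass, so a countable family of events captures \<open>equilibrating\<close>.\<close>

definition good :: "nat \<Rightarrow> nat \<Rightarrow> ('k fgroup \<Rightarrow> 'v \<Rightarrow> 'v) set" where
  "good j n = {s. is_sofic (V n) (wball j) (1 / real (Suc j)) s} \<inter>
    {s. wsum n (\<lambda>\<nu>. - u \<nu>) (far (1 / real (Suc j))) s \<le> 1 / real (Suc j) * Z n s}"

text \<open>Labelings near equilibrium contribute at most \<eta>; the others have mass at most
  \<eta>, and the distance never exceeds 4.\<close>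

lemma integral_phi_le:
  assumes \<tau>: "\<tau> \<in> Hom (V n)" and "\<eta> > 0" and w: "wsum n (\<lambda>\<nu>. - u \<nu>) (far \<eta>) \<tau> \<le> \<eta> * Z n \<tau>"
  shows "(\<integral>x. phi (empirical (V n) \<tau> x) \<partial>finite_gibbs h J (V n) \<tau>) \<le> 5 * \<eta>"
proof -
  let ?w = "finite_weight h J (V n) \<tau>"
  let ?L = "labelings (V n) :: ('v \<Rightarrow> 'a) set"
  have "(\<Sum>x\<in>?L. ?w x * phi (empirical (V n) \<tau> x))
      \<le> (\<Sum>x\<in>?L. \<eta> * ?w x + (if empirical (V n) \<tau> x \<in> far \<eta> then 4 * ?w x else 0))"
  proof (rule sum_mono)
    fix x :: "'v \<Rightarrow> 'a"
    have P: "empirical (V n) \<tau> x \<in> Prob_inv" by (rule empirical_Prob_inv[OF V \<tau>])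
    show "?w x * phi (empirical (V n) \<tau> x) \<le> \<eta> * ?w x + (if empirical (V n) \<tau> x \<in> far \<eta> then 4 * ?w x else 0)"
    proof (cases "empirical (V n) \<tau> x \<in> far \<eta>")
      case True
      have "?w x * phi (empirical (V n) \<tau> x) \<le> ?w x * 4"
        using phi_le_4[OF Prob_inv_Prob[OF P]] by (intro mult_left_mono) (auto simp: less_imp_le)
      moreover have "0 \<le> \<eta> * ?w x" using \<open>\<eta> > 0\<close> by (simp add: less_imp_le)
      ultimately have "?w x * phi (empirical (V n) \<tau> x) \<le> \<eta> * ?w x + 4 * ?w x" by linarith
      then show ?thesis using True by simp
    next
      case False
      then have "phi (empirical (V n) \<tau> x) \<le> \<eta>" using P by (simp add: far_def)
      then have "?w x * phi (empirical (V n) \<tau> x) \<le> ?w x * \<eta>"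
        by (intro mult_left_mono) (auto simp: less_imp_le)
      then show ?thesis using False by (simp add: mult.commute)
    qed
  qed
  also have "\<dots> = \<eta> * Z n \<tau> + 4 * wsum n (\<lambda>\<nu>. - u \<nu>) (far \<eta>) \<tau>"
  proof -
    have "(\<Sum>x\<in>?L. if empirical (V n) \<tau> x \<in> far \<eta> then 4 * ?w x else 0) = 4 * wsum n (\<lambda>\<nu>. - u \<nu>) (far \<eta>) \<tau>"
      unfolding wsum_weight sum_distrib_left using V(1)[of n]
      by (simp add: sum.inter_filter[symmetric])
    then show ?thesis by (simp add: sum.distrib partition_function_def sum_distrib_left)
  qed
  also have "\<dots> \<le> 5 * \<eta> * Z n \<tau>" using w by simp
  finally show ?thesis
    using Z_pos[of n \<tau>] by (simp add: integral_finite_gibbs[OF V] pos_divide_le_eq)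
qed

lemma equilibratingI:
  assumes \<tau>: "\<And>n. \<tau> n \<in> Hom (V n)" and good: "\<And>j. \<forall>\<^sub>F n in sequentially. \<tau> n \<in> good j n"
  shows "equilibrating \<tau>"
  unfolding equilibrating_def sofic_approx_def
proof (intro conjI allI impI)
  show "\<tau> n \<in> Hom (V n)" for n by (rule \<tau>)
  fix F :: "'k fgroup set" and \<delta> :: real assume F\<delta>: "finite F \<and> 0 < \<delta>"
  then obtain R where R: "F \<subseteq> wball R" using finite_subset_wball by blast
  obtain m where m: "1 / real (Suc m) < \<delta>" using nat_approx_posE[of \<delta>] F\<delta> by auto
  have "F \<subseteq> wball (max R m)" using R wball_mono[of R "max R m"] by auto
  moreover have "1 / real (Suc (max R m)) \<le> \<delta>" using m
    by (intro order.trans[OF _ less_imp_le[OF m]] frac_le) auto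
  ultimately show "\<forall>\<^sub>F n in sequentially. is_sofic (V n) F \<delta> (\<tau> n)"
    using good[of "max R m"] V(1) by (auto elim!: eventually_mono simp: good_def intro: is_sofic_mono)
next
  show "(\<lambda>n. \<integral>x. phi (empirical (V n) (\<tau> n) x) \<partial>finite_gibbs h J (V n) (\<tau> n)) \<longlonglongrightarrow> 0"
  proof (rule order_tendstoI)
    fix a :: real assume "0 < a"
    then obtain j where j: "1 / real (Suc j) < a / 5" using nat_approx_posE[of "a / 5"] by auto
    show "\<forall>\<^sub>F n in sequentially. (\<integral>x. phi (empirical (V n) (\<tau> n) x) \<partial>finite_gibbs h J (V n) (\<tau> n)) < a"
      using good[of j]
    proof eventually_elim
      case (elim n)
      then have "(\<integral>x. phi (empirical (V n) (\<tau> n) x) \<partial>finite_gibbs h J (V n) (\<tau> n)) \<le> 5 * (1 / real (Suc j))"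
        by (intro integral_phi_le[OF \<tau>]) (auto simp: good_def)
      then show ?case using j by linarith
    qed
  next
    fix a :: real assume "a < 0"
    have "0 \<le> (\<integral>x. phi (empirical (V n) (\<tau> n) x) \<partial>finite_gibbs h J (V n) (\<tau> n))" for n
      by (rule Bochner_Integration.integral_nonneg) (rule phi_nonneg)
    then show "\<forall>\<^sub>F n in sequentially. a < (\<integral>x. phi (empirical (V n) (\<tau> n) x) \<partial>finite_gibbs h J (V n) (\<tau> n))"
      using \<open>a < 0\<close> by (intro always_eventually allI) (rule less_le_trans)
  qed
qed

text \<open>Markov's inequality bounds the weight of far labelings, whose expectation has rate c <
  \<open>Pmax\<close>, against the typical lower bound on Z. With \<delta> half the gap
  \<open>Pmax - c\<close>, the two rates differ by exactly \<delta>.\<close>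

lemma good_typical:
  assumes "exp_concentrated V \<sigma>" "\<mu> \<in> EQ" "second_moment_criterion V \<sigma> \<mu>"
  shows "(\<lambda>n. measure_pmf.prob (\<sigma> n) (good j n)) \<longlonglongrightarrow> 1"
  unfolding good_def
proof (rule prob_Int_tendsto_1[OF measure_pmf.prob_space_axioms sets_measure_pmf])
  define \<eta> where "\<eta> = 1 / real (Suc j)"
  have \<eta>: "\<eta> > 0" by (simp add: \<eta>_def)
  have compl: "measure_pmf.prob p {s. P s} = 1 - measure_pmf.prob p {s. \<not> P s}"
    for p :: "('k fgroup \<Rightarrow> 'v \<Rightarrow> 'v) pmf" and P
    using measure_pmf.prob_compl[of "{s. \<not> P s}" p]
      by (simp add: Compl_eq_Diff_UNIV[symmetric] Collect_neg_eq)
  have tend: "(\<lambda>n. measure_pmf.prob (\<sigma> n) {s. P n s}) \<longlonglongrightarrow> 1"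
    if ev: "\<forall>\<^sub>F n in sequentially. measure_pmf.prob (\<sigma> n) {s. \<not> P n s} \<le> b n" and "b \<longlonglongrightarrow> 0" for P b
  proof -
    have "(\<lambda>n. measure_pmf.prob (\<sigma> n) {s. \<not> P n s}) \<longlonglongrightarrow> 0"
      by (rule tendsto_sandwich[OF _ ev tendsto_const that(2)]) auto
    then have "(\<lambda>n. 1 - measure_pmf.prob (\<sigma> n) {s. \<not> P n s}) \<longlonglongrightarrow> 1 - 0" by (intro tendsto_intros)
    then show ?thesis by (simp add: compl[of _ "P _"])
  qed
  have "\<forall>\<^sub>F n in sequentially. measure_pmf.prob (\<sigma> n) {s. \<not> is_sofic (V n) (wball j) (1 / real (Suc j)) s} \<le> exp (- 1 * N n)"
    by (rule not_sofic_prob) auto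
  then show "(\<lambda>n. measure_pmf.prob (\<sigma> n) {s. is_sofic (V n) (wball j) (1 / real (Suc j)) s}) \<longlonglongrightarrow> 1"
    by (rule tend) (rule exp_N_tendsto, simp)
  obtain c where c: "c < Pmax" "\<forall>\<^sub>F n in sequentially. ewsum n (\<lambda>\<nu>. - u \<nu>) (far \<eta>) \<le> exp (c * N n)"
    using ewsum_far[OF \<eta>] by blast
  define \<delta> where "\<delta> = (Pmax - c) / 2"
  have \<delta>: "\<delta> > 0" using c by (simp add: \<delta>_def)
  define b where "b n = measure_pmf.prob (\<sigma> n) {s. Z n s < exp ((Pmax - \<delta>) * N n)} + exp (- \<delta> * N n) / \<eta>"
    for n
  have "b \<longlonglongrightarrow> 0 + 0 / \<eta>"
    unfolding b_def using \<delta> \<eta> by (intro tendsto_intros Z_typically_large[OF assms] exp_N_tendsto) auto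
  moreover have "\<forall>\<^sub>F n in sequentially. measure_pmf.prob (\<sigma> n) {s. \<not> wsum n (\<lambda>\<nu>. - u \<nu>) (far \<eta>) s \<le> \<eta> * Z n s} \<le> b n"
    using c(2)
  proof eventually_elim
    case (elim n)
    let ?A = "{s. Z n s < exp ((Pmax - \<delta>) * N n)}" and ?B = "{s \<in> space (measure_pmf (\<sigma> n)). \<eta> * exp ((Pmax - \<delta>) * N n) \<le> wsum n (\<lambda>\<nu>. - u \<nu>) (far \<eta>) s}"
    have "{s. \<not> wsum n (\<lambda>\<nu>. - u \<nu>) (far \<eta>) s \<le> \<eta> * Z n s} \<subseteq> ?A \<union> ?B"
    proof
      fix s assume s: "s \<in> {s. \<not> wsum n (\<lambda>\<nu>. - u \<nu>) (far \<eta>) s \<le> \<eta> * Z n s}"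
      show "s \<in> ?A \<union> ?B"
      proof (cases "s \<in> ?A")
        case False
        then have "\<eta> * exp ((Pmax - \<delta>) * N n) \<le> \<eta> * Z n s" using \<eta> by simp
        then show ?thesis using s by simp
      qed simp
    qed
    then have "measure_pmf.prob (\<sigma> n) {s. \<not> wsum n (\<lambda>\<nu>. - u \<nu>) (far \<eta>) s \<le> \<eta> * Z n s} \<le> measure_pmf.prob (\<sigma> n) (?A \<union> ?B)"
      by (intro measure_pmf.finite_measure_mono) auto
    also have "\<dots> \<le> measure_pmf.prob (\<sigma> n) ?A + measure_pmf.prob (\<sigma> n) ?B"
      by (rule measure_Un_le) auto
    also have "measure_pmf.prob (\<sigma> n) ?B \<le> ewsum n (\<lambda>\<nu>. - u \<nu>) (far \<eta>) / (\<eta> * exp ((Pmax - \<delta>) * N n))"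
      unfolding ewsum_def
      by (rule integral_Markov_inequality_measure[OF integrable_wsum[OF cont_minus_u], where A = UNIV])
        (use \<eta> in \<open>auto simp: wsum_nonneg\<close>)
    also have "\<dots> \<le> exp (c * N n) / (\<eta> * exp ((Pmax - \<delta>) * N n))"
      using elim \<eta> by (intro divide_right_mono) auto
    also have "\<dots> = exp (- \<delta> * N n) / \<eta>"
      using \<eta> by (simp add: \<delta>_def field_simps mult_exp_exp exp_diff[symmetric] exp_minus)
    finally show ?case by (simp add: b_def)
  qed
  ultimately have "(\<lambda>n. measure_pmf.prob (\<sigma> n) {s. wsum n (\<lambda>\<nu>. - u \<nu>) (far \<eta>) s \<le> \<eta> * Z n s}) \<longlonglongrightarrow> 1"
    using tend by simp
  then show "(\<lambda>n. measure_pmf.prob (\<sigma> n) {s. wsum n (\<lambda>\<nu>. - u \<nu>) (far (1 / real (Suc j))) s \<le> 1 / real (Suc j) * Z n s}) \<longlonglongrightarrow> 1"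
    by (simp add: \<eta>_def)
qed

lemma typically_equilibrating:
  assumes "exp_concentrated V \<sigma>" "\<mu> \<in> EQ" "second_moment_criterion V \<sigma> \<mu>"
    and P: "\<And>\<tau>. equilibrating \<tau> \<Longrightarrow> P \<tau>"
  shows "typically V \<sigma> P"
proof -
  have "\<exists>S. (\<forall>n. S n \<subseteq> set_pmf (\<sigma> n) \<and> S n \<noteq> {}) \<and> (\<lambda>n. measure_pmf.prob (\<sigma> n) (S n)) \<longlonglongrightarrow> 1 \<and>
    (\<forall>j. \<forall>\<^sub>F n in sequentially. S n \<subseteq> good j n)"
    by (rule diagonal_events[OF measure_pmf.prob_space_axioms sets_measure_pmf _ good_typical[OF assms(1-3)]])
      (simp add: measure_pmf.prob_eq_1 AE_measure_pmf_iff)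
  then obtain S where S: "\<forall>n. S n \<subseteq> set_pmf (\<sigma> n) \<and> S n \<noteq> {}" "(\<lambda>n. measure_pmf.prob (\<sigma> n) (S n)) \<longlonglongrightarrow> 1"
    "\<forall>j. \<forall>\<^sub>F n in sequentially. S n \<subseteq> good j n" by (elim exE conjE)
  have "equilibrating \<tau>" if \<tau>: "\<forall>n. \<tau> n \<in> S n" for \<tau>
  proof (rule equilibratingI)
    show "\<tau> n \<in> Hom (V n)" for n using \<tau> S(1) set_pmf_Hom by blast
    show "\<forall>\<^sub>F n in sequentially. \<tau> n \<in> good j n" for j
      using S(3)[rule_format, of j] by eventually_elim (use \<tau> in blast)
  qed
  moreover have "S n \<subseteq> Hom (V n)" for n using S(1) set_pmf_Hom[of n] by blast
  ultimately show ?thesis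
    unfolding typically_def using S(1,2) P
    by (intro exI[of _ S]) (simp add: equilibrating_def)
qed

text \<open>
  Under the planted law, which reweights \<open>\<sigma> n\<close> by the partition function, the same events have
  probability tending to 1 without the second moment criterion; this gives at least one sequence
  from which an equilibrium Gibbs state can be extracted.
\<close>

definition planted :: "nat \<Rightarrow> ('k fgroup \<Rightarrow> 'v \<Rightarrow> 'v) measure" where
  "planted n = density (measure_pmf (\<sigma> n)) (\<lambda>s. ennreal (Z n s / EZ n))"

lemma EZ_pos: "EZ n > 0"
proof -
  have "EZ n \<ge> 0" unfolding EZ_def by (rule Bochner_Integration.integral_nonneg) (simp add: Z_pos less_imp_le)
  moreover have "EZ n \<noteq> 0"
  proof
    assume "EZ n = 0"
    then have "AE s in measure_pmf (\<sigma> n). Z n s = 0"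
      unfolding EZ_def using integral_nonneg_eq_0_iff_AE[OF integrable_Z] Z_pos by (simp add: less_imp_le)
    then show False using Z_pos set_pmf_not_empty by (auto simp: AE_measure_pmf_iff less_le)
  qed
  ultimately show ?thesis by simp
qed

lemma emeasure_planted: "emeasure (planted n) B = ennreal ((\<integral>s. Z n s * indicator B s \<partial>measure_pmf (\<sigma> n)) / EZ n)"
proof -
  have int: "integrable (measure_pmf (\<sigma> n)) (\<lambda>s. Z n s * indicator B s)"
    by (rule integrable_real_mult_indicator[OF _ integrable_Z]) simp
  have "emeasure (planted n) B = (\<integral>\<^sup>+s. ennreal (Z n s / EZ n) * indicator B s \<partial>measure_pmf (\<sigma> n))"
    unfolding planted_def by (rule emeasure_density) auto
  also have "\<dots> = (\<integral>\<^sup>+s. ennreal (Z n s * indicator B s / EZ n) \<partial>measure_pmf (\<sigma> n))"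
    by (rule nn_integral_cong) (auto simp: indicator_def)
  also have "\<dots> = ennreal (\<integral>s. Z n s * indicator B s / EZ n \<partial>measure_pmf (\<sigma> n))"
    using int Z_pos[of n] EZ_pos[of n] by (intro nn_integral_eq_integral) (auto simp: less_imp_le)
  finally show ?thesis by simp
qed

lemma measure_planted: "measure (planted n) B = (\<integral>s. Z n s * indicator B s \<partial>measure_pmf (\<sigma> n)) / EZ n"
proof -
  have "0 \<le> (\<integral>s. Z n s * indicator B s \<partial>measure_pmf (\<sigma> n))"
    by (rule Bochner_Integration.integral_nonneg) (simp add: Z_pos less_imp_le)
  then show ?thesis
    using EZ_pos[of n] unfolding measure_def emeasure_planted by (simp add: less_imp_le)
qed

lemma prob_space_planted: "prob_space (planted n)"
  by (rule prob_spaceI) (use EZ_pos[of n] in \<open>simp add: planted_def[symmetric] emeasure_planted EZ_def\<close>, simp_all add: planted_def)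

lemma sets_planted: "sets (planted n) = UNIV"
  by (simp add: planted_def)

text \<open>The reweighting cancels the random Z against the denominator: the planted probability
  that far labelings carry more than \<eta> of Z is at most their expected weight divided by \<eta>
  times the mean of Z. Failure of soficity stays negligible because its probability decays faster
  than any exponential, which outweighs the at most exponential density.\<close>

lemma good_planted: "(\<lambda>n. measure (planted n) (good j n)) \<longlonglongrightarrow> 1"
  unfolding good_def
proof (rule prob_Int_tendsto_1[OF prob_space_planted sets_planted])
  define \<eta> where "\<eta> = 1 / real (Suc j)"
  have \<eta>: "\<eta> > 0" by (simp add: \<eta>_def)
  have compl: "measure (planted n) {s. P s} = 1 - measure (planted n) {s. \<not> P s}" for n P
  proof -
    interpret prob_space "planted n" by (rule prob_space_planted)
    have "space (planted n) = UNIV" by (simp add: planted_def)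
    then show ?thesis
      using prob_compl[of "{s. \<not> P s}"]
        by (simp add: sets_planted Compl_eq_Diff_UNIV[symmetric] Collect_neg_eq)
  qed
  have tend: "(\<lambda>n. measure (planted n) {s. P n s}) \<longlonglongrightarrow> 1"
    if ev: "\<forall>\<^sub>F n in sequentially. measure (planted n) {s. \<not> P n s} \<le> b n" and "b \<longlonglongrightarrow> 0" for P b
  proof -
    have "(\<lambda>n. measure (planted n) {s. \<not> P n s}) \<longlonglongrightarrow> 0"
      by (rule tendsto_sandwich[OF _ ev tendsto_const that(2)]) auto
    then have "(\<lambda>n. 1 - measure (planted n) {s. \<not> P n s}) \<longlonglongrightarrow> 1 - 0" by (intro tendsto_intros)
    then show ?thesis by (simp add: compl[of _ "P _"])
  qed
  obtain B where B: "B > 0" "\<And>\<mu> :: ('k, 'a) config measure. \<mu> \<in> Prob config_top \<Longrightarrow> \<bar>u \<mu>\<bar> \<le> B"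
    using mean_energy_bounded[of h J] by blast
  define D where "D = ln (real CARD('a)) + B"
  have Z_le: "Z n s \<le> exp (D * N n)" for n s
  proof -
    have "Z n s \<le> (\<Sum>x\<in>(labelings (V n) :: ('v \<Rightarrow> 'a) set). exp (B * N n))"
      unfolding partition_function_def
    proof (rule sum_mono)
      fix x :: "'v \<Rightarrow> 'a"
      have "N n * - u (empirical (V n) s x) \<le> N n * B"
        using B(2)[OF empirical_Prob[OF V], of n s x] N_pos[of n] by (intro mult_left_mono) auto
      then show "finite_weight h J (V n) s x \<le> exp (B * N n)"
        unfolding finite_weight_N by (simp add: mult.commute)
    qed
    also have "\<dots> = exp (ln (real CARD('a)) * N n) * exp (B * N n)"
      using V(1)[of n] by (simp add: card_PiE N_def exp_of_nat2_mult)
    finally show ?thesis by (simp add: D_def mult_exp_exp algebra_simps)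
  qed
  \<comment> \<open>The rate is chosen to cancel: D for the largest possible Z, and
    \<open>Pmax - 1\<close> for the mean of Z in the denominator, leaving exp (- N).\<close>
  have ev1: "\<forall>\<^sub>F n in sequentially. measure_pmf.prob (\<sigma> n) {s. \<not> is_sofic (V n) (wball j) (1 / real (Suc j)) s} \<le> exp ((Pmax - 2 - D) * N n)"
    by (rule not_sofic_prob) auto
  have ev2: "\<forall>\<^sub>F n in sequentially. exp ((Pmax - 1) * N n) \<le> EZ n"
    by (rule EZ_lower) simp
  have "\<forall>\<^sub>F n in sequentially. measure (planted n) {s. \<not> is_sofic (V n) (wball j) (1 / real (Suc j)) s} \<le> exp (- 1 * N n)"
    using ev1 ev2
  proof eventually_elim
    case (elim n)
    let ?B = "{s. \<not> is_sofic (V n) (wball j) (1 / real (Suc j)) s}"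
    have "(\<integral>s. Z n s * indicator ?B s \<partial>measure_pmf (\<sigma> n)) \<le> (\<integral>s. exp (D * N n) * indicator ?B s \<partial>measure_pmf (\<sigma> n))"
      using Z_le by (intro integral_mono integrable_real_mult_indicator integrable_Z) (auto simp: indicator_def)
    also have "\<dots> = exp (D * N n) * measure_pmf.prob (\<sigma> n) ?B" by simp
    also have "\<dots> \<le> exp (D * N n) * exp ((Pmax - 2 - D) * N n)" using elim by (intro mult_left_mono) auto
    also have "\<dots> = exp (- 1 * N n) * exp ((Pmax - 1) * N n)" by (simp add: mult_exp_exp algebra_simps)
    also have "\<dots> \<le> exp (- 1 * N n) * EZ n" using elim by (intro mult_left_mono) auto
    finally show ?case using EZ_pos[of n] by (simp add: measure_planted pos_divide_le_eq)
  qed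
  then show "(\<lambda>n. measure (planted n) {s. is_sofic (V n) (wball j) (1 / real (Suc j)) s}) \<longlonglongrightarrow> 1"
    by (rule tend) (rule exp_N_tendsto, simp)
  obtain c where c: "c < Pmax" "\<forall>\<^sub>F n in sequentially. ewsum n (\<lambda>\<nu>. - u \<nu>) (far \<eta>) \<le> exp (c * N n)"
    using ewsum_far[OF \<eta>] by blast
  define \<delta> where "\<delta> = (Pmax - c) / 2"
  have \<delta>: "\<delta> > 0" using c by (simp add: \<delta>_def)
  have "(\<lambda>n. exp (- \<delta> * N n) / \<eta>) \<longlonglongrightarrow> 0 / \<eta>" using \<delta> \<eta> by (intro tendsto_intros exp_N_tendsto) auto
  moreover have "\<forall>\<^sub>F n in sequentially. measure (planted n) {s. \<not> wsum n (\<lambda>\<nu>. - u \<nu>) (far \<eta>) s \<le> \<eta> * Z n s} \<le> exp (- \<delta> * N n) / \<eta>"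
    using c(2) EZ_lower[OF \<delta>]
  proof eventually_elim
    case (elim n)
    let ?B = "{s. \<not> wsum n (\<lambda>\<nu>. - u \<nu>) (far \<eta>) s \<le> \<eta> * Z n s}"
    have "(\<integral>s. Z n s * indicator ?B s \<partial>measure_pmf (\<sigma> n)) \<le> (\<integral>s. wsum n (\<lambda>\<nu>. - u \<nu>) (far \<eta>) s / \<eta> \<partial>measure_pmf (\<sigma> n))"
      using \<eta> by (intro integral_mono integrable_real_mult_indicator integrable_Z integrable_divide integrable_wsum cont_minus_u)
        (auto simp: indicator_def pos_le_divide_eq mult.commute wsum_nonneg)
    also have "\<dots> = ewsum n (\<lambda>\<nu>. - u \<nu>) (far \<eta>) / \<eta>" by (simp add: ewsum_def)
    also have "\<dots> \<le> exp (c * N n) / \<eta>" using elim \<eta> by (intro divide_right_mono) auto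
    also have "\<dots> = exp (- \<delta> * N n) / \<eta> * exp ((Pmax - \<delta>) * N n)"
    proof -
      have "c = - \<delta> + (Pmax - \<delta>)" by (simp add: \<delta>_def field_simps)
      then have "exp (c * N n) = exp (- \<delta> * N n) * exp ((Pmax - \<delta>) * N n)"
        by (metis distrib_right mult_exp_exp)
      then show ?thesis by simp
    qed
    also have "\<dots> \<le> exp (- \<delta> * N n) / \<eta> * EZ n" using elim \<eta> by (intro mult_left_mono) auto
    finally show ?case using EZ_pos[of n] by (simp add: measure_planted pos_divide_le_eq)
  qed
  ultimately have "(\<lambda>n. measure (planted n) {s. wsum n (\<lambda>\<nu>. - u \<nu>) (far \<eta>) s \<le> \<eta> * Z n s}) \<longlonglongrightarrow> 1"
    using tend by simp
  then show "(\<lambda>n. measure (planted n) {s. wsum n (\<lambda>\<nu>. - u \<nu>) (far (1 / real (Suc j))) s \<le> 1 / real (Suc j) * Z n s}) \<longlonglongrightarrow> 1"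
    by (simp add: \<eta>_def)
qed

lemma exists_equilibrating: "\<exists>\<tau>. equilibrating \<tau>"
proof -
  have "measure (planted n) (set_pmf (\<sigma> n)) = 1" for n
  proof -
    have "(\<integral>s. Z n s * indicator (set_pmf (\<sigma> n)) s \<partial>measure_pmf (\<sigma> n)) = EZ n"
      unfolding EZ_def by (rule integral_cong_AE) (auto simp: AE_measure_pmf_iff)
    then show ?thesis using EZ_pos[of n] by (simp add: measure_planted)
  qed
  then have "\<exists>S. (\<forall>n. S n \<subseteq> set_pmf (\<sigma> n) \<and> S n \<noteq> {}) \<and> (\<lambda>n. measure (planted n) (S n)) \<longlonglongrightarrow> 1 \<and>
    (\<forall>j. \<forall>\<^sub>F n in sequentially. S n \<subseteq> good j n)"
    by (rule diagonal_events[OF prob_space_planted sets_planted _ good_planted])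
  then obtain S where S: "\<forall>n. S n \<subseteq> set_pmf (\<sigma> n) \<and> S n \<noteq> {}" "\<forall>j. \<forall>\<^sub>F n in sequentially. S n \<subseteq> good j n"
    by (elim exE conjE)
  define \<tau> where "\<tau> n = (SOME s. s \<in> S n)" for n
  have \<tau>: "\<tau> n \<in> S n" for n unfolding \<tau>_def using S(1) by (simp add: some_in_eq)
  have "equilibrating \<tau>"
  proof (rule equilibratingI)
    show "\<tau> n \<in> Hom (V n)" for n using \<tau>[of n] S(1) set_pmf_Hom by blast
    show "\<forall>\<^sub>F n in sequentially. \<tau> n \<in> good j n" for j
      using S(2)[rule_format, of j] by eventually_elim (use \<tau> in blast)
  qed
  then show ?thesis by blast
qed

end

section \<open>The Gibbs specification\<close>

definition edges_at :: "'k fgroup set \<Rightarrow> ('k fgroup \<times> 'k) set" where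
  "edges_at \<Lambda> = {(g, k). g \<in> \<Lambda> \<or> fg_mult (gen k) g \<in> \<Lambda>}"

text \<open>The region together with its outer neighbours, that is, all sites on which
  \<open>region_energy\<close> depends.\<close>

definition window :: "'k fgroup set \<Rightarrow> 'k fgroup set" where
  "window \<Lambda> = \<Lambda> \<union> fst ` edges_at \<Lambda> \<union> (\<lambda>(g, k). fg_mult (gen k) g) ` edges_at \<Lambda>"

text \<open>The conditional probability of the pattern \<open>a\<close> on \<Lambda> that
  \<open>Gibbs\<close> prescribes, as a function of the configuration outside.\<close>

definition spec :: "('a::finite \<Rightarrow> real) \<Rightarrow> ('a \<Rightarrow> 'a \<Rightarrow> real) \<Rightarrow> 'k fgroup set \<Rightarrow>
    ('k, 'a) config \<Rightarrow> ('k, 'a) config \<Rightarrow> real" where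
  "spec h J \<Lambda> a x = exp (- region_energy h J \<Lambda> (override_on x a \<Lambda>)) /
     (\<Sum>b\<in>labelings \<Lambda>. exp (- region_energy h J \<Lambda> (override_on x b \<Lambda>)))"

lemma finite_edges_at: "finite \<Lambda> \<Longrightarrow> finite (edges_at (\<Lambda> :: 'k::finite fgroup set))"
proof -
  assume fin: "finite \<Lambda>"
  have "edges_at \<Lambda> \<subseteq> \<Lambda> \<times> UNIV \<union> (\<lambda>(g, k). (fg_mult (fg_inv (gen k)) g, k)) ` (\<Lambda> \<times> UNIV)"
  proof
    fix p assume p: "p \<in> edges_at \<Lambda>"
    obtain g k where gk: "p = (g, k)" by (cases p)
    show "p \<in> \<Lambda> \<times> UNIV \<union> (\<lambda>(g, k). (fg_mult (fg_inv (gen k)) g, k)) ` (\<Lambda> \<times> UNIV)"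
    proof (cases "g \<in> \<Lambda>")
      case False
      then have "fg_mult (gen k) g \<in> \<Lambda>" using p gk by (simp add: edges_at_def)
      then have "(fg_mult (gen k) g, k) \<in> \<Lambda> \<times> UNIV" by simp
      moreover have "p = (\<lambda>(g, k). (fg_mult (fg_inv (gen k)) g, k)) (fg_mult (gen k) g, k)" by (simp add: gk)
      ultimately show ?thesis by blast
    qed (simp add: gk)
  qed
  then show ?thesis by (rule finite_subset) (simp add: fin)
qed

lemma finite_window: "finite \<Lambda> \<Longrightarrow> finite (window (\<Lambda> :: 'k::finite fgroup set))"
  by (simp add: window_def finite_edges_at)

lemma subset_window: "\<Lambda> \<subseteq> window \<Lambda>"
  by (auto simp: window_def)

lemma region_energy_eq: "region_energy h J \<Lambda> x = (\<Sum>g\<in>\<Lambda>. h (x g)) + (\<Sum>p\<in>edges_at \<Lambda>. J (x (fst p)) (x (fg_mult (gen (snd p)) (fst p))))"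
  unfolding region_energy_def edges_at_def by (simp add: case_prod_unfold)

lemma region_energy_cong:
  assumes "\<And>g. g \<in> window \<Lambda> \<Longrightarrow> x g = y g"
  shows "region_energy h J \<Lambda> x = region_energy h J \<Lambda> y"
proof -
  have "x (fst p) = y (fst p)" "x (fg_mult (gen (snd p)) (fst p)) = y (fg_mult (gen (snd p)) (fst p))"
    if "p \<in> edges_at \<Lambda>" for p
  proof -
    have "fst p \<in> window \<Lambda>" "fg_mult (gen (snd p)) (fst p) \<in> window \<Lambda>"
      using that by (cases p; force simp: window_def)+
    then show "x (fst p) = y (fst p)" "x (fg_mult (gen (snd p)) (fst p)) = y (fg_mult (gen (snd p)) (fst p))"
      by (simp_all add: assms)
  qed
  then show ?thesis
    unfolding region_energy_eq
    by (intro arg_cong2[where f = "(+)"] sum.cong refl)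
      (simp_all add: assms[OF subsetD[OF subset_window]])
qed

lemma spec_local:
  assumes "\<forall>g\<in>window \<Lambda> - \<Lambda>. x g = y g"
  shows "spec h J \<Lambda> a x = spec h J \<Lambda> a y"
proof -
  have "region_energy h J \<Lambda> (override_on x b \<Lambda>) = region_energy h J \<Lambda> (override_on y b \<Lambda>)" for b
    by (rule region_energy_cong) (use assms in \<open>auto simp: override_on_def\<close>)
  then show ?thesis by (simp add: spec_def)
qed

lemma spec_denom_pos:
  fixes h :: "'a::finite \<Rightarrow> real"
  shows "finite \<Lambda> \<Longrightarrow> 0 < (\<Sum>b\<in>labelings \<Lambda>. exp (- region_energy h J \<Lambda> (override_on x b \<Lambda>)))"
  by (rule sum_pos) auto

lemma spec_nonneg: "0 \<le> spec h J \<Lambda> a x"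
  by (simp add: spec_def sum_nonneg)

lemma spec_sum: "finite \<Lambda> \<Longrightarrow> (\<Sum>a\<in>labelings \<Lambda>. spec h J \<Lambda> a x) = 1"
  using spec_denom_pos[of \<Lambda> h J x] by (simp add: spec_def sum_divide_distrib[symmetric])

lemma spec_le_1: "finite \<Lambda> \<Longrightarrow> a \<in> labelings \<Lambda> \<Longrightarrow> spec h J \<Lambda> a x \<le> 1"
  using member_le_sum[of a "labelings \<Lambda>" "\<lambda>a. spec h J \<Lambda> a x"] by (simp add: spec_sum spec_nonneg)

lemma spec_bdd_continuous:
  "finite \<Lambda> \<Longrightarrow> spec h J \<Lambda> a \<in> bdd_continuous (config_top :: ('k::finite, 'a::finite) config topology)"
  by (rule bdd_continuous_local[of "window \<Lambda>"]) (auto simp: finite_window intro!: spec_local)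

section \<open>Finitary Gibbs states satisfy the Gibbs property locally\<close>

text \<open>
  The sum over all labelings is fibred over their restrictions to the complement of the region
  \<open>\<Lambda> v\<close>; injectivity of \<open>\<sigma>\<close> on the window makes the energy near \<open>v\<close> that of the tree.
\<close>

lemma finite_DLR:
  fixes \<sigma> :: "'k::finite fgroup \<Rightarrow> 'v \<Rightarrow> 'v" and J :: "'a::finite \<Rightarrow> 'a \<Rightarrow> real" and G :: "('v \<Rightarrow> 'a) \<Rightarrow> real"
  assumes V: "finite V" and \<sigma>: "\<sigma> \<in> Hom V" and J: "\<forall>a b. J a b = J b a" and v: "v \<in> V"
    and \<Lambda>: "finite \<Lambda>" and inj: "inj_on (\<lambda>g. \<sigma> g v) (window \<Lambda>)" and a: "a \<in> labelings \<Lambda>"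
    and G: "\<And>x y. (\<And>w. w \<in> V - (\<lambda>g. \<sigma> g v) ` \<Lambda> \<Longrightarrow> x w = y w) \<Longrightarrow> G x = G y"
  shows "(\<Sum>x\<in>labelings V. finite_weight h J V \<sigma> x * (indicator (cyl \<Lambda> a) (pullback \<sigma> v x) * G x)) =
    (\<Sum>x\<in>labelings V. finite_weight h J V \<sigma> x * (spec h J \<Lambda> a (pullback \<sigma> v x) * G x))"
proof -
  define L where "L = (\<lambda>g. \<sigma> g v) ` \<Lambda>"
  have LV: "L \<subseteq> V" using Hom_in[OF \<sigma> v] by (auto simp: L_def)
  have inj\<Lambda>: "inj_on (\<lambda>g. \<sigma> g v) \<Lambda>" using inj subset_window by (rule inj_on_subset)
  \<comment> \<open>The labelled edges of the finite graph that meet the image of \<Lambda>.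
    Injectivity on the window puts them in bijection with the tree edges at \<Lambda>, so no two
    tree edges are identified.\<close>
  define T where "T = {p \<in> V \<times> UNIV. fst p \<in> L \<or> \<sigma> (gen (snd p)) (fst p) \<in> L}"
  have T: "T = (\<lambda>p. (\<sigma> (fst p) v, snd p)) ` edges_at \<Lambda>"
  proof (intro equalityI subsetI)
    fix q assume "q \<in> T"
    then obtain w k where q: "q = (w, k)" "w \<in> V" "w \<in> L \<or> \<sigma> (gen k) w \<in> L" by (auto simp: T_def)
    show "q \<in> (\<lambda>p. (\<sigma> (fst p) v, snd p)) ` edges_at \<Lambda>"
    proof (cases "w \<in> L")
      case True
      then obtain g where "g \<in> \<Lambda>" "w = \<sigma> g v" by (auto simp: L_def)
      then show ?thesis using q by (intro image_eqI[of _ _ "(g, k)"]) (auto simp: edges_at_def)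
    next
      case False
      then obtain g where g: "g \<in> \<Lambda>" "\<sigma> (gen k) w = \<sigma> g v" using q by (auto simp: L_def)
      then have "w = \<sigma> (fg_inv (gen k)) (\<sigma> g v)" using Hom_inv(1)[OF \<sigma> q(2), of "gen k"] by simp
      then have "w = \<sigma> (fg_mult (fg_inv (gen k)) g) v" by (simp add: Hom_mult[OF \<sigma> v])
      then show ?thesis using q g
        by (intro image_eqI[of _ _ "(fg_mult (fg_inv (gen k)) g, k)"]) (auto simp: edges_at_def)
    qed
  next
    fix q assume "q \<in> (\<lambda>p. (\<sigma> (fst p) v, snd p)) ` edges_at \<Lambda>"
    then obtain g k where q: "q = (\<sigma> g v, k)" "(g, k) \<in> edges_at \<Lambda>" by auto
    then have "\<sigma> (gen k) (\<sigma> g v) = \<sigma> (fg_mult (gen k) g) v" by (simp add: Hom_mult[OF \<sigma> v])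
    then show "q \<in> T" using q Hom_in[OF \<sigma> v] by (auto simp: T_def edges_at_def L_def)
  qed
  have injE: "inj_on (\<lambda>p. (\<sigma> (fst p) v, snd p)) (edges_at \<Lambda>)"
  proof (rule inj_onI)
    fix p q assume pq: "p \<in> edges_at \<Lambda>" "q \<in> edges_at \<Lambda>" "(\<sigma> (fst p) v, snd p) = (\<sigma> (fst q) v, snd q)"
    then have "fst p \<in> window \<Lambda>" "fst q \<in> window \<Lambda>" by (auto simp: window_def)
    then have "fst p = fst q" using inj pq(3) by (auto dest: inj_onD)
    then show "p = q" using pq(3) by (simp add: prod_eq_iff)
  qed
  \<comment> \<open>The factor of the weight that does not see the image of \<Lambda>; it is common
    to all fillings of that image.\<close>
  define R where "R x = exp (- ((\<Sum>w\<in>V - L. h (x w)) + (\<Sum>p\<in>V \<times> UNIV - T. J (x (fst p)) (x (\<sigma> (gen (snd p)) (fst p))))))" for x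
  have weight: "finite_weight h J V \<sigma> x = R x * exp (- region_energy h J \<Lambda> (pullback \<sigma> v x))" for x
  proof -
    have "(\<Sum>v\<in>V. site_energy h J (pullback \<sigma> v x)) = (\<Sum>w\<in>V. h (x w)) +
        (\<Sum>p\<in>V \<times> UNIV. J (x (fst p)) (x (\<sigma> (gen (snd p)) (fst p))))"
      by (simp add: site_energy_sum[OF \<sigma> J] sum.cartesian_product case_prod_unfold)
    also have "(\<Sum>w\<in>V. h (x w)) = (\<Sum>w\<in>V - L. h (x w)) + (\<Sum>w\<in>L. h (x w))"
      using LV V by (rule sum.subset_diff)
    also have "(\<Sum>w\<in>L. h (x w)) = (\<Sum>g\<in>\<Lambda>. h (pullback \<sigma> v x g))"
      unfolding L_def by (simp add: sum.reindex[OF inj\<Lambda>] pullback_def)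
    also have "(\<Sum>p\<in>V \<times> UNIV. J (x (fst p)) (x (\<sigma> (gen (snd p)) (fst p)))) =
        (\<Sum>p\<in>V \<times> UNIV - T. J (x (fst p)) (x (\<sigma> (gen (snd p)) (fst p)))) + (\<Sum>p\<in>T. J (x (fst p)) (x (\<sigma> (gen (snd p)) (fst p))))"
      by (rule sum.subset_diff) (auto simp: T_def V)
    also have "(\<Sum>p\<in>T. J (x (fst p)) (x (\<sigma> (gen (snd p)) (fst p)))) =
        (\<Sum>p\<in>edges_at \<Lambda>. J (pullback \<sigma> v x (fst p)) (pullback \<sigma> v x (fg_mult (gen (snd p)) (fst p))))"
      unfolding T by (simp add: sum.reindex[OF injE] pullback_def Hom_mult[OF \<sigma> v])
    finally show ?thesis
      unfolding finite_weight_def R_def region_energy_eq by (simp add: mult_exp_exp algebra_simps)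
  qed
  have R_cong: "R x = R y" if eq: "\<And>w. w \<in> V - L \<Longrightarrow> x w = y w" for x y
  proof -
    have "x (fst p) = y (fst p)" "x (\<sigma> (gen (snd p)) (fst p)) = y (\<sigma> (gen (snd p)) (fst p))"
      if "p \<in> V \<times> UNIV - T" for p
      using that Hom_in[OF \<sigma>] by (auto intro!: eq simp: T_def)
    then have "(\<Sum>p\<in>V \<times> UNIV - T. J (x (fst p)) (x (\<sigma> (gen (snd p)) (fst p)))) =
        (\<Sum>p\<in>V \<times> UNIV - T. J (y (fst p)) (y (\<sigma> (gen (snd p)) (fst p))))"
      by (intro sum.cong) simp_all
    moreover have "(\<Sum>w\<in>V - L. h (x w)) = (\<Sum>w\<in>V - L. h (y w))"
      by (rule sum.cong) (simp_all add: eq)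
    ultimately show ?thesis by (simp only: R_def)
  qed
  \<comment> \<open>Gluing: the pattern \<open>c\<close>, transported along the orbit map at
    \<open>v\<close>, replaces \<open>y\<close> on the image of \<Lambda>. Every labeling arises
    exactly once from an outside part and a pattern.\<close>
  define m where "m y c = (\<lambda>w\<in>V. if w \<in> L then c (inv_into \<Lambda> (\<lambda>g. \<sigma> g v) w) else y w)"
    for y :: "'v \<Rightarrow> 'a" and c :: "'k fgroup \<Rightarrow> 'a"
  have m_L: "m y c (\<sigma> g v) = c g" if "g \<in> \<Lambda>" for y c g
    using that LV inv_into_f_f[OF inj\<Lambda> that] by (auto simp: m_def L_def)
  have m_out: "m y c w = y w" if "w \<in> V - L" for y c w using that by (simp add: m_def)
  have reindex: "(\<Sum>x\<in>labelings V. F x) = (\<Sum>y\<in>labelings (V - L). \<Sum>c\<in>labelings \<Lambda>. F (m y c))"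
    for F :: "('v \<Rightarrow> 'a) \<Rightarrow> real"
    unfolding sum.cartesian_product case_prod_unfold
  proof (rule sum.reindex_bij_witness[where i = "\<lambda>p. m (fst p) (snd p)" and j = "\<lambda>x. (restrict x (V - L), \<lambda>g\<in>\<Lambda>. x (\<sigma> g v))"])
    fix x :: "'v \<Rightarrow> 'a" assume x: "x \<in> labelings V"
    have "m (restrict x (V - L)) (\<lambda>g\<in>\<Lambda>. x (\<sigma> g v)) w = x w" for w
    proof (cases "w \<in> V")
      case True
      show ?thesis
      proof (cases "w \<in> L")
        case True
        then obtain g where "g \<in> \<Lambda>" "w = \<sigma> g v" by (auto simp: L_def)
        then show ?thesis by (simp add: m_L)
      qed (use True m_out in simp)
    next
      case False
      then show ?thesis using x by (simp add: m_def PiE_def extensional_def)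
    qed
    then show eq: "m (fst (restrict x (V - L), \<lambda>g\<in>\<Lambda>. x (\<sigma> g v))) (snd (restrict x (V - L), \<lambda>g\<in>\<Lambda>. x (\<sigma> g v))) = x" by auto
    show "(restrict x (V - L), \<lambda>g\<in>\<Lambda>. x (\<sigma> g v)) \<in> labelings (V - L) \<times> labelings \<Lambda>" by auto
    show "F (m (fst (restrict x (V - L), \<lambda>g\<in>\<Lambda>. x (\<sigma> g v))) (snd (restrict x (V - L), \<lambda>g\<in>\<Lambda>. x (\<sigma> g v)))) = F x"
      by (simp only: eq)
  next
    fix p :: "('v \<Rightarrow> 'a) \<times> ('k fgroup \<Rightarrow> 'a)" assume p: "p \<in> labelings (V - L) \<times> labelings \<Lambda>"
    show "m (fst p) (snd p) \<in> labelings V" by (simp add: m_def)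
    have "restrict (m (fst p) (snd p)) (V - L) = fst p"
      using p m_out by (auto simp: restrict_def PiE_def extensional_def fun_eq_iff)
    moreover have "(\<lambda>g\<in>\<Lambda>. m (fst p) (snd p) (\<sigma> g v)) = snd p"
      using p m_L by (auto simp: restrict_def PiE_def extensional_def fun_eq_iff)
    ultimately show "(restrict (m (fst p) (snd p)) (V - L), \<lambda>g\<in>\<Lambda>. m (fst p) (snd p) (\<sigma> g v)) = p"
      by (simp add: prod_eq_iff)
  qed
  have "(\<Sum>c\<in>labelings \<Lambda>. finite_weight h J V \<sigma> (m y c) * (indicator (cyl \<Lambda> a) (pullback \<sigma> v (m y c)) * G (m y c))) =
    (\<Sum>c\<in>labelings \<Lambda>. finite_weight h J V \<sigma> (m y c) * (spec h J \<Lambda> a (pullback \<sigma> v (m y c)) * G (m y c)))" for y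
  proof -
    define z where "z = pullback \<sigma> v (m y a)"
    define e where "e c = exp (- region_energy h J \<Lambda> (override_on z c \<Lambda>))" for c
    have out: "\<sigma> g v \<in> V - L" if "g \<in> window \<Lambda> - \<Lambda>" for g
    proof -
      have "\<sigma> g v \<notin> L"
      proof
        assume "\<sigma> g v \<in> L"
        then obtain g' where "g' \<in> \<Lambda>" "\<sigma> g v = \<sigma> g' v" by (auto simp: L_def)
        then show False using inj that subset_window by (auto dest: inj_onD)
      qed
      then show ?thesis using Hom_in[OF \<sigma> v] by simp
    qed
    have pz: "pullback \<sigma> v (m y c) g = z g" if "g \<in> window \<Lambda> - \<Lambda>" for c g
      using m_out[OF out[OF that]] by (simp add: z_def pullback_def)
    have re: "exp (- region_energy h J \<Lambda> (pullback \<sigma> v (m y c))) = e c" for c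
    proof -
      have "region_energy h J \<Lambda> (pullback \<sigma> v (m y c)) = region_energy h J \<Lambda> (override_on z c \<Lambda>)"
      proof (rule region_energy_cong)
        fix g assume "g \<in> window \<Lambda>"
        then show "pullback \<sigma> v (m y c) g = override_on z c \<Lambda> g"
          using pz[of g c] m_L[of g y c] by (cases "g \<in> \<Lambda>") (auto simp: override_on_def pullback_def)
      qed
      then show ?thesis by (simp add: e_def)
    qed
    have sp: "spec h J \<Lambda> a (pullback \<sigma> v (m y c)) = e a / (\<Sum>b\<in>labelings \<Lambda>. e b)" for c
    proof -
      have "spec h J \<Lambda> a (pullback \<sigma> v (m y c)) = spec h J \<Lambda> a z" by (rule spec_local) (use pz in blast)
      then show ?thesis by (simp add: spec_def e_def)
    qed
    have Gc: "G (m y c) = G (m y a)" for c by (rule G) (simp add: m_out L_def[symmetric])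
    have Rc: "R (m y c) = R (m y a)" for c by (rule R_cong) (simp add: m_out)
    have ind: "indicator (cyl \<Lambda> a) (pullback \<sigma> v (m y c)) = (if c = a then 1 else 0 :: real)"
      if "c \<in> labelings \<Lambda>" for c
    proof -
      have "pullback \<sigma> v (m y c) \<in> cyl \<Lambda> a \<longleftrightarrow> (\<forall>g\<in>\<Lambda>. c g = a g)" by (simp add: cyl_def pullback_def m_L)
      also have "\<dots> \<longleftrightarrow> c = a" using that a by (metis PiE_ext)
      finally show ?thesis by (simp add: indicator_def)
    qed
    have epos: "(\<Sum>b\<in>labelings \<Lambda>. e b) > 0" unfolding e_def by (rule spec_denom_pos[OF \<Lambda>])
    have "(\<Sum>c\<in>labelings \<Lambda>. finite_weight h J V \<sigma> (m y c) * (indicator (cyl \<Lambda> a) (pullback \<sigma> v (m y c)) * G (m y c)))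
        = (\<Sum>c\<in>labelings \<Lambda>. if c = a then R (m y a) * e a * G (m y a) else 0)"
      by (rule sum.cong[OF refl]) (auto simp only: weight re ind if_True if_False mult_1_left mult_zero_left mult_zero_right simp_thms split: if_split)
    also have "\<dots> = R (m y a) * e a * G (m y a)" using a \<Lambda> by (subst sum.delta) auto
    \<comment> \<open>The normaliser of \<open>spec\<close> is the sum of the local weights over all
      fillings, so it cancels against the summation over \<open>c\<close>.\<close>
    also have "\<dots> = (\<Sum>c\<in>labelings \<Lambda>. e c) * (R (m y a) * (e a / (\<Sum>b\<in>labelings \<Lambda>. e b)) * G (m y a))"
      using epos by simp
    also have "\<dots> = (\<Sum>c\<in>labelings \<Lambda>. finite_weight h J V \<sigma> (m y c) * (spec h J \<Lambda> a (pullback \<sigma> v (m y c)) * G (m y c)))"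
      unfolding sum_distrib_right
    proof (rule sum.cong[OF refl])
      fix c
      show "e c * (R (m y a) * (e a / (\<Sum>b\<in>labelings \<Lambda>. e b)) * G (m y a)) =
        finite_weight h J V \<sigma> (m y c) * (spec h J \<Lambda> a (pullback \<sigma> v (m y c)) * G (m y c))"
        unfolding weight re sp Gc[of c] Rc[of c] by (simp add: mult_ac)
    qed
    finally show ?thesis .
  qed
  then show ?thesis by (simp only: reindex)
qed

text \<open>The defect in the conditional probability of \<open>a\<close> on \<Lambda>, tested
  against a cylinder. For \<open>B\<close> disjoint from \<Lambda>, vanishing of its integral is one
  instance of the DLR equation.\<close>

definition dlr_test :: "('a::finite \<Rightarrow> real) \<Rightarrow> ('a \<Rightarrow> 'a \<Rightarrow> real) \<Rightarrow> 'k fgroup set \<Rightarrow> ('k, 'a) config \<Rightarrow>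
    'k fgroup set \<Rightarrow> ('k, 'a) config \<Rightarrow> ('k, 'a) config \<Rightarrow> real" where
  "dlr_test h J \<Lambda> a B b x = (indicator (cyl \<Lambda> a) x - spec h J \<Lambda> a x) * indicator (cyl B b) x"

lemma dlr_test_local:
  assumes "\<forall>g\<in>window \<Lambda> \<union> B. x g = y g"
  shows "dlr_test h J \<Lambda> a B b x = dlr_test h J \<Lambda> a B b y"
proof -
  have "spec h J \<Lambda> a x = spec h J \<Lambda> a y" by (rule spec_local) (use assms in blast)
  moreover have "x \<in> cyl \<Lambda> a \<longleftrightarrow> y \<in> cyl \<Lambda> a" "x \<in> cyl B b \<longleftrightarrow> y \<in> cyl B b"
    using assms subset_window[of \<Lambda>] by (auto simp: cyl_def) (metis UnCI subsetD)+
  ultimately show ?thesis by (simp add: dlr_test_def indicator_def)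
qed

lemma dlr_test_bdd_continuous:
  "finite \<Lambda> \<Longrightarrow> finite B \<Longrightarrow> dlr_test h J \<Lambda> a B b \<in> bdd_continuous (config_top :: ('k::finite, 'a::finite) config topology)"
  by (rule bdd_continuous_local[of "window \<Lambda> \<union> B", OF _ dlr_test_local]) (simp_all add: finite_window)

lemma dlr_test_bound: "finite \<Lambda> \<Longrightarrow> a \<in> labelings \<Lambda> \<Longrightarrow> \<bar>dlr_test h J \<Lambda> a B b x\<bar> \<le> 1"
  using spec_nonneg[of h J \<Lambda> a x] spec_le_1[of \<Lambda> a h J x] by (auto simp: dlr_test_def indicator_def)

section \<open>Mean and variance of the DLR defect in a finitary Gibbs state\<close>

context
  fixes V :: "'v set" and h :: "'a::finite \<Rightarrow> real" and J :: "'a \<Rightarrow> 'a \<Rightarrow> real"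
    and \<sigma> :: "'k::finite fgroup \<Rightarrow> 'v \<Rightarrow> 'v"
    and \<Lambda> B :: "'k fgroup set" and a b :: "('k, 'a) config"
  assumes V: "finite V" "V \<noteq> {}" and \<sigma>: "\<sigma> \<in> Hom V" and J: "\<forall>a b. J a b = J b a"
    and \<Lambda>: "finite \<Lambda>" "finite B" "B \<inter> \<Lambda> = {}" and a: "a \<in> labelings \<Lambda>"
begin

private abbreviation "W \<equiv> window \<Lambda> \<union> B"
private abbreviation "inj_at v \<equiv> inj_on (\<lambda>g. \<sigma> g v) W"
private abbreviation "expect f \<equiv> (\<integral>x. f x \<partial>finite_gibbs h J V \<sigma>)"
private abbreviation "D \<equiv> dlr_test h J \<Lambda> a B b"

lemma expect_dlr:
  assumes v: "v \<in> V" "inj_at v" and G: "\<And>x y. (\<And>w. w \<in> V - (\<lambda>g. \<sigma> g v) ` \<Lambda> \<Longrightarrow> x w = y w) \<Longrightarrow> G x = (G y :: real)"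
  shows "expect (\<lambda>x. D (pullback \<sigma> v x) * G x) = 0"
proof -
  \<comment> \<open>The cylinder over \<open>B\<close> is absorbed into the multiplier: injectivity
    on the window and \<open>B\<close> ensures that \<open>B\<close> is read off vertices outside
    the image of \<Lambda>.\<close>
  define G' where "G' x = indicator (cyl B b) (pullback \<sigma> v x) * G x" for x
  have G': "G' x = G' y" if "\<And>w. w \<in> V - (\<lambda>g. \<sigma> g v) ` \<Lambda> \<Longrightarrow> x w = y w" for x y
  proof -
    have "pullback \<sigma> v x g = pullback \<sigma> v y g" if "g \<in> B" for g
    proof -
      have "\<sigma> g v \<notin> (\<lambda>g. \<sigma> g v) ` \<Lambda>"
      proof
        assume "\<sigma> g v \<in> (\<lambda>g. \<sigma> g v) ` \<Lambda>"
        then obtain g' where g': "g' \<in> \<Lambda>" "\<sigma> g v = \<sigma> g' v" by auto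
        then have "g = g'" using inj_onD[OF v(2) g'(2)] that subset_window[of \<Lambda>] by auto
        then show False using g'(1) that \<Lambda>(3) by auto
      qed
      then show ?thesis using \<open>\<And>w. w \<in> V - (\<lambda>g. \<sigma> g v) ` \<Lambda> \<Longrightarrow> x w = y w\<close> Hom_in[OF \<sigma> v(1)]
        by (simp add: pullback_def)
    qed
    then have "pullback \<sigma> v x \<in> cyl B b \<longleftrightarrow> pullback \<sigma> v y \<in> cyl B b" by (simp add: cyl_def)
    then show ?thesis using G[of x y] that by (simp add: G'_def indicator_def)
  qed
  have injw: "inj_on (\<lambda>g. \<sigma> g v) (window \<Lambda>)" using v(2) by (rule inj_on_subset) auto
  have "(\<Sum>x\<in>labelings V. finite_weight h J V \<sigma> x * (D (pullback \<sigma> v x) * G x)) =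
      (\<Sum>x\<in>labelings V. finite_weight h J V \<sigma> x * (indicator (cyl \<Lambda> a) (pullback \<sigma> v x) * G' x)) -
      (\<Sum>x\<in>labelings V. finite_weight h J V \<sigma> x * (spec h J \<Lambda> a (pullback \<sigma> v x) * G' x))"
    by (simp add: dlr_test_def G'_def algebra_simps flip: sum_subtractf)
  also have "\<dots> = 0"
    using finite_DLR[where h = h and G = G', OF V(1) \<sigma> J v(1) \<Lambda>(1) injw a G'] by simp
  finally show ?thesis by (simp add: integral_finite_gibbs[OF V])
qed

lemma expect_dlr_one: "v \<in> V \<Longrightarrow> inj_at v \<Longrightarrow> expect (\<lambda>x. D (pullback \<sigma> v x)) = 0"
  using expect_dlr[of v "\<lambda>_. 1"] by simp

text \<open>A weak law of large numbers. At a vertex \<open>v\<close> with injective window, the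
  defect is uncorrelated with anything that does not look at the image of \<Lambda>, so the
  covariance with \<open>w\<close> vanishes unless the neighbourhoods meet; that leaves boundedly
  many \<open>w\<close> for each \<open>v\<close>. Vertices without injectivity are charged a full
  row.\<close>

lemma expect_dlr_square:
  "expect (\<lambda>x. (\<integral>y. D y \<partial>empirical V \<sigma> x)\<^sup>2) \<le>
    real (card \<Lambda> * card W) / real (card V) + real (card {v \<in> V. \<not> inj_at v}) / real (card V)"
proof -
  interpret prob_space "finite_gibbs h J V \<sigma>" by (rule prob_space_finite_gibbs[OF V])
  \<comment> \<open>Such a \<open>w\<close> is determined by \<open>v\<close> and the pair of group
    elements at which the images meet, whence the bound by a product of cardinalities.\<close>
  define meets where "meets v = {w \<in> V. (\<lambda>g. \<sigma> g v) ` \<Lambda> \<inter> (\<lambda>g. \<sigma> g w) ` W \<noteq> {}}" for v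
  have finW: "finite W" using \<Lambda> by (simp add: finite_window)
  have meets: "card (meets v) \<le> card \<Lambda> * card W" if "v \<in> V" for v
  proof -
    have "meets v \<subseteq> (\<lambda>p. \<sigma> (fg_inv (snd p)) (\<sigma> (fst p) v)) ` (\<Lambda> \<times> W)"
    proof
      fix w assume "w \<in> meets v"
      then obtain g g' where w: "w \<in> V" "g \<in> \<Lambda>" "g' \<in> W" "\<sigma> g v = \<sigma> g' w" by (auto simp: meets_def)
      then have "w = \<sigma> (fg_inv g') (\<sigma> g v)" by (simp add: Hom_inv(1)[OF \<sigma>])
      then show "w \<in> (\<lambda>p. \<sigma> (fg_inv (snd p)) (\<sigma> (fst p) v)) ` (\<Lambda> \<times> W)"
        using w by (intro image_eqI[of _ _ "(g, g')"]) auto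
    qed
    then have "card (meets v) \<le> card ((\<lambda>p. \<sigma> (fg_inv (snd p)) (\<sigma> (fst p) v)) ` (\<Lambda> \<times> W))"
      using \<Lambda> finW by (intro card_mono) auto
    also have "\<dots> \<le> card (\<Lambda> \<times> W)" using \<Lambda> finW by (intro card_image_le) auto
    finally show ?thesis by (simp add: card_cartesian_product)
  qed
  define n where "n = real (card V)"
  have n: "n > 0" using V by (simp add: n_def card_gt_0_iff)
  define c where "c v w = expect (\<lambda>x. D (pullback \<sigma> v x) * D (pullback \<sigma> w x))" for v w
  have int: "integrable (finite_gibbs h J V \<sigma>) f" for f :: "_ \<Rightarrow> real" by (rule integrable_finite_gibbs[OF V])
  have c1: "c v w \<le> 1" for v w
  proof -
    have "D (pullback \<sigma> v x) * D (pullback \<sigma> w x) \<le> 1" for x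
    proof -
      have "\<bar>D (pullback \<sigma> v x) * D (pullback \<sigma> w x)\<bar> \<le> 1 * 1"
        unfolding abs_mult by (intro mult_mono dlr_test_bound \<Lambda> a) auto
      then show ?thesis by linarith
    qed
    then have "c v w \<le> expect (\<lambda>_. 1)" unfolding c_def by (intro integral_mono int)
    then show ?thesis by (simp add: prob_space)
  qed
  have c0: "c v w = 0" if "v \<in> V" "w \<in> V" "inj_at v" "w \<notin> meets v" for v w
    unfolding c_def
  proof (rule expect_dlr[OF that(1,3)])
    fix x y :: "'v \<Rightarrow> 'a" assume eq: "\<And>w. w \<in> V - (\<lambda>g. \<sigma> g v) ` \<Lambda> \<Longrightarrow> x w = y w"
    show "D (pullback \<sigma> w x) = D (pullback \<sigma> w y)"
    proof (rule dlr_test_local, rule ballI)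
      fix g assume "g \<in> W"
      then have "\<sigma> g w \<in> V - (\<lambda>g. \<sigma> g v) ` \<Lambda>" using that Hom_in[OF \<sigma> that(2)] by (auto simp: meets_def)
      then show "pullback \<sigma> w x g = pullback \<sigma> w y g" using eq by (simp add: pullback_def)
    qed
  qed
  have row: "(\<Sum>w\<in>V. c v w) \<le> real (card \<Lambda> * card W) + (if inj_at v then 0 else n)" if v: "v \<in> V" for v
  proof (cases "inj_at v")
    case True
    have "(\<Sum>w\<in>V. c v w) = (\<Sum>w\<in>meets v. c v w)"
      by (rule sum.mono_neutral_right) (use V v True c0 in \<open>auto simp: meets_def\<close>)
    also have "\<dots> \<le> (\<Sum>w\<in>meets v. 1)" by (intro sum_mono c1)
    also have "\<dots> \<le> real (card \<Lambda> * card W)" using meets[OF v] by (simp del: of_nat_mult)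
    finally show ?thesis using True by simp
  next
    case False
    have "(\<Sum>w\<in>V. c v w) \<le> (\<Sum>w\<in>V. 1)" by (intro sum_mono c1)
    then show ?thesis using False by (simp add: n_def add_increasing)
  qed
  have Dm: "D \<in> borel_measurable (borel_of config_top)"
    using dlr_test_bdd_continuous[OF \<Lambda>(1,2), of h J a b]
      by (auto simp: bdd_continuous_def intro: continuous_map_borel_measurable)
  have "expect (\<lambda>x. (\<integral>y. D y \<partial>empirical V \<sigma> x)\<^sup>2) = expect (\<lambda>x. \<Sum>v\<in>V. \<Sum>w\<in>V. D (pullback \<sigma> v x) * D (pullback \<sigma> w x) / n\<^sup>2)"
    by (rule arg_cong[where f = "integral\<^sup>L _"])
      (simp add: fun_eq_iff integral_empirical[OF V Dm] n_def[symmetric] power2_eq_square sum_product sum_divide_distrib)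
  also have "\<dots> = (\<Sum>v\<in>V. \<Sum>w\<in>V. c v w) / n\<^sup>2"
    unfolding c_def by (simp add: Bochner_Integration.integral_sum int sum_divide_distrib)
  also have "\<dots> \<le> (\<Sum>v\<in>V. real (card \<Lambda> * card W) + (if inj_at v then 0 else n)) / n\<^sup>2"
    by (intro divide_right_mono sum_mono row) auto
  also have "(\<Sum>v\<in>V. real (card \<Lambda> * card W) + (if inj_at v then 0 else n)) = n * real (card \<Lambda> * card W) + n * real (card {v \<in> V. \<not> inj_at v})"
  proof -
    have "(\<Sum>v\<in>V. (if inj_at v then 0 else n)) = (\<Sum>v | v \<in> V \<and> \<not> inj_at v. n)"
      unfolding sum.inter_filter[OF V(1)] by (rule sum.cong) simp_all
    then show ?thesis by (simp add: sum.distrib n_def)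
  qed
  also have "(n * real (card \<Lambda> * card W) + n * real (card {v \<in> V. \<not> inj_at v})) / n\<^sup>2 =
      real (card \<Lambda> * card W) / n + real (card {v \<in> V. \<not> inj_at v}) / n"
    using n by (simp add: power2_eq_square add_divide_distrib)
  finally show ?thesis by (simp add: n_def)
qed

end

lemma sofic_inj_fraction:
  fixes \<tau> :: "nat \<Rightarrow> 'k fgroup \<Rightarrow> 'v \<Rightarrow> 'v"
  assumes "sofic_approx V \<tau>" "finite F" "\<And>n. finite (V n) \<and> V n \<noteq> {}"
  shows "(\<lambda>n. real (card {v \<in> V n. \<not> inj_on (\<lambda>g. \<tau> n g v) F}) / real (card (V n))) \<longlonglongrightarrow> 0"
proof (rule order_tendstoI)
  fix e :: real assume "e > 0"
  then have "\<forall>\<^sub>F n in sequentially. is_sofic (V n) F e (\<tau> n)" using assms by (auto simp: sofic_approx_def)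
  then show "\<forall>\<^sub>F n in sequentially. real (card {v \<in> V n. \<not> inj_on (\<lambda>g. \<tau> n g v) F}) / real (card (V n)) < e"
  proof eventually_elim
    case (elim n)
    have fV: "finite (V n)" "V n \<noteq> {}" using assms(3) by auto
    let ?I = "{v \<in> V n. inj_on (\<lambda>g. \<tau> n g v) F}"
    have eq: "{v \<in> V n. \<forall>\<gamma>1\<in>F. \<forall>\<gamma>2\<in>F. \<gamma>1 \<noteq> \<gamma>2 \<longrightarrow> \<tau> n \<gamma>1 v \<noteq> \<tau> n \<gamma>2 v} = ?I" by (auto simp: inj_on_def)
    have "{v \<in> V n. \<not> inj_on (\<lambda>g. \<tau> n g v) F} = V n - ?I" by auto
    then have "card {v \<in> V n. \<not> inj_on (\<lambda>g. \<tau> n g v) F} = card (V n) - card ?I"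
      using fV by (simp add: card_Diff_subset)
    moreover have "card ?I \<le> card (V n)" using fV by (intro card_mono) auto
    ultimately have "real (card {v \<in> V n. \<not> inj_on (\<lambda>g. \<tau> n g v) F}) = real (card (V n)) - real (card ?I)"
      by simp
    moreover have "real (card (V n)) > 0" using fV by (simp add: card_gt_0_iff)
    ultimately show ?case using elim by (simp add: is_sofic_def eq diff_divide_distrib)
  qed
next
  fix e :: real assume "e < 0"
  then show "\<forall>\<^sub>F n in sequentially. e < real (card {v \<in> V n. \<not> inj_on (\<lambda>g. \<tau> n g v) F}) / real (card (V n))"
    by (intro always_eventually allI) (rule less_le_trans, auto)
qed

section \<open>Gibbs measures through the DLR equations\<close>

definition outer_cyls :: "'k fgroup set \<Rightarrow> ('k, 'a) config set set" where
  "outer_cyls \<Lambda> = insert {} {cyl B b | B b. finite B \<and> B \<inter> \<Lambda> = {}}"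

lemma space_outside_sigma [simp]: "space (outside_sigma \<Lambda>) = UNIV"
  unfolding outside_sigma_def by (rule space_measure_of) auto

lemma sets_outside_sigma_gen: "sets (outside_sigma \<Lambda>) = sigma_sets UNIV {{x. x g \<in> A} | g A. g \<notin> \<Lambda>}"
  unfolding outside_sigma_def by (rule sets_measure_of) auto

lemma outside_sigma_coordinate:
  "g \<notin> \<Lambda> \<Longrightarrow> {x. x g \<in> A} \<in> sets (outside_sigma \<Lambda>)"
  unfolding sets_outside_sigma_gen by (rule sigma_sets.Basic) auto

lemma cyl_outside_sigma:
  assumes "finite B" "B \<inter> \<Lambda> = {}"
  shows "cyl B b \<in> sets (outside_sigma \<Lambda>)"
proof -
  have "{x \<in> space (outside_sigma \<Lambda>). x g = b g} \<in> sets (outside_sigma \<Lambda>)" if "g \<in> B" for g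
    using outside_sigma_coordinate[of g \<Lambda> "{b g}"] that assms(2) by auto
  then have "{x \<in> space (outside_sigma \<Lambda>). \<forall>g\<in>B. x g = b g} \<in> sets (outside_sigma \<Lambda>)"
    using assms(1) by (rule sets.sets_Collect_finite_All)
  then show ?thesis by (simp add: cyl_def)
qed

text \<open>Over a finite alphabet a one-site event is a finite union of one-letter cylinders, so
  cylinders based outside \<Lambda> already generate.\<close>

lemma sets_outside_sigma:
  "sets (outside_sigma \<Lambda> :: ('k, 'a::finite) config measure) = sigma_sets UNIV (outer_cyls \<Lambda>)"
proof
  let ?M = "sigma UNIV (outer_cyls \<Lambda>) :: ('k, 'a) config measure"
  have sp: "space ?M = UNIV" by (rule space_measure_of) auto
  have st: "sets ?M = sigma_sets UNIV (outer_cyls \<Lambda>)" by (rule sets_measure_of) auto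
  have "{x. x g \<in> A} \<in> sets ?M" if "g \<notin> \<Lambda>" for g and A :: "'a set"
  proof -
    have "{x \<in> space ?M. x g = c} \<in> sets ?M" for c
    proof -
      have "cyl {g} (\<lambda>_. c) \<in> outer_cyls \<Lambda>" using that by (auto simp: outer_cyls_def)
      moreover have "cyl {g} (\<lambda>_. c) = {x \<in> space ?M. x g = c}" by (auto simp: cyl_def sp)
      ultimately show ?thesis unfolding st by (metis sigma_sets.Basic)
    qed
    then have "{x \<in> space ?M. \<exists>c\<in>A. x g = c} \<in> sets ?M" by (intro sets.sets_Collect_finite_Ex) auto
    then show ?thesis by (simp add: sp)
  qed
  then have "sigma_sets UNIV {{x. x g \<in> A} | g A. g \<notin> \<Lambda>} \<subseteq> sigma_sets (space ?M) (sets ?M)"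
    unfolding sp by (intro sigma_sets_mono') auto
  then show "sets (outside_sigma \<Lambda> :: ('k, 'a) config measure) \<subseteq> sigma_sets UNIV (outer_cyls \<Lambda>)"
    unfolding sets_outside_sigma_gen sets.sigma_sets_eq unfolding st .
  have "outer_cyls \<Lambda> \<subseteq> sets (outside_sigma \<Lambda> :: ('k, 'a) config measure)"
    by (auto simp: outer_cyls_def cyl_outside_sigma)
  from sets.sigma_sets_subset[OF this]
  show "sigma_sets UNIV (outer_cyls \<Lambda>) \<subseteq> sets (outside_sigma \<Lambda> :: ('k, 'a) config measure)" by simp
qed

lemma Int_stable_outer_cyls: "Int_stable (outer_cyls \<Lambda>)"
proof (rule Int_stableI)
  fix A B :: "('a, 'b) config set"
  assume "A \<in> outer_cyls \<Lambda>" "B \<in> outer_cyls \<Lambda>"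
  then consider "A \<inter> B = {}" | F a G b where "A = cyl F a" "finite F" "F \<inter> \<Lambda> = {}" "B = cyl G b" "finite G" "G \<inter> \<Lambda> = {}"
    unfolding outer_cyls_def by blast
  then show "A \<inter> B \<in> outer_cyls \<Lambda>"
  proof cases
    case 2
    then have "finite (F \<union> G)" "(F \<union> G) \<inter> \<Lambda> = {}" by auto
    then show ?thesis unfolding 2(1,4) cyl_Int outer_cyls_def by (auto simp del: finite_Un)
  qed (simp add: outer_cyls_def)
qed

lemma outside_sigma_measurable_local:
  fixes f :: "('k, 'a::finite) config \<Rightarrow> real"
  assumes F: "finite F" "F \<inter> \<Lambda> = {}" and f: "\<And>x y. \<forall>g\<in>F. x g = y g \<Longrightarrow> f x = f y"
  shows "f \<in> borel_measurable (outside_sigma \<Lambda>)"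
proof -
  have fe: "f x = (\<Sum>c\<in>labelings F. f c * indicator (cyl F c) x)" for x
    using local_eq_sum_cyl[OF F(1), of f x] f[of x "restrict x F"] by simp
  have "f = (\<lambda>x. \<Sum>c\<in>labelings F. f c * indicator (cyl F c) x)" by (rule ext) (rule fe)
  also have "\<dots> \<in> borel_measurable (outside_sigma \<Lambda>)"
    by (intro borel_measurable_sum borel_measurable_times borel_measurable_const borel_measurable_indicator
        cyl_outside_sigma F)
  finally show ?thesis .
qed

lemma spec_outside_measurable:
  "finite \<Lambda> \<Longrightarrow> spec h J \<Lambda> a \<in> borel_measurable (outside_sigma \<Lambda> :: ('k::finite, 'a::finite) config measure)"
  by (rule outside_sigma_measurable_local[of "window \<Lambda> - \<Lambda>"]) (auto simp: finite_window intro!: spec_local)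

lemma override_measurable:
  "(\<lambda>x. override_on x a \<Lambda>) \<in> outside_sigma \<Lambda> \<rightarrow>\<^sub>M borel_of (config_top :: ('k::finite, 'a::finite) config topology)"
proof (rule measurable_sigma_sets[OF sets_config_top])
  fix A assume "A \<in> {cyl F b | F (b :: ('k, 'a) config). finite F}"
  then obtain F b where A: "A = cyl F b" "finite F" by blast
  have "(\<lambda>x. override_on x a \<Lambda>) -` A = (if \<forall>g\<in>F \<inter> \<Lambda>. a g = b g then cyl (F - \<Lambda>) b else {})"
    by (auto simp: A(1) cyl_def override_on_def)
  then show "(\<lambda>x. override_on x a \<Lambda>) -` A \<inter> space (outside_sigma \<Lambda>) \<in> sets (outside_sigma \<Lambda>)"
    using cyl_outside_sigma[of "F - \<Lambda>" \<Lambda> b] A(2) by auto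
qed auto

text \<open>Overwriting the coordinates in \<Lambda> by a fixed pattern leaves \<open>G\<close>
  unchanged, and the overwriting map is measurable with respect to the outside coordinates.\<close>

lemma outside_measurable_invariant:
  fixes G :: "('k::finite, 'a::finite) config \<Rightarrow> real"
  assumes "G \<in> borel_measurable (borel_of config_top)" "\<And>x y. (\<And>g. g \<notin> \<Lambda> \<Longrightarrow> x g = y g) \<Longrightarrow> G x = G y"
  shows "G \<in> borel_measurable (outside_sigma \<Lambda>)"
proof -
  have "G = (\<lambda>x. G (override_on x undefined \<Lambda>))" by (rule ext, rule assms(2)) (simp add: override_on_def)
  also have "\<dots> \<in> borel_measurable (outside_sigma \<Lambda>)"
    by (rule measurable_compose[OF override_measurable assms(1)])
  finally show ?thesis .
qed

lemma subalgebra_outside_sigma: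
  assumes "\<nu> \<in> Prob (config_top :: ('k::finite, 'a::finite) config topology)"
  shows "finite_measure_subalgebra \<nu> (outside_sigma \<Lambda>)"
proof -
  have "outer_cyls \<Lambda> \<subseteq> sets (borel_of (config_top :: ('k, 'a) config topology))"
    by (auto simp: outer_cyls_def)
  from sets.sigma_sets_subset[OF this] have "subalgebra \<nu> (outside_sigma \<Lambda>)"
    by (simp add: subalgebra_def sets_outside_sigma Prob_config_D[OF assms])
  then show ?thesis
    using prob_space.finite_measure[OF Prob_config_D(1)[OF assms]]
    by (simp add: finite_measure_subalgebra_def finite_measure_subalgebra_axioms_def)
qed

lemma Prob_config_integrable:
  fixes f :: "('k, 'a) config \<Rightarrow> real"
  assumes "\<nu> \<in> Prob config_top" "f \<in> borel_measurable (borel_of config_top)" "\<And>x. \<bar>f x\<bar> \<le> C"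
  shows "integrable \<nu> f"
proof -
  interpret prob_space \<nu> by (rule Prob_config_D[OF assms(1)])
  show ?thesis
    using assms(2,3) by (intro integrable_const_bound[of _ C])
      (simp_all add: measurable_cong_sets[OF Prob_config_D(2)[OF assms(1)] refl])
qed

lemma spec_measurable [measurable]:
  "finite \<Lambda> \<Longrightarrow> spec h J \<Lambda> a \<in> borel_measurable (borel_of (config_top :: ('k::finite, 'a::finite) config topology))"
  using spec_bdd_continuous[of \<Lambda> h J a]
    by (auto simp: bdd_continuous_def intro: continuous_map_borel_measurable)

text \<open>Conditioning on the outside lets \<open>G\<close> be pulled out, and the conditional
  probability of the pattern is \<open>spec\<close> almost surely. This is the integrated form in
  which the Gibbs property is applied.\<close>

lemma Gibbs_test:
  fixes \<nu> :: "('k::finite, 'a::finite) config measure"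
  assumes \<nu>: "\<nu> \<in> Gibbs h J" and \<Lambda>: "finite \<Lambda>" and a: "a \<in> labelings \<Lambda>"
    and G: "G \<in> borel_measurable (borel_of config_top)" "\<And>x. \<bar>G x\<bar> \<le> (C :: real)"
      "\<And>x y. (\<And>g. g \<notin> \<Lambda> \<Longrightarrow> x g = y g) \<Longrightarrow> G x = G y"
  shows "(\<integral>x. indicator (cyl \<Lambda> a) x * G x \<partial>\<nu>) = (\<integral>x. spec h J \<Lambda> a x * G x \<partial>\<nu>)"
proof -
  have P: "\<nu> \<in> Prob config_top" using \<nu> by (simp add: Gibbs_def)
  interpret finite_measure_subalgebra \<nu> "outside_sigma \<Lambda>" by (rule subalgebra_outside_sigma[OF P])
  let ?f = "indicator (cyl \<Lambda> a) :: ('k, 'a) config \<Rightarrow> real"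
  have im: "?f \<in> borel_measurable (borel_of config_top)" using \<Lambda> by (intro borel_measurable_indicator) simp
  have GF: "G \<in> borel_measurable (outside_sigma \<Lambda>)" by (rule outside_measurable_invariant[OF G(1,3)])
  have int: "integrable \<nu> (\<lambda>x. G x * ?f x)"
  proof (rule Prob_config_integrable[OF P])
    show "\<bar>G x * ?f x\<bar> \<le> C" for x using G(2)[of x]
      by (auto simp: indicator_def intro: order.trans[OF abs_ge_zero])
  qed (intro borel_measurable_times G im)
  have "(\<integral>x. G x * real_cond_exp \<nu> (outside_sigma \<Lambda>) ?f x \<partial>\<nu>) = (\<integral>x. G x * ?f x \<partial>\<nu>)"
    by (rule real_cond_exp_intg(2)[OF int GF]) (simp add: im measurable_cong_sets[OF Prob_config_D(2)[OF P] refl])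
  moreover have "(\<integral>x. G x * real_cond_exp \<nu> (outside_sigma \<Lambda>) ?f x \<partial>\<nu>) = (\<integral>x. G x * spec h J \<Lambda> a x \<partial>\<nu>)"
  proof (rule integral_cong_AE)
    have cylc: "{y. \<forall>g\<in>\<Lambda>. y g = a g} = cyl \<Lambda> a" by (simp add: cyl_def)
    have "AE x in \<nu>. real_cond_exp \<nu> (outside_sigma \<Lambda>) ?f x = spec h J \<Lambda> a x"
      using \<nu> \<Lambda> a unfolding Gibbs_def spec_def cylc[symmetric] by blast
    then show "AE x in \<nu>. G x * real_cond_exp \<nu> (outside_sigma \<Lambda>) ?f x = G x * spec h J \<Lambda> a x"
      by eventually_elim simp
    have [measurable]: "G \<in> borel_measurable \<nu>" "spec h J \<Lambda> a \<in> borel_measurable \<nu>"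
      using G(1) spec_measurable[OF \<Lambda>] by (simp_all add: measurable_cong_sets[OF Prob_config_D(2)[OF P] refl])
    show "(\<lambda>x. G x * real_cond_exp \<nu> (outside_sigma \<Lambda>) ?f x) \<in> borel_measurable \<nu>" by measurable
    show "(\<lambda>x. G x * spec h J \<Lambda> a x) \<in> borel_measurable \<nu>" by measurable
  qed
  ultimately show ?thesis by (simp add: mult.commute)
qed

definition DLR :: "('a::finite \<Rightarrow> real) \<Rightarrow> ('a \<Rightarrow> 'a \<Rightarrow> real) \<Rightarrow> ('k, 'a) config measure set" where
  "DLR h J = {\<nu> \<in> Prob config_top. \<forall>\<Lambda> B a b. finite \<Lambda> \<longrightarrow> finite B \<longrightarrow> B \<inter> \<Lambda> = {} \<longrightarrow> a \<in> labelings \<Lambda> \<longrightarrow>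
    (\<integral>x. dlr_test h J \<Lambda> a B b x \<partial>\<nu>) = 0}"

text \<open>For the converse, the events over which the defect integrates to 0 form a Dynkin system
  containing the outer cylinders, hence all outside events, and this characterises the conditional
  expectation. The gain is that being Gibbs becomes a family of continuous linear
  conditions.\<close>

lemma Gibbs_eq_DLR: "(Gibbs h J :: ('k::finite, 'a::finite) config measure set) = DLR h J"
proof (intro equalityI subsetI)
  fix \<nu> :: "('k, 'a) config measure" assume \<nu>: "\<nu> \<in> Gibbs h J"
  then have P: "\<nu> \<in> Prob config_top" by (simp add: Gibbs_def)
  have "(\<integral>x. dlr_test h J \<Lambda> a B b x \<partial>\<nu>) = 0"
    if *: "finite \<Lambda>" "finite B" "B \<inter> \<Lambda> = {}" "a \<in> labelings \<Lambda>" for \<Lambda> B a b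
  proof -
    let ?G = "indicator (cyl B b) :: ('k, 'a) config \<Rightarrow> real"
    have G: "?G \<in> borel_measurable (borel_of config_top)" using * by (intro borel_measurable_indicator) simp
    have im: "(indicator (cyl \<Lambda> a) :: ('k, 'a) config \<Rightarrow> real) \<in> borel_measurable (borel_of config_top)"
      using * by (intro borel_measurable_indicator) simp
    have int: "integrable \<nu> (\<lambda>x. indicator (cyl \<Lambda> a) x * ?G x)" "integrable \<nu> (\<lambda>x. spec h J \<Lambda> a x * ?G x)"
    proof -
      show "integrable \<nu> (\<lambda>x. indicator (cyl \<Lambda> a) x * ?G x)"
        by (rule Prob_config_integrable[OF P borel_measurable_times[OF im G], where C = 1]) (simp add: indicator_def)
      show "integrable \<nu> (\<lambda>x. spec h J \<Lambda> a x * ?G x)"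
      proof (rule Prob_config_integrable[OF P borel_measurable_times[OF spec_measurable G]])
        show "\<bar>spec h J \<Lambda> a x * ?G x\<bar> \<le> 1" for x
          using spec_nonneg[of h J \<Lambda> a x] spec_le_1[of \<Lambda> a h J x] * by (auto simp: indicator_def)
      qed (rule *)
    qed
    have "(\<integral>x. indicator (cyl \<Lambda> a) x * ?G x \<partial>\<nu>) = (\<integral>x. spec h J \<Lambda> a x * ?G x \<partial>\<nu>)"
    proof (rule Gibbs_test[OF \<nu> *(1,4) G, where C = 1])
      fix x y :: "('k, 'a) config" assume xy: "\<And>g. g \<notin> \<Lambda> \<Longrightarrow> x g = y g"
      have "x g = y g" if "g \<in> B" for g by (rule xy) (use that *(3) in blast)
      then have "x \<in> cyl B b \<longleftrightarrow> y \<in> cyl B b" by (simp add: cyl_def)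
      then show "?G x = ?G y" by (simp add: indicator_def)
    qed (simp add: indicator_def)
    then show ?thesis using int unfolding dlr_test_def by (simp add: left_diff_distrib)
  qed
  then show "\<nu> \<in> DLR h J" using P by (simp add: DLR_def)
next
  fix \<nu> :: "('k, 'a) config measure" assume \<nu>: "\<nu> \<in> DLR h J"
  then have P: "\<nu> \<in> Prob config_top" by (simp add: DLR_def)
  have "AE x in \<nu>. real_cond_exp \<nu> (outside_sigma \<Lambda>) (indicator {y. \<forall>g\<in>\<Lambda>. y g = a g}) x =
       exp (- region_energy h J \<Lambda> (override_on x a \<Lambda>)) /
         (\<Sum>b\<in>labelings \<Lambda>. exp (- region_energy h J \<Lambda> (override_on x b \<Lambda>)))"
    if \<Lambda>: "finite \<Lambda>" and a: "a \<in> labelings \<Lambda>" for \<Lambda> a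
  proof -
    interpret finite_measure_subalgebra \<nu> "outside_sigma \<Lambda>" by (rule subalgebra_outside_sigma[OF P])
    let ?i = "indicator (cyl \<Lambda> a) :: ('k, 'a) config \<Rightarrow> real"
    let ?f = "\<lambda>x. ?i x - spec h J \<Lambda> a x"
    have im: "?i \<in> borel_measurable (borel_of config_top)" using \<Lambda> by (intro borel_measurable_indicator) simp
    have int: "integrable \<nu> ?i" "integrable \<nu> (spec h J \<Lambda> a)"
    proof -
      show "integrable \<nu> ?i"
        by (rule Prob_config_integrable[OF P im, where C = 1]) (simp add: indicator_def)
      show "integrable \<nu> (spec h J \<Lambda> a)"
      proof (rule Prob_config_integrable[OF P spec_measurable[OF \<Lambda>]])
        show "\<bar>spec h J \<Lambda> a x\<bar> \<le> 1" for x
          using spec_nonneg[of h J \<Lambda> a x] spec_le_1[of \<Lambda> a h J x] \<Lambda> a by auto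
      qed
    qed
    have intf: "integrable \<nu> ?f" using int by simp
    have sub: "A \<in> sets \<nu>" if "A \<in> sigma_sets UNIV (outer_cyls \<Lambda>)" for A
      using that subalg by (auto simp: subalgebra_def sets_outside_sigma)
    have sif: "set_integrable \<nu> A ?f" if "A \<in> sigma_sets UNIV (outer_cyls \<Lambda>)" for A
      unfolding set_integrable_def using integrable_mult_indicator[OF sub[OF that] intf] .
    have zero: "(LINT x:A|\<nu>. ?f x) = 0" if A: "A \<in> sigma_sets UNIV (outer_cyls \<Lambda>)" for A
      using Int_stable_outer_cyls subset_UNIV[of "outer_cyls \<Lambda>", folded Pow_UNIV] A
    proof (induction rule: sigma_sets_induct_disjoint)
      case (basic A)
      then consider "A = {}" | B b where "A = cyl B b" "finite B" "B \<inter> \<Lambda> = {}" by (auto simp: outer_cyls_def)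
      then show ?case
      proof cases
        case 2
        have "(LINT x:A|\<nu>. ?f x) = (\<integral>x. dlr_test h J \<Lambda> a B b x \<partial>\<nu>)"
          unfolding set_lebesgue_integral_def dlr_test_def 2(1) by (simp add: mult.commute)
        also have "\<dots> = 0" using \<nu> 2 \<Lambda> a by (simp add: DLR_def)
        finally show ?thesis .
      qed (simp add: set_lebesgue_integral_def)
    next
      case (compl A)
      have "cyl {} undefined = (UNIV :: ('k, 'a) config set)" by (auto simp: cyl_def)
      then have "(\<integral>x. ?f x \<partial>\<nu>) = (\<integral>x. dlr_test h J \<Lambda> a {} undefined x \<partial>\<nu>)" by (simp add: dlr_test_def)
      also have "\<dots> = 0" using \<nu> \<Lambda> a by (simp add: DLR_def)
      finally have 0: "(\<integral>x. ?f x \<partial>\<nu>) = 0" .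
      have "(LINT x:UNIV - A|\<nu>. ?f x) = (\<integral>x. ?f x - indicator A x *\<^sub>R ?f x \<partial>\<nu>)"
        unfolding set_lebesgue_integral_def
          by (rule arg_cong[where f = "integral\<^sup>L \<nu>"]) (auto simp: indicator_def)
      also have "\<dots> = (\<integral>x. ?f x \<partial>\<nu>) - (LINT x:A|\<nu>. ?f x)"
        unfolding set_lebesgue_integral_def
        by (rule Bochner_Integration.integral_diff[OF intf sif[OF compl(1), unfolded set_integrable_def]])
      finally show ?case using 0 compl(2) by simp
    next
      case (union A)
      have "(LINT x:(\<Union>i. A i)|\<nu>. ?f x) = (\<Sum>i. (LINT x:(A i)|\<nu>. ?f x))"
      proof (rule lebesgue_integral_countable_add)
        show "A i \<in> sets \<nu>" for i using union(2) sub by blast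
        show "i \<noteq> j \<Longrightarrow> A i \<inter> A j = {}" for i j using union(1) by (auto simp: disjoint_family_on_def)
        show "set_integrable \<nu> (\<Union>i. A i) ?f" by (rule sif) (rule sigma_sets.Union, use union(2) in blast)
      qed
      then show ?case using union(3) by simp
    qed (simp add: set_lebesgue_integral_def)
    have "AE x in \<nu>. real_cond_exp \<nu> (outside_sigma \<Lambda>) ?i x = spec h J \<Lambda> a x"
    proof (rule real_cond_exp_charact[OF _ int spec_outside_measurable[OF \<Lambda>]])
      fix A assume "A \<in> sets (outside_sigma \<Lambda> :: ('k, 'a) config measure)"
      then have A: "A \<in> sigma_sets UNIV (outer_cyls \<Lambda>)" by (simp add: sets_outside_sigma)
      have "set_integrable \<nu> A ?i" "set_integrable \<nu> A (spec h J \<Lambda> a)"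
        unfolding set_integrable_def
          using integrable_mult_indicator[OF sub[OF A] int(1)] integrable_mult_indicator[OF sub[OF A] int(2)] by auto
      then have "(LINT x:A|\<nu>. ?i x - spec h J \<Lambda> a x) = (LINT x:A|\<nu>. ?i x) - (LINT x:A|\<nu>. spec h J \<Lambda> a x)"
        by (rule set_integral_diff(2))
      then show "(LINT x:A|\<nu>. ?i x) = (LINT x:A|\<nu>. spec h J \<Lambda> a x)" using zero[OF A] by simp
    qed
    moreover have "{y. \<forall>g\<in>\<Lambda>. y g = a g} = cyl \<Lambda> a" by (simp add: cyl_def)
    ultimately show ?thesis by (simp only: spec_def)
  qed
  then show "\<nu> \<in> Gibbs h J" using P by (simp add: Gibbs_def)
qed

lemma dlr_test_restrict: "dlr_test h J \<Lambda> a B (restrict b B) = dlr_test h J \<Lambda> a B b"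
proof -
  have "cyl B (restrict b B) = cyl B b" by (auto simp: cyl_def)
  then show ?thesis by (simp add: dlr_test_def[abs_def])
qed

lemma closedin_Gibbs: "closedin Pcomp (Gibbs h J :: ('k::finite, 'a::finite) config measure set)"
proof -
  define I where "I = {(\<Lambda> :: 'k fgroup set, B :: 'k fgroup set, a :: ('k, 'a) config, b :: ('k, 'a) config).
    finite \<Lambda> \<and> finite B \<and> B \<inter> \<Lambda> = {} \<and> a \<in> labelings \<Lambda>}"
  define K where "K p = {\<nu> \<in> topspace Pcomp. (case p of (\<Lambda>, B, a, b) \<Rightarrow> (\<integral>x. dlr_test h J \<Lambda> a B b x \<partial>\<nu>)) \<in> {0}}"
    for p :: "'k fgroup set \<times> 'k fgroup set \<times> ('k, 'a) config \<times> ('k, 'a) config"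
  have "closedin Pcomp (K p)" if "p \<in> I" for p
  proof -
    obtain \<Lambda> B a b where p: "p = (\<Lambda>, B, a, b)" by (cases p)
    show ?thesis
      unfolding K_def p prod.case
      by (rule closedin_continuous_map_preimage[OF continuous_map_integral[OF dlr_test_bdd_continuous]])
        (use that p in \<open>auto simp: I_def\<close>)
  qed
  moreover have "({}, {}, \<lambda>_. undefined, undefined) \<in> I" by (simp add: I_def)
  then have "I \<noteq> {}" by blast
  ultimately have "closedin Pcomp (\<Inter>p\<in>I. K p)" by (intro closedin_INT)
  also have "(\<Inter>p\<in>I. K p) = DLR h J"
  proof (intro equalityI subsetI)
    fix \<nu> assume \<nu>: "\<nu> \<in> (\<Inter>p\<in>I. K p)"
    then have "\<nu> \<in> K ({}, {}, \<lambda>_. undefined, undefined)" using \<open>({}, {}, \<lambda>_. undefined, undefined) \<in> I\<close>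
      by blast
    then have "\<nu> \<in> Prob config_top" by (simp add: K_def)
    moreover have "(\<integral>x. dlr_test h J \<Lambda> a B b x \<partial>\<nu>) = 0"
      if "finite \<Lambda>" "finite B" "B \<inter> \<Lambda> = {}" "a \<in> labelings \<Lambda>" for \<Lambda> B a b
    proof -
      have "(\<Lambda>, B, a, b) \<in> I" using that by (simp add: I_def)
      then have "\<nu> \<in> K (\<Lambda>, B, a, b)" using \<nu> by blast
      then show ?thesis by (simp add: K_def)
    qed
    ultimately show "\<nu> \<in> DLR h J" by (simp add: DLR_def)
  qed (auto simp: DLR_def K_def I_def)
  finally show ?thesis by (simp add: Gibbs_eq_DLR)
qed

text \<open>Only the restriction of \<open>b\<close> to \<open>B\<close> matters, so countably many
  tests exhaust the DLR equations and their exceptional null sets can be united.\<close>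

lemma AE_Gibbs:
  fixes \<theta> :: "('k::finite, 'a::finite) config measure measure"
  assumes \<theta>: "\<theta> \<in> Prob Pcomp"
    and test: "\<And>\<Lambda> B a b. finite \<Lambda> \<Longrightarrow> finite B \<Longrightarrow> B \<inter> \<Lambda> = {} \<Longrightarrow> a \<in> labelings \<Lambda> \<Longrightarrow>
      AE \<nu> in \<theta>. (\<integral>x. dlr_test h J \<Lambda> a B b x \<partial>\<nu>) = 0"
  shows "AE \<nu> in \<theta>. \<nu> \<in> Gibbs h J"
proof -
  define X where "X = (SIGMA p : Collect finite \<times> Collect finite. (labelings (fst p) :: ('k, 'a) config set) \<times> (labelings (snd p) :: ('k, 'a) config set))"
  have "countable X"
    unfolding X_def
  proof (rule countable_SIGMA)
    show "countable (Collect finite \<times> Collect finite :: ('k fgroup set \<times> 'k fgroup set) set)"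
      by (intro countable_SIGMA countable_Collect_finite)
    show "countable ((labelings (fst p) :: ('k, 'a) config set) \<times> (labelings (snd p) :: ('k, 'a) config set))"
      if "p \<in> Collect finite \<times> Collect finite" for p :: "'k fgroup set \<times> 'k fgroup set"
      using that by (intro countable_finite finite_cartesian_product finite_labelings) auto
  qed
  have "AE \<nu> in \<theta>. \<forall>q\<in>X. snd (fst q) \<inter> fst (fst q) = {} \<longrightarrow> (\<integral>x. dlr_test h J (fst (fst q)) (fst (snd q)) (snd (fst q)) (snd (snd q)) x \<partial>\<nu>) = 0"
    unfolding AE_ball_countable[OF \<open>countable X\<close>]
  proof
    fix q assume q: "q \<in> X"
    show "AE \<nu> in \<theta>. snd (fst q) \<inter> fst (fst q) = {} \<longrightarrow> (\<integral>x. dlr_test h J (fst (fst q)) (fst (snd q)) (snd (fst q)) (snd (snd q)) x \<partial>\<nu>) = 0"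
      by (cases "snd (fst q) \<inter> fst (fst q) = {}") (use q test[of "fst (fst q)" "snd (fst q)" "fst (snd q)" "snd (snd q)"] in \<open>auto simp: X_def\<close>)
  qed
  moreover have "AE \<nu> in \<theta>. \<nu> \<in> Prob config_top" using Prob_D(3)[OF \<theta>] by (intro AE_I2) simp
  ultimately show ?thesis
  proof eventually_elim
    case (elim \<nu>)
    have "(\<integral>x. dlr_test h J \<Lambda> a B b x \<partial>\<nu>) = 0"
      if *: "finite \<Lambda>" "finite B" "B \<inter> \<Lambda> = {}" "a \<in> labelings \<Lambda>" for \<Lambda> B a b
    proof -
      have "((\<Lambda>, B), (a, restrict b B)) \<in> X" using * by (auto simp: X_def)
      from bspec[OF elim(1) this] have "(\<integral>x. dlr_test h J \<Lambda> a B (restrict b B) x \<partial>\<nu>) = 0" using *(3) by simp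
      then show ?thesis by (simp only: dlr_test_restrict)
    qed
    then show ?case using elim(2) by (simp add: Gibbs_eq_DLR DLR_def)
  qed
qed

section \<open>Limits on average\<close>

context
  fixes V :: "'v set" and h :: "'a::finite \<Rightarrow> real" and J :: "'a \<Rightarrow> 'a \<Rightarrow> real"
    and \<sigma> :: "'k::finite fgroup \<Rightarrow> 'v \<Rightarrow> 'v"
  assumes V: "finite V" "V \<noteq> {}"
begin

lemma averaged_law_Prob: "averaged_law V \<sigma> (finite_gibbs h J V \<sigma>) \<in> Prob config_top"
  and measure_averaged_law: "finite F \<Longrightarrow> measure (averaged_law V \<sigma> (finite_gibbs h J V \<sigma>)) (cyl F a) =
    (\<integral>x. measure (empirical V \<sigma> x) (cyl F a) \<partial>finite_gibbs h J V \<sigma>)"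
proof -
  let ?\<xi> = "finite_gibbs h J V \<sigma>"
  interpret prob_space ?\<xi> by (rule prob_space_finite_gibbs[OF V])
  have ps: "prob_space (empirical V \<sigma> x)" "sets (empirical V \<sigma> x) = sets (borel_of config_top)"
    for x :: "'v \<Rightarrow> 'a"
    by (rule Prob_config_D[OF empirical_Prob[OF V]])+
  have k: "empirical V \<sigma> \<in> ?\<xi> \<rightarrow>\<^sub>M subprob_algebra (borel_of config_top)"
    unfolding measurable_finite_gibbs[OF V] space_subprob_algebra using ps prob_space_imp_subprob_space
      by auto
  have "prob_space (?\<xi> \<bind> empirical V \<sigma>)"
    by (rule prob_space_bind[OF _ k]) (simp add: ps)
  moreover have "sets (?\<xi> \<bind> empirical V \<sigma>) = sets (borel_of config_top)"
    by (rule sets_bind[OF _ not_empty]) (simp add: ps)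
  ultimately show "averaged_law V \<sigma> ?\<xi> \<in> Prob config_top" by (simp add: averaged_law_def Prob_def)
  assume F: "finite F"
  have "emeasure (averaged_law V \<sigma> ?\<xi>) (cyl F a) = (\<integral>\<^sup>+x. emeasure (empirical V \<sigma> x) (cyl F a) \<partial>?\<xi>)"
    unfolding averaged_law_def by (rule emeasure_bind[OF not_empty k]) (simp add: F)
  also have "\<dots> = (\<integral>\<^sup>+x. ennreal (measure (empirical V \<sigma> x) (cyl F a)) \<partial>?\<xi>)"
    by (simp add: finite_measure.emeasure_eq_measure[OF prob_space.finite_measure[OF ps(1)]])
  also have "\<dots> = ennreal (\<integral>x. measure (empirical V \<sigma> x) (cyl F a) \<partial>?\<xi>)"
    by (rule nn_integral_eq_integral[OF integrable_finite_gibbs[OF V]]) simp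
  finally show "measure (averaged_law V \<sigma> ?\<xi>) (cyl F a) = (\<integral>x. measure (empirical V \<sigma> x) (cyl F a) \<partial>?\<xi>)"
    by (simp add: measure_def integral_nonneg_AE)
qed

lemma empirical_law_Prob: "distr (finite_gibbs h J V \<sigma>) (borel_of Pcomp) (empirical V \<sigma>) \<in> Prob Pcomp"
  by (rule distr_Prob[OF prob_space_finite_gibbs[OF V]]) (simp add: measurable_finite_gibbs[OF V] empirical_Prob[OF V])

lemma integral_empirical_law:
  "f \<in> borel_measurable (borel_of Pcomp) \<Longrightarrow>
    (\<integral>\<nu>. f \<nu> \<partial>distr (finite_gibbs h J V \<sigma>) (borel_of Pcomp) (empirical V \<sigma>)) =
    (\<integral>x. f (empirical V \<sigma> x) \<partial>finite_gibbs h J V \<sigma>)" for f :: "_ \<Rightarrow> real"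
  by (rule integral_distr) (simp_all add: measurable_finite_gibbs[OF V] empirical_Prob[OF V])

end

text \<open>Integrals of a continuous function on a compact space pass to the limit, and a
  nonnegative function with zero integral vanishes almost everywhere. This is how approximate
  properties become exact ones in the limit.\<close>

lemma limit_null_AE:
  fixes f :: "('k::finite, 'a::finite) config measure \<Rightarrow> real"
  assumes lim: "limitin (weak_topology Pcomp) \<theta> \<theta>' sequentially"
    and f: "continuous_map Pcomp euclideanreal f" "\<And>\<nu>. 0 \<le> f \<nu>"
    and 0: "(\<lambda>n. \<integral>\<nu>. f \<nu> \<partial>\<theta> n) \<longlonglongrightarrow> 0"
  shows "AE \<nu> in \<theta>'. f \<nu> = 0"
proof -
  have fb: "f \<in> bdd_continuous Pcomp" by (rule compact_bdd_continuous[OF compact_Pcomp f(1)])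
  have P: "\<theta>' \<in> Prob Pcomp" using lim by (simp add: limitin_weak_topology)
  have "(\<lambda>n. \<integral>\<nu>. f \<nu> \<partial>\<theta> n) \<longlonglongrightarrow> (\<integral>\<nu>. f \<nu> \<partial>\<theta>')" using lim fb by (simp add: limitin_weak_topology)
  then have "(\<integral>\<nu>. f \<nu> \<partial>\<theta>') = 0" using 0 by (rule LIMSEQ_unique)
  then show ?thesis
    using integral_nonneg_eq_0_iff_AE[OF bdd_continuous_integrable[OF fb P]] f(2) by simp
qed

context gibbs_sofic
begin

abbreviation E :: "('k, 'a) config measure set" where "E \<equiv> equilibrium_Gibbs V \<sigma> h J"

lemma E_eq: "E = EQ \<inter> Gibbs h J"
  by (auto simp: equilibrium_Gibbs_def EQ_def)

lemma closedin_E: "closedin Pcomp E"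
  unfolding E_eq by (intro closedin_Int closedin_EQ closedin_Gibbs)

text \<open>The average law is the barycentre of the random empirical measure under the Gibbs state.
  A subsequential limit of the laws of that random measure is carried by the equilibrium states,
  since the mean of \<open>phi\<close> tends to 0, and by the Gibbs measures, since the squared DLR
  defects do; its barycentre is still \<mu>.\<close>

theorem equilibrating_limit_mixture:
  assumes eqb: "equilibrating \<tau>" and \<phi>: "strict_mono \<phi>"
    and lim: "limitin Pcomp (\<lambda>n. averaged_law (V (\<phi> n)) (\<tau> (\<phi> n)) (finite_gibbs h J (V (\<phi> n)) (\<tau> (\<phi> n)))) \<mu> sequentially"
  shows "mixture_of config_top E \<mu>"
proof -
  have \<tau>: "\<tau> n \<in> Hom (V n)" and sof: "sofic_approx V \<tau>" for n
    using eqb by (auto simp: equilibrating_def sofic_approx_def)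
  define \<xi> where "\<xi> n = finite_gibbs h J (V n) (\<tau> n)" for n
  define \<theta> where "\<theta> n = distr (\<xi> (\<phi> n)) (borel_of Pcomp) (empirical (V (\<phi> n)) (\<tau> (\<phi> n)))" for n
  have \<theta>P: "\<theta> n \<in> Prob Pcomp" for n unfolding \<theta>_def \<xi>_def by (rule empirical_law_Prob[OF V])
  obtain r \<theta>' where r: "strict_mono (r :: nat \<Rightarrow> nat)" and \<theta>': "limitin (weak_topology Pcomp) (\<theta> \<circ> r) \<theta>' sequentially"
    using Prob_Pcomp_sequentially_compact[of \<theta>, OF \<theta>P] by metis
  have P': "\<theta>' \<in> Prob Pcomp" using \<theta>' by (simp add: limitin_weak_topology)
  have \<phi>r: "strict_mono (\<lambda>n. \<phi> (r n))" using strict_mono_o[OF \<phi> r] by (simp add: comp_def)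
  have int: "(\<integral>\<nu>. f \<nu> \<partial>(\<theta> \<circ> r) n) = (\<integral>x. f (empirical (V (\<phi> (r n))) (\<tau> (\<phi> (r n))) x) \<partial>\<xi> (\<phi> (r n)))"
    if "continuous_map Pcomp euclideanreal f" for f n
    unfolding comp_def \<theta>_def \<xi>_def by (rule integral_empirical_law[OF V continuous_map_borel_measurable[OF that]])
  have sub: "(\<lambda>n. s (\<phi> (r n))) \<longlonglongrightarrow> l" if "s \<longlonglongrightarrow> l" for s and l :: real
    using LIMSEQ_subseq_LIMSEQ[OF that \<phi>r] by (simp add: comp_def)
  have "AE \<nu> in \<theta>'. phi \<nu> = 0"
  proof (rule limit_null_AE[OF \<theta>' continuous_map_phi phi_nonneg])
    show "(\<lambda>n. \<integral>\<nu>. phi \<nu> \<partial>(\<theta> \<circ> r) n) \<longlonglongrightarrow> 0"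
      unfolding int[OF continuous_map_phi] \<xi>_def
      using sub[of "\<lambda>n. \<integral>x. phi (empirical (V n) (\<tau> n) x) \<partial>finite_gibbs h J (V n) (\<tau> n)"] eqb
      by (simp add: equilibrating_def)
  qed
  moreover have "AE \<nu> in \<theta>'. \<nu> \<in> Prob config_top" using Prob_D(3)[OF P'] by (intro AE_I2) simp
  moreover have "AE \<nu> in \<theta>'. \<nu> \<in> Gibbs h J"
  proof (rule AE_Gibbs[OF P'])
    fix \<Lambda> B :: "'k fgroup set" and a b :: "('k, 'a) config"
    assume *: "finite \<Lambda>" "finite B" "B \<inter> \<Lambda> = {}" "a \<in> labelings \<Lambda>"
    let ?D = "dlr_test h J \<Lambda> a B b"
    \<comment> \<open>The square is essential: the defect is signed, so a vanishing mean would allow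
      cancellation between different empirical measures.\<close>
    have cD: "continuous_map Pcomp euclideanreal (\<lambda>\<nu>. (\<integral>x. ?D x \<partial>\<nu>)\<^sup>2)"
      unfolding power2_eq_square
      by (intro continuous_map_real_mult continuous_map_integral dlr_test_bdd_continuous *)
    have "AE \<nu> in \<theta>'. (\<integral>x. ?D x \<partial>\<nu>)\<^sup>2 = 0"
    proof (rule limit_null_AE[OF \<theta>' cD])
      let ?W = "window \<Lambda> \<union> B"
      let ?b = "\<lambda>n. real (card \<Lambda> * card ?W) / N n + real (card {v \<in> V n. \<not> inj_on (\<lambda>g. \<tau> n g v) ?W}) / real (card (V n))"
      have "(\<lambda>n. real (card \<Lambda> * card ?W) / N n) \<longlonglongrightarrow> 0"
        by (rule tendsto_divide_0[OF tendsto_const filterlim_at_top_imp_at_infinity[OF N_at_top]])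
      moreover have "(\<lambda>n. real (card {v \<in> V n. \<not> inj_on (\<lambda>g. \<tau> n g v) ?W}) / real (card (V n))) \<longlonglongrightarrow> 0"
        by (rule sofic_inj_fraction[OF sof]) (use * V finite_window in auto)
      ultimately have "?b \<longlonglongrightarrow> 0 + 0" by (rule tendsto_add)
      then have b: "(\<lambda>n. ?b (\<phi> (r n))) \<longlonglongrightarrow> 0" using sub[of ?b] by simp
      show "(\<lambda>n. \<integral>\<nu>. (\<integral>x. ?D x \<partial>\<nu>)\<^sup>2 \<partial>(\<theta> \<circ> r) n) \<longlonglongrightarrow> 0"
        unfolding int[OF cD]
      proof (rule tendsto_sandwich[OF always_eventually always_eventually tendsto_const b])
        show "\<forall>n. 0 \<le> (\<integral>x. (\<integral>y. ?D y \<partial>empirical (V (\<phi> (r n))) (\<tau> (\<phi> (r n))) x)\<^sup>2 \<partial>\<xi> (\<phi> (r n)))"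
          by (simp add: integral_nonneg_AE)
        show "\<forall>n. (\<integral>x. (\<integral>y. ?D y \<partial>empirical (V (\<phi> (r n))) (\<tau> (\<phi> (r n))) x)\<^sup>2 \<partial>\<xi> (\<phi> (r n))) \<le> ?b (\<phi> (r n))"
          unfolding \<xi>_def N_def using expect_dlr_square[OF V \<tau> J_sym *] by blast
      qed
    qed simp
    then show "AE \<nu> in \<theta>'. (\<integral>x. ?D x \<partial>\<nu>) = 0" by simp
  qed
  ultimately have AE: "AE \<nu> in \<theta>'. \<nu> \<in> E"
    by eventually_elim (simp add: E_eq phi_eq_0)
  have \<mu>P: "\<mu> \<in> Prob config_top" using lim by (simp add: limitin_Pcomp)
  show ?thesis
  proof (rule mixture_ofI[OF P' AE \<mu>P])
    fix F :: "'k fgroup set" and a :: "('k, 'a) config" assume F: "finite F"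
    note c = continuous_map_measure_cyl[OF F, of a]
    have "((\<lambda>\<nu>. measure \<nu> (cyl F a)) \<circ> (\<lambda>n. averaged_law (V (\<phi> n)) (\<tau> (\<phi> n)) (\<xi> (\<phi> n)))) \<longlonglongrightarrow> measure \<mu> (cyl F a)"
      using continuous_map_limit[OF c lim] by (simp add: \<xi>_def)
    then have "(\<lambda>n. measure (averaged_law (V (\<phi> (r n))) (\<tau> (\<phi> (r n))) (\<xi> (\<phi> (r n)))) (cyl F a)) \<longlonglongrightarrow> measure \<mu> (cyl F a)"
      using LIMSEQ_subseq_LIMSEQ[OF _ r] by (fastforce simp: comp_def)
    then have "(\<lambda>n. \<integral>\<nu>. measure \<nu> (cyl F a) \<partial>(\<theta> \<circ> r) n) \<longlonglongrightarrow> measure \<mu> (cyl F a)"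
      unfolding int[OF c] by (simp add: \<xi>_def measure_averaged_law[OF V F])
    moreover have "(\<lambda>n. \<integral>\<nu>. measure \<nu> (cyl F a) \<partial>(\<theta> \<circ> r) n) \<longlonglongrightarrow> (\<integral>\<nu>. measure \<nu> (cyl F a) \<partial>\<theta>')"
      using \<theta>' compact_bdd_continuous[OF compact_Pcomp c] by (simp add: limitin_weak_topology)
    ultimately show "measure \<mu> (cyl F a) = (\<integral>\<nu>. measure \<nu> (cyl F a) \<partial>\<theta>')" by (rule LIMSEQ_unique)
  qed
qed

text \<open>Compactness provides a limit on average along an equilibrating sequence, and a mixture
  cannot be carried by the empty set.\<close>

lemma E_nonempty: "E \<noteq> {}"
proof -
  obtain \<tau> where \<tau>: "equilibrating \<tau>" using exists_equilibrating by blast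
  define \<mu> where "\<mu> n = averaged_law (V n) (\<tau> n) (finite_gibbs h J (V n) (\<tau> n))" for n
  have "closedin Pcomp (topspace Pcomp :: ('k, 'a) config measure set)" by (rule closedin_topspace)
  moreover have "\<mu> n \<in> topspace Pcomp" for n unfolding \<mu>_def by (simp add: averaged_law_Prob[OF V])
  ultimately obtain r \<nu> where r: "strict_mono (r :: nat \<Rightarrow> nat)" "limitin Pcomp (\<mu> \<circ> r) \<nu> sequentially"
    using compactin_Pcomp_sequence[of "topspace Pcomp" \<mu>] by metis
  have "mixture_of config_top E \<nu>"
    by (rule equilibrating_limit_mixture[OF \<tau> r(1)]) (use r(2) in \<open>simp add: \<mu>_def[abs_def] comp_def\<close>)
  then obtain \<theta> where \<theta>: "\<theta> \<in> Prob Pcomp" "AE \<nu> in \<theta>. \<nu> \<in> E" by (rule mixture_ofD)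
  show ?thesis
  proof
    assume "E = {}"
    then have "AE \<nu> in \<theta>. False" using \<theta>(2) by simp
    then show False using prob_space.AE_False[OF Prob_D(1)[OF \<theta>(1)]] by simp
  qed
qed

end

section \<open>Gibbs kernels and extreme Gibbs measures\<close>

text \<open>The heat-bath operator: the average of \<open>f\<close> after resampling the sites of
  \<Lambda> given the outside.\<close>

definition kmean :: "('a::finite \<Rightarrow> real) \<Rightarrow> ('a \<Rightarrow> 'a \<Rightarrow> real) \<Rightarrow> 'k fgroup set \<Rightarrow>
    (('k, 'a) config \<Rightarrow> real) \<Rightarrow> ('k, 'a) config \<Rightarrow> real" where
  "kmean h J \<Lambda> f x = (\<Sum>a\<in>labelings \<Lambda>. spec h J \<Lambda> a x * f (override_on x a \<Lambda>))"

definition kern :: "('a::finite \<Rightarrow> real) \<Rightarrow> ('a \<Rightarrow> 'a \<Rightarrow> real) \<Rightarrow> 'k fgroup set \<Rightarrow>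
    ('k, 'a) config \<Rightarrow> ('k, 'a) config measure" where
  "kern h J \<Lambda> x = distr (point_measure (labelings \<Lambda>) (\<lambda>a. ennreal (spec h J \<Lambda> a x)))
     (borel_of config_top) (\<lambda>a. override_on x a \<Lambda>)"

lemma kmean_invariant:
  assumes "\<And>g. g \<notin> \<Lambda> \<Longrightarrow> x g = y g"
  shows "kmean h J \<Lambda> f x = kmean h J \<Lambda> f y"
proof -
  have "override_on x a \<Lambda> = override_on y a \<Lambda>" for a using assms by (auto simp: override_on_def)
  moreover have "spec h J \<Lambda> a x = spec h J \<Lambda> a y" for a by (rule spec_local) (use assms in blast)
  ultimately show ?thesis by (simp add: kmean_def)
qed

context
  fixes \<Lambda> :: "'k::finite fgroup set" and h :: "'a::finite \<Rightarrow> real" and J :: "'a \<Rightarrow> 'a \<Rightarrow> real"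
  assumes \<Lambda>: "finite \<Lambda>"
begin

lemma kmean_nonneg: "(\<And>x. 0 \<le> f x) \<Longrightarrow> 0 \<le> kmean h J \<Lambda> f x"
  unfolding kmean_def by (intro sum_nonneg mult_nonneg_nonneg spec_nonneg)

lemma kmean_le: "(\<And>x. f x \<le> C) \<Longrightarrow> kmean h J \<Lambda> f x \<le> C"
proof -
  assume f: "\<And>x. f x \<le> C"
  have "kmean h J \<Lambda> f x \<le> (\<Sum>a\<in>labelings \<Lambda>. spec h J \<Lambda> a x * C)"
    unfolding kmean_def by (intro sum_mono mult_left_mono spec_nonneg f)
  then show ?thesis using spec_sum[OF \<Lambda>, of h J x] by (simp flip: sum_distrib_right)
qed

lemma kern_Prob: "kern h J \<Lambda> x \<in> Prob config_top"
proof -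
  have "prob_space (point_measure (labelings \<Lambda>) (\<lambda>a. ennreal (spec h J \<Lambda> a x)))"
    by (rule prob_space_point_measure) (simp_all add: \<Lambda> spec_sum[OF \<Lambda>] sum_ennreal spec_nonneg)
  then show ?thesis unfolding kern_def by (rule distr_Prob) simp
qed

lemma integral_kern:
  assumes "f \<in> borel_measurable (borel_of config_top)"
  shows "(\<integral>y. f y \<partial>kern h J \<Lambda> x) = kmean h J \<Lambda> f x"
proof -
  have "(\<integral>y. f y \<partial>kern h J \<Lambda> x) = (\<integral>a. f (override_on x a \<Lambda>) \<partial>point_measure (labelings \<Lambda>) (\<lambda>a. ennreal (spec h J \<Lambda> a x)))"
    unfolding kern_def by (rule integral_distr) (simp_all add: assms)
  also have "\<dots> = kmean h J \<Lambda> f x"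
    unfolding kmean_def using \<Lambda> by (subst lebesgue_integral_point_measure_finite) (auto simp: spec_nonneg)
  finally show ?thesis .
qed

lemma measure_kern_cyl:
  assumes "finite F"
  shows "measure (kern h J \<Lambda> x) (cyl F c) = kmean h J \<Lambda> (indicator (cyl F c)) x"
proof -
  have "(\<integral>y. indicator (cyl F c) y \<partial>kern h J \<Lambda> x) = kmean h J \<Lambda> (indicator (cyl F c)) x"
    by (rule integral_kern) (use assms in \<open>auto intro: borel_measurable_indicator\<close>)
  then show ?thesis by (simp add: Prob_config_D[OF kern_Prob])
qed

lemma continuous_map_override: "continuous_map config_top config_top (\<lambda>x :: ('k, 'a) config. override_on x a \<Lambda>)"
proof (rule continuous_map_config_into)
  show "\<exists>F. finite F \<and> (\<forall>x y. (\<forall>\<gamma>\<in>F. x \<gamma> = y \<gamma>) \<longrightarrow> override_on x a \<Lambda> i = override_on y a \<Lambda> i)" for i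
    by (intro exI[of _ "{i}"]) (auto simp: override_on_def)
qed

lemma continuous_map_spec: "continuous_map config_top euclideanreal (spec h J \<Lambda> a)"
  using spec_bdd_continuous[OF \<Lambda>, of h J a] by (simp add: bdd_continuous_def)

lemma continuous_map_kmean:
  assumes "continuous_map config_top euclideanreal f"
  shows "continuous_map config_top euclideanreal (kmean h J \<Lambda> f)"
  unfolding kmean_def
  by (intro continuous_map_sum continuous_map_real_mult continuous_map_spec
      continuous_map_compose[OF continuous_map_override assms, unfolded comp_def]) (simp add: \<Lambda>)

lemma continuous_map_kern: "continuous_map config_top Pcomp (kern h J \<Lambda>)"
  unfolding continuous_map_into_weak_topology
proof (intro conjI ballI)
  show "kern h J \<Lambda> \<in> topspace config_top \<rightarrow> Prob config_top" by (simp add: kern_Prob)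
  fix f :: "('k, 'a) config \<Rightarrow> real" assume "f \<in> bdd_continuous config_top"
  then have f: "continuous_map config_top euclideanreal f" by (simp add: bdd_continuous_def)
  show "continuous_map config_top euclideanreal (\<lambda>y. \<integral>x. f x \<partial>kern h J \<Lambda> y)"
    unfolding integral_kern[OF continuous_map_borel_measurable[OF f]] by (rule continuous_map_kmean[OF f])
qed

lemma kmean_measurable:
  assumes "f \<in> borel_measurable (borel_of config_top)"
  shows "kmean h J \<Lambda> f \<in> borel_measurable (borel_of config_top)"
  unfolding kmean_def
  by (intro borel_measurable_sum borel_measurable_times continuous_map_borel_measurable[OF continuous_map_spec]
      measurable_compose[OF continuous_map_measurable_borel_of[OF continuous_map_override] assms])

text \<open>Splitting \<open>f\<close> by the pattern on \<Lambda> leaves, for each pattern, a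
  factor that depends on the outside only; the DLR equation then replaces each pattern's indicator
  by its conditional probability.\<close>

lemma Gibbs_kmean:
  fixes f G :: "('k, 'a) config \<Rightarrow> real"
  assumes \<nu>: "\<nu> \<in> Gibbs h J"
    and f: "f \<in> borel_measurable (borel_of config_top)" "\<And>x. \<bar>f x\<bar> \<le> C"
    and G: "G \<in> borel_measurable (borel_of config_top)" "\<And>x. \<bar>G x\<bar> \<le> Cg"
      "\<And>x y. (\<And>g. g \<notin> \<Lambda> \<Longrightarrow> x g = y g) \<Longrightarrow> G x = G y"
  shows "(\<integral>x. f x * G x \<partial>\<nu>) = (\<integral>x. kmean h J \<Lambda> f x * G x \<partial>\<nu>)"
proof -
  have P: "\<nu> \<in> Prob config_top" using \<nu> by (simp add: Gibbs_def)
  define H where "H a x = f (override_on x a \<Lambda>) * G x" for a x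
  have H: "H a \<in> borel_measurable (borel_of config_top)" for a
    unfolding H_def
    by (intro borel_measurable_times G(1) measurable_compose[OF continuous_map_measurable_borel_of[OF continuous_map_override] f(1)])
  have Hb: "\<bar>H a x\<bar> \<le> C * Cg" for a x
    unfolding H_def abs_mult by (intro mult_mono f G) (use abs_ge_zero order.trans f(2) in blast)+
  have Hi: "H a x = H a y" if "\<And>g. g \<notin> \<Lambda> \<Longrightarrow> x g = y g" for a x y
  proof -
    have "override_on x a \<Lambda> = override_on y a \<Lambda>" using that by (auto simp: override_on_def)
    then show ?thesis using G(3)[OF that] by (simp add: H_def)
  qed
  have iL: "(indicator (cyl \<Lambda> a) :: ('k, 'a) config \<Rightarrow> real) \<in> borel_measurable (borel_of config_top)"
    for a :: "('k, 'a) config"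
    using \<Lambda> by (intro borel_measurable_indicator) simp
  have int1: "integrable \<nu> (\<lambda>x. indicator (cyl \<Lambda> a) x * H a x)" for a
  proof (rule Prob_config_integrable[OF P borel_measurable_times[OF iL H]])
    show "\<bar>indicator (cyl \<Lambda> a) x * H a x\<bar> \<le> C * Cg" for x
      using Hb[of a x] abs_ge_zero[of "H a x"] by (auto simp: indicator_def simp del: abs_ge_zero)
  qed
  have int2: "integrable \<nu> (\<lambda>x. spec h J \<Lambda> a x * H a x)" if "a \<in> labelings \<Lambda>" for a
  proof (rule Prob_config_integrable[OF P borel_measurable_times[OF spec_measurable[OF \<Lambda>] H]])
    show "\<bar>spec h J \<Lambda> a x * H a x\<bar> \<le> 1 * (C * Cg)" for x
      unfolding abs_mult using spec_nonneg[of h J \<Lambda> a x] spec_le_1[OF \<Lambda> that, of h J x]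
      by (intro mult_mono Hb) auto
  qed
  have "f x * G x = (\<Sum>a\<in>labelings \<Lambda>. indicator (cyl \<Lambda> a) x * H a x)" for x
  proof -
    have "(\<Sum>a\<in>labelings \<Lambda>. indicator (cyl \<Lambda> a) x * H a x) = (\<Sum>a\<in>labelings \<Lambda>. if a = restrict x \<Lambda> then H a x else 0)"
      by (rule sum.cong) (auto simp: cyl_iff_restrict indicator_def)
    also have "\<dots> = H (restrict x \<Lambda>) x" using \<Lambda> by (subst sum.delta) auto
    also have "override_on x (restrict x \<Lambda>) \<Lambda> = x" by (auto simp: override_on_def)
    then have "H (restrict x \<Lambda>) x = f x * G x" by (simp add: H_def)
    finally show ?thesis by simp
  qed
  then have "(\<integral>x. f x * G x \<partial>\<nu>) = (\<Sum>a\<in>labelings \<Lambda>. \<integral>x. indicator (cyl \<Lambda> a) x * H a x \<partial>\<nu>)"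
    using int1 by (simp add: Bochner_Integration.integral_sum)
  also have "\<dots> = (\<Sum>a\<in>labelings \<Lambda>. \<integral>x. spec h J \<Lambda> a x * H a x \<partial>\<nu>)"
  proof (rule sum.cong[OF refl])
    fix a :: "('k, 'a) config" assume "a \<in> labelings \<Lambda>"
    then show "(\<integral>x. indicator (cyl \<Lambda> a) x * H a x \<partial>\<nu>) = (\<integral>x. spec h J \<Lambda> a x * H a x \<partial>\<nu>)"
      by (rule Gibbs_test[OF \<nu> \<Lambda> _ H Hb Hi])
  qed
  also have "\<dots> = (\<integral>x. kmean h J \<Lambda> f x * G x \<partial>\<nu>)"
  proof -
    have "kmean h J \<Lambda> f x * G x = (\<Sum>a\<in>labelings \<Lambda>. spec h J \<Lambda> a x * H a x)" for x
      unfolding kmean_def H_def sum_distrib_right by (simp only: mult.assoc)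
    then show ?thesis by (simp add: Bochner_Integration.integral_sum[OF int2])
  qed
  finally show ?thesis .
qed

end

text \<open>A density insensitive to changes at finitely many sites is an admissible multiplier in
  every DLR test, so it can be absorbed into the test function.\<close>

lemma Gibbs_density:
  fixes \<rho> :: "('k::finite, 'a::finite) config measure" and w :: "('k, 'a) config \<Rightarrow> real"
  assumes \<rho>: "\<rho> \<in> Gibbs h J" and w: "w \<in> borel_measurable (borel_of config_top)" "\<And>x. 0 \<le> w x" "\<And>x. w x \<le> C"
    and inv: "\<And>x y. finite {g. x g \<noteq> y g} \<Longrightarrow> w x = w y" and one: "(\<integral>x. w x \<partial>\<rho>) = 1"
  shows "density \<rho> (\<lambda>x. ennreal (w x)) \<in> Gibbs h J"
proof -
  have P: "\<rho> \<in> Prob config_top" using \<rho> by (simp add: Gibbs_def)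
  have wm: "w \<in> borel_measurable \<rho>" using w(1)
    by (simp add: measurable_cong_sets[OF Prob_config_D(2)[OF P] refl])
  have wb: "\<bar>w x\<bar> \<le> C" for x using w(2,3)[of x] by simp
  have wint: "integrable \<rho> w" by (rule Prob_config_integrable[OF P w(1) wb])
  let ?\<nu> = "density \<rho> (\<lambda>x. ennreal (w x))"
  have "emeasure ?\<nu> (space ?\<nu>) = 1"
    using nn_integral_eq_integral[OF wint] w(2) one wm by (simp add: emeasure_density)
  then have "prob_space ?\<nu>" by (rule prob_spaceI)
  then have P': "?\<nu> \<in> Prob config_top" by (simp add: Prob_def Prob_config_D[OF P])
  have "(\<integral>x. dlr_test h J \<Lambda> a B b x \<partial>?\<nu>) = 0"
    if *: "finite \<Lambda>" "finite B" "B \<inter> \<Lambda> = {}" "a \<in> labelings \<Lambda>" for \<Lambda> B a b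
  proof -
    let ?G = "\<lambda>x. indicator (cyl B b) x * w x"
    have iB: "(indicator (cyl B b) :: ('k, 'a) config \<Rightarrow> real) \<in> borel_measurable (borel_of config_top)"
      using * by (intro borel_measurable_indicator) simp
    have iL: "(indicator (cyl \<Lambda> a) :: ('k, 'a) config \<Rightarrow> real) \<in> borel_measurable (borel_of config_top)"
      using * by (intro borel_measurable_indicator) simp
    have Gm: "?G \<in> borel_measurable (borel_of config_top)" by (intro borel_measurable_times iB w)
    have Gb: "\<bar>?G x\<bar> \<le> C" for x
      using wb[of x] w(2)[of x] by (simp add: indicator_def)
    have Gi: "?G x = ?G y" if xy: "\<And>g. g \<notin> \<Lambda> \<Longrightarrow> x g = y g" for x y
    proof -
      have "x g = y g" if "g \<in> B" for g by (rule xy) (use that *(3) in blast)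
      then have "x \<in> cyl B b \<longleftrightarrow> y \<in> cyl B b" by (simp add: cyl_def)
      moreover have "finite {g. x g \<noteq> y g}" by (rule finite_subset[OF _ *(1)]) (use xy in blast)
      then have "w x = w y" by (rule inv)
      ultimately show ?thesis by (simp add: indicator_def)
    qed
    have dm: "dlr_test h J \<Lambda> a B b \<in> borel_measurable (borel_of config_top)"
      using dlr_test_bdd_continuous[OF *(1,2), of h J a b]
        by (auto simp: bdd_continuous_def intro: continuous_map_borel_measurable)
    have int1: "integrable \<rho> (\<lambda>x. indicator (cyl \<Lambda> a) x * ?G x)"
    proof (rule Prob_config_integrable[OF P borel_measurable_times[OF iL Gm]])
      show "\<bar>indicator (cyl \<Lambda> a) x * ?G x\<bar> \<le> C" for x using wb[of x] w(2)[of x] by (simp add: indicator_def)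
    qed
    have int2: "integrable \<rho> (\<lambda>x. spec h J \<Lambda> a x * ?G x)"
    proof (rule Prob_config_integrable[OF P borel_measurable_times[OF spec_measurable[OF *(1)] Gm]])
      show "\<bar>spec h J \<Lambda> a x * ?G x\<bar> \<le> 1 * C" for x
        unfolding abs_mult[of "spec h J \<Lambda> a x"] using spec_nonneg[of h J \<Lambda> a x] spec_le_1[OF *(1,4), of h J x]
        by (intro mult_mono Gb) auto
    qed
    have "(\<integral>x. dlr_test h J \<Lambda> a B b x \<partial>?\<nu>) = (\<integral>x. w x *\<^sub>R dlr_test h J \<Lambda> a B b x \<partial>\<rho>)"
      by (rule integral_density)
        (simp_all add: wm w dm measurable_cong_sets[OF Prob_config_D(2)[OF P] refl])
    also have "\<dots> = (\<integral>x. indicator (cyl \<Lambda> a) x * ?G x - spec h J \<Lambda> a x * ?G x \<partial>\<rho>)"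
      by (simp add: dlr_test_def algebra_simps)
    also have "\<dots> = 0"
      using Gibbs_test[OF \<rho> *(1,4) Gm Gb Gi] by (simp add: Bochner_Integration.integral_diff[OF int1 int2])
    finally show ?thesis .
  qed
  then show ?thesis using P' by (simp add: Gibbs_eq_DLR DLR_def)
qed

text \<open>The densities 1 + (f - m) and 1 - (f - m) define two Gibbs measures whose average is
  \<rho>. By extremality both are \<rho>, and integrating \<open>f\<close> against this identity
  shows that its variance is 0. Tail triviality is obtained in this functional form.\<close>

lemma extreme_Gibbs_trivial:
  fixes \<rho> :: "('k::finite, 'a::finite) config measure" and f :: "('k, 'a) config \<Rightarrow> real"
  assumes ex: "extreme_in (Gibbs h J) \<rho>"
    and f: "f \<in> borel_measurable (borel_of config_top)" "\<And>x. 0 \<le> f x" "\<And>x. f x \<le> 1"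
    and inv: "\<And>x y. finite {g. x g \<noteq> y g} \<Longrightarrow> f x = f y"
  shows "AE x in \<rho>. f x = (\<integral>x. f x \<partial>\<rho>)"
proof -
  have \<rho>: "\<rho> \<in> Gibbs h J" using ex by (simp add: extreme_in_def)
  then have P: "\<rho> \<in> Prob config_top" by (simp add: Gibbs_def)
  interpret prob_space \<rho> by (rule Prob_config_D[OF P])
  have fm: "f \<in> borel_measurable \<rho>" using f(1)
    by (simp add: measurable_cong_sets[OF Prob_config_D(2)[OF P] refl])
  have fint: "integrable \<rho> f" by (rule Prob_config_integrable[OF P f(1), of 1]) (use f in auto)
  define m where "m = (\<integral>x. f x \<partial>\<rho>)"
  have m: "0 \<le> m" "m \<le> 1"
    unfolding m_def using f integral_ge_const[OF fint, of 0] integral_le_const[OF fint, of 1] by auto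
  define w where "w s x = 1 + s * (f x - m)" for s :: real and x
  have wm: "w s \<in> borel_measurable (borel_of config_top)" for s
    unfolding w_def by (intro borel_measurable_add borel_measurable_times borel_measurable_diff borel_measurable_const f(1))
  have w0: "0 \<le> w s x" "w s x \<le> 2" if "\<bar>s\<bar> = 1" for s x
    using that f(2,3)[of x] m by (auto simp: w_def abs_if split: if_splits)
  have winv: "w s x = w s y" if "finite {g. x g \<noteq> y g}" for s x y using inv[OF that] by (simp add: w_def)
  have wint: "(\<integral>x. w s x \<partial>\<rho>) = 1" for s
    using fint by (simp add: w_def prob_space m_def)
  have G: "density \<rho> (\<lambda>x. ennreal (w s x)) \<in> Gibbs h J" if "\<bar>s\<bar> = 1" for s
    by (rule Gibbs_density[OF \<rho> wm w0[OF that] winv wint])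
  have wi: "integrable \<rho> (w s)" for s unfolding w_def using fint by simp
  have md: "measure (density \<rho> (\<lambda>x. ennreal (w s x))) B = (\<integral>x. indicator B x * w s x \<partial>\<rho>)"
    if "B \<in> sets \<rho>" "\<bar>s\<bar> = 1" for B s
  proof -
    have "emeasure (density \<rho> (\<lambda>x. ennreal (w s x))) B = (\<integral>\<^sup>+x. ennreal (indicator B x * w s x) \<partial>\<rho>)"
      using that wm[of s] by (subst emeasure_density) (auto simp: measurable_cong_sets[OF Prob_config_D(2)[OF P] refl] indicator_def intro!: nn_integral_cong)
    also have "\<dots> = ennreal (\<integral>x. indicator B x * w s x \<partial>\<rho>)"
      by (rule nn_integral_eq_integral)
        (use integrable_mult_indicator[OF that(1) wi[of s]] w0[OF that(2)] in \<open>auto simp: indicator_def\<close>)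
    finally show ?thesis
      using w0[OF that(2)] by (simp add: measure_def integral_nonneg_AE)
  qed
  have "measure \<rho> B = 1/2 * measure (density \<rho> (\<lambda>x. ennreal (w 1 x))) B + (1 - 1/2) * measure (density \<rho> (\<lambda>x. ennreal (w (-1) x))) B"
    if B: "B \<in> sets \<rho>" for B
  proof -
    have i: "integrable \<rho> (\<lambda>x. indicator B x * w s x)" for s using integrable_mult_indicator[OF B wi[of s]]
      by simp
    have "(\<integral>x. indicator B x * w 1 x \<partial>\<rho>) + (\<integral>x. indicator B x * w (-1) x \<partial>\<rho>) = (\<integral>x. 2 * indicator B x \<partial>\<rho>)"
      unfolding Bochner_Integration.integral_add[OF i i, symmetric]
      by (rule arg_cong[where f = "integral\<^sup>L \<rho>"]) (auto simp: w_def algebra_simps)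
    also have "\<dots> = 2 * measure \<rho> B" using B by (simp add: Prob_config_D[OF P])
    finally show ?thesis using B by (simp add: md)
  qed
  moreover have "density \<rho> (\<lambda>x. ennreal (w 1 x)) \<in> Gibbs h J" "density \<rho> (\<lambda>x. ennreal (w (-1) x)) \<in> Gibbs h J"
    by (simp_all add: G)
  moreover have "(1/2 :: real) \<in> {0<..<1}" by simp
  ultimately have eq: "density \<rho> (\<lambda>x. ennreal (w 1 x)) = \<rho>"
    using ex unfolding extreme_in_def by blast
  have "(\<integral>x. f x \<partial>density \<rho> (\<lambda>x. ennreal (w 1 x))) = (\<integral>x. w 1 x *\<^sub>R f x \<partial>\<rho>)"
    by (rule integral_density)
      (use fm wm w0 in \<open>auto simp: measurable_cong_sets[OF Prob_config_D(2)[OF P] refl]\<close>)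
  \<comment> \<open>Expanding the integrand gives m = (1 - m) m + E f^2, that is, E f^2 =
    m^2.\<close>
  then have mw: "m = (\<integral>x. w 1 x * f x \<partial>\<rho>)" by (simp add: eq m_def)
  have f2: "integrable \<rho> (\<lambda>x. f x * f x)"
    by (rule Prob_config_integrable[OF P borel_measurable_times[OF f(1) f(1)], of 1])
      (use f in \<open>auto simp: abs_mult intro!: mult_le_one\<close>)
  have "(\<integral>x. w 1 x * f x \<partial>\<rho>) = (\<integral>x. (1 - m) * f x + f x * f x \<partial>\<rho>)"
    by (rule arg_cong[where f = "integral\<^sup>L \<rho>"]) (auto simp: w_def algebra_simps)
  also have "\<dots> = (1 - m) * m + (\<integral>x. f x * f x \<partial>\<rho>)" using fint f2 by (simp add: m_def)
  finally have sq: "(\<integral>x. f x * f x \<partial>\<rho>) = m * m" using mw by (simp add: algebra_simps)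
  have "(\<integral>x. (f x - m)\<^sup>2 \<partial>\<rho>) = (\<integral>x. f x * f x - 2 * m * f x + m * m \<partial>\<rho>)"
    by (rule arg_cong[where f = "integral\<^sup>L \<rho>"]) (auto simp: power2_eq_square algebra_simps)
  also have "\<dots> = m * m - 2 * m * m + m * m" using fint f2 by (simp add: sq prob_space m_def[symmetric])
  finally have "(\<integral>x. (f x - m)\<^sup>2 \<partial>\<rho>) = 0" by simp
  moreover have "integrable \<rho> (\<lambda>x. (f x - m)\<^sup>2)"
  proof -
    have "integrable \<rho> (\<lambda>x. f x * f x - 2 * m * f x + m * m)" using fint f2 by simp
    then show ?thesis by (simp add: power2_eq_square algebra_simps)
  qed
  ultimately have "AE x in \<rho>. (f x - m)\<^sup>2 = 0"
    by (subst (asm) integral_nonneg_eq_0_iff_AE) auto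
  then show ?thesis by (simp add: m_def)
qed

lemma (in prob_space) tendsto_integral_AE_const:
  fixes s :: "nat \<Rightarrow> 'a \<Rightarrow> real"
  assumes [measurable]: "\<And>n. s n \<in> borel_measurable M"
    and "AE x in M. (\<lambda>n. s n x) \<longlonglongrightarrow> c" "\<And>n. AE x in M. \<bar>s n x\<bar> \<le> B"
  shows "(\<lambda>n. \<integral>x. s n x \<partial>M) \<longlonglongrightarrow> c"
proof -
  have "(\<lambda>n. \<integral>x. s n x \<partial>M) \<longlonglongrightarrow> (\<integral>x. c \<partial>M)"
    by (rule integral_dominated_convergence[where w = "\<lambda>_. B"]) (use assms in auto)
  then show ?thesis by (simp add: prob_space)
qed

lemma abs_le_square: "\<bar>t\<bar> \<le> e + t\<^sup>2 / e" if "e > 0" for t e :: real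
proof -
  have "0 \<le> (\<bar>t\<bar> - e)\<^sup>2 + \<bar>t\<bar> * e" using that by simp
  then have "\<bar>t\<bar> * e \<le> e * e + t\<^sup>2" by (simp add: power2_eq_square algebra_simps)
  then show ?thesis using that by (simp add: field_simps)
qed

text \<open>Levy's downward theorem for the reverse martingale of conditional probabilities, in \<open>L\<^sup>1\<close>.\<close>

lemma extreme_Gibbs_kmean_tendsto:
  fixes \<rho> :: "('k::finite, 'a::finite) config measure" and c :: "('k, 'a) config"
  assumes ex: "extreme_in (Gibbs h J) \<rho>" and F: "finite F"
  shows "(\<lambda>k. \<integral>x. \<bar>kmean h J (wball k) (indicator (cyl F c)) x - measure \<rho> (cyl F c)\<bar> \<partial>\<rho>) \<longlonglongrightarrow> 0"
proof -
  have \<rho>: "\<rho> \<in> Gibbs h J" using ex by (simp add: extreme_in_def)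
  then have P: "\<rho> \<in> Prob config_top" by (simp add: Gibbs_def)
  interpret prob_space \<rho> by (rule Prob_config_D[OF P])
  let ?C = "indicator (cyl F c) :: ('k, 'a) config \<Rightarrow> real"
  define p where "p = measure \<rho> (cyl F c)"
  define M where "M k = kmean h J (wball k) ?C" for k
  have C: "?C \<in> borel_measurable (borel_of config_top)" "\<bar>?C x\<bar> \<le> 1" for x
    using F by (auto intro!: borel_measurable_indicator simp: indicator_def)
  have M: "M k \<in> borel_measurable (borel_of config_top)" for k
    unfolding M_def by (rule kmean_measurable[OF finite_wball C(1)])
  have Mm [measurable]: "M k \<in> borel_measurable \<rho>" for k
    using M[of k] by (simp add: measurable_cong_sets[OF Prob_config_D(2)[OF P] refl])
  have M0: "0 \<le> M k x" for k x unfolding M_def by (rule kmean_nonneg[OF finite_wball]) simp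
  have M1: "M k x \<le> 1" for k x unfolding M_def by (rule kmean_le[OF finite_wball]) (simp add: indicator_def)
  have Mb: "\<bar>M k x\<bar> \<le> 1" for k x using M0 M1 by simp
  have Minv: "M k x = M k y" if "\<And>g. g \<notin> wball k \<Longrightarrow> x g = y g" for k x y
    unfolding M_def by (rule kmean_invariant) (rule that)
  have Mint: "integrable \<rho> (M k)" for k by (rule Prob_config_integrable[OF P M Mb])
  have MMint: "integrable \<rho> (\<lambda>x. M k x * M l x)" for k l
    by (rule Prob_config_integrable[OF P borel_measurable_times[OF M M], where C = 1])
      (use M0 M1 in \<open>simp add: abs_mult mult_le_one\<close>)
  have mean: "(\<integral>x. M k x \<partial>\<rho>) = p" for k
  proof -
    have "(\<integral>x. ?C x * 1 \<partial>\<rho>) = (\<integral>x. kmean h J (wball k) ?C x * 1 \<partial>\<rho>)"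
      by (rule Gibbs_kmean[OF finite_wball \<rho> C, where Cg = 1]) auto
    then show ?thesis by (simp add: M_def p_def Prob_config_D[OF P])
  qed
  \<comment> \<open>The second moments decrease, and by orthogonality of increments the squared L2
    distance of two terms is the difference of their second moments; convergence of this sequence is
    what makes the martingale Cauchy.\<close>
  define e where "e k = (\<integral>x. M k x * M k x \<partial>\<rho>)" for k
  have cross: "(\<integral>x. M k x * M l x \<partial>\<rho>) = e l" if "k \<le> l" for k l
  proof -
    have inv: "M l x = M l y" if "\<And>g. g \<notin> wball k \<Longrightarrow> x g = y g" for x y
      by (rule Minv, rule that) (use wball_mono[OF \<open>k \<le> l\<close>] in blast)
    have "(\<integral>x. ?C x * M l x \<partial>\<rho>) = (\<integral>x. M k x * M l x \<partial>\<rho>)"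
      unfolding M_def[of k] by (rule Gibbs_kmean[OF finite_wball \<rho> C M Mb inv])
    moreover have "(\<integral>x. ?C x * M l x \<partial>\<rho>) = e l"
      unfolding e_def M_def[of l] by (rule Gibbs_kmean[OF finite_wball \<rho> C M[unfolded M_def] Mb[unfolded M_def] Minv[unfolded M_def]])
    ultimately show ?thesis by simp
  qed
  have sq: "(\<integral>x. (M k x - M l x)\<^sup>2 \<partial>\<rho>) = e k - e l" if "k \<le> l" for k l
  proof -
    have "(\<integral>x. (M k x - M l x)\<^sup>2 \<partial>\<rho>) = (\<integral>x. M k x * M k x - 2 * (M k x * M l x) + M l x * M l x \<partial>\<rho>)"
      by (rule arg_cong[where f = "integral\<^sup>L \<rho>"]) (auto simp: power2_eq_square algebra_simps)
    also have "\<dots> = e k - 2 * e l + e l" using MMint by (simp add: cross[OF that] e_def[symmetric])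
    finally show ?thesis by simp
  qed
  have dec: "e l \<le> e k" if "k \<le> l" for k l
  proof -
    have "0 \<le> (\<integral>x. (M k x - M l x)\<^sup>2 \<partial>\<rho>)" by simp
    then show ?thesis using sq[OF that] by simp
  qed
  have e0: "0 \<le> e k" for k unfolding e_def using M0 by (intro integral_nonneg_AE) auto
  obtain L where L: "e \<longlonglongrightarrow> L" "\<And>k. L \<le> e k"
    using decseq_convergent[of e 0] dec e0 by (metis decseq_def)
  have sqint: "integrable \<rho> (\<lambda>x. (M k x - b x)\<^sup>2)"
    if "b \<in> borel_measurable (borel_of config_top)" "\<And>x. 0 \<le> b x" "\<And>x. b x \<le> 1" for k b
  proof (rule Prob_config_integrable[OF P])
    show "\<bar>(M k x - b x)\<^sup>2\<bar> \<le> 1" for x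
      using M0[of k x] M1[of k x] that(2,3)[of x] by (simp add: abs_square_le_1)
  qed (intro borel_measurable_power borel_measurable_diff M that)
  have absle: "(\<integral>x. \<bar>M k x - b x\<bar> \<partial>\<rho>) \<le> \<eta> + (\<integral>x. (M k x - b x)\<^sup>2 \<partial>\<rho>) / \<eta>"
    if b: "b \<in> borel_measurable (borel_of config_top)" "\<And>x. 0 \<le> b x" "\<And>x. b x \<le> 1" and "\<eta> > 0" for k b \<eta>
  proof -
    have "(\<integral>x. \<bar>M k x - b x\<bar> \<partial>\<rho>) \<le> (\<integral>x. \<eta> + (M k x - b x)\<^sup>2 / \<eta> \<partial>\<rho>)"
    proof (rule integral_mono)
      show "integrable \<rho> (\<lambda>x. \<bar>M k x - b x\<bar>)"
      proof (rule Prob_config_integrable[OF P])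
        show "\<bar>\<bar>M k x - b x\<bar>\<bar> \<le> 1" for x using M0[of k x] M1[of k x] b(2,3)[of x] by simp
      qed (intro borel_measurable_abs borel_measurable_diff M b)
      show "integrable \<rho> (\<lambda>x. \<eta> + (M k x - b x)\<^sup>2 / \<eta>)" using sqint[OF b] by simp
    qed (rule abs_le_square[OF \<open>\<eta> > 0\<close>])
    also have "\<dots> = \<eta> + (\<integral>x. (M k x - b x)\<^sup>2 \<partial>\<rho>) / \<eta>" using sqint[OF b] by (simp add: prob_space)
    finally show ?thesis .
  qed
  obtain r :: "nat \<Rightarrow> nat" where r: "strict_mono r" "AE x in \<rho>. Cauchy (\<lambda>i. M (r i) x)"
  proof (rule cauchy_L1_AE_cauchy_subseq[of \<rho> M])
    fix \<eta> :: real assume "\<eta> > 0"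
    then have "\<forall>\<^sub>F k in sequentially. e k < L + (\<eta> / 4)\<^sup>2" using order_tendstoD(2)[OF L(1)] by simp
    then obtain N where N: "\<And>k. k \<ge> N \<Longrightarrow> e k < L + (\<eta> / 4)\<^sup>2" unfolding eventually_sequentially by blast
    have half: "(\<integral>x. norm (M i x - M j x) \<partial>\<rho>) < \<eta>" if "i \<ge> N" "i \<le> j" for i j
    proof -
      have "(\<integral>x. \<bar>M i x - M j x\<bar> \<partial>\<rho>) \<le> \<eta> / 4 + (e i - e j) / (\<eta> / 4)"
        unfolding sq[OF that(2), symmetric] using \<open>\<eta> > 0\<close> by (intro absle M M0 M1) simp
      also have "e i - e j \<le> (\<eta> / 4)\<^sup>2" using N[OF that(1)] L(2)[of j] by simp
      then have "(e i - e j) / (\<eta> / 4) \<le> (\<eta> / 4)\<^sup>2 / (\<eta> / 4)" using \<open>\<eta> > 0\<close> by (intro divide_right_mono) auto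
      also have "(\<eta> / 4)\<^sup>2 / (\<eta> / 4) = \<eta> / 4" using \<open>\<eta> > 0\<close> by (simp add: power2_eq_square)
      finally show ?thesis using \<open>\<eta> > 0\<close> by simp
    qed
    have "(\<integral>x. norm (M i x - M j x) \<partial>\<rho>) < \<eta>" if "i \<ge> N" "j \<ge> N" for i j
      using half[of i j] half[of j i] that by (cases "i \<le> j") (simp_all add: abs_minus_commute)
    then show "\<exists>N. \<forall>i\<ge>N. \<forall>j\<ge>N. (\<integral>x. norm (M i x - M j x) \<partial>\<rho>) < \<eta>" by blast
  qed (rule Mint)
  \<comment> \<open>Off the convergence set \<open>lim\<close> is arbitrary; clamping gives values
    in [0,1] everywhere, as the triviality lemma requires pointwise, and changes nothing where the
    limit exists.\<close>
  define f where "f x = max 0 (min 1 (lim (\<lambda>i. M (r i) x)))" for x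
  have f: "f \<in> borel_measurable (borel_of config_top)"
    unfolding f_def by (intro borel_measurable_max borel_measurable_min borel_measurable_const borel_measurable_lim_metric M)
  have lim: "AE x in \<rho>. (\<lambda>i. M (r i) x) \<longlonglongrightarrow> f x"
    using r(2)
  proof eventually_elim
    case (elim x)
    then obtain l where l: "(\<lambda>i. M (r i) x) \<longlonglongrightarrow> l" unfolding Cauchy_convergent_iff convergent_def by blast
    have "0 \<le> l" "l \<le> 1" by (rule LIMSEQ_le_const[OF l], use M0 in blast) (rule LIMSEQ_le_const2[OF l], use M1 in blast)
    then have "f x = l" by (simp add: f_def limI[OF l])
    then show ?case using l by simp
  qed
  \<comment> \<open>The k-th term does not look inside the ball of radius k, so once the ball covers
    the sites of disagreement the two sequences coincide, whether or not they converge.\<close>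
  have "f x = f y" if xy: "finite {g. x g \<noteq> y g}" for x y
  proof -
    obtain R where R: "{g. x g \<noteq> y g} \<subseteq> wball R" using finite_subset_wball[OF xy] by blast
    have "\<forall>\<^sub>F i in sequentially. M (r i) x = M (r i) y"
    proof (rule eventually_sequentiallyI)
      fix i assume "R \<le> i"
      then have "wball R \<subseteq> (wball (r i) :: 'k fgroup set)" using seq_suble[OF r(1), of i]
        by (intro wball_mono) simp
      then show "M (r i) x = M (r i) y" using R by (intro Minv) blast
    qed
    then have "(\<lambda>i. M (r i) x) \<longlonglongrightarrow> l \<longleftrightarrow> (\<lambda>i. M (r i) y) \<longlonglongrightarrow> l" for l by (rule tendsto_cong)
    then show ?thesis by (simp add: f_def lim_def)
  qed
  then have "AE x in \<rho>. f x = (\<integral>x. f x \<partial>\<rho>)" by (intro extreme_Gibbs_trivial[OF ex f]) (simp_all add: f_def)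
  with lim have limc: "AE x in \<rho>. (\<lambda>i. M (r i) x) \<longlonglongrightarrow> (\<integral>x. f x \<partial>\<rho>)" by eventually_elim simp
  have "(\<lambda>i. \<integral>x. M (r i) x \<partial>\<rho>) \<longlonglongrightarrow> (\<integral>x. f x \<partial>\<rho>)"
    by (rule tendsto_integral_AE_const[OF Mm limc]) (use Mb in auto)
  then have fp: "(\<integral>x. f x \<partial>\<rho>) = p" by (simp add: mean LIMSEQ_const_iff)
  have "(\<lambda>i. \<integral>x. M (r i) x * M (r i) x \<partial>\<rho>) \<longlonglongrightarrow> p * p"
  proof (rule tendsto_integral_AE_const)
    show "AE x in \<rho>. (\<lambda>i. M (r i) x * M (r i) x) \<longlonglongrightarrow> p * p"
      using limc by eventually_elim (auto simp: fp intro: tendsto_mult)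
    show "AE x in \<rho>. \<bar>M (r i) x * M (r i) x\<bar> \<le> 1" for i
      using M0 M1 by (simp add: abs_mult mult_le_one)
  qed measurable
  moreover have "(\<lambda>i. e (r i)) \<longlonglongrightarrow> L" using LIMSEQ_subseq_LIMSEQ[OF L(1) r(1)] by (simp add: comp_def)
  \<comment> \<open>The subsequence identifies the limit of the second moments as p^2. Since these
    converge along the full sequence, the variance tends to 0 for all k and no subsequence is left
    in the conclusion.\<close>
  ultimately have Lp: "L = p * p" unfolding e_def by (rule LIMSEQ_unique[rotated])
  have p01: "0 \<le> p" "p \<le> 1" by (simp_all add: p_def)
  have var: "(\<integral>x. (M k x - p)\<^sup>2 \<partial>\<rho>) = e k - p * p" for k
  proof -
    have "(\<integral>x. (M k x - p)\<^sup>2 \<partial>\<rho>) = (\<integral>x. M k x * M k x - 2 * p * M k x + p * p \<partial>\<rho>)"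
      by (rule arg_cong[where f = "integral\<^sup>L \<rho>"]) (auto simp: power2_eq_square algebra_simps)
    also have "\<dots> = e k - 2 * p * p + p * p" using MMint Mint by (simp add: mean e_def[symmetric] prob_space)
    finally show ?thesis by simp
  qed
  have "(\<lambda>k. \<integral>x. \<bar>M k x - p\<bar> \<partial>\<rho>) \<longlonglongrightarrow> 0"
  proof (rule order_tendstoI)
    fix \<eta> :: real assume "\<eta> < 0"
    then show "\<forall>\<^sub>F k in sequentially. \<eta> < (\<integral>x. \<bar>M k x - p\<bar> \<partial>\<rho>)"
      by (intro always_eventually allI less_le_trans[OF _ integral_nonneg_AE]) auto
  next
    fix \<eta> :: real assume \<eta>: "0 < \<eta>"
    then have "\<forall>\<^sub>F k in sequentially. e k < L + (\<eta> / 4)\<^sup>2" using order_tendstoD(2)[OF L(1)] by simp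
    then show "\<forall>\<^sub>F k in sequentially. (\<integral>x. \<bar>M k x - p\<bar> \<partial>\<rho>) < \<eta>"
    proof eventually_elim
      case (elim k)
      have "(\<integral>x. \<bar>M k x - p\<bar> \<partial>\<rho>) \<le> \<eta> / 4 + (e k - p * p) / (\<eta> / 4)"
        unfolding var[symmetric] using \<eta> p01 by (intro absle borel_measurable_const) auto
      also have "(e k - p * p) / (\<eta> / 4) \<le> (\<eta> / 4)\<^sup>2 / (\<eta> / 4)" using \<eta> elim Lp
        by (intro divide_right_mono) auto
      also have "(\<eta> / 4)\<^sup>2 / (\<eta> / 4) = \<eta> / 4" using \<eta> by (simp add: power2_eq_square)
      finally show ?case using \<eta> by simp
    qed
  qed
  then show ?thesis by (simp add: M_def p_def)
qed

text \<open>The distance to \<open>S\<close> is at most that to \<rho>, which is controlled up to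
  \<eta>/2 by finitely many cylinder probabilities; each of these converges in mean.\<close>

lemma extreme_Gibbs_kern_tendsto:
  fixes \<rho> :: "('k::finite, 'a::finite) config measure"
  assumes S: "S \<noteq> {}" "S \<subseteq> Prob config_top" and \<rho>S: "\<rho> \<in> S" and ex: "extreme_in (Gibbs h J) \<rho>"
  shows "(\<lambda>k. \<integral>x. set_dprob S (kern h J (wball k) x) \<partial>\<rho>) \<longlonglongrightarrow> 0"
proof (rule order_tendstoI)
  fix \<eta> :: real assume "\<eta> < 0"
  then show "\<forall>\<^sub>F k in sequentially. \<eta> < (\<integral>x. set_dprob S (kern h J (wball k) x) \<partial>\<rho>)"
    using set_dprob_nonneg[OF S] by (intro always_eventually allI less_le_trans[OF _ integral_nonneg_AE]) auto
next
  fix \<eta> :: real assume \<eta>: "0 < \<eta>"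
  have P: "\<rho> \<in> Prob config_top" using S \<rho>S by blast
  interpret prob_space \<rho> by (rule Prob_config_D[OF P])
  obtain R where R: "\<And>\<mu> \<nu> :: ('k, 'a) config measure. \<mu> \<in> Prob config_top \<Longrightarrow> \<nu> \<in> Prob config_top \<Longrightarrow>
      dbar \<mu> \<nu> \<le> 2 * (\<eta> / 4) + 2 * cdist (wball R) \<mu> \<nu>"
    using dbar_le_cdist[of "\<eta> / 4"] \<eta> by (metis zero_less_divide_iff zero_less_numeral)
  let ?d = "\<lambda>k a x. \<bar>kmean h J (wball k) (indicator (cyl (wball R) a)) x - measure \<rho> (cyl (wball R) a)\<bar>"
  have lim: "(\<lambda>k. 2 * (\<Sum>a\<in>labelings (wball R). \<integral>x. ?d k a x \<partial>\<rho>)) \<longlonglongrightarrow> 2 * (\<Sum>a\<in>(labelings (wball R) :: ('k, 'a) config set). 0)"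
    by (intro tendsto_mult tendsto_const tendsto_sum extreme_Gibbs_kmean_tendsto ex finite_wball)
  have iC: "(indicator (cyl (wball R) a) :: ('k, 'a) config \<Rightarrow> real) \<in> borel_measurable (borel_of config_top)"
    for a :: "('k, 'a) config"
    by (intro borel_measurable_indicator) simp
  have dint: "integrable \<rho> (?d k a)" for k a
  proof (rule Prob_config_integrable[OF P])
    show "\<bar>?d k a x\<bar> \<le> 1" for x
    proof -
      let ?m = "kmean h J (wball k) (indicator (cyl (wball R) a)) x"
      have "0 \<le> ?m" by (rule kmean_nonneg[OF finite_wball]) simp
      moreover have "?m \<le> 1" by (rule kmean_le[OF finite_wball]) (simp add: indicator_def)
      ultimately show ?thesis using prob_le_1[of "cyl (wball R) a"] measure_nonneg[of \<rho> "cyl (wball R) a"]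
        by linarith
    qed
  qed (intro borel_measurable_abs borel_measurable_diff borel_measurable_const kmean_measurable iC finite_wball)
  have le: "(\<integral>x. set_dprob S (kern h J (wball k) x) \<partial>\<rho>) \<le> \<eta> / 2 + 2 * (\<Sum>a\<in>labelings (wball R). \<integral>x. ?d k a x \<partial>\<rho>)"
    for k
  proof -
    have c: "continuous_map config_top euclideanreal (\<lambda>x. set_dprob S (kern h J (wball k) x))"
      using continuous_map_compose[OF continuous_map_kern[OF finite_wball] continuous_map_set_dprob[OF S]]
        by (simp add: comp_def)
    have sint: "integrable \<rho> (\<lambda>x. set_dprob S (kern h J (wball k) x))"
      by (rule bdd_continuous_integrable[OF compact_bdd_continuous[OF compact_config_top c] P])
    have "(\<integral>x. set_dprob S (kern h J (wball k) x) \<partial>\<rho>) \<le> (\<integral>x. \<eta> / 2 + 2 * (\<Sum>a\<in>labelings (wball R). ?d k a x) \<partial>\<rho>)"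
    proof (rule integral_mono[OF sint])
      show "integrable \<rho> (\<lambda>x. \<eta> / 2 + 2 * (\<Sum>a\<in>labelings (wball R). ?d k a x))" using dint by simp
      fix x
      note K = kern_Prob[OF finite_wball, of h J k x]
      have "set_dprob S (kern h J (wball k) x) \<le> dbar (kern h J (wball k) x) \<rho>"
        using set_dprob_le[OF S \<rho>S, of "kern h J (wball k) x"] dprob_eq[OF K P] by simp
      also have "\<dots> \<le> 2 * (\<eta> / 4) + 2 * cdist (wball R) (kern h J (wball k) x) \<rho>" by (rule R[OF K P])
      finally show "set_dprob S (kern h J (wball k) x) \<le> \<eta> / 2 + 2 * (\<Sum>a\<in>labelings (wball R). ?d k a x)"
        by (simp add: cdist_def measure_kern_cyl[OF finite_wball finite_wball])
    qed
    also have "\<dots> = \<eta> / 2 + 2 * (\<Sum>a\<in>labelings (wball R). \<integral>x. ?d k a x \<partial>\<rho>)"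
      using dint by (simp add: prob_space Bochner_Integration.integral_sum)
    finally show ?thesis .
  qed
  have "\<forall>\<^sub>F k in sequentially. 2 * (\<Sum>a\<in>labelings (wball R). \<integral>x. ?d k a x \<partial>\<rho>) < \<eta> / 2"
    using order_tendstoD(2)[OF lim, of "\<eta> / 2"] \<eta> by simp
  then show "\<forall>\<^sub>F k in sequentially. (\<integral>x. set_dprob S (kern h J (wball k) x) \<partial>\<rho>) < \<eta>"
  proof eventually_elim
    case (elim k)
    then show ?case using le[of k] by simp
  qed
qed

section \<open>Local limits\<close>

context
  fixes V :: "'v set" and h :: "'a::finite \<Rightarrow> real" and J :: "'a \<Rightarrow> 'a \<Rightarrow> real"
    and \<sigma> :: "'k::finite fgroup \<Rightarrow> 'v \<Rightarrow> 'v"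
  assumes V: "finite V" "V \<noteq> {}"
begin

lemma vertex_law_Prob:
  "distr (finite_gibbs h J V \<sigma>) (borel_of config_top) (pullback \<sigma> v) \<in> Prob config_top"
  by (rule distr_Prob[OF prob_space_finite_gibbs[OF V]]) (simp add: measurable_finite_gibbs[OF V])

lemma integral_vertex_law:
  fixes f :: "('k, 'a) config \<Rightarrow> real"
  assumes "f \<in> borel_measurable (borel_of config_top)"
  shows "(\<integral>y. f y \<partial>distr (finite_gibbs h J V \<sigma>) (borel_of config_top) (pullback \<sigma> v)) =
    (\<integral>x. f (pullback \<sigma> v x) \<partial>finite_gibbs h J V \<sigma>)"
  by (rule integral_distr[OF _ assms]) (simp add: measurable_finite_gibbs[OF V])

lemma integral_local_law:
  fixes f :: "('k, 'a) config measure \<Rightarrow> real"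
  assumes "f \<in> borel_measurable (borel_of Pcomp)"
  shows "(\<integral>\<nu>. f \<nu> \<partial>local_law V \<sigma> (finite_gibbs h J V \<sigma>)) =
    (\<Sum>v\<in>V. f (distr (finite_gibbs h J V \<sigma>) (borel_of config_top) (pullback \<sigma> v))) / real (card V)"
  unfolding local_law_def using assms
  by (subst integral_distr) (simp_all add: measurable_uniform_V[OF V] integral_uniform_V[OF V] vertex_law_Prob)

text \<open>Averaging over vertices commutes with averaging over labelings. Hence the local law and
  the law on average have the same mean, and a local limit has a limit on average as its
  barycentre.\<close>

lemma local_law_cyl:
  fixes c :: "('k, 'a) config"
  assumes F: "finite F"
  shows "(\<integral>\<nu>. measure \<nu> (cyl F c) \<partial>local_law V \<sigma> (finite_gibbs h J V \<sigma>)) =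
    measure (averaged_law V \<sigma> (finite_gibbs h J V \<sigma>)) (cyl F c)"
proof -
  let ?\<xi> = "finite_gibbs h J V \<sigma>" and ?C = "indicator (cyl F c) :: ('k, 'a) config \<Rightarrow> real"
  have C: "?C \<in> borel_measurable (borel_of config_top)" using F by (intro borel_measurable_indicator) simp
  have vl: "measure (distr ?\<xi> (borel_of config_top) (pullback \<sigma> v)) (cyl F c) = (\<integral>x. ?C (pullback \<sigma> v x) \<partial>?\<xi>)"
    for v
  proof -
    have "(\<integral>y. ?C y \<partial>distr ?\<xi> (borel_of config_top) (pullback \<sigma> v)) = (\<integral>x. ?C (pullback \<sigma> v x) \<partial>?\<xi>)"
      by (rule integral_vertex_law[OF C])
    then show ?thesis by (simp add: Prob_config_D[OF vertex_law_Prob])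
  qed
  have "(\<integral>\<nu>. measure \<nu> (cyl F c) \<partial>local_law V \<sigma> ?\<xi>) = (\<Sum>v\<in>V. \<integral>x. ?C (pullback \<sigma> v x) \<partial>?\<xi>) / real (card V)"
    unfolding integral_local_law[OF continuous_map_borel_measurable[OF continuous_map_measure_cyl[OF F]]] vl ..
  also have "\<dots> = (\<integral>x. (\<Sum>v\<in>V. ?C (pullback \<sigma> v x)) / real (card V) \<partial>?\<xi>)"
    by (simp add: Bochner_Integration.integral_sum[OF integrable_finite_gibbs[OF V]])
  also have "\<dots> = measure (averaged_law V \<sigma> ?\<xi>) (cyl F c)"
    by (simp add: measure_averaged_law[OF V F] measure_empirical_cyl[OF V F])
  finally show ?thesis .
qed

text \<open>At a vertex with injective window the DLR equation holds exactly for the law seen from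
  it, so the absolute value can be taken vertex by vertex; the remaining vertices contribute at most
  1 each.\<close>

lemma local_law_dlr:
  fixes a :: "('k, 'a) config"
  assumes \<sigma>: "\<sigma> \<in> Hom V" and J: "\<forall>a b. J a b = J b a"
    and *: "finite \<Lambda>" "finite B" "B \<inter> \<Lambda> = {}" "a \<in> labelings \<Lambda>"
  shows "(\<integral>\<nu>. \<bar>\<integral>x. dlr_test h J \<Lambda> a B b x \<partial>\<nu>\<bar> \<partial>local_law V \<sigma> (finite_gibbs h J V \<sigma>))
    \<le> real (card {v \<in> V. \<not> inj_on (\<lambda>g. \<sigma> g v) (window \<Lambda> \<union> B)}) / real (card V)"
proof -
  let ?\<xi> = "finite_gibbs h J V \<sigma>" and ?T = "dlr_test h J \<Lambda> a B b"
  let ?Bad = "{v \<in> V. \<not> inj_on (\<lambda>g. \<sigma> g v) (window \<Lambda> \<union> B)}"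
  interpret prob_space ?\<xi> by (rule prob_space_finite_gibbs[OF V])
  have T: "?T \<in> bdd_continuous config_top" by (rule dlr_test_bdd_continuous[OF *(1,2)])
  then have Tm: "?T \<in> borel_measurable (borel_of config_top)"
    by (intro continuous_map_borel_measurable) (simp add: bdd_continuous_def)
  have Tc: "continuous_map Pcomp euclideanreal (\<lambda>\<nu>. \<bar>\<integral>x. ?T x \<partial>\<nu>\<bar>)"
    by (intro continuous_map_real_abs continuous_map_integral T)
  have bd: "\<bar>\<integral>x. ?T (pullback \<sigma> v x) \<partial>?\<xi>\<bar> \<le> indicator ?Bad v" if "v \<in> V" for v
  proof (cases "v \<in> ?Bad")
    case False
    then have "(\<integral>x. ?T (pullback \<sigma> v x) \<partial>?\<xi>) = 0" using expect_dlr_one[OF V \<sigma> J * that] that by simp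
    then show ?thesis by simp
  next
    case True
    have "\<bar>\<integral>x. ?T (pullback \<sigma> v x) \<partial>?\<xi>\<bar> \<le> (\<integral>x. \<bar>?T (pullback \<sigma> v x)\<bar> \<partial>?\<xi>)" by (rule integral_abs_bound)
    also have "\<dots> \<le> 1" by (rule integral_le_const[OF integrable_finite_gibbs[OF V]]) (simp add: dlr_test_bound[OF *(1,4)])
    finally show ?thesis using True by simp
  qed
  have "(\<integral>\<nu>. \<bar>\<integral>x. ?T x \<partial>\<nu>\<bar> \<partial>local_law V \<sigma> ?\<xi>) = (\<Sum>v\<in>V. \<bar>\<integral>x. ?T (pullback \<sigma> v x) \<partial>?\<xi>\<bar>) / real (card V)"
    unfolding integral_local_law[OF continuous_map_borel_measurable[OF Tc]] integral_vertex_law[OF Tm] ..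
  also have "\<dots> \<le> (\<Sum>v\<in>V. indicator ?Bad v) / real (card V)" by (intro divide_right_mono sum_mono bd) auto
  also have "(\<Sum>v\<in>V. indicator ?Bad v :: real) = (\<Sum>v\<in>V. if \<not> inj_on (\<lambda>g. \<sigma> g v) (window \<Lambda> \<union> B) then 1 else 0)"
    by (rule sum.cong) (auto simp: indicator_def)
  also have "\<dots> = real (card ?Bad)" using V by (simp flip: sum.inter_filter)
  finally show ?thesis .
qed

end

context gibbs_sofic
begin

lemma E_sub: "E \<subseteq> Prob config_top"
  by (auto simp: E_eq Gibbs_def)

text \<open>Resampling preserves a Gibbs measure, so the laws of the random kernels under \<nu> all
  have barycentre \<nu>. If the kernels approach \<open>E\<close> in mean, a weak limit of these
  laws is carried by the closed set \<open>E\<close> and represents \<nu>.\<close>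

lemma Gibbs_mixture:
  assumes \<nu>: "\<nu> \<in> Gibbs h J" and r: "(\<lambda>i. \<integral>x. set_dprob E (kern h J (wball (r i)) x) \<partial>\<nu>) \<longlonglongrightarrow> 0"
  shows "mixture_of config_top E \<nu>"
proof -
  have P: "\<nu> \<in> Prob config_top" using \<nu> by (simp add: Gibbs_def)
  define \<theta> where "\<theta> i = distr \<nu> (borel_of Pcomp) (kern h J (wball (r i)))" for i
  have \<theta>P: "\<theta> i \<in> Prob Pcomp" for i
    unfolding \<theta>_def by (rule distr_in_Prob[OF continuous_map_kern[OF finite_wball] P])
  have int: "(\<integral>\<kappa>. f \<kappa> \<partial>\<theta> i) = (\<integral>x. f (kern h J (wball (r i)) x) \<partial>\<nu>)"
    if "continuous_map Pcomp euclideanreal f" for f i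
    unfolding \<theta>_def
    by (rule integral_distr[OF Prob_measurable_distr[OF continuous_map_kern[OF finite_wball] P] continuous_map_borel_measurable[OF that]])
  obtain s \<theta>' where s: "strict_mono (s :: nat \<Rightarrow> nat)" and \<theta>': "limitin (weak_topology Pcomp) (\<theta> \<circ> s) \<theta>' sequentially"
    using Prob_Pcomp_sequentially_compact[of \<theta>, OF \<theta>P] by metis
  have P': "\<theta>' \<in> Prob Pcomp" using \<theta>' by (simp add: limitin_weak_topology)
  note c = continuous_map_set_dprob[OF E_nonempty E_sub]
  have "AE \<kappa> in \<theta>'. set_dprob E \<kappa> = 0"
  proof (rule limit_null_AE[OF \<theta>' c set_dprob_nonneg[OF E_nonempty E_sub]])
    show "(\<lambda>n. \<integral>\<kappa>. set_dprob E \<kappa> \<partial>(\<theta> \<circ> s) n) \<longlonglongrightarrow> 0"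
      unfolding comp_def int[OF c] using LIMSEQ_subseq_LIMSEQ[OF r s] by (simp add: comp_def)
  qed
  moreover have "AE \<kappa> in \<theta>'. \<kappa> \<in> Prob config_top" using Prob_D(3)[OF P'] by (intro AE_I2) simp
  ultimately have AE: "AE \<kappa> in \<theta>'. \<kappa> \<in> E"
    by eventually_elim (rule set_dprob_eq_0_closed[OF E_nonempty E_sub closedin_E])
  show ?thesis
  proof (rule mixture_ofI[OF P' AE P])
    fix F :: "'k fgroup set" and a :: "('k, 'a) config" assume F: "finite F"
    note cF = continuous_map_measure_cyl[OF F, of a]
    let ?C = "indicator (cyl F a) :: ('k, 'a) config \<Rightarrow> real"
    have C: "?C \<in> borel_measurable (borel_of config_top)" "\<bar>?C x\<bar> \<le> 1" for x
      using F by (auto intro!: borel_measurable_indicator simp: indicator_def)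
    have "(\<integral>\<kappa>. measure \<kappa> (cyl F a) \<partial>\<theta> i) = measure \<nu> (cyl F a)" for i
    proof -
      have "(\<integral>x. ?C x * 1 \<partial>\<nu>) = (\<integral>x. kmean h J (wball (r i)) ?C x * 1 \<partial>\<nu>)"
        by (rule Gibbs_kmean[OF finite_wball \<nu> C, where Cg = 1]) auto
      then show ?thesis by (simp add: int[OF cF] measure_kern_cyl[OF finite_wball F] Prob_config_D[OF P])
    qed
    then have "(\<lambda>n. \<integral>\<kappa>. measure \<kappa> (cyl F a) \<partial>(\<theta> \<circ> s) n) \<longlonglongrightarrow> measure \<nu> (cyl F a)" by simp
    moreover have "(\<lambda>n. \<integral>\<kappa>. measure \<kappa> (cyl F a) \<partial>(\<theta> \<circ> s) n) \<longlonglongrightarrow> (\<integral>\<kappa>. measure \<kappa> (cyl F a) \<partial>\<theta>')"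
      using \<theta>' compact_bdd_continuous[OF compact_Pcomp cF] by (simp add: limitin_weak_topology)
    ultimately show "measure \<nu> (cyl F a) = (\<integral>\<kappa>. measure \<kappa> (cyl F a) \<partial>\<theta>')" by (rule LIMSEQ_unique)
  qed
qed

text \<open>Almost every \<nu> is Gibbs by the local DLR bound. The remaining input, that the
  kernels approach \<open>E\<close> under \<nu>, is known for members of \<open>E\<close> by
  extremality and reaches \<nu> through the common barycentre of \<open>m\<close> and a law carried
  by \<open>E\<close>.\<close>

theorem equilibrating_local_limit_mixture:
  assumes eqb: "equilibrating \<tau>" and \<phi>: "strict_mono \<phi>"
    and lim: "limitin (weak_topology Pcomp) (\<lambda>n. local_law (V (\<phi> n)) (\<tau> (\<phi> n)) (finite_gibbs h J (V (\<phi> n)) (\<tau> (\<phi> n)))) m sequentially"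
    and ex: "\<And>\<mu>. \<mu> \<in> E \<Longrightarrow> extreme_in (Gibbs h J) \<mu>"
  shows "AE \<nu> in m. mixture_of config_top E \<nu>"
proof -
  have \<tau>: "\<tau> n \<in> Hom (V n)" and sof: "sofic_approx V \<tau>" for n
    using eqb by (auto simp: equilibrating_def sofic_approx_def)
  have P: "m \<in> Prob Pcomp" using lim by (simp add: limitin_weak_topology)
  interpret m: prob_space m by (rule Prob_D(1)[OF P])
  have Gibbs: "AE \<nu> in m. \<nu> \<in> Gibbs h J"
  proof (rule AE_Gibbs[OF P])
    fix \<Lambda> B :: "'k fgroup set" and a b :: "('k, 'a) config"
    assume *: "finite \<Lambda>" "finite B" "B \<inter> \<Lambda> = {}" "a \<in> labelings \<Lambda>"
    let ?T = "dlr_test h J \<Lambda> a B b"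
    have Tc: "continuous_map Pcomp euclideanreal (\<lambda>\<nu>. \<bar>\<integral>x. ?T x \<partial>\<nu>\<bar>)"
      by (intro continuous_map_real_abs continuous_map_integral dlr_test_bdd_continuous *)
    have "AE \<nu> in m. \<bar>\<integral>x. ?T x \<partial>\<nu>\<bar> = 0"
    proof (rule limit_null_AE[OF lim Tc])
      let ?b = "\<lambda>n. real (card {v \<in> V n. \<not> inj_on (\<lambda>g. \<tau> n g v) (window \<Lambda> \<union> B)}) / real (card (V n))"
      have "?b \<longlonglongrightarrow> 0" by (rule sofic_inj_fraction[OF sof]) (use * V finite_window in auto)
      from LIMSEQ_subseq_LIMSEQ[OF this \<phi>] have b: "(\<lambda>n. ?b (\<phi> n)) \<longlonglongrightarrow> 0" by (simp add: comp_def)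
      show "(\<lambda>n. \<integral>\<nu>. \<bar>\<integral>x. ?T x \<partial>\<nu>\<bar> \<partial>local_law (V (\<phi> n)) (\<tau> (\<phi> n)) (finite_gibbs h J (V (\<phi> n)) (\<tau> (\<phi> n)))) \<longlonglongrightarrow> 0"
        by (rule tendsto_sandwich[OF always_eventually always_eventually tendsto_const b])
          (use local_law_dlr[OF V \<tau> J_sym *] in \<open>simp_all add: integral_nonneg_AE\<close>)
    qed simp
    then show "AE \<nu> in m. (\<integral>x. ?T x \<partial>\<nu>) = 0" by simp
  qed
  define \<mu> where "\<mu> n = averaged_law (V (\<phi> n)) (\<tau> (\<phi> n)) (finite_gibbs h J (V (\<phi> n)) (\<tau> (\<phi> n)))" for n
  have "closedin Pcomp (topspace Pcomp :: ('k, 'a) config measure set)" by (rule closedin_topspace)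
  moreover have "\<mu> n \<in> topspace Pcomp" for n unfolding \<mu>_def by (simp add: averaged_law_Prob[OF V])
  ultimately obtain r \<nu>\<^sub>0 where r: "strict_mono (r :: nat \<Rightarrow> nat)" "\<nu>\<^sub>0 \<in> topspace Pcomp" "limitin Pcomp (\<mu> \<circ> r) \<nu>\<^sub>0 sequentially"
    using compactin_Pcomp_sequence[of "topspace Pcomp" \<mu>] by metis
  have \<nu>0: "\<nu>\<^sub>0 \<in> Prob config_top" using r(2) by simp
  \<comment> \<open>The limit on average along a further subsequence is a mixture by the averaged
    theorem, and cylinder probabilities identify it with the barycentre of \<open>m\<close>; this
    yields the second decomposition \<theta> of that barycentre.\<close>
  have mix: "mixture_of config_top E \<nu>\<^sub>0"
    by (rule equilibrating_limit_mixture[OF eqb strict_mono_o[OF \<phi> r(1)]]) (use r(3) in \<open>simp add: \<mu>_def[abs_def] comp_def\<close>)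
  have "\<nu>\<^sub>0 = bary m"
  proof (rule Prob_config_eqI[OF \<nu>0 bary_Prob[OF P]])
    fix F :: "'k fgroup set" and a :: "('k, 'a) config" assume F: "finite F"
    note c = continuous_map_measure_cyl[OF F, of a]
    have "((\<lambda>\<nu>. measure \<nu> (cyl F a)) \<circ> (\<mu> \<circ> r)) \<longlonglongrightarrow> measure \<nu>\<^sub>0 (cyl F a)"
      using continuous_map_limit[OF c r(3)] by simp
    then have "(\<lambda>n. measure (\<mu> (r n)) (cyl F a)) \<longlonglongrightarrow> measure \<nu>\<^sub>0 (cyl F a)" by (simp add: comp_def)
    moreover have "(\<lambda>n. measure (\<mu> n) (cyl F a)) \<longlonglongrightarrow> (\<integral>\<nu>. measure \<nu> (cyl F a) \<partial>m)"
      using lim compact_bdd_continuous[OF compact_Pcomp c]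
      by (simp add: limitin_weak_topology \<mu>_def flip: local_law_cyl[OF V F])
    from LIMSEQ_subseq_LIMSEQ[OF this r(1)] have "(\<lambda>n. measure (\<mu> (r n)) (cyl F a)) \<longlonglongrightarrow> measure (bary m) (cyl F a)"
      by (simp add: comp_def measure_bary_cyl[OF P F])
    ultimately show "measure \<nu>\<^sub>0 (cyl F a) = measure (bary m) (cyl F a)" by (rule LIMSEQ_unique)
  qed
  with mix obtain \<theta> where \<theta>: "\<theta> \<in> Prob Pcomp" "AE \<nu> in \<theta>. \<nu> \<in> E" and bary: "bary m = bary \<theta>"
    by (metis mixture_ofD)
  interpret \<theta>: prob_space \<theta> by (rule Prob_D(1)[OF \<theta>(1)])
  define f where "f k x = set_dprob E (kern h J (wball k) x)" for k x
  have fc: "f k \<in> bdd_continuous config_top" for k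
    unfolding f_def[abs_def]
    using continuous_map_compose[OF continuous_map_kern[OF finite_wball] continuous_map_set_dprob[OF E_nonempty E_sub]]
    by (intro compact_bdd_continuous compact_config_top) (simp add: comp_def)
  have f0: "0 \<le> f k x" and f4: "f k x \<le> 4" for k x
    unfolding f_def by (rule set_dprob_nonneg[OF E_nonempty E_sub] set_dprob_le_4[OF E_nonempty E_sub kern_Prob[OF finite_wball]])+
  have fb: "\<bar>f k x\<bar> \<le> 4" for k x using f0[of k x] f4[of k x] by simp
  have fm: "f k \<in> borel_measurable (borel_of config_top)" for k
    using fc[of k] by (intro continuous_map_borel_measurable) (simp add: bdd_continuous_def)
  have a_c: "(\<lambda>\<nu>. \<integral>x. f k x \<partial>\<nu>) \<in> bdd_continuous Pcomp" for k
    by (rule compact_bdd_continuous[OF compact_Pcomp continuous_map_integral[OF fc]])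
  have a_0: "0 \<le> (\<integral>x. f k x \<partial>\<nu>)" for k \<nu> using f0 by (simp add: integral_nonneg_AE)
  have a_4: "(\<integral>x. f k x \<partial>\<nu>) \<le> 4" if "\<nu> \<in> Prob config_top" for k \<nu>
    by (rule prob_space.integral_le_const[OF Prob_config_D(1)[OF that] bdd_continuous_integrable[OF fc that]]) (simp add: f4)
  have "(\<lambda>k. \<integral>\<nu>. (\<integral>x. f k x \<partial>\<nu>) \<partial>\<theta>) \<longlonglongrightarrow> 0"
  proof (rule \<theta>.tendsto_integral_AE_const)
    show "(\<lambda>\<nu>. \<integral>x. f k x \<partial>\<nu>) \<in> borel_measurable \<theta>" for k by (rule integral_bary(2)[OF \<theta>(1) fm fb])
    show "AE \<nu> in \<theta>. (\<lambda>k. \<integral>x. f k x \<partial>\<nu>) \<longlonglongrightarrow> 0"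
      using \<theta>(2)
    proof eventually_elim
      case (elim \<nu>)
      show ?case unfolding f_def by (rule extreme_Gibbs_kern_tendsto[OF E_nonempty E_sub elim ex[OF elim]])
    qed
    show "AE \<nu> in \<theta>. \<bar>\<integral>x. f k x \<partial>\<nu>\<bar> \<le> 4" for k
      using a_0 a_4 Prob_D(3)[OF \<theta>(1)] by (intro AE_I2) (simp add: abs_of_nonneg)
  qed
  \<comment> \<open>Both averages equal the integral of \<open>f k\<close> over the common
    barycentre, so the decay under \<theta> transfers to \<open>m\<close>. Nonnegativity turns it
    into convergence in L1, from which an almost surely convergent subsequence is drawn; the
    subsequence does not depend on \<nu>.\<close>
  then have conv: "(\<lambda>k. \<integral>\<nu>. norm (\<integral>x. f k x \<partial>\<nu>) \<partial>m) \<longlonglongrightarrow> 0"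
    using integral_bary(1)[OF P fm fb] integral_bary(1)[OF \<theta>(1) fm fb] by (simp add: bary a_0)
  obtain s :: "nat \<Rightarrow> nat" where s: "strict_mono s" "AE \<nu> in m. (\<lambda>i. \<integral>x. f (s i) x \<partial>\<nu>) \<longlonglongrightarrow> 0"
    using tendsto_L1_AE_subseq[OF bdd_continuous_integrable[OF a_c P] conv] by blast
  from s(2) Gibbs show ?thesis
  proof eventually_elim
    case (elim \<nu>)
    show ?case by (rule Gibbs_mixture[OF elim(2)]) (use elim(1) in \<open>simp add: f_def\<close>)
  qed
qed

end

theorem proposition3p1:
  fixes V :: "nat \<Rightarrow> 'v set"
    and \<sigma> :: "nat \<Rightarrow> ('k::finite fgroup \<Rightarrow> 'v \<Rightarrow> 'v) pmf"
    and h :: "'a::finite \<Rightarrow> real"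
    and J :: "'a \<Rightarrow> 'a \<Rightarrow> real"
    and E :: "('k, 'a) config measure set"
  defines "E \<equiv> equilibrium_Gibbs V \<sigma> h J"
  assumes "random_sofic_approx V \<sigma>"
    and "exp_concentrated V \<sigma>"
    and "\<forall>\<mu>\<in>(Prob_inv :: ('k, 'a) config measure set). h_ann_upper V \<sigma> \<mu> = h_ann_lower V \<sigma> \<mu>"
    and "\<forall>a b. J a b = J b a"
    and "\<forall>\<mu>\<in>E. second_moment_criterion V \<sigma> \<mu>"
  shows "typically V \<sigma> (\<lambda>\<tau>. \<forall>\<mu> :: ('k, 'a) config measure.
           subseq_limit_on_average V \<tau> (\<lambda>n. finite_gibbs h J (V n) (\<tau> n)) \<mu>
             \<longrightarrow> mixture_of config_top E \<mu>)
       \<and> ((\<forall>\<mu>\<in>E. extreme_in (Gibbs h J) \<mu>) \<longrightarrow>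
          typically V \<sigma> (\<lambda>\<tau>. \<forall>m :: ('k, 'a) config measure measure.
            subseq_local_limit V \<tau> (\<lambda>n. finite_gibbs h J (V n) (\<tau> n)) m
              \<longrightarrow> (AE \<nu> in m. mixture_of config_top E \<nu>)))"
proof -
  interpret gibbs_sofic V \<sigma> h J
    by unfold_locales (use assms in auto)
  have E: "E = equilibrium_Gibbs V \<sigma> h J" by (simp add: E_def)
  \<comment> \<open>One state of \<open>E\<close> is enough: it carries the second moment argument
    that bounds the partition function from below, and equilibration then holds with respect to all
    annealed equilibrium states.\<close>
  obtain \<mu> where \<mu>: "\<mu> \<in> equilibrium_Gibbs V \<sigma> h J" using E_nonempty by blast
  then have EQ: "\<mu> \<in> EQ" and sm: "second_moment_criterion V \<sigma> \<mu>" using assms(6) by (auto simp: E_eq E)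
  show ?thesis
    unfolding E
  proof (intro conjI impI)
    show "typically V \<sigma> (\<lambda>\<tau>. \<forall>\<mu> :: ('k, 'a) config measure.
        subseq_limit_on_average V \<tau> (\<lambda>n. finite_gibbs h J (V n) (\<tau> n)) \<mu> \<longrightarrow>
        mixture_of config_top (equilibrium_Gibbs V \<sigma> h J) \<mu>)"
      by (rule typically_equilibrating[OF assms(3) EQ sm])
        (auto simp: subseq_limit_on_average_def intro: equilibrating_limit_mixture)
    assume "\<forall>\<mu>\<in>equilibrium_Gibbs V \<sigma> h J. extreme_in (Gibbs h J) \<mu>"
    then show "typically V \<sigma> (\<lambda>\<tau>. \<forall>m :: ('k, 'a) config measure measure.
        subseq_local_limit V \<tau> (\<lambda>n. finite_gibbs h J (V n) (\<tau> n)) m \<longrightarrow>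
        (AE \<nu> in m. mixture_of config_top (equilibrium_Gibbs V \<sigma> h J) \<nu>))"
      by (intro typically_equilibrating[OF assms(3) EQ sm])
        (auto simp: subseq_local_limit_def intro: equilibrating_local_limit_mixture)
  qed
qed

end
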